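(* For $t\ge0$ let $N_B(t)$ be the number of zeros $\rho$ of $\zeta$ with $\mathrm{Re}(\rho)>\tfrac12$ and $|\mathrm{Im}(\rho)|\le t$ (counted with multiplicity), and define $$N_1(t):=\frac1\pi\bigl[\vartheta(t)+2\arctan(2t)\bigr],\qquad N_2(t):=-\frac{1}{2\pi^2}\frac{d}{dt}\int_{-\infty}^\infty\log\left|1-\frac{t^2}{u^2}\right|\,\log\left|\zeta(\tfrac12+iu)\right|\,du,$$ $$N_3(t):=\frac1{2\pi}\int_{-t}^{t}\frac{B'(\tfrac12+iu)}{B(\tfrac12+iu)}\,du,$$ (where these are defined, i.e. for $t\ge 0$ outside a discrete singular set). Extend $N_B,N_1,N_2,N_3$ to all of $\mathbb R$ as odd functions. Then for almost all $t\in\mathbb R$, $$N(t)-N_B(t)=N_1(t)+N_2(t)+N_3(t).$$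
   Context: For $t\ge 0$, $N(t)$ is the number of zeros $\rho=\sigma+i\tau$ of $\zeta$ with $0<\sigma<1$ and $0\le\tau\le t$, counted with multiplicity, and $N(t):=-N(-t)$ for $t<0$. The function $\vartheta:\mathbb R\to\mathbb R$ is $$\vartheta(t):=-\arctan(2t)-\frac t2(\gamma+\log\pi)+\sum_{k=1}^\infty\left\{\frac{t}{2k}-\arctan\frac{t}{2k+\frac12}\right\},$$ with $\gamma$ Euler's constant. $B$ is the Blaschke product $$B(s):=\prod_{\substack{\rho:\ \zeta(\rho)=0\\ \mathrm{Re}(\rho)>1/2}}\left\{\frac{1-\frac{s}{\rho}}{1-\frac{s}{1-\overline\rho}}\cdot\left|\frac{\rho}{1-\rho}\right|\right\},$$ over zeros of $\zeta$ with real part $>\tfrac12$, counted with multiplicity; it is meromorphic with zeros only in $\mathrm{Re}(s)>\tfrac12$ and poles only in $\mathrm{Re}(s)<\tfrac12$. *)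

theory Defs
  imports "HOL-Analysis.Analysis"
begin

text \<open>Riemann zeta function on the half-plane Re s > 0 (s \<noteq> 1), via the standard
  analytic continuation  zeta s = s/(s-1) - s * int_1^oo frac x * x^(-s-1) dx.
  Only values with Re s > 0 are used below.\<close>
definition zeta :: "complex \<Rightarrow> complex" where
  "zeta s = s / (s - 1)
     - s * integral {1..} (\<lambda>x::real. complex_of_real (frac x) * (complex_of_real x) powr (- s - 1))"

definition zero_mult :: "(complex \<Rightarrow> complex) \<Rightarrow> complex \<Rightarrow> nat" where
  "zero_mult f z = (LEAST n. (deriv ^^ n) f z \<noteq> 0)"

definition oddext :: "(real \<Rightarrow> 'a::ab_group_add) \<Rightarrow> real \<Rightarrow> 'a" where
  "oddext f t = (if 0 \<le> t then f t else - f (- t))"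

definition Nzeta :: "real \<Rightarrow> real" where
  "Nzeta = oddext (\<lambda>t. real (\<Sum>\<rho>\<in>{\<rho>. 0 < Re \<rho> \<and> Re \<rho> < 1 \<and> zeta \<rho> = 0 \<and> 0 \<le> Im \<rho> \<and> Im \<rho> \<le> t}.
                                 zero_mult zeta \<rho>))"

definition NB :: "real \<Rightarrow> real" where
  "NB = oddext (\<lambda>t. real (\<Sum>\<rho>\<in>{\<rho>. 1/2 < Re \<rho> \<and> zeta \<rho> = 0 \<and> \<bar>Im \<rho>\<bar> \<le> t}.
                                 zero_mult zeta \<rho>))"

definition vartheta :: "real \<Rightarrow> real" where
  "vartheta t = - arctan (2 * t) - t / 2 * (euler_mascheroni + ln pi)
     + (\<Sum>k. t / (2 * real (Suc k)) - arctan (t / (2 * real (Suc k) + 1/2)))"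

definition N1 :: "real \<Rightarrow> real" where
  "N1 = oddext (\<lambda>t. (vartheta t + 2 * arctan (2 * t)) / pi)"

definition F2 :: "real \<Rightarrow> real" where
  "F2 t = (\<integral>u. ln \<bar>1 - t\<^sup>2 / u\<^sup>2\<bar> * ln (cmod (zeta (1/2 + \<i> * complex_of_real u))) \<partial>lborel)"

definition N2 :: "real \<Rightarrow> real" where
  "N2 = oddext (\<lambda>t. - (1 / (2 * pi\<^sup>2)) * deriv F2 t)"

definition blaschke_factor :: "complex \<Rightarrow> complex \<Rightarrow> complex" where
  "blaschke_factor \<rho> s = (1 - s / \<rho>) / (1 - s / (1 - cnj \<rho>)) * complex_of_real (cmod (\<rho> / (1 - \<rho>)))"

text \<open>Blaschke product over zeros with Re > 1/2 (with multiplicity); the product is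
  absolutely convergent, taken here as the limit of the partial products over |Im \<rho>| \<le> T.\<close>
definition Blaschke :: "complex \<Rightarrow> complex" where
  "Blaschke s = Lim at_top (\<lambda>T::real.
      \<Prod>\<rho>\<in>{\<rho>. 1/2 < Re \<rho> \<and> zeta \<rho> = 0 \<and> \<bar>Im \<rho>\<bar> \<le> T}. blaschke_factor \<rho> s ^ zero_mult zeta \<rho>)"

definition B_logderiv_line :: "real \<Rightarrow> complex" where
  "B_logderiv_line u = deriv Blaschke (1/2 + \<i> * complex_of_real u) / Blaschke (1/2 + \<i> * complex_of_real u)"

definition N3 :: "real \<Rightarrow> complex" where
  "N3 = oddext (\<lambda>t. integral {-t..t} B_logderiv_line / complex_of_real (2 * pi))"

end

theory Submission
  imports Defs "HOL-Complex_Analysis.Complex_Analysis" "HOL-Probability.Probability"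
    "HOL-Real_Asymp.Real_Asymp"
begin

text \<open>Write s = 1/2 + w and let F be the completed zeta function, normalised by F(0) = 1.
It is even and of order less than two, so Hadamard's argument gives
ln |F(w)| as the sum of (m(z)/2) ln |1 - w^2/z^2| over its zeros z; on the critical line, together with the
Weierstrass product of Gamma, this makes ln |zeta| a sum of terms ln |1 + u^2/a^2| / 2 with
Re a >= 0. For each of them, moving a contour to the right half-plane gives
  int ln |1 - t^2/u^2| ln |1 + u^2/a^2| / 2 du = - 2 pi int_0^t (Arg (a + iu) + Arg (conj a + iu)) / 2 du.
The kernel ln |1 - t^2/u^2| decays too slowly for summation, so t^2/(1 + u^2) is added to it; the
integral of ln |zeta| against the added term is a Poisson integral, evaluated by comparison with
the value at large real points. Thus F2' is - 2 pi times a sum of arguments, in which the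
Gamma factors give the phase vartheta, a zero on the critical line gives pi or 0, and the zeros off the line
give the integral of B'/B, whose value at iu is minus a sum of Poisson kernels.\<close>

section \<open>Contour integrals along vertical lines\<close>

text \<open>\<open>zeta\<close> is given only for Re s > 0, so the symmetry of F has to be earned;
  it comes from the transformation law of the theta series. Evenness improves the Borel-Caratheodory
  estimate from first to second order, so that growth below order two leaves no exponential factor
  next to the product over the zeros. No lower bound for |zeta| on the critical line is at hand, so
  ln |zeta| has no pointwise majorant. Hence every kernel is integrated against one factor at a
  time, where the value is exact, and the L1 norms have to be O(|a|^(-2)) to match the known
  convergence of the sum of m(z)/|z|^2. The Poisson kernel misses this by one power of |a|; it is
  reached from kernels of faster decay by monotone convergence, which asks only for an upper bound
  of |zeta|. Non-vanishing for Re s >= 1 confines the zeros to |Re w| < 1/2: \<open>Nzeta\<close>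
  counts zeros with Re < 1 while \<open>NB\<close> sets no upper limit, and first-order terms such
  as Re (y/a) = y Re a / |a|^2 become summable because Re a is bounded.\<close>

lemma vertical_line_integral_zero:
  fixes h :: "complex \<Rightarrow> complex"
  assumes holo: "h holomorphic_on {w. Re w > 0}"
    and bound: "\<And>w. Re w > 0 \<Longrightarrow> cmod w \<ge> R0 \<Longrightarrow> cmod (h w) \<le> C * cmod w powr (-3/2)"
    and d: "d > 0" and int: "integrable lborel (\<lambda>u. h (Complex d u))"
  shows "(\<integral>u. h (Complex d u) \<partial>lborel) = 0"
proof -
  let ?g = "\<lambda>u. h (Complex d u)"
  let ?H = "{w. Re w > 0}"
  have cH: "convex ?H" by (simp add: convex_halfspace_Re_gt)
  have key: "cmod (integral {-R..R} ?g) \<le> \<bar>C\<bar> * pi * R powr (-1/2)" if R: "R \<ge> R0" "R > 0" for R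
  proof -
    define p where "p = linepath (Complex d (-R)) (Complex d R)"
    \<comment> \<open>The arc is centred at d rather than at 0, so that it closes up with the
      segment exactly. Its points still have modulus at least R, so it contributes at most |C|
      R^(-3/2) times its length pi R, which tends to 0.\<close>
    define q where "q = part_circlepath (of_real d) R (pi/2) (-(pi/2))"
    have sp: "pathstart q = Complex d R" "pathfinish q = Complex d (-R)"
      unfolding q_def by (auto simp: complex_eq_iff Re_exp Im_exp cos_minus)
    have q_norm: "Re w > 0 \<and> cmod w \<ge> R" if wq: "w \<in> path_image q" for w
    proof -
      obtain x where x: "x \<in> closed_segment (pi/2) (-(pi/2))" "w = of_real d + of_real R * exp (\<i> * of_real x)"
        using wq unfolding q_def path_image_part_circlepath' by (auto simp: cis_conv_exp)
      have cx: "cos x \<ge> 0" using x(1) pi_gt_zero by (intro cos_ge_zero) (auto simp: closed_segment_eq_real_ivl split: if_splits)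
      have re: "Re w = d + R * cos x" and im: "Im w = R * sin x" using x(2) by (auto simp: Re_exp Im_exp)
      have "R^2 = (R * cos x)^2 + (R * sin x)^2"
        by (simp add: power_mult_distrib flip: distrib_left)
      also have "\<dots> \<le> (d + R * cos x)^2 + (R * sin x)^2"
        using d R cx by (intro add_right_mono power_mono) auto
      also have "\<dots> = (cmod w)^2" by (simp add: cmod_power2 re im)
      finally have "R \<le> cmod w" using R by (simp add: power_mono_iff)
      moreover have "Re w > 0" using re d R cx by (simp add: add_pos_nonneg)
      ultimately show ?thesis by auto
    qed
    have imp: "path_image p \<subseteq> ?H" unfolding p_def path_image_linepath
      by (rule closed_segment_subset) (use d cH in simp_all)
    have imq: "path_image q \<subseteq> ?H" using q_norm by auto
    have vp: "valid_path p" "valid_path q" unfolding p_def q_def by auto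
    have pf: "pathfinish p = pathstart q" "pathfinish q = pathstart p" by (simp_all add: p_def sp)
    have "(h has_contour_integral 0) (p +++ q)"
    proof (rule Cauchy_theorem_convex_simple[OF holo cH])
      show "valid_path (p +++ q)" by (rule valid_path_join[OF vp pf(1)])
      show "path_image (p +++ q) \<subseteq> ?H" using imp imq by (simp add: path_image_join[OF pf(1)])
      show "pathfinish (p +++ q) = pathstart (p +++ q)" by (simp add: pf(2))
    qed
    moreover have cip: "h contour_integrable_on p"
      using continuous_on_subset[OF holomorphic_on_imp_continuous_on[OF holo] imp]
      unfolding p_def by (intro contour_integrable_continuous_linepath) simp
    moreover have ciq: "h contour_integrable_on q"
      using continuous_on_subset[OF holomorphic_on_imp_continuous_on[OF holo] imq]
      unfolding q_def by (intro contour_integrable_continuous_part_circlepath) simp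
    ultimately have sum0: "contour_integral p h + contour_integral q h = 0"
      using contour_integral_join[OF cip ciq] vp contour_integral_unique by fastforce
    have "contour_integral p h = \<i> * integral {-R..R} ?g"
      unfolding p_def by (rule contour_integral_linepath_same_Re) (use R in auto)
    then have "cmod (integral {-R..R} ?g) = cmod (contour_integral q h)"
      using sum0 by (metis add_eq_0_iff2 mult_1 norm_ii norm_minus_cancel norm_mult)
    also have "\<dots> \<le> (\<bar>C\<bar> * R powr (-3/2)) * R * \<bar>-(pi/2) - pi/2\<bar>"
      unfolding q_def
    proof (rule contour_integral_bound_part_circlepath)
      show "h contour_integrable_on part_circlepath (complex_of_real d) R (pi / 2) (- (pi / 2))"
        using ciq q_def by simp
      fix x assume "x \<in> path_image (part_circlepath (complex_of_real d) R (pi / 2) (- (pi / 2)))"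
      then have x: "Re x > 0" "cmod x \<ge> R" using q_norm q_def by auto
      have "cmod (h x) \<le> C * cmod x powr (-3/2)" using bound x R by auto
      also have "\<dots> \<le> \<bar>C\<bar> * R powr (-3/2)"
        using x R by (intro mult_mono powr_mono2') auto
      finally show "cmod (h x) \<le> \<bar>C\<bar> * R powr (-3/2)" .
    qed (use R in auto)
    also have "\<dots> = \<bar>C\<bar> * pi * (R powr (-3/2) * R powr 1)" using R by simp
    also have "R powr (-3/2) * R powr 1 = R powr (-1/2)" by (subst powr_add [symmetric]) simp
    finally show ?thesis .
  qed
  have seq: "(\<lambda>n::nat. integral {-real n..real n} ?g) \<longlonglongrightarrow> (\<integral>u. ?g u \<partial>lborel)"
  proof -
    have eq: "integral {-real n..real n} ?g = (\<integral>u. indicat_real {-real n..real n} u *\<^sub>R ?g u \<partial>lborel)" for n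
    proof -
      have "set_integrable lborel {-real n..real n} ?g"
        unfolding set_integrable_def using int by (intro integrable_mult_indicator) auto
      then show ?thesis
        using set_borel_integral_eq_integral(2)[of "{-real n..real n}" ?g] by (simp add: set_lebesgue_integral_def)
    qed
    have "(\<lambda>n::nat. \<integral>u. indicat_real {-real n..real n} u *\<^sub>R ?g u \<partial>lborel) \<longlonglongrightarrow> (\<integral>u. ?g u \<partial>lborel)"
    proof (rule integral_dominated_convergence[where w="\<lambda>u. cmod (?g u)"])
      show "AE x in lborel. (\<lambda>i. indicat_real {-real i..real i} x *\<^sub>R ?g x) \<longlonglongrightarrow> ?g x"
      proof (intro AE_I2)
        fix x :: real
        obtain N :: nat where N: "\<bar>x\<bar> \<le> real N" using real_arch_simple[of "\<bar>x\<bar>"] by auto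
        have "indicat_real {-real i..real i} x *\<^sub>R ?g x = ?g x" if "N \<le> i" for i
        proof -
          have "real N \<le> real i" using that by (rule of_nat_mono)
          then have "-real i \<le> x" "x \<le> real i" using N by linarith+
          then show ?thesis by simp
        qed
        then have "eventually (\<lambda>i. indicat_real {-real i..real i} x *\<^sub>R ?g x = ?g x) sequentially"
          by (rule eventually_sequentiallyI)
        then show "(\<lambda>i. indicat_real {-real i..real i} x *\<^sub>R ?g x) \<longlonglongrightarrow> ?g x"
          using tendsto_eventually by fast
      qed
    next
      show "?g \<in> borel_measurable lborel" using int by (rule borel_measurable_integrable)
      show "(\<lambda>u. indicat_real {-real n..real n} u *\<^sub>R ?g u) \<in> borel_measurable lborel" for n
        by (rule borel_measurable_integrable, rule integrable_mult_indicator[OF _ int]) simp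
      show "integrable lborel (\<lambda>u. cmod (?g u))" using int by (rule integrable_norm)
      show "AE x in lborel. norm (indicat_real {-real n..real n} x *\<^sub>R ?g x) \<le> cmod (?g x)" for n
        by (intro AE_I2) (simp split: split_indicator)
    qed
    then show ?thesis by (simp add: eq)
  qed
  have "(\<lambda>n::nat. integral {-real n..real n} ?g) \<longlonglongrightarrow> 0"
  proof (rule Lim_null_comparison)
    show "eventually (\<lambda>n. norm (integral {-real n..real n} ?g) \<le> \<bar>C\<bar> * pi * real n powr (-1/2)) sequentially"
    proof (rule eventually_sequentiallyI[of "nat \<lceil>R0\<rceil> + 1"])
      fix n assume "nat \<lceil>R0\<rceil> + 1 \<le> n"
      then have n: "nat \<lceil>R0\<rceil> \<le> n" "0 < n" by (metis add_leD1, simp)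
      have "R0 \<le> of_int \<lceil>R0\<rceil>" by (rule le_of_int_ceiling)
      also have "\<dots> \<le> real (nat \<lceil>R0\<rceil>)" by linarith
      also have "\<dots> \<le> real n" using n(1) by (rule of_nat_mono)
      finally have "R0 \<le> real n" .
      moreover have "0 < real n" using n(2) by simp
      ultimately show "norm (integral {-real n..real n} ?g) \<le> \<bar>C\<bar> * pi * real n powr (-1/2)" by (rule key)
    qed
    have "(\<lambda>n. real n powr (-1/2)) \<longlonglongrightarrow> 0"
      by (rule tendsto_neg_powr[OF _ filterlim_real_sequentially]) auto
    then show "(\<lambda>n. \<bar>C\<bar> * pi * real n powr (-1/2)) \<longlonglongrightarrow> 0" by (rule tendsto_mult_right_zero)
  qed
  with seq show ?thesis using LIMSEQ_unique by blast
qed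

text \<open>Dominated convergence as the line Re w = d moves to the imaginary axis. Majorant and
  limit are asked for only almost everywhere, because the boundary values used later have
  logarithmic singularities.\<close>

lemma boundary_integral_zero:
  fixes h :: "complex \<Rightarrow> complex"
  assumes holo: "h holomorphic_on {w. Re w > 0}"
    and bound: "\<And>w. Re w > 0 \<Longrightarrow> cmod w \<ge> R0 \<Longrightarrow> cmod (h w) \<le> C * cmod w powr (-3/2)"
    and G: "integrable lborel G" and d0: "d0 > 0"
    and dom: "\<And>d. 0 < d \<Longrightarrow> d \<le> d0 \<Longrightarrow> AE u in lborel. cmod (h (Complex d u)) \<le> G u"
    and lim: "AE u in lborel. ((\<lambda>d. h (Complex d u)) \<longlongrightarrow> h0 u) (at_right 0)"
    and h0: "h0 \<in> borel_measurable borel"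
  shows "integrable lborel h0" "(\<integral>u. h0 u \<partial>lborel) = 0"
proof -
  define dn where "dn n = d0 / (real n + 1)" for n
  have dn: "0 < dn n" "dn n \<le> d0" for n using d0 by (auto simp: dn_def field_simps)
  have dn0: "dn \<longlonglongrightarrow> 0"
    using tendsto_mult[OF tendsto_const[of d0] LIMSEQ_inverse_real_of_nat] by (simp add: dn_def[abs_def] divide_inverse add.commute)
  then have dlim: "filterlim dn (at_right 0) sequentially"
    using dn(1) by (intro tendsto_imp_filterlim_at_right) auto
  have meas: "(\<lambda>u. h (Complex d u)) \<in> borel_measurable lborel" if "d > 0" for d
  proof -
    have "continuous_on UNIV (\<lambda>u. h (Complex d u))"
      by (rule continuous_on_compose2[OF holomorphic_on_imp_continuous_on[OF holo]])
         (use that in \<open>auto simp: Complex_eq intro!: continuous_intros\<close>)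
    then show ?thesis by (simp add: borel_measurable_continuous_onI)
  qed
  have lim': "AE u in lborel. (\<lambda>n. h (Complex (dn n) u)) \<longlonglongrightarrow> h0 u"
    using lim by eventually_elim (rule filterlim_compose[OF _ dlim])
  have h0': "h0 \<in> borel_measurable lborel" using h0 by simp
  have D: "AE u in lborel. cmod (h (Complex (dn n) u)) \<le> G u" for n using dom dn by blast
  note L = integrable_dominated_convergence[OF h0' meas[OF dn(1)] G lim' D]
    integrable_dominated_convergence2[OF h0' meas[OF dn(1)] G lim' D]
    integral_dominated_convergence[OF h0' meas[OF dn(1)] G lim' D]
  show "integrable lborel h0" using L by blast
  have "(\<integral>u. h (Complex (dn n) u) \<partial>lborel) = 0" for n
    by (rule vertical_line_integral_zero[OF holo bound dn(1) L(2)])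
  then show "(\<integral>u. h0 u \<partial>lborel) = 0"
    using L(3) by (simp add: LIMSEQ_const_iff)
qed

section \<open>Integrable majorants with finitely many logarithmic singularities\<close>

lemma integrable_inverse_powr_three_halves: "integrable lborel (\<lambda>u::real. (1 + \<bar>u\<bar>) powr (-3/2))"
proof -
  define f where "f x = indicat_real {1..} x * x powr (-3/2)" for x :: real
  have f: "integrable lborel f"
  proof -
    have "(\<lambda>x::real. x powr (-3/2)) integrable_on {1..}"
      using has_integral_powr_to_inf[of "-3/2" 1] by auto
    then have "(\<lambda>x::real. x powr (-3/2)) absolutely_integrable_on {1..}"
      by (intro nonnegative_absolutely_integrable_1) auto
    then have "integrable lebesgue f" by (simp add: set_integrable_def f_def[abs_def])
    then show ?thesis
      by (subst (asm) integrable_completion) (auto simp: f_def[abs_def])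
  qed
  have "integrable lborel (\<lambda>u. f (1 + 1 * u) + f (1 + (-1) * u))"
    by (intro Bochner_Integration.integrable_add lborel_integrable_real_affine f) auto
  then show ?thesis
    by (rule Bochner_Integration.integrable_bound) (auto simp: f_def indicator_def)
qed

lemma integrable_log_weight: "integrable lborel (\<lambda>u::real. (1 + \<bar>u\<bar>) powr (-3/2) * (1 + \<bar>u - c\<bar> powr (-1/2)))"
proof -
  define f where "f x = indicat_real {0<..1} x * x powr (-1/2)" for x :: real
  have f: "integrable lborel f"
  proof -
    have "(\<lambda>x::real. x powr (-1/2)) integrable_on {0<..1}"
      by (rule integrable_on_powr_from_0') auto
    then have "(\<lambda>x::real. x powr (-1/2)) absolutely_integrable_on {0<..1}"
      by (intro nonnegative_absolutely_integrable_1) auto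
    then have "integrable lebesgue f" by (simp add: set_integrable_def f_def[abs_def])
    then show ?thesis
      by (subst (asm) integrable_completion) (auto simp: f_def[abs_def])
  qed
  have "integrable lborel (\<lambda>u. 2 * (1 + \<bar>u\<bar>) powr (-3/2) + (f (-c + 1 * u) + f (c + (-1) * u)))"
    by (intro Bochner_Integration.integrable_add integrable_mult_right integrable_inverse_powr_three_halves lborel_integrable_real_affine f) auto
  then show ?thesis
  proof (rule Bochner_Integration.integrable_bound)
    show "AE u in lborel. norm ((1 + \<bar>u\<bar>) powr (-3/2) * (1 + \<bar>u - c\<bar> powr (-1/2)))
        \<le> norm (2 * (1 + \<bar>u\<bar>) powr (-3/2) + (f (-c + 1 * u) + f (c + (-1) * u)))"
    proof (intro AE_I2)
      fix u :: real
      have k: "0 \<le> (1 + \<bar>u\<bar>) powr (-3/2)" "(1 + \<bar>u\<bar>) powr (-3/2) \<le> 1"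
        using powr_mono2'[of "-3/2" 1 "1 + \<bar>u\<bar>"] by auto
      have fpos: "f x \<ge> 0" for x by (simp add: f_def)
      show "norm ((1 + \<bar>u\<bar>) powr (-3/2) * (1 + \<bar>u - c\<bar> powr (-1/2)))
        \<le> norm (2 * (1 + \<bar>u\<bar>) powr (-3/2) + (f (-c + 1 * u) + f (c + (-1) * u)))"
      proof (cases "\<bar>u - c\<bar> \<le> 1 \<and> u \<noteq> c")
        case True
        then have "\<bar>u - c\<bar> powr (-1/2) \<le> f (-c + 1 * u) + f (c + (-1) * u)"
          using fpos by (cases "u > c") (auto simp: f_def indicator_def)
        moreover have "(1 + \<bar>u\<bar>) powr (-3/2) * \<bar>u - c\<bar> powr (-1/2) \<le> 1 * \<bar>u - c\<bar> powr (-1/2)"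
          using k by (intro mult_right_mono) auto
        moreover have "f (-c + 1 * u) + f (c + (-1) * u) \<ge> 0" using fpos by (simp add: add_nonneg_nonneg)
        ultimately have "(1 + \<bar>u\<bar>) powr (-3/2) * (1 + \<bar>u - c\<bar> powr (-1/2))
            \<le> 2 * (1 + \<bar>u\<bar>) powr (-3/2) + (f (-c + 1 * u) + f (c + (-1) * u))"
          using k(1) unfolding distrib_left by linarith
        then show ?thesis by simp
      next
        case False
        then have "\<bar>u - c\<bar> powr (-1/2) \<le> 1"
        proof (cases "u = c")
          case False2: False
          then have "\<bar>u - c\<bar> \<ge> 1" using False by auto
          then have "\<bar>u - c\<bar> powr (-1/2) \<le> 1 powr (-1/2)" by (intro powr_mono2') auto
          then show ?thesis by simp
        qed auto
        then have "(1 + \<bar>u\<bar>) powr (-3/2) * \<bar>u - c\<bar> powr (-1/2) \<le> (1 + \<bar>u\<bar>) powr (-3/2) * 1"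
          using k by (intro mult_left_mono) auto
        then show ?thesis using k fpos[of "-c + 1 * u"] fpos[of "c + (-1) * u"] by (simp add: algebra_simps)
      qed
    qed
  qed auto
qed

text \<open>Common majorant for products of two logarithms. Each logarithm is O(|u - c|^(-1/4)) at a
  singularity c, so even where two singularities coincide the product is O(|u - c|^(-1/2)), which is
  still integrable.\<close>

definition log_dominator :: "real set \<Rightarrow> real \<Rightarrow> real" where
  "log_dominator S u = (1 + \<bar>u\<bar>) powr (-3/2) * (1 + (\<Sum>c\<in>S. \<bar>u - c\<bar> powr (-1/2)))"

lemma integrable_log_dominator:
  assumes "finite S" shows "integrable lborel (log_dominator S)"
proof -
  have "integrable lborel (\<lambda>u. (1 + \<bar>u\<bar>) powr (-3/2) + (\<Sum>c\<in>S. (1 + \<bar>u\<bar>) powr (-3/2) * \<bar>u - c\<bar> powr (-1/2)))"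
  proof (intro Bochner_Integration.integrable_add Bochner_Integration.integrable_sum integrable_inverse_powr_three_halves)
    fix c :: real
    show "integrable lborel (\<lambda>u. (1 + \<bar>u\<bar>) powr (-3/2) * \<bar>u - c\<bar> powr (-1/2))"
      by (rule Bochner_Integration.integrable_bound[OF integrable_log_weight[of c]])
         (auto simp: algebra_simps)
  qed
  then show ?thesis by (simp add: log_dominator_def[abs_def] algebra_simps sum_distrib_left)
qed

lemma abs_ln_le_powr:
  assumes "(r::real) > 0" shows "\<bar>ln r\<bar> \<le> 4 * (r powr (1/4) + r powr (-1/4))"
proof (cases "r \<ge> 1")
  case True
  have "ln r \<le> 4 * r powr (1/4)" using ln_powr_bound[of r "1/4"] True by (simp add: mult.commute)
  moreover have "r powr (-1/4) \<ge> 0" by simp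
  moreover have "ln r \<ge> 0" using True by simp
  ultimately show ?thesis unfolding distrib_left abs_of_nonneg[OF \<open>ln r \<ge> 0\<close>] by linarith
next
  case False
  have "ln (1/r) \<le> 4 * (1/r) powr (1/4)" using ln_powr_bound[of "1/r" "1/4"] False assms by (simp add: mult.commute)
  moreover have "(1/r) powr (1/4) = r powr (-1/4)" using assms by (simp add: powr_divide powr_minus_divide)
  moreover have "r powr (1/4) \<ge> 0" by simp
  moreover have "ln r \<le> 0" "ln (1/r) = - ln r" using False assms by (auto simp: ln_div)
  ultimately show ?thesis unfolding distrib_left abs_of_nonpos[OF \<open>ln r \<le> 0\<close>] by linarith
qed

lemma cmod_Ln_le:
  assumes "z \<noteq> 0" shows "cmod (Ln z) \<le> \<bar>ln (cmod z)\<bar> + pi"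
proof -
  have "cmod (Ln z) \<le> \<bar>Re (Ln z)\<bar> + \<bar>Im (Ln z)\<bar>" by (rule cmod_le)
  also have "\<dots> \<le> \<bar>ln (cmod z)\<bar> + pi"
    using mpi_less_Im_Ln[OF assms] Im_Ln_le_pi[OF assms] assms by (auto simp: abs_le_iff)
  finally show ?thesis .
qed

text \<open>Since |v| <= |x + iv| <= X + |v|, the modulus is controlled by v alone and x enters only
  through X. This uniformity is what provides a majorant while the vertical line moves.\<close>

lemma cmod_Ln_vertical_le:
  assumes x: "0 \<le> x" "x \<le> X" and v: "v \<noteq> 0"
  shows "cmod (Ln (Complex x v)) \<le> (4 * X + 12) * (1 + \<bar>v\<bar>) powr (1/4) * (1 + \<bar>v\<bar> powr (-1/4))"
proof -
  define r where "r = cmod (Complex x v)"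
  have rv: "\<bar>v\<bar> \<le> r" unfolding r_def using abs_Im_le_cmod[of "Complex x v"] by simp
  have rX: "r \<le> X + \<bar>v\<bar>" unfolding r_def using cmod_le[of "Complex x v"] x by simp
  have r0: "r > 0" using rv v by linarith
  define A where "A = (1 + \<bar>v\<bar>) powr (1/4)"
  define B where "B = \<bar>v\<bar> powr (-1/4)"
  have A1: "A \<ge> 1" unfolding A_def by (rule ge_one_powr_ge_zero) auto
  have B0: "B \<ge> 0" by (simp add: B_def)
  have "Complex x v \<noteq> 0" using v by (simp add: complex_eq_iff)
  then have 1: "cmod (Ln (Complex x v)) \<le> 4 * (r powr (1/4) + r powr (-1/4)) + pi"
    using cmod_Ln_le[of "Complex x v"] abs_ln_le_powr[OF r0] by (simp add: r_def)
  have 2: "r powr (1/4) \<le> (X + 1) * A"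
  proof -
    have "r \<le> (X+1) * (1 + \<bar>v\<bar>)" using rX x mult_nonneg_nonneg[of X "\<bar>v\<bar>"] unfolding ring_distribs by linarith
    then have "r powr (1/4) \<le> ((X+1) * (1 + \<bar>v\<bar>)) powr (1/4)" using r0 by (intro powr_mono2) auto
    also have "\<dots> = (X+1) powr (1/4) * A" using x by (simp add: powr_mult A_def)
    also have "\<dots> \<le> (X+1) powr 1 * A"
      using x A1 by (intro mult_right_mono powr_mono) auto
    finally show ?thesis using x by simp
  qed
  have 3: "r powr (-1/4) \<le> B" unfolding B_def using rv v by (intro powr_mono2') auto
  have 4: "4 * ((X+1) * A + B) + 4 \<le> (4 * X + 12) * A * (1 + B)"
  proof -
    have "1 * B \<le> A * B" using A1 B0 by (intro mult_right_mono) auto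
    moreover have "X * A * B \<ge> 0" using x A1 B0 by simp
    moreover have "(4 * X + 12) * A * (1 + B) = 4 * ((X+1) * A) + 8 * A + 4 * (X * A * B) + 12 * (A * B)"
      by (simp add: algebra_simps)
    ultimately show ?thesis using A1 B0 by argo
  qed
  have "cmod (Ln (Complex x v)) \<le> 4 * ((X+1) * A + B) + 4" using 1 2 3 pi_less_4 unfolding distrib_left by linarith
  then have "cmod (Ln (Complex x v)) \<le> (4 * X + 12) * A * (1 + B)" using 4 by linarith
  then show ?thesis by (simp add: A_def B_def)
qed

section \<open>The integral of a single logarithmic factor\<close>

text \<open>The real parts of the boundary values of green_log t and pair_log a at Complex 0 u are
ln |1 - t^2/u^2| and lnfac a u, and the harmonic conjugate of the latter is argfac a u.\<close>

definition green_log :: "real \<Rightarrow> complex \<Rightarrow> complex" where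
  "green_log t w = Ln (w + Complex 0 t) + Ln (w + Complex 0 (-t)) - 2 * Ln w"

definition pair_log :: "complex \<Rightarrow> complex \<Rightarrow> complex" where
  "pair_log a w = (Ln (a + w) + Ln (cnj a + w)) / 2 - of_real (ln (cmod a))"

definition lnfac :: "complex \<Rightarrow> real \<Rightarrow> real" where
  "lnfac a u = ln (cmod (1 + of_real (u^2) / a^2)) / 2"

definition argfac :: "complex \<Rightarrow> real \<Rightarrow> real" where
  "argfac a u = (Im (Ln (a + Complex 0 u)) + Im (Ln (cnj a + Complex 0 u))) / 2"

section \<open>Growth and boundary values of the two logarithms\<close>

lemma pos_Re_notin_nonpos_Reals: "Re z > 0 \<Longrightarrow> z \<notin> \<real>\<^sub>\<le>\<^sub>0"
  by (auto simp: complex_nonpos_Reals_iff)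

lemma holomorphic_pair_log: "Re a \<ge> 0 \<Longrightarrow> pair_log a holomorphic_on {w. Re w > 0}"
  unfolding pair_log_def[abs_def]
  by (intro holomorphic_intros) (auto intro!: pos_Re_notin_nonpos_Reals)

lemma holomorphic_green_log: "green_log t holomorphic_on {w. Re w > 0}"
  unfolding green_log_def[abs_def]
  by (intro holomorphic_intros) (auto intro!: pos_Re_notin_nonpos_Reals)

lemma powr_shift_le: "(1 + \<bar>u + c\<bar>) powr (1/4) \<le> (1 + \<bar>c\<bar>) * (1 + \<bar>u::real\<bar>) powr (1/4)"
proof -
  have "1 + \<bar>u + c\<bar> \<le> (1 + \<bar>c\<bar>) * (1 + \<bar>u\<bar>)"
    using abs_triangle_ineq[of u c] mult_nonneg_nonneg[of "\<bar>c\<bar>" "\<bar>u\<bar>"] unfolding ring_distribs by linarith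
  then have "(1 + \<bar>u + c\<bar>) powr (1/4) \<le> ((1 + \<bar>c\<bar>) * (1 + \<bar>u\<bar>)) powr (1/4)"
    by (intro powr_mono2) auto
  also have "\<dots> = (1 + \<bar>c\<bar>) powr (1/4) * (1 + \<bar>u\<bar>) powr (1/4)" by (simp add: powr_mult)
  also have "\<dots> \<le> (1 + \<bar>c\<bar>) powr 1 * (1 + \<bar>u\<bar>) powr (1/4)"
    by (intro mult_right_mono powr_mono) auto
  finally show ?thesis by simp
qed

lemma cmod_Ln_shift_le:
  assumes "0 \<le> x" "x \<le> X" "u + c \<noteq> 0"
  shows "cmod (Ln (Complex x (u + c))) \<le> (4 * X + 12) * (1 + \<bar>c\<bar>) * (1 + \<bar>u\<bar>) powr (1/4) * (1 + \<bar>u + c\<bar> powr (-1/4))"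
proof -
  have "cmod (Ln (Complex x (u + c))) \<le> (4 * X + 12) * (1 + \<bar>u + c\<bar>) powr (1/4) * (1 + \<bar>u + c\<bar> powr (-1/4))"
    by (rule cmod_Ln_vertical_le) (use assms in auto)
  also have "\<dots> \<le> (4 * X + 12) * ((1 + \<bar>c\<bar>) * (1 + \<bar>u\<bar>) powr (1/4)) * (1 + \<bar>u + c\<bar> powr (-1/4))"
    using assms by (intro mult_right_mono mult_left_mono powr_shift_le) auto
  finally show ?thesis by (simp only: mult.assoc)
qed

text \<open>The constant does not depend on \<open>d\<close>, so the bound survives the limit d ->
  0. The singularities at \<open>Im a\<close> and \<open>- Im a\<close> are genuine when Re a = 0,
  the case of a zero on the critical line.\<close>

lemma pair_log_vertical_le:
  assumes a: "Re a \<ge> 0"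
  obtains C where "C \<ge> 0" "\<And>d u. 0 < d \<Longrightarrow> d \<le> 1 \<Longrightarrow> u \<noteq> Im a \<Longrightarrow> u \<noteq> - Im a \<Longrightarrow>
     cmod (pair_log a (Complex d u)) \<le> C * (1 + \<bar>u\<bar>) powr (1/4) * (1 + \<bar>u - Im a\<bar> powr (-1/4) + \<bar>u + Im a\<bar> powr (-1/4))"
proof -
  define K where "K = (4 * (Re a + 1) + 12) * (1 + \<bar>Im a\<bar>)"
  have K: "K \<ge> 0" using a by (simp add: K_def)
  define C where "C = K + \<bar>ln (cmod a)\<bar>"
  show thesis
  proof (rule that[of C])
    show "C \<ge> 0" using K by (simp add: C_def)
    fix d u :: real assume d: "0 < d" "d \<le> 1" and u: "u \<noteq> Im a" "u \<noteq> - Im a"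
    define A where "A = (1 + \<bar>u\<bar>) powr (1/4)"
    define p where "p = \<bar>u - Im a\<bar> powr (-1/4)"
    define q where "q = \<bar>u + Im a\<bar> powr (-1/4)"
    have A: "A \<ge> 1" unfolding A_def by (rule ge_one_powr_ge_zero) auto
    have pq: "p \<ge> 0" "q \<ge> 0" by (auto simp: p_def q_def)
    have "cmod (Ln (Complex (Re a + d) (u + Im a))) \<le> (4 * (Re a + 1) + 12) * (1 + \<bar>Im a\<bar>) * (1 + \<bar>u\<bar>) powr (1/4) * (1 + \<bar>u + Im a\<bar> powr (-1/4))"
      by (rule cmod_Ln_shift_le) (use a d u in auto)
    then have 1: "cmod (Ln (a + Complex d u)) \<le> K * A * (1 + q)"
      by (simp add: K_def A_def q_def complex_eq_iff plus_complex.code add.commute)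
    have "cmod (Ln (Complex (Re a + d) (u + - Im a))) \<le> (4 * (Re a + 1) + 12) * (1 + \<bar>- Im a\<bar>) * (1 + \<bar>u\<bar>) powr (1/4) * (1 + \<bar>u + - Im a\<bar> powr (-1/4))"
      by (rule cmod_Ln_shift_le) (use a d u in auto)
    moreover have "cnj a + Complex d u = Complex (Re a + d) (u + - Im a)" by (simp add: complex_eq_iff)
    ultimately have 2: "cmod (Ln (cnj a + Complex d u)) \<le> K * A * (1 + p)"
      by (simp add: K_def A_def p_def)
    have "cmod (pair_log a (Complex d u)) \<le> cmod ((Ln (a + Complex d u) + Ln (cnj a + Complex d u)) / 2) + cmod (of_real (ln (cmod a)))"
      unfolding pair_log_def by (rule norm_triangle_ineq4)
    also have "\<dots> \<le> (cmod (Ln (a + Complex d u)) + cmod (Ln (cnj a + Complex d u))) / 2 + \<bar>ln (cmod a)\<bar>"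
      using norm_triangle_ineq[of "Ln (a + Complex d u)" "Ln (cnj a + Complex d u)"] by (simp add: norm_divide)
    also have "\<dots> \<le> (K * A * (1 + q) + K * A * (1 + p)) / 2 + \<bar>ln (cmod a)\<bar>" using 1 2 by simp
    also have "\<dots> \<le> K * A * (1 + p + q) + \<bar>ln (cmod a)\<bar> * (A * (1 + p + q))"
    proof (rule add_mono)
      have "K * A * p \<ge> 0" "K * A * q \<ge> 0" using K A pq by auto
      then show "(K * A * (1 + q) + K * A * (1 + p)) / 2 \<le> K * A * (1 + p + q)" by (simp add: distrib_left add_divide_distrib)
      have "1 * 1 \<le> A * (1 + p + q)" using A pq by (intro mult_mono) auto
      then show "\<bar>ln (cmod a)\<bar> \<le> \<bar>ln (cmod a)\<bar> * (A * (1 + p + q))" by (simp add: mult_left_le mult_le_cancel_left1)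
    qed
    also have "\<dots> = C * A * (1 + p + q)" by (simp add: C_def algebra_simps)
    finally show "cmod (pair_log a (Complex d u)) \<le> C * (1 + \<bar>u\<bar>) powr (1/4) * (1 + \<bar>u - Im a\<bar> powr (-1/4) + \<bar>u + Im a\<bar> powr (-1/4))"
      by (simp add: A_def p_def q_def)
  qed
qed

lemma pair_log_large_le:
  assumes a: "Re a \<ge> 0"
  obtains C R0 where "C \<ge> 0" "R0 \<ge> 1" "\<And>w. Re w > 0 \<Longrightarrow> cmod w \<ge> R0 \<Longrightarrow> cmod (pair_log a w) \<le> C * cmod w powr (1/4)"
proof -
  define C where "C = 20 + \<bar>ln (cmod a)\<bar>"
  define R0 where "R0 = 1 + cmod a"
  have one: "cmod (Ln (b + w)) \<le> 20 * cmod w powr (1/4)" if w: "Re w > 0" "cmod w \<ge> R0" and b: "cmod b = cmod a" "Re b \<ge> 0" for b w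
  proof -
    have ge: "cmod (b + w) \<ge> 1" using norm_diff_ineq[of w b] w b by (simp add: R0_def add.commute)
    have le: "cmod (b + w) \<le> 2 * cmod w" using norm_triangle_ineq[of b w] w b by (simp add: R0_def)
    have w1: "cmod w \<ge> 1" using w norm_ge_zero[of a] unfolding R0_def by linarith
    have "b + w \<noteq> 0" using ge by auto
    then have "cmod (Ln (b + w)) \<le> \<bar>ln (cmod (b + w))\<bar> + pi" by (rule cmod_Ln_le)
    also have "\<bar>ln (cmod (b + w))\<bar> = ln (cmod (b + w))" using ge by simp
    also have "\<dots> \<le> 4 * cmod (b + w) powr (1/4)" using ln_powr_bound[of "cmod (b+w)" "1/4"] ge by (simp add: mult.commute)
    also have "cmod (b + w) powr (1/4) \<le> (2 * cmod w) powr (1/4)" using le by (intro powr_mono2) auto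
    also have "(2 * cmod w) powr (1/4) = 2 powr (1/4) * cmod w powr (1/4)" by (simp add: powr_mult)
    also have "2 powr (1/4) * cmod w powr (1/4) \<le> 2 powr 1 * cmod w powr (1/4)" by (intro mult_right_mono powr_mono) auto
    finally have "cmod (Ln (b + w)) \<le> 8 * cmod w powr (1/4) + 4" using pi_less_4 by simp
    moreover have "cmod w powr (1/4) \<ge> 1" using w1 by (intro ge_one_powr_ge_zero) auto
    ultimately show ?thesis by linarith
  qed
  show thesis
  proof (rule that[of C R0])
    show "C \<ge> 0" "R0 \<ge> 1" by (auto simp: C_def R0_def)
    fix w assume w: "Re w > 0" "cmod w \<ge> R0"
    have w1: "cmod w \<ge> 1" using w norm_ge_zero[of a] unfolding R0_def by linarith
    have A: "cmod w powr (1/4) \<ge> 1" using w1 by (intro ge_one_powr_ge_zero) auto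
    have "cmod (pair_log a w) \<le> cmod ((Ln (a + w) + Ln (cnj a + w)) / 2) + cmod (of_real (ln (cmod a)))"
      unfolding pair_log_def by (rule norm_triangle_ineq4)
    also have "\<dots> \<le> (cmod (Ln (a + w)) + cmod (Ln (cnj a + w))) / 2 + \<bar>ln (cmod a)\<bar>"
      using norm_triangle_ineq[of "Ln (a + w)" "Ln (cnj a + w)"] by (simp add: norm_divide)
    also have "\<dots> \<le> 20 * cmod w powr (1/4) + \<bar>ln (cmod a)\<bar>"
      using one[OF w, of a] one[OF w, of "cnj a"] a by simp
    also have "\<dots> = 20 * cmod w powr (1/4) + \<bar>ln (cmod a)\<bar> * 1" by simp
    also have "\<dots> \<le> 20 * cmod w powr (1/4) + \<bar>ln (cmod a)\<bar> * cmod w powr (1/4)" using A by (intro add_left_mono mult_left_mono) auto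
    finally show "cmod (pair_log a w) \<le> C * cmod w powr (1/4)" by (simp add: C_def algebra_simps)
  qed
qed

text \<open>In the right half-plane all arguments lie within (-pi/2, pi/2), so Ln (w + is) - Ln w =
  Ln (1 + is/w) without a branch correction. For s = t and s = -t the first-order terms cancel,
  which leaves second order in t/w.\<close>

lemma green_log_large_le:
  assumes t: "t > 0" and w: "Re w > 0" "cmod w \<ge> 2 * t"
  shows "cmod (green_log t w) \<le> 4 * t^2 / cmod w ^ 2"
proof -
  have w0: "w \<noteq> 0" using w by auto
  have Ln_shift: "Ln (w + Complex 0 s) - Ln w = Ln (1 + Complex 0 s / w)" if "\<bar>s\<bar> = t" for s
  proof -
    have r: "Re (w + Complex 0 s) > 0" using w by simp
    then have nz: "w + Complex 0 s \<noteq> 0" by (metis less_irrefl zero_complex.sel(1))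
    have "exp (Ln (w + Complex 0 s) - Ln w) = 1 + Complex 0 s / w"
      using w0 nz by (simp add: exp_diff field_simps)
    moreover have "\<bar>Im (Ln (w + Complex 0 s))\<bar> < pi/2" "\<bar>Im (Ln w)\<bar> < pi/2"
      using r w by (simp_all only: Re_Ln_pos_lt_imp)
    ultimately show ?thesis by (intro Ln_unique[symmetric]) auto
  qed
  define z where "z = Complex 0 t / w"
  have zt: "cmod z = t / cmod w" unfolding z_def norm_divide using t by (simp add: cmod_def)
  have z: "cmod z \<le> 1/2" using w t w0 by (simp add: zt field_simps)
  have mz: "Complex 0 (-t) / w = - z"
  proof -
    have "Complex 0 (-t) = - Complex 0 t" by (simp add: complex_eq_iff)
    then show ?thesis by (simp add: z_def)
  qed
  have "green_log t w = (Ln (1 + z) - z) + (Ln (1 + (- z)) - (- z))"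
    using Ln_shift[of t] Ln_shift[of "-t"] t unfolding mz z_def[symmetric] green_log_def by (simp add: algebra_simps)
  also have "cmod \<dots> \<le> cmod z ^ 2 / (1 - cmod z) + cmod (-z) ^ 2 / (1 - cmod (-z))"
    using z by (intro norm_triangle_le add_mono Ln_approx_linear) auto
  also have "\<dots> = 2 * (cmod z ^ 2 / (1 - cmod z))" by simp
  also have "\<dots> \<le> 2 * (cmod z ^ 2 / (1/2))" using z by (intro mult_left_mono divide_left_mono) auto
  finally show ?thesis by (simp add: zt power_divide)
qed

lemma green_log_vertical_le:
  assumes t: "t > 0"
  obtains C where "C \<ge> 0" "\<And>d u. 0 < d \<Longrightarrow> d \<le> 1 \<Longrightarrow> u \<noteq> 0 \<Longrightarrow> u \<noteq> t \<Longrightarrow> u \<noteq> - t \<Longrightarrow>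
     cmod (green_log t (Complex d u)) \<le> C * (1 + \<bar>u\<bar>) powr (-2) * (1 + \<bar>u\<bar> powr (-1/4) + \<bar>u - t\<bar> powr (-1/4) + \<bar>u + t\<bar> powr (-1/4))"
proof -
  define K where "K = 16 * (1 + t) * (2 + 2 * t)"
  have K: "K \<ge> 0" using t by (simp add: K_def)
  \<comment> \<open>One summand per regime: the first serves |u| < 2t, where 1 + |u| <= 2 + 2t, and
    the second serves |u| >= 2t, where 1 + |u| <= (1 + 1/(2t)) |u|.\<close>
  define C where "C = 4 * (K * (2 + 2 * t)^2) + 4 * t^2 * (1 + 1 / (2 * t))^2"
  have C: "C \<ge> 0" using K t by (simp add: C_def)
  show thesis
  proof (rule that[of C])
    show "C \<ge> 0" by fact
    fix d u :: real assume d: "0 < d" "d \<le> 1" and u: "u \<noteq> 0" "u \<noteq> t" "u \<noteq> - t"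
    define Q where "Q = 1 + \<bar>u\<bar> powr (-1/4) + \<bar>u - t\<bar> powr (-1/4) + \<bar>u + t\<bar> powr (-1/4)"
    have Q: "Q \<ge> 1" by (simp add: Q_def add_nonneg_nonneg)
    have B: "(1 + \<bar>u\<bar>) powr (-2) = 1 / (1 + \<bar>u\<bar>)^2"
      by (simp add: powr_minus_divide powr_realpow[of _ 2, simplified])
    have Bpos: "(1 + \<bar>u\<bar>) powr (-2) \<ge> 0" by simp
    show "cmod (green_log t (Complex d u)) \<le> C * (1 + \<bar>u\<bar>) powr (-2) * (1 + \<bar>u\<bar> powr (-1/4) + \<bar>u - t\<bar> powr (-1/4) + \<bar>u + t\<bar> powr (-1/4))"
    proof (cases "\<bar>u\<bar> \<ge> 2 * t")
      case True
      have cu: "cmod (Complex d u) \<ge> \<bar>u\<bar>" using abs_Im_le_cmod[of "Complex d u"] by simp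
      have "cmod (green_log t (Complex d u)) \<le> 4 * t^2 / cmod (Complex d u) ^ 2"
        by (rule green_log_large_le) (use t d True cu in auto)
      also have "\<dots> \<le> 4 * t^2 / \<bar>u\<bar>^2"
        using cu u by (intro divide_left_mono power_mono mult_pos_pos) (auto simp: complex_eq_iff)
      also have "\<dots> \<le> 4 * t^2 * (1 + 1 / (2 * t))^2 * (1 / (1 + \<bar>u\<bar>)^2)"
      proof -
        have "1 + \<bar>u\<bar> \<le> (1 + 1 / (2 * t)) * \<bar>u\<bar>" using True t by (simp add: field_simps)
        then have "(1 + \<bar>u\<bar>)^2 \<le> ((1 + 1 / (2 * t)) * \<bar>u\<bar>)^2" by (intro power_mono) auto
        then have "(1 + \<bar>u\<bar>)^2 \<le> (1 + 1 / (2 * t))^2 * \<bar>u\<bar>^2" by (simp only: power_mult_distrib)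
        then have "1 / \<bar>u\<bar>^2 \<le> (1 + 1 / (2 * t))^2 * (1 / (1 + \<bar>u\<bar>)^2)"
          using u by (simp add: pos_divide_le_eq pos_le_divide_eq mult.commute)
        then have "4 * t^2 * (1 / \<bar>u\<bar>^2) \<le> 4 * t^2 * ((1 + 1 / (2 * t))^2 * (1 / (1 + \<bar>u\<bar>)^2))"
          by (intro mult_left_mono) auto
        then show ?thesis by (simp only: mult.assoc times_divide_eq_right mult_1_right)
      qed
      also have "\<dots> \<le> C * (1 / (1 + \<bar>u\<bar>)^2)"
        using K t by (intro mult_right_mono) (auto simp: C_def)
      also have "\<dots> = C * (1 + \<bar>u\<bar>) powr (-2) * 1" by (simp add: B)
      also have "\<dots> \<le> C * (1 + \<bar>u\<bar>) powr (-2) * Q" using Q C Bpos by (intro mult_left_mono mult_nonneg_nonneg) auto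
      finally show ?thesis by (simp add: Q_def)
    next
      case False
      have e: "(1 + \<bar>u\<bar>) powr (1/4) \<le> 2 + 2 * t"
      proof -
        have "(1 + \<bar>u\<bar>) powr (1/4) \<le> (1 + \<bar>u\<bar>) powr 1" by (intro powr_mono) auto
        then show ?thesis using False by simp
      qed
      have L: "cmod (Ln (Complex d (u + c))) \<le> 16 * (1 + t) * (2 + 2 * t) * (1 + \<bar>u + c\<bar> powr (-1/4))" if c: "\<bar>c\<bar> \<le> t" "u + c \<noteq> 0" for c
      proof -
        have "cmod (Ln (Complex d (u + c))) \<le> (4 * 1 + 12) * (1 + \<bar>c\<bar>) * (1 + \<bar>u\<bar>) powr (1/4) * (1 + \<bar>u + c\<bar> powr (-1/4))"
          by (rule cmod_Ln_shift_le) (use d c in auto)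
        also have "\<dots> \<le> (4 * 1 + 12) * (1 + t) * (2 + 2 * t) * (1 + \<bar>u + c\<bar> powr (-1/4))"
          using c e t by (intro mult_right_mono mult_mono) auto
        finally show ?thesis by simp
      qed
      have "green_log t (Complex d u) = Ln (Complex d (u + t)) + Ln (Complex d (u + (-t))) - 2 * Ln (Complex d (u + 0))"
        by (simp add: green_log_def plus_complex.code)
      also have "cmod \<dots> \<le> cmod (Ln (Complex d (u + t))) + cmod (Ln (Complex d (u + (-t)))) + 2 * cmod (Ln (Complex d (u + 0)))"
        by (intro norm_triangle_le_diff add_mono norm_triangle_ineq) (simp add: norm_mult)
      also have "\<dots> \<le> K * (1 + \<bar>u + t\<bar> powr (-1/4)) + K * (1 + \<bar>u + (-t)\<bar> powr (-1/4)) + 2 * (K * (1 + \<bar>u + 0\<bar> powr (-1/4)))"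
        unfolding K_def using L[of t] L[of "-t"] L[of 0] t u by (intro add_mono mult_left_mono) simp_all
      also have "\<dots> \<le> K * 4 * Q"
      proof -
        define x y z where "x = \<bar>u + t\<bar> powr (-1/4)" and "y = \<bar>u + (-t)\<bar> powr (-1/4)" and "z = \<bar>u + 0\<bar> powr (-1/4)"
        have "x \<ge> 0" "y \<ge> 0" "z \<ge> 0" by (auto simp: x_def y_def z_def)
        then have "K * x \<ge> 0" "K * y \<ge> 0" "K * z \<ge> 0" using K by auto
        moreover have "Q = 1 + z + y + x" by (simp add: Q_def x_def y_def z_def)
        ultimately show ?thesis using K unfolding x_def[symmetric] y_def[symmetric] z_def[symmetric]
          by (simp add: algebra_simps)
      qed
      also have "\<dots> \<le> K * (2 + 2 * t)^2 * (1 / (1 + \<bar>u\<bar>)^2) * Q * 4"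
      proof -
        have "(1 + \<bar>u\<bar>)^2 \<le> (2 + 2 * t)^2" using False by (intro power_mono) auto
        then have "1 \<le> (2 + 2 * t)^2 * (1 / (1 + \<bar>u\<bar>)^2)" by (simp add: field_simps)
        then have "K * 4 * Q * 1 \<le> K * 4 * Q * ((2 + 2 * t)^2 * (1 / (1 + \<bar>u\<bar>)^2))" using K Q by (intro mult_left_mono) auto
        then show ?thesis by (simp add: algebra_simps)
      qed
      also have "\<dots> = 4 * (K * (2 + 2 * t)^2) * (1 / (1 + \<bar>u\<bar>)^2) * Q" by (simp add: algebra_simps)
      also have "\<dots> \<le> C * (1 / (1 + \<bar>u\<bar>)^2) * Q" using K t Q by (intro mult_right_mono) (auto simp: C_def)
      finally show ?thesis by (simp add: B Q_def)
    qed
  qed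
qed

lemma tendsto_pair_log_boundary:
  assumes "Re a \<ge> 0" "u \<noteq> Im a" "u \<noteq> - Im a"
  shows "((\<lambda>d. pair_log a (Complex d u)) \<longlongrightarrow> pair_log a (Complex 0 u)) (at_right 0)"
  unfolding pair_log_def using assms
  by (intro tendsto_intros) (auto simp: complex_nonpos_Reals_iff)

lemma tendsto_green_log_boundary:
  assumes "u \<noteq> 0" "u \<noteq> t" "u \<noteq> - t"
  shows "((\<lambda>d. green_log t (Complex d u)) \<longlongrightarrow> green_log t (Complex 0 u)) (at_right 0)"
  unfolding green_log_def using assms
  by (intro tendsto_intros) (auto simp: complex_nonpos_Reals_iff)

lemma pair_factor_product:
  assumes "a \<noteq> 0"
  shows "1 + of_real (u^2) / a^2 = (a + Complex 0 u) * (a - Complex 0 u) / a^2"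
proof -
  have "(a + Complex 0 u) * (a - Complex 0 u) = a^2 - (Complex 0 u)^2" by (simp add: power2_eq_square algebra_simps)
  also have "(Complex 0 u)^2 = - of_real (u^2)" by (simp add: power2_eq_square complex_eq_iff)
  finally show ?thesis using assms by (simp add: field_simps)
qed

lemma Re_pair_log_boundary:
  assumes "a \<noteq> 0" "u \<noteq> Im a" "u \<noteq> - Im a"
  shows "Re (pair_log a (Complex 0 u)) = lnfac a u"
proof -
  have nz: "a + Complex 0 u \<noteq> 0" "cnj a + Complex 0 u \<noteq> 0" "a - Complex 0 u \<noteq> 0" using assms by (auto simp: complex_eq_iff)
  have c: "cmod (cnj a + Complex 0 u) = cmod (a - Complex 0 u)"
  proof -
    have "cnj a + Complex 0 u = cnj (a - Complex 0 u)" by (simp add: complex_eq_iff)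
    then show ?thesis by (simp only: complex_mod_cnj)
  qed
  have "Re (pair_log a (Complex 0 u)) = (ln (cmod (a + Complex 0 u)) + ln (cmod (a - Complex 0 u))) / 2 - ln (cmod a)"
    using nz by (simp add: pair_log_def c)
  also have "\<dots> = ln (cmod (a + Complex 0 u) * cmod (a - Complex 0 u) / cmod a ^ 2) / 2"
    using nz assms(1) by (simp add: ln_mult ln_div ln_realpow field_simps)
  also have "\<dots> = lnfac a u" unfolding lnfac_def pair_factor_product[OF assms(1)]
    by (simp add: norm_mult norm_divide norm_power)
  finally show ?thesis .
qed

lemma Im_pair_log_boundary: "Im (pair_log a (Complex 0 u)) = argfac a u"
  by (simp add: pair_log_def argfac_def)

lemma Im_Ln_imaginary:
  assumes "v \<noteq> 0" shows "Im (Ln (Complex 0 v)) = sgn v * pi / 2"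
proof (cases "v > 0")
  case True
  have "Ln (Complex 0 v) = Complex (ln v) (pi/2)"
    by (rule Ln_unique) (use True in \<open>auto simp: exp_eq_polar complex_eq_iff cis.ctr\<close>)
  then show ?thesis using True by simp
next
  case False
  have "Ln (Complex 0 v) = Complex (ln (-v)) (-pi/2)"
    by (rule Ln_unique) (use False assms pi_gt_zero in \<open>auto simp: exp_eq_polar complex_eq_iff cis.ctr intro: order_trans[of _ 0]\<close>)
  then show ?thesis using False assms by simp
qed

lemma green_log_boundary_eq: "green_log t (Complex 0 u) = Ln (Complex 0 (u + t)) + Ln (Complex 0 (u - t)) - 2 * Ln (Complex 0 u)"
  by (simp add: green_log_def plus_complex.code)

lemma Re_green_log_boundary:
  assumes "u \<noteq> 0" "u \<noteq> t" "u \<noteq> - t"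
  shows "Re (green_log t (Complex 0 u)) = ln \<bar>1 - t^2 / u^2\<bar>"
proof -
  have nz: "Complex 0 (u + t) \<noteq> 0" "Complex 0 (u - t) \<noteq> 0" "Complex 0 u \<noteq> 0" using assms by (auto simp: complex_eq_iff)
  have n: "cmod (Complex 0 v) = \<bar>v\<bar>" for v by (simp add: cmod_def)
  have "1 - t^2 / u^2 = (u + t) * (u - t) / u^2" using assms by (simp add: field_simps power2_eq_square)
  then have "ln \<bar>1 - t^2 / u^2\<bar> = ln (\<bar>u + t\<bar> * \<bar>u - t\<bar> / \<bar>u\<bar>^2)" by (simp add: abs_mult)
  also have "\<dots> = ln \<bar>u + t\<bar> + ln \<bar>u - t\<bar> - 2 * ln \<bar>u\<bar>"
    using assms ln_realpow[of "\<bar>u\<bar>" 2] by (simp add: ln_mult ln_div)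
  finally show ?thesis using nz by (simp add: green_log_boundary_eq n)
qed

text \<open>The three arguments are each pi/2 up to sign. For |u| > t they agree in sign and cancel
  with weights 1, 1, -2; for |u| < t the first two cancel each other and -2 Arg (iu) remains. This
  is what localises the Green integral to the interval [-t, t].\<close>

lemma Im_green_log_boundary:
  assumes "u \<noteq> 0" "u \<noteq> t" "u \<noteq> - t" "t > 0"
  shows "Im (green_log t (Complex 0 u)) = (if \<bar>u\<bar> > t then 0 else - pi * sgn u)"
  using assms by (auto simp: green_log_boundary_eq Im_Ln_imaginary sgn_if)

lemma argfac_minus:
  assumes "Re a \<ge> 0" "u \<noteq> Im a" "u \<noteq> - Im a"
  shows "argfac a (-u) = - argfac a u"
proof -
  have eq: "a + Complex 0 (-u) = cnj (cnj a + Complex 0 u)" "cnj a + Complex 0 (-u) = cnj (a + Complex 0 u)"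
    by (auto simp: complex_eq_iff)
  have "cnj a + Complex 0 u \<notin> \<real>\<^sub>\<le>\<^sub>0" "a + Complex 0 u \<notin> \<real>\<^sub>\<le>\<^sub>0"
    using assms by (auto simp: complex_nonpos_Reals_iff)
  then have "Im (Ln (cnj (cnj a + Complex 0 u))) = - Im (Ln (cnj a + Complex 0 u))"
    "Im (Ln (cnj (a + Complex 0 u))) = - Im (Ln (a + Complex 0 u))"
    by (metis cnj_Ln cnj.sel(2))+
  then show ?thesis unfolding argfac_def eq by (simp add: field_simps)
qed

lemma argfac_bounded:
  assumes "u \<noteq> Im a" "u \<noteq> - Im a"
  shows "\<bar>argfac a u\<bar> \<le> pi"
proof -
  have "\<bar>Im (Ln z)\<bar> \<le> pi" if "z \<noteq> 0" for z
    using mpi_less_Im_Ln[OF that] Im_Ln_le_pi[OF that] by (auto simp: abs_le_iff)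
  from this[of "a + Complex 0 u"] this[of "cnj a + Complex 0 u"] show ?thesis
    using assms unfolding argfac_def abs_le_iff by (auto simp: field_simps complex_eq_iff)
qed

lemma Complex_measurable [measurable (raw)]:
  "f \<in> borel_measurable M \<Longrightarrow> g \<in> borel_measurable M \<Longrightarrow> (\<lambda>x. Complex (f x) (g x)) \<in> borel_measurable M"
  by (subst borel_measurable_complex_iff) simp

lemma argfac_measurable [measurable]: "argfac a \<in> borel_measurable borel"
  unfolding argfac_def[abs_def] by measurable

lemma lnfac_measurable [measurable]: "lnfac a \<in> borel_measurable borel"
  unfolding lnfac_def[abs_def] by measurable

lemma pair_log_measurable [measurable]: "pair_log a \<in> borel_measurable borel"
  unfolding pair_log_def[abs_def] by measurable

lemma green_log_measurable [measurable]: "green_log t \<in> borel_measurable borel"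
  unfolding green_log_def[abs_def] by measurable

lemma one_plus_powr_le:
  assumes "e \<le> -3/2" shows "(1 + \<bar>u::real\<bar>) powr e \<le> (1 + \<bar>u\<bar>) powr (-3/2)"
  using assms by (intro powr_mono) auto

lemma powr_quarter_square: "(\<bar>x::real\<bar> powr (-1/4))^2 = \<bar>x\<bar> powr (-1/2)"
  by (simp add: power2_eq_square flip: powr_add)

lemma AE_lborel_not_in: "finite S \<Longrightarrow> AE u in lborel. (u::real) \<notin> S"
  by (intro AE_not_in finite_imp_null_set_lborel)

text \<open>Decay |w|^(-2) of one factor against growth |w|^(1/4) of the other gives |w|^(-7/4),
  enough for the exponent -3/2 that the contour argument demands.\<close>

lemma green_pair_boundary_integral:
  assumes t: "t > 0" and a: "Re a \<ge> 0"
  shows "integrable lborel (\<lambda>u. green_log t (Complex 0 u) * pair_log a (Complex 0 u))"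
    and "(\<integral>u. green_log t (Complex 0 u) * pair_log a (Complex 0 u) \<partial>lborel) = 0"
proof -
  define S where "S = {Im a, - Im a, 0, t, -t}"
  have fS: "finite S" by (simp add: S_def)
  obtain C1 where C1: "C1 \<ge> 0" "\<And>d u. 0 < d \<Longrightarrow> d \<le> 1 \<Longrightarrow> u \<noteq> Im a \<Longrightarrow> u \<noteq> - Im a \<Longrightarrow>
     cmod (pair_log a (Complex d u)) \<le> C1 * (1 + \<bar>u\<bar>) powr (1/4) * (1 + \<bar>u - Im a\<bar> powr (-1/4) + \<bar>u + Im a\<bar> powr (-1/4))"
    using pair_log_vertical_le[OF a] by metis
  obtain C2 where C2: "C2 \<ge> 0" "\<And>d u. 0 < d \<Longrightarrow> d \<le> 1 \<Longrightarrow> u \<noteq> 0 \<Longrightarrow> u \<noteq> t \<Longrightarrow> u \<noteq> - t \<Longrightarrow>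
     cmod (green_log t (Complex d u)) \<le> C2 * (1 + \<bar>u\<bar>) powr (-2) * (1 + \<bar>u\<bar> powr (-1/4) + \<bar>u - t\<bar> powr (-1/4) + \<bar>u + t\<bar> powr (-1/4))"
    using green_log_vertical_le[OF t] by metis
  obtain C3 R0 where C3: "C3 \<ge> 0" "R0 \<ge> 1" "\<And>w. Re w > 0 \<Longrightarrow> cmod w \<ge> R0 \<Longrightarrow> cmod (pair_log a w) \<le> C3 * cmod w powr (1/4)"
    using pair_log_large_le[OF a] by metis
  let ?h = "\<lambda>w. green_log t w * pair_log a w"
  have holo: "?h holomorphic_on {w. Re w > 0}"
    by (intro holomorphic_intros holomorphic_green_log holomorphic_pair_log a)
  have bound: "cmod (?h w) \<le> (4 * t^2 * C3) * cmod w powr (-3/2)" if w: "Re w > 0" "cmod w \<ge> max R0 (2*t)" for w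
  proof -
    have w1: "cmod w \<ge> 1" using w C3 by simp
    have "cmod (?h w) \<le> (4 * t^2 / cmod w ^ 2) * (C3 * cmod w powr (1/4))"
      unfolding norm_mult using w C3 t by (intro mult_mono green_log_large_le) auto
    also have "\<dots> = (4 * t^2 * C3) * (cmod w powr (-2) * cmod w powr (1/4))"
      using w1 by (simp add: powr_minus_divide powr_realpow[of _ 2, simplified])
    also have "cmod w powr (-2) * cmod w powr (1/4) = cmod w powr (-7/4)" by (simp flip: powr_add)
    also have "(4 * t^2 * C3) * cmod w powr (-7/4) \<le> (4 * t^2 * C3) * cmod w powr (-3/2)"
      using w1 C3 by (intro mult_left_mono powr_mono) auto
    finally show ?thesis .
  qed
  \<comment> \<open>With T the sum of |u - c|^(-1/2) over \<open>S\<close>, the two singular factors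
    satisfy P^2 <= 3 (1 + 2T) and Q^2 <= 4 (1 + 3T), so P Q <= (P^2 + Q^2)/2 <= 18 (1 + T).\<close>
  define G where "G u = 18 * C1 * C2 * log_dominator S u" for u
  have G: "integrable lborel G" unfolding G_def by (intro integrable_mult_right integrable_log_dominator fS)
  have dom: "AE u in lborel. cmod (?h (Complex d u)) \<le> G u" if d: "0 < d" "d \<le> 1" for d
    using AE_lborel_not_in[OF fS]
  proof eventually_elim
    fix u assume u: "u \<notin> S"
    define s where "s c = \<bar>u - c\<bar> powr (-1/4)" for c
    have s0: "s c \<ge> 0" for c by (simp add: s_def)
    have s2: "(s c)^2 \<le> (\<Sum>c\<in>S. \<bar>u - c\<bar> powr (-1/2))" if "c \<in> S" for c
      unfolding s_def powr_quarter_square using that by (intro member_le_sum fS) auto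
    define T where "T = (\<Sum>c\<in>S. \<bar>u - c\<bar> powr (-1/2))"
    define A where "A = (1 + \<bar>u\<bar>) powr (1/4)"
    define B where "B = (1 + \<bar>u\<bar>) powr (-2)"
    have AB: "A * B \<le> (1 + \<bar>u\<bar>) powr (-3/2)" "A \<ge> 0" "B \<ge> 0"
      using one_plus_powr_le[of "-7/4" u] by (auto simp: A_def B_def simp flip: powr_add)
    have 1: "cmod (pair_log a (Complex d u)) \<le> C1 * A * (1 + s (Im a) + s (- Im a))"
      using C1(2)[of d u] d u by (simp add: S_def A_def s_def)
    have 2: "cmod (green_log t (Complex d u)) \<le> C2 * B * (1 + s 0 + s t + s (-t))"
      using C2(2)[of d u] d u by (simp add: S_def B_def s_def)
    have sq: "x * y \<le> (x^2 + y^2) / 2" for x y :: real using sum_squares_bound[of x y] by (simp add: mult_ac)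
    have le3: "(1 + x + y)^2 \<le> 3 * (1 + x^2 + y^2)" for x y :: real
      using sum_power2_ge_zero[of "1 - x" "1 - y"] zero_le_power2[of "x - y"] by (simp add: power2_eq_square algebra_simps)
    have le4: "(1 + x + y + z)^2 \<le> 4 * (1 + x^2 + y^2 + z^2)" for x y z :: real
      using zero_le_power2[of "1 - x"] zero_le_power2[of "1 - y"] zero_le_power2[of "1 - z"] zero_le_power2[of "x - y"] zero_le_power2[of "x - z"] zero_le_power2[of "y - z"]
      by (simp add: power2_eq_square algebra_simps)
    define P where "P = 1 + s (Im a) + s (- Im a)"
    define Q where "Q = 1 + s 0 + s t + s (-t)"
    have PQ: "P \<ge> 0" "Q \<ge> 0" using s0 by (simp_all add: P_def Q_def add_nonneg_nonneg)
    have T0: "T \<ge> 0" by (simp add: T_def sum_nonneg)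
    have prod: "P * Q \<le> 18 * (1 + T)"
    proof -
      have "P^2 \<le> 3 * (1 + T + T)"
        using le3[of "s (Im a)" "s (- Im a)"] s2[of "Im a"] s2[of "- Im a"] by (simp add: S_def T_def P_def)
      moreover have "Q^2 \<le> 4 * (1 + T + T + T)"
        using le4[of "s 0" "s t" "s (-t)"] s2[of 0] s2[of t] s2[of "-t"] by (simp add: S_def T_def Q_def)
      ultimately show ?thesis using sq[of P Q] T0 by argo
    qed
    have "cmod (?h (Complex d u)) \<le> (C2 * B * Q) * (C1 * A * P)"
      unfolding norm_mult using 1 2 C1(1) C2(1) AB PQ unfolding P_def Q_def by (intro mult_mono) auto
    also have "\<dots> = (C1 * C2) * ((A * B) * (P * Q))" by (simp add: mult_ac)
    also have "\<dots> \<le> (C1 * C2) * ((1 + \<bar>u\<bar>) powr (-3/2) * (18 * (1 + T)))"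
      using C1(1) C2(1) PQ by (intro mult_left_mono mult_mono[OF AB(1) prod]) auto
    also have "\<dots> = G u" by (simp add: G_def log_dominator_def T_def)
    finally show "cmod (?h (Complex d u)) \<le> G u" .
  qed
  have lim: "AE u in lborel. ((\<lambda>d. ?h (Complex d u)) \<longlongrightarrow> ?h (Complex 0 u)) (at_right 0)"
    using AE_lborel_not_in[OF fS]
    by eventually_elim (intro tendsto_mult tendsto_green_log_boundary tendsto_pair_log_boundary a, simp_all add: S_def)
  have meas: "(\<lambda>u. ?h (Complex 0 u)) \<in> borel_measurable borel" by measurable
  note L = boundary_integral_zero[where ?R0.0="max R0 (2*t)" and C="4 * t^2 * C3", OF holo bound G zero_less_one dom lim meas]
  show "integrable lborel (\<lambda>u. ?h (Complex 0 u))" "(\<integral>u. ?h (Complex 0 u) \<partial>lborel) = 0"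
    using L by auto
qed

text \<open>The real part of the vanishing integral of \<open>green_log t\<close> times
  \<open>pair_log a\<close> is the wanted integrand minus the product of the imaginary parts. That
  product lives on |u| < t, where it is - pi sgn u times the odd function \<open>argfac a\<close>;
  \<open>j u + j (-u)\<close> records its two halves, and they have equal integrals.\<close>

lemma
  assumes t: "t > 0" and a: "Re a \<ge> 0" "a \<noteq> 0"
  shows integrable_green_lnfac: "integrable lborel (\<lambda>u. ln \<bar>1 - t^2 / u^2\<bar> * lnfac a u)" (is ?A)
    and integral_green_lnfac: "(\<integral>u. ln \<bar>1 - t^2 / u^2\<bar> * lnfac a u \<partial>lborel) = - 2 * pi * (\<integral>u. indicat_real {0..t} u * argfac a u \<partial>lborel)" (is ?B)
proof -
  define j where "j u = indicat_real {0..t} u * argfac a u" for u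
  have jmeas[measurable]: "j \<in> borel_measurable borel" unfolding j_def[abs_def] by measurable
  have jint: "integrable lborel j"
  proof (rule Bochner_Integration.integrable_bound)
    show "integrable lborel (\<lambda>u. indicat_real {0..t} u * pi)"
      by (intro integrable_mult_left integrable_real_indicator) (auto simp: emeasure_lborel_Icc_eq)
    have "AE u in lborel. u \<notin> {Im a, - Im a}" by (rule AE_lborel_not_in) simp
    then show "AE u in lborel. norm (j u) \<le> norm (indicat_real {0..t} u * pi)"
      by eventually_elim (use argfac_bounded in \<open>auto simp: j_def abs_mult indicator_def\<close>)
  qed auto
  have jint': "integrable lborel (\<lambda>u. j (-u))"
    using lborel_integrable_real_affine[OF jint, of "-1" 0] by simp
  have jeq: "(\<integral>u. j (-u) \<partial>lborel) = (\<integral>u. j u \<partial>lborel)"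
    using lborel_integral_real_affine[of "-1" j 0] by simp
  define h where "h u = green_log t (Complex 0 u) * pair_log a (Complex 0 u)" for u
  have hint: "integrable lborel h" "(\<integral>u. h u \<partial>lborel) = 0"
    using green_pair_boundary_integral[OF t a(1)] by (simp_all add: h_def[abs_def])
  have Rh: "integrable lborel (\<lambda>u. Re (h u))" "(\<integral>u. Re (h u) \<partial>lborel) = 0"
    using hint by (auto simp: integral_Re)
  have fin: "AE u in lborel. u \<notin> {Im a, - Im a, 0, t, -t}" by (rule AE_lborel_not_in) simp
  have ae: "AE u in lborel. Re (h u) - pi * (j u + j (-u)) = ln \<bar>1 - t^2 / u^2\<bar> * lnfac a u"
    using fin
  proof eventually_elim
    fix u assume u': "u \<notin> {Im a, - Im a, 0, t, -t}"
    then have u: "u \<noteq> Im a" "u \<noteq> - Im a" "u \<noteq> 0" "u \<noteq> t" "u \<noteq> -t" by auto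
    have "Re (h u) = ln \<bar>1 - t^2 / u^2\<bar> * lnfac a u - Im (green_log t (Complex 0 u)) * argfac a u"
      using u a by (simp add: h_def Re_green_log_boundary Re_pair_log_boundary Im_pair_log_boundary)
    moreover have "Im (green_log t (Complex 0 u)) * argfac a u = - pi * (j u + j (-u))"
      using u t argfac_minus[of a u] a by (auto simp: Im_green_log_boundary j_def sgn_if indicator_def)
    ultimately show "Re (h u) - pi * (j u + j (-u)) = ln \<bar>1 - t^2 / u^2\<bar> * lnfac a u" by simp
  qed
  have I: "integrable lborel (\<lambda>u. Re (h u) - pi * (j u + j (-u)))"
    using Rh jint jint' by auto
  show ?A
    by (rule integrable_cong_AE_imp[OF I _ ae]) measurable
  have "(\<integral>u. ln \<bar>1 - t^2 / u^2\<bar> * lnfac a u \<partial>lborel) = (\<integral>u. Re (h u) - pi * (j u + j (-u)) \<partial>lborel)"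
    by (rule integral_cong_AE) (use ae I in \<open>auto simp: eq_commute\<close>)
  also have "\<dots> = - 2 * pi * (\<integral>u. j u \<partial>lborel)" using Rh jint jint' jeq by simp
  finally show ?B
    by (simp add: j_def)
qed

section \<open>Cauchy, Green and Poisson kernels\<close>

lemma integral_transfer_AE:
  fixes f g :: "'a \<Rightarrow> 'b::{banach, second_countable_topology}"
  assumes "integrable M f" "AE x in M. f x = g x" "g \<in> borel_measurable M"
  shows "integral\<^sup>L M g = integral\<^sup>L M f"
  using assms by (intro integral_cong_AE) (auto elim!: eventually_mono dest: borel_measurable_integrable)

lemma
  assumes y: "(y::real) > 0"
  shows integrable_cauchy_kernel: "integrable lborel (\<lambda>u. 1 / (y^2 + u^2))" (is ?A)
    and integral_cauchy_kernel: "(\<integral>u. 1 / (y^2 + u^2) \<partial>lborel) = pi / y" (is ?B)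
proof -
  define f where "f u = indicat_real {0<..} u * (1 / (1 + u^2))" for u :: real
  have f: "integrable lborel f" "(\<integral>u. f u \<partial>lborel) = pi / 2"
    using integrable_I0i_1_div_plus_square LBINT_I0i_1_div_plus_square
    unfolding interval_lebesgue_integral_0_infty interval_lebesgue_integrable_def
    by (simp_all add: set_integrable_def set_lebesgue_integral_def f_def[abs_def] zero_ereal_def)
  have f2: "integrable lborel (\<lambda>u. f (0 + (1/y) * u))" "integrable lborel (\<lambda>u. f (0 + (-1/y) * u))"
    using y by (intro lborel_integrable_real_affine f; simp)+
  have v2: "(\<integral>u. f (0 + (1/y) * u) \<partial>lborel) = y * (pi/2)" "(\<integral>u. f (0 + (-1/y) * u) \<partial>lborel) = y * (pi/2)"
    using lborel_integral_real_affine[of "1/y" f 0] lborel_integral_real_affine[of "-1/y" f 0] y f(2)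
    by (auto simp: field_simps)
  have ae: "AE u in lborel. (f (0 + (1/y) * u) + f (0 + (-1/y) * u)) / y^2 = 1 / (y^2 + u^2)"
    using AE_lborel_singleton[of 0]
  proof eventually_elim
    fix u :: real assume u: "u \<noteq> 0"
    have "f (0 + (1/y) * u) + f (0 + (-1/y) * u) = 1 / (1 + (u/y)^2)"
    proof (cases "u > 0")
      case True
      then show ?thesis using y by (simp add: f_def divide_less_0_iff)
    next
      case False
      then show ?thesis using y u by (simp add: f_def zero_less_divide_iff divide_less_0_iff)
    qed
    moreover have "(1 + (u/y)^2) * y^2 = y^2 + u^2" using y by (simp add: field_simps)
    ultimately show "(f (0 + (1/y) * u) + f (0 + (-1/y) * u)) / y^2 = 1 / (y^2 + u^2)" by (simp only: divide_divide_eq_left)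
  qed
  have I: "integrable lborel (\<lambda>u. (f (0 + (1/y) * u) + f (0 + (-1/y) * u)) / y^2)"
    by (intro integrable_divide Bochner_Integration.integrable_add f2)
  show ?A
    by (rule integrable_cong_AE_imp[OF I _ ae]) measurable
  have "(\<integral>u. 1 / (y^2 + u^2) \<partial>lborel) = (\<integral>u. (f (0 + (1/y) * u) + f (0 + (-1/y) * u)) / y^2 \<partial>lborel)"
    by (rule integral_transfer_AE[OF I ae]) measurable
  also have "\<dots> = (y * (pi/2) + y * (pi/2)) / y^2"
    by (simp only: integral_divide_zero Bochner_Integration.integral_add[OF f2] v2)
  also have "\<dots> = pi / y" using y by (simp add: power2_eq_square)
  finally show ?B .
qed

text \<open>The contour argument with the second factor replaced by 1. Because the value is 0, the
  constant term of ln |zeta| is seen by \<open>green_kernel\<close> only through its correction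
  t^2/(1 + u^2).\<close>

lemma
  assumes t: "(t::real) > 0"
  shows integrable_ln_green: "integrable lborel (\<lambda>u. ln \<bar>1 - t^2 / u^2\<bar>)" (is ?A)
    and integral_ln_green: "(\<integral>u. ln \<bar>1 - t^2 / u^2\<bar> \<partial>lborel) = 0" (is ?B)
proof -
  define S where "S = {0, t, -t}"
  have fS: "finite S" by (simp add: S_def)
  obtain C2 where C2: "C2 \<ge> 0" "\<And>d u. 0 < d \<Longrightarrow> d \<le> 1 \<Longrightarrow> u \<noteq> 0 \<Longrightarrow> u \<noteq> t \<Longrightarrow> u \<noteq> - t \<Longrightarrow>
     cmod (green_log t (Complex d u)) \<le> C2 * (1 + \<bar>u\<bar>) powr (-2) * (1 + \<bar>u\<bar> powr (-1/4) + \<bar>u - t\<bar> powr (-1/4) + \<bar>u + t\<bar> powr (-1/4))"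
    using green_log_vertical_le[OF t] by metis
  have bound: "cmod (green_log t w) \<le> (4 * t^2) * cmod w powr (-3/2)" if w: "Re w > 0" "cmod w \<ge> max 1 (2*t)" for w
  proof -
    have w1: "cmod w \<ge> 1" using w by simp
    have "cmod (green_log t w) \<le> (4 * t^2 / cmod w ^ 2)" using w t by (intro green_log_large_le) auto
    also have "\<dots> = (4 * t^2) * (cmod w powr (-2))"
      using w1 by (simp add: powr_minus_divide powr_realpow[of _ 2, simplified])
    also have "\<dots> \<le> (4 * t^2) * cmod w powr (-3/2)"
      using w1 by (intro mult_left_mono powr_mono) auto
    finally show ?thesis .
  qed
  define G where "G u = 4 * C2 * log_dominator S u" for u
  have G: "integrable lborel G" unfolding G_def by (intro integrable_mult_right integrable_log_dominator fS)
  have dom: "AE u in lborel. cmod (green_log t (Complex d u)) \<le> G u" if d: "0 < d" "d \<le> 1" for d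
    using AE_lborel_not_in[OF fS]
  proof eventually_elim
    fix u assume u: "u \<notin> S"
    define s where "s c = \<bar>u - c\<bar> powr (-1/4)" for c
    define T where "T = (\<Sum>c\<in>S. \<bar>u - c\<bar> powr (-1/2))"
    have s2: "s c \<le> 1 + T" if "c \<in> S" for c
    proof -
      have "(s c)^2 \<le> T"
        unfolding s_def powr_quarter_square T_def using that by (intro member_le_sum fS) auto
      moreover have "2 * s c \<le> 1 + (s c)^2" using zero_le_power2[of "1 - s c"] by (simp add: power2_eq_square algebra_simps)
      moreover have "s c \<ge> 0" by (simp add: s_def)
      ultimately show ?thesis by linarith
    qed
    have T0: "T \<ge> 0" by (simp add: T_def sum_nonneg)
    have "cmod (green_log t (Complex d u)) \<le> C2 * (1 + \<bar>u\<bar>) powr (-2) * (1 + s 0 + s t + s (-t))"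
      using C2(2)[of d u] d u by (simp add: S_def s_def)
    also have "\<dots> \<le> C2 * (1 + \<bar>u\<bar>) powr (-3/2) * (4 * (1 + T))"
      using s2[of 0] s2[of t] s2[of "-t"] T0 C2(1) one_plus_powr_le[of "-2" u]
      by (intro mult_mono mult_left_mono) (auto simp: S_def s_def intro!: add_nonneg_nonneg)
    also have "\<dots> = G u" by (simp add: G_def log_dominator_def T_def)
    finally show "cmod (green_log t (Complex d u)) \<le> G u" .
  qed
  have lim: "AE u in lborel. ((\<lambda>d. green_log t (Complex d u)) \<longlongrightarrow> green_log t (Complex 0 u)) (at_right 0)"
    using AE_lborel_not_in[OF fS]
    by eventually_elim (intro tendsto_green_log_boundary, simp_all add: S_def)
  have meas: "(\<lambda>u. green_log t (Complex 0 u)) \<in> borel_measurable borel" by measurable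
  note L = boundary_integral_zero[where ?R0.0="max 1 (2*t)" and C="4 * t^2", OF holomorphic_green_log bound G zero_less_one dom lim meas]
  have ae: "AE u in lborel. Re (green_log t (Complex 0 u)) = ln \<bar>1 - t^2 / u^2\<bar>"
    using AE_lborel_not_in[OF fS] by eventually_elim (rule Re_green_log_boundary, simp_all add: S_def)
  have I: "integrable lborel (\<lambda>u. Re (green_log t (Complex 0 u)))" "(\<integral>u. Re (green_log t (Complex 0 u)) \<partial>lborel) = 0"
    using L by (auto simp: integral_Re)
  show ?A
    by (rule integrable_cong_AE_imp[OF I(1) _ ae]) measurable
  have "(\<integral>u. ln \<bar>1 - t^2 / u^2\<bar> \<partial>lborel) = (\<integral>u. Re (green_log t (Complex 0 u)) \<partial>lborel)"
    by (rule integral_transfer_AE[OF I(1) ae]) measurable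
  then show ?B using I by simp
qed

text \<open>On the imaginary axis the denominator equals -(y^2 + u^2). Subtracting the value at y
  makes the singularity at w = y removable, so the function is holomorphic in the whole half-plane
  and its boundary integral vanishes; this is Poisson's formula at y.\<close>

lemma poisson_boundary_integral:
  assumes y: "y > 0" and a: "Re a \<ge> 0"
  defines "h0 \<equiv> \<lambda>u. (pair_log a (Complex 0 u) - pair_log a (of_real y)) / ((Complex 0 u - of_real y) * (Complex 0 u + of_real y))"
  shows "integrable lborel h0" and "(\<integral>u. h0 u \<partial>lborel) = 0"
proof -
  define S where "S = {Im a, - Im a}"
  have fS: "finite S" by (simp add: S_def)
  obtain C1 where C1: "C1 \<ge> 0" "\<And>d u. 0 < d \<Longrightarrow> d \<le> 1 \<Longrightarrow> u \<noteq> Im a \<Longrightarrow> u \<noteq> - Im a \<Longrightarrow>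
     cmod (pair_log a (Complex d u)) \<le> C1 * (1 + \<bar>u\<bar>) powr (1/4) * (1 + \<bar>u - Im a\<bar> powr (-1/4) + \<bar>u + Im a\<bar> powr (-1/4))"
    using pair_log_vertical_le[OF a] by metis
  obtain C3 R0 where C3: "C3 \<ge> 0" "R0 \<ge> 1" "\<And>w. Re w > 0 \<Longrightarrow> cmod w \<ge> R0 \<Longrightarrow> cmod (pair_log a w) \<le> C3 * cmod w powr (1/4)"
    using pair_log_large_le[OF a] by metis
  define L0 where "L0 = cmod (pair_log a (of_real y))"
  define q where "q w = (if w = of_real y then deriv (pair_log a) (of_real y) else (pair_log a w - pair_log a (of_real y)) / (w - of_real y))" for w
  define h where "h w = q w / (w + of_real y)" for w
  have oH: "open {w. Re w > 0}" by (simp add: open_halfspace_Re_gt)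
  have qholo: "q holomorphic_on {w. Re w > 0}"
    unfolding q_def by (rule pole_lemma_open[OF holomorphic_pair_log[OF a] oH])
  have holo: "h holomorphic_on {w. Re w > 0}"
    unfolding h_def[abs_def]
  proof (intro holomorphic_intros qholo)
    fix z assume z: "z \<in> {w. Re w > 0}"
    have "Re (z + of_real y) > 0" using z y by simp
    then show "z + of_real y \<noteq> 0" by (metis less_irrefl zero_complex.sel(1))
  qed
  have heq: "h w = (pair_log a w - pair_log a (of_real y)) / ((w - of_real y) * (w + of_real y))" if "w \<noteq> of_real y" for w
    using that by (simp add: h_def q_def)
  have bound: "cmod (h w) \<le> (2 * (C3 + L0)) * cmod w powr (-3/2)" if w: "Re w > 0" "cmod w \<ge> max R0 (2*y)" for w
  proof -
    have w1: "cmod w \<ge> 1" using w C3 by simp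
    have wy: "w \<noteq> of_real y" using w y by auto
    have A1: "cmod w powr (1/4) \<ge> 1" using w1 by (intro ge_one_powr_ge_zero) auto
    have n1: "cmod (w - of_real y) \<ge> cmod w / 2" using norm_triangle_ineq2[of w "of_real y"] w y by simp
    have n2: "cmod (w + of_real y) \<ge> cmod w"
    proof -
      have "(cmod w)^2 \<le> (cmod (w + of_real y))^2" using w y by (auto simp: cmod_power2 intro!: power_mono)
      then show ?thesis by (simp add: power_mono_iff)
    qed
    have "cmod (pair_log a w - pair_log a (of_real y)) \<le> C3 * cmod w powr (1/4) + L0"
      using norm_triangle_ineq4[of "pair_log a w" "pair_log a (of_real y)"] C3(3)[of w] w by (simp add: L0_def)
    also have "\<dots> \<le> (C3 + L0) * cmod w powr (1/4)"
      using mult_left_mono[OF A1, of L0] by (simp add: L0_def algebra_simps)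
    finally have num: "cmod (pair_log a w - pair_log a (of_real y)) \<le> (C3 + L0) * cmod w powr (1/4)" .
    have den: "cmod ((w - of_real y) * (w + of_real y)) \<ge> cmod w / 2 * cmod w" unfolding norm_mult using n1 n2 by (intro mult_mono) auto
    have "cmod (h w) \<le> ((C3 + L0) * cmod w powr (1/4)) / (cmod w / 2 * cmod w)"
      unfolding heq[OF wy] norm_divide using num den w1 C3(1) by (intro frac_le) (auto intro!: mult_pos_pos mult_nonneg_nonneg simp: L0_def)
    also have "\<dots> = (2 * (C3 + L0)) * (cmod w powr (1/4) * cmod w powr (-2))"
      using w1 by (simp add: powr_minus_divide powr_realpow[of _ 2, simplified] power2_eq_square)
    also have "cmod w powr (1/4) * cmod w powr (-2) = cmod w powr (-7/4)" by (simp flip: powr_add)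
    also have "(2 * (C3 + L0)) * cmod w powr (-7/4) \<le> (2 * (C3 + L0)) * cmod w powr (-3/2)"
      using w1 C3 by (intro mult_left_mono powr_mono) (auto simp: L0_def)
    finally show ?thesis .
  qed
  \<comment> \<open>Lines with d <= y/2 stay at distance at least y/2 from both y and -y. Together
    with the trivial distance |u| this gives the lower bound m (1 + |u|)/2 for each factor of the
    denominator.\<close>
  define m where "m = min 1 (y/2)"
  have m: "m > 0" "m \<le> 1" "m \<le> y/2" using y by (auto simp: m_def)
  define G where "G u = 12 * (C1 + L0) / m^2 * log_dominator S u" for u
  have G: "integrable lborel G" unfolding G_def by (intro integrable_mult_right integrable_log_dominator fS)
  have dom: "AE u in lborel. cmod (h (Complex d u)) \<le> G u" if d: "0 < d" "d \<le> m" for d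
    using AE_lborel_not_in[OF fS]
  proof eventually_elim
    fix u assume u: "u \<notin> S"
    define s where "s c = \<bar>u - c\<bar> powr (-1/4)" for c
    define T where "T = (\<Sum>c\<in>S. \<bar>u - c\<bar> powr (-1/2))"
    have s0: "s c \<ge> 0" for c by (simp add: s_def)
    have s2: "s c \<le> 1 + T" if "c \<in> S" for c
    proof -
      have "(s c)^2 \<le> T"
        unfolding s_def powr_quarter_square T_def using that by (intro member_le_sum fS) auto
      moreover have "2 * s c \<le> 1 + (s c)^2" using zero_le_power2[of "1 - s c"] by (simp add: power2_eq_square algebra_simps)
      ultimately show ?thesis using s0[of c] by linarith
    qed
    have T0: "T \<ge> 0" by (simp add: T_def sum_nonneg)
    define P where "P = 1 + s (Im a) + s (- Im a)"
    have P: "P \<ge> 1" "P \<le> 3 * (1 + T)" using s0 s2[of "Im a"] s2[of "- Im a"] T0 by (auto simp: P_def S_def add_nonneg_nonneg)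
    define A where "A = (1 + \<bar>u\<bar>) powr (1/4)"
    have A1: "A \<ge> 1" unfolding A_def by (intro ge_one_powr_ge_zero) auto
    have wy: "Complex d u \<noteq> of_real y" using d m y by (auto simp: complex_eq_iff)
    have "cmod (pair_log a (Complex d u) - pair_log a (of_real y)) \<le> C1 * A * P + L0"
      using norm_triangle_ineq4[of "pair_log a (Complex d u)" "pair_log a (of_real y)"] C1(2)[of d u] d m u
      by (simp add: L0_def S_def A_def P_def s_def)
    also have "\<dots> \<le> (C1 + L0) * (A * P)"
    proof -
      have "1 * 1 \<le> A * P" using A1 P by (intro mult_mono) auto
      then have "L0 * 1 \<le> L0 * (A * P)" by (intro mult_left_mono) (auto simp: L0_def)
      then show ?thesis by (simp add: algebra_simps)
    qed
    finally have num: "cmod (pair_log a (Complex d u) - pair_log a (of_real y)) \<le> (C1 + L0) * (A * P)" .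
    have n1: "cmod (Complex d u - of_real y) \<ge> m * (1 + \<bar>u\<bar>) / 2"
    proof -
      have "cmod (Complex d u - of_real y) \<ge> \<bar>u\<bar>" using abs_Im_le_cmod[of "Complex d u - of_real y"] by simp
      moreover have "cmod (Complex d u - of_real y) \<ge> y / 2" using abs_Re_le_cmod[of "Complex d u - of_real y"] d m by simp
      moreover have "m * \<bar>u\<bar> \<le> 1 * \<bar>u\<bar>" using m by (intro mult_right_mono) auto
      ultimately show ?thesis using m by (simp add: distrib_left)
    qed
    have n2: "cmod (Complex d u + of_real y) \<ge> m * (1 + \<bar>u\<bar>) / 2"
    proof -
      have "cmod (Complex d u + of_real y) \<ge> \<bar>u\<bar>" using abs_Im_le_cmod[of "Complex d u + of_real y"] by simp
      moreover have "cmod (Complex d u + of_real y) \<ge> y / 2" using abs_Re_le_cmod[of "Complex d u + of_real y"] d m y by simp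
      moreover have "m * \<bar>u\<bar> \<le> 1 * \<bar>u\<bar>" using m by (intro mult_right_mono) auto
      ultimately show ?thesis using m by (simp add: distrib_left)
    qed
    have den: "cmod ((Complex d u - of_real y) * (Complex d u + of_real y)) \<ge> (m * (1 + \<bar>u\<bar>) / 2) * (m * (1 + \<bar>u\<bar>) / 2)"
      unfolding norm_mult using n1 n2 m by (intro mult_mono) auto
    have "cmod (h (Complex d u)) \<le> ((C1 + L0) * (A * P)) / ((m * (1 + \<bar>u\<bar>) / 2) * (m * (1 + \<bar>u\<bar>) / 2))"
      unfolding heq[OF wy] norm_divide using num den m A1 P C1(1) by (intro frac_le) (auto intro!: mult_pos_pos mult_nonneg_nonneg simp: L0_def)
    also have "\<dots> = (4 * (C1 + L0) / m^2) * ((A * (1 + \<bar>u\<bar>) powr (-2)) * P)"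
    proof -
      have B: "(1 + \<bar>u\<bar>) powr (-2) = 1 / (1 + \<bar>u\<bar>)^2"
        by (simp add: powr_minus_divide powr_realpow[of _ 2, simplified])
      have "(C1 + L0) * (A * P) / ((m * z / 2) * (m * z / 2)) = (4 * (C1 + L0) / m^2) * ((A * (1 / z^2)) * P)" if "z \<noteq> 0" for z
        using m that by (simp add: field_simps power2_eq_square)
      from this[of "1 + \<bar>u\<bar>"] show ?thesis unfolding B by (simp add: abs_add_one_gt_zero[THEN less_imp_neq, symmetric])
    qed
    also have "\<dots> \<le> (4 * (C1 + L0) / m^2) * ((1 + \<bar>u\<bar>) powr (-3/2) * (3 * (1 + T)))"
    proof (intro mult_left_mono mult_mono)
      show "A * (1 + \<bar>u\<bar>) powr (-2) \<le> (1 + \<bar>u\<bar>) powr (-3/2)"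
        using one_plus_powr_le[of "-7/4" u] by (simp add: A_def flip: powr_add)
    qed (use P C1(1) in \<open>auto simp: L0_def\<close>)
    also have "\<dots> = G u"
    proof -
      have "(4 * K / M) * (B * (3 * X)) = 12 * K / M * (B * X)" for K M B X :: real by simp
      then show ?thesis by (simp only: G_def log_dominator_def T_def)
    qed
    finally show "cmod (h (Complex d u)) \<le> G u" .
  qed
  have lim: "AE u in lborel. ((\<lambda>d. h (Complex d u)) \<longlongrightarrow> h0 u) (at_right 0)"
    using AE_lborel_not_in[OF fS]
  proof eventually_elim
    fix u assume u: "u \<notin> S"
    have nz: "(Complex 0 u - of_real y) * (Complex 0 u + of_real y) \<noteq> 0"
      unfolding mult_eq_0_iff using y by (auto simp: complex_eq_iff)
    have "((\<lambda>d. (pair_log a (Complex d u) - pair_log a (of_real y)) / ((Complex d u - of_real y) * (Complex d u + of_real y))) \<longlongrightarrow> h0 u) (at_right 0)"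
      unfolding h0_def using u a
      by (intro tendsto_intros tendsto_pair_log_boundary nz) (auto simp: S_def)
    moreover have "eventually (\<lambda>d. d \<in> {0<..<y}) (at_right 0)" using y by (rule eventually_at_right_real)
    then have "eventually (\<lambda>d. (pair_log a (Complex d u) - pair_log a (of_real y)) / ((Complex d u - of_real y) * (Complex d u + of_real y)) = h (Complex d u)) (at_right 0)"
      by eventually_elim (subst heq, auto simp: complex_eq_iff)
    ultimately show "((\<lambda>d. h (Complex d u)) \<longlongrightarrow> h0 u) (at_right 0)"
      by (rule Lim_transform_eventually)
  qed
  have meas: "h0 \<in> borel_measurable borel" unfolding h0_def by measurable
  note L = boundary_integral_zero[where ?R0.0="max R0 (2*y)" and C="2 * (C3 + L0)", OF holo bound G m(1) dom lim meas]
  show "integrable lborel h0" "(\<integral>u. h0 u \<partial>lborel) = 0" using L by auto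
qed

text \<open>Poisson's formula recovers the harmonic function Re (\<open>pair_log a\<close>) at the
  real point y; since a + y and cnj a + y have the same modulus, its value there is ln |1 +
  y/a|.\<close>

lemma
  assumes y: "y > 0" and a: "Re a \<ge> 0" "a \<noteq> 0"
  shows integrable_poisson_lnfac: "integrable lborel (\<lambda>u. lnfac a u / (y^2 + u^2))" (is ?A)
    and integral_poisson_lnfac: "(\<integral>u. lnfac a u / (y^2 + u^2) \<partial>lborel) = pi / y * ln (cmod (1 + of_real y / a))" (is ?B)
proof -
  define c where "c = ln (cmod (1 + of_real y / a))"
  have Rey: "Re (pair_log a (of_real y)) = c"
  proof -
    have r: "Re (a + of_real y) > 0" "Re (cnj a + of_real y) > 0" using a y by auto
    have nz: "a + of_real y \<noteq> 0" "cnj a + of_real y \<noteq> 0" using r by (metis less_irrefl zero_complex.sel(1))+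
    have "cnj a + of_real y = cnj (a + of_real y)" by simp
    then have "cmod (cnj a + of_real y) = cmod (a + of_real y)" by (simp only: complex_mod_cnj)
    then have "Re (pair_log a (of_real y)) = ln (cmod (a + of_real y)) - ln (cmod a)" using nz by (simp add: pair_log_def)
    also have "\<dots> = ln (cmod ((a + of_real y) / a))" using nz a by (simp add: norm_divide ln_div)
    finally show ?thesis using a by (simp add: c_def add_divide_distrib)
  qed
  define h0 where "h0 = (\<lambda>u. (pair_log a (Complex 0 u) - pair_log a (of_real y)) / ((Complex 0 u - of_real y) * (Complex 0 u + of_real y)))"
  have H: "integrable lborel h0" "(\<integral>u. h0 u \<partial>lborel) = 0"
    using poisson_boundary_integral[OF y a(1)] by (simp_all add: h0_def)
  have R: "integrable lborel (\<lambda>u. Re (h0 u))" "(\<integral>u. Re (h0 u) \<partial>lborel) = 0"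
    using H by (auto simp: integral_Re)
  have "AE u in lborel. u \<notin> {Im a, - Im a}" by (rule AE_lborel_not_in) simp
  then have ae: "AE u in lborel. c * (1 / (y^2 + u^2)) - Re (h0 u) = lnfac a u / (y^2 + u^2)"
  proof eventually_elim
    fix u assume u: "u \<notin> {Im a, - Im a}"
    have "(Complex 0 u - of_real y) * (Complex 0 u + of_real y) = of_real (- (y^2 + u^2))"
      by (simp add: complex_eq_iff power2_eq_square)
    then have "h0 u = (pair_log a (Complex 0 u) - pair_log a (of_real y)) / of_real (- (y^2 + u^2))" by (simp add: h0_def)
    then have "Re (h0 u) = (lnfac a u - c) / (- (y^2 + u^2))" using u a
      by (simp only: Re_divide_of_real minus_complex.sel Rey) (simp add: Re_pair_log_boundary)
    moreover have "y^2 + u^2 \<noteq> 0" using y by (simp add: add_pos_nonneg pos_add_strict sum_power2_eq_zero_iff)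
    ultimately show "c * (1 / (y^2 + u^2)) - Re (h0 u) = lnfac a u / (y^2 + u^2)" by (simp add: field_simps)
  qed
  have I: "integrable lborel (\<lambda>u. c * (1 / (y^2 + u^2)) - Re (h0 u))"
    by (intro Bochner_Integration.integrable_diff integrable_mult_right integrable_cauchy_kernel y R)
  show ?A
    by (rule integrable_cong_AE_imp[OF I _ ae]) measurable
  have "(\<integral>u. lnfac a u / (y^2 + u^2) \<partial>lborel) = (\<integral>u. c * (1 / (y^2 + u^2)) - Re (h0 u) \<partial>lborel)"
    by (rule integral_transfer_AE[OF I ae]) measurable
  also have "\<dots> = c * (pi / y)"
    by (subst Bochner_Integration.integral_diff[OF integrable_mult_right[OF integrable_cauchy_kernel[OF y]] R(1)])
       (simp only: integral_mult_right_zero R(2) integral_cauchy_kernel[OF y] diff_zero)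
  finally show ?B by (simp add: c_def)
qed

section \<open>Decay in the parameter a\<close>

lemma ln_cmod_one_plus_approx:
  assumes "cmod z \<le> 1/2" shows "\<bar>ln (cmod (1 + z)) - Re z\<bar> \<le> 2 * cmod z ^ 2"
proof -
  have nz: "1 + z \<noteq> 0"
  proof
    assume "1 + z = 0"
    then have "z = -1" by (simp add: eq_neg_iff_add_eq_0 add.commute)
    then show False using assms by simp
  qed
  have "\<bar>Re (Ln (1 + z) - z)\<bar> \<le> cmod (Ln (1 + z) - z)" by (rule abs_Re_le_cmod)
  also have "\<dots> \<le> cmod z ^ 2 / (1 - cmod z)" using assms by (intro Ln_approx_linear) auto
  also have "\<dots> \<le> cmod z ^ 2 / (1/2)" using assms by (intro divide_left_mono) auto
  finally show ?thesis using nz by (simp add: mult.commute)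
qed

lemma abs_lnfac_small:
  assumes "a \<noteq> 0" "2 * \<bar>u\<bar> \<le> cmod a"
  shows "\<bar>lnfac a u\<bar> \<le> u^2 / cmod a ^ 2"
proof -
  define z where "z = of_real (u^2) / a^2"
  have cz: "cmod z = u^2 / cmod a ^ 2" by (simp add: z_def norm_divide norm_power)
  have "\<bar>u\<bar>^2 \<le> (cmod a / 2)^2" using assms by (intro power_mono) auto
  then have z4: "cmod z \<le> 1/4" using assms by (simp add: cz field_simps)
  have "\<bar>ln (cmod (1 + z))\<bar> \<le> \<bar>Re z\<bar> + 2 * cmod z ^ 2" using ln_cmod_one_plus_approx[of z] z4 by linarith
  also have "\<dots> \<le> cmod z + 2 * (cmod z * (1/4))"
    unfolding power2_eq_square using z4 by (intro add_mono mult_left_mono abs_Re_le_cmod) auto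
  also have "\<dots> \<le> 2 * cmod z" by simp
  finally show ?thesis unfolding lnfac_def z_def[symmetric] cz by (simp add: mult.commute)
qed

text \<open>Replacing a by its modulus gives a nonnegative majorant of the same family, whose
  integrals are therefore known exactly.\<close>

lemma lnfac_le_abs:
  assumes "a \<noteq> 0" shows "lnfac a u \<le> lnfac (of_real (cmod a)) u" "0 \<le> lnfac (of_real (cmod a)) u"
proof -
  have e: "1 + of_real (u^2) / of_real (cmod a)^2 = (of_real (1 + u^2 / cmod a ^ 2) :: complex)" by simp
  have r: "cmod (1 + of_real (u^2) / of_real (cmod a)^2) = 1 + u^2 / cmod a ^ 2"
    unfolding e norm_of_real by (simp add: add_nonneg_nonneg)
  have "cmod (1 + of_real (u^2) / a^2) \<le> 1 + u^2 / cmod a ^ 2"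
    using norm_triangle_ineq[of 1 "of_real (u^2) / a^2"] by (simp add: norm_divide norm_power)
  then have "ln (cmod (1 + of_real (u^2) / a^2)) \<le> ln (1 + u^2 / cmod a ^ 2)"
    by (cases "cmod (1 + of_real (u^2) / a^2) = 0") (simp_all only: ln_0 ln_ge_zero_iff ln_le_cancel_iff, auto simp: add_pos_nonneg ln_le_cancel_iff)
  then show "lnfac a u \<le> lnfac (of_real (cmod a)) u" unfolding lnfac_def r by simp
  show "0 \<le> lnfac (of_real (cmod a)) u" unfolding lnfac_def r by simp
qed

text \<open>Unlike the Poisson kernel, this difference decays like u^(-4), so its integrals against lnfac a
are O(|a|^(-2)) and can be summed over the zeros.\<close>

definition diff_kernel :: "real \<Rightarrow> real \<Rightarrow> real" where
  "diff_kernel R u = 1 / (1 + u^2) - 1 / (R^2 + u^2)"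

lemma diff_kernel_eq: "R \<ge> 1 \<Longrightarrow> diff_kernel R u = (R^2 - 1) / ((1 + u^2) * (R^2 + u^2))"
proof -
  assume "R \<ge> 1"
  then have "1 + u^2 > 0" "R^2 + u^2 > 0" by (auto simp: add_pos_nonneg)
  then show ?thesis unfolding diff_kernel_def by (subst diff_frac_eq) auto
qed

lemma diff_kernel_nonneg: "R \<ge> 1 \<Longrightarrow> diff_kernel R u \<ge> 0"
  by (simp add: diff_kernel_eq)

lemma
  assumes R: "R \<ge> 1" and a: "Re a \<ge> 0" "a \<noteq> 0"
  shows integrable_diff_kernel_lnfac: "integrable lborel (\<lambda>u. diff_kernel R u * lnfac a u)" (is ?A)
    and integral_diff_kernel_lnfac: "(\<integral>u. diff_kernel R u * lnfac a u \<partial>lborel)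
       = pi * (ln (cmod (1 + 1 / a)) - ln (cmod (1 + of_real R / a)) / R)" (is ?B)
proof -
  have e: "diff_kernel R u * lnfac a u = lnfac a u / (1^2 + u^2) - lnfac a u / (R^2 + u^2)" for u
    by (simp add: diff_kernel_def left_diff_distrib)
  note I = integrable_poisson_lnfac[OF zero_less_one a] integrable_poisson_lnfac[of R, OF _ a]
  show ?A
    unfolding e using R by (intro Bochner_Integration.integrable_diff I) auto
  show ?B
    unfolding e using R integral_poisson_lnfac[OF zero_less_one a] integral_poisson_lnfac[of R, OF _ a]
    by (subst Bochner_Integration.integral_diff[OF I]) (auto simp: algebra_simps)
qed

text \<open>Write l for \<open>lnfac a\<close> and L for \<open>lnfac\<close> at |a|. From l <= L
  and L >= 0 follows |l| <= 2L - l, so the absolute integral is bounded by two exact ones. In each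
  of them the first-order term Re (1/b) drops out of ln |1 + 1/b| - ln |1 + R/b| / R, which leaves
  O(|a|^(-2)).\<close>

lemma integral_diff_kernel_abs_lnfac_le:
  assumes R: "R \<ge> 1" and a: "Re a \<ge> 0" "cmod a \<ge> 2 * R"
  shows "(\<integral>u. diff_kernel R u * \<bar>lnfac a u\<bar> \<partial>lborel) \<le> 6 * pi * (1 + R) / cmod a ^ 2"
proof -
  have a0: "a \<noteq> 0" using a R by auto
  define X where "X b = ln (cmod (1 + 1 / b)) - ln (cmod (1 + of_real R / b)) / R" for b
  have X: "\<bar>X b\<bar> \<le> (2 + 2 * R) / cmod a ^ 2" if b: "cmod b = cmod a" for b
  proof -
    have 1: "\<bar>ln (cmod (1 + 1 / b)) - Re (1 / b)\<bar> \<le> 2 * cmod (1 / b) ^ 2"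
      using a b R a0 by (intro ln_cmod_one_plus_approx) (auto simp: norm_divide field_simps)
    have 2: "\<bar>ln (cmod (1 + of_real R / b)) - Re (of_real R / b)\<bar> \<le> 2 * cmod (of_real R / b) ^ 2"
      using a b R a0 by (intro ln_cmod_one_plus_approx) (auto simp: norm_divide field_simps)
    have "\<bar>ln (cmod (1 + of_real R / b)) / R - Re (of_real R / b) / R\<bar> \<le> 2 * cmod (of_real R / b) ^ 2 / R"
      using 2 R by (simp add: abs_divide divide_right_mono flip: diff_divide_distrib)
    moreover have "Re (of_real R / b) / R = Re (1 / b)" using R by (simp add: Re_divide)
    moreover have "2 * cmod (of_real R / b) ^ 2 / R = 2 * R / cmod a ^ 2" using R b by (simp add: norm_divide power_divide power2_eq_square)
    moreover have "2 * cmod (1 / b) ^ 2 = 2 / cmod a ^ 2" using b by (simp add: norm_divide power_divide)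
    ultimately show ?thesis using 1 unfolding X_def add_divide_distrib by linarith
  qed
  let ?b = "of_real (cmod a) :: complex"
  have b: "Re ?b \<ge> 0" "?b \<noteq> 0" using a0 by auto
  note Ia = integrable_diff_kernel_lnfac[OF R a(1) a0] and Ib = integrable_diff_kernel_lnfac[OF R b]
  have "(\<integral>u. diff_kernel R u * \<bar>lnfac a u\<bar> \<partial>lborel) \<le> (\<integral>u. 2 * (diff_kernel R u * lnfac ?b u) - diff_kernel R u * lnfac a u \<partial>lborel)"
  proof (rule integral_mono)
    show "integrable lborel (\<lambda>u. diff_kernel R u * \<bar>lnfac a u\<bar>)"
      using integrable_abs[OF Ia] diff_kernel_nonneg[OF R] by (simp add: abs_mult)
    show "integrable lborel (\<lambda>u. 2 * (diff_kernel R u * lnfac ?b u) - diff_kernel R u * lnfac a u)" using Ia Ib by auto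
    fix u
    have "\<bar>lnfac a u\<bar> \<le> 2 * lnfac ?b u - lnfac a u" using lnfac_le_abs[OF a0, of u] by linarith
    then have "diff_kernel R u * \<bar>lnfac a u\<bar> \<le> diff_kernel R u * (2 * lnfac ?b u - lnfac a u)"
      using diff_kernel_nonneg[OF R] by (intro mult_left_mono) auto
    then show "diff_kernel R u * \<bar>lnfac a u\<bar> \<le> 2 * (diff_kernel R u * lnfac ?b u) - diff_kernel R u * lnfac a u"
      by (simp add: algebra_simps)
  qed
  also have "\<dots> = 2 * (pi * X ?b) - pi * X a"
    using Ia Ib integral_diff_kernel_lnfac[OF R a(1) a0] integral_diff_kernel_lnfac[OF R b] by (simp add: X_def)
  also have "\<dots> = pi * (2 * X ?b - X a)" by (simp add: algebra_simps)
  also have "\<dots> \<le> pi * (3 * ((2 + 2 * R) / cmod a ^ 2))"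
    using X[of ?b] X[of a] by (intro mult_left_mono) (simp_all only: norm_of_real abs_norm_cancel pi_ge_zero, linarith)
  finally show ?thesis by (simp add: algebra_simps add_divide_distrib)
qed

text \<open>Inside [-T, T] the kernel is merely integrable, but \<open>lnfac a\<close> is at most
  T^2/|a|^2 there; outside, comparison with \<open>diff_kernel 2\<close> applies. The threshold
  \<open>max 4 (2 * T)\<close> makes both estimates available, 4 being twice the parameter
  2.\<close>

lemma kernel_lnfac_bound:
  assumes K: "K \<in> borel_measurable borel" and KT: "integrable lborel (\<lambda>u. indicat_real {-T..T} u * K u)"
    and T: "T \<ge> 0" and C: "C \<ge> 0" and dec: "\<And>u. \<bar>u\<bar> > T \<Longrightarrow> \<bar>K u\<bar> \<le> C * diff_kernel 2 u"
  obtains B where "B \<ge> 0" "\<And>a. Re a \<ge> 0 \<Longrightarrow> cmod a \<ge> max 4 (2 * T) \<Longrightarrow> integrable lborel (\<lambda>u. K u * lnfac a u)"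
    "\<And>a. Re a \<ge> 0 \<Longrightarrow> cmod a \<ge> max 4 (2 * T) \<Longrightarrow> (\<integral>u. \<bar>K u * lnfac a u\<bar> \<partial>lborel) \<le> B / cmod a ^ 2"
proof -
  note K[measurable]
  define I where "I = (\<integral>u. \<bar>indicat_real {-T..T} u * K u\<bar> \<partial>lborel)"
  define B where "B = T^2 * I + C * (6 * pi * (1 + 2))"
  have I0: "I \<ge> 0" by (simp add: I_def)
  have main: "integrable lborel (\<lambda>u. K u * lnfac a u) \<and> (\<integral>u. \<bar>K u * lnfac a u\<bar> \<partial>lborel) \<le> B / cmod a ^ 2"
    if a: "Re a \<ge> 0" "cmod a \<ge> max 4 (2 * T)" for a
  proof -
    have a0: "a \<noteq> 0" using a by auto
    define G where "G u = T^2 / cmod a ^ 2 * \<bar>indicat_real {-T..T} u * K u\<bar> + C * (diff_kernel 2 u * \<bar>lnfac a u\<bar>)" for u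
    have D: "integrable lborel (\<lambda>u. diff_kernel 2 u * \<bar>lnfac a u\<bar>)"
      using integrable_abs[OF integrable_diff_kernel_lnfac[of 2 a]] a a0 diff_kernel_nonneg[of 2] by (simp add: abs_mult)
    have G: "integrable lborel G" unfolding G_def
      by (intro Bochner_Integration.integrable_add integrable_mult_right integrable_abs KT D)
    have le: "\<bar>K u * lnfac a u\<bar> \<le> G u" for u
    proof (cases "\<bar>u\<bar> \<le> T")
      case True
      have "\<bar>lnfac a u\<bar> \<le> u^2 / cmod a ^ 2" using a True by (intro abs_lnfac_small a0) auto
      also have "\<dots> \<le> T^2 / cmod a ^ 2" using power_mono[OF True, of 2] by (intro divide_right_mono) auto
      finally have "\<bar>K u\<bar> * \<bar>lnfac a u\<bar> \<le> \<bar>K u\<bar> * (T^2 / cmod a ^ 2)" by (intro mult_left_mono) auto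
      moreover have "C * (diff_kernel 2 u * \<bar>lnfac a u\<bar>) \<ge> 0" using C diff_kernel_nonneg[of 2 u] by simp
      moreover have "indicat_real {-T..T} u = 1" using True by (simp add: abs_le_iff)
      ultimately show ?thesis by (simp add: G_def abs_mult mult.commute)
    next
      case False
      then have "\<bar>K u\<bar> * \<bar>lnfac a u\<bar> \<le> C * diff_kernel 2 u * \<bar>lnfac a u\<bar>" by (intro mult_right_mono dec) auto
      moreover have "indicat_real {-T..T} u = 0" using False by (auto simp: indicator_def)
      ultimately show ?thesis by (simp add: G_def abs_mult mult.assoc)
    qed
    have int: "integrable lborel (\<lambda>u. K u * lnfac a u)"
    proof (rule Bochner_Integration.integrable_bound[OF G])
      show "AE u in lborel. norm (K u * lnfac a u) \<le> norm (G u)" using le by (intro AE_I2) (simp add: order_trans[OF le abs_ge_self])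
    qed measurable
    moreover have "(\<integral>u. \<bar>K u * lnfac a u\<bar> \<partial>lborel) \<le> (\<integral>u. G u \<partial>lborel)"
      by (rule integral_mono[OF integrable_abs[OF int] G le])
    moreover have "(\<integral>u. G u \<partial>lborel) = T^2 / cmod a ^ 2 * I + C * (\<integral>u. diff_kernel 2 u * \<bar>lnfac a u\<bar> \<partial>lborel)"
      unfolding G_def I_def
      by (subst Bochner_Integration.integral_add)
         (simp_all only: integral_mult_right_zero integrable_mult_right integrable_abs KT D)
    moreover have "C * (\<integral>u. diff_kernel 2 u * \<bar>lnfac a u\<bar> \<partial>lborel) \<le> C * (6 * pi * (1 + 2) / cmod a ^ 2)"
      using a by (intro mult_left_mono integral_diff_kernel_abs_lnfac_le C) auto
    moreover have "B / cmod a ^ 2 = T^2 / cmod a ^ 2 * I + C * (6 * pi * (1 + 2) / cmod a ^ 2)"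
      by (simp add: B_def add_divide_distrib)
    ultimately show ?thesis by linarith
  qed
  show thesis by (rule that[of B]) (use main I0 C in \<open>auto simp: B_def\<close>)
qed

section \<open>Even entire functions of order less than two\<close>

text \<open>Induction on the set of points: each step divides the cofactor by its own zero at the
  new point. The point p with F p \<noteq> 0 keeps every cofactor from vanishing identically, so
  that its order at a point is meaningful.\<close>

lemma divide_out_zeros:
  fixes F :: "complex \<Rightarrow> complex"
  assumes F: "F holomorphic_on UNIV" and nz: "F p \<noteq> 0" and S: "finite S"
  shows "\<exists>g. g holomorphic_on UNIV \<and> (\<forall>z. F z = (\<Prod>k\<in>S. (z - k) ^ nat (zorder F k)) * g z) \<and> (\<forall>k\<in>S. g k \<noteq> 0)"
  using S
proof (induction S rule: finite_induct)
  case empty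
  show ?case using F by auto
next
  case (insert a S)
  obtain g where g: "g holomorphic_on UNIV" "\<And>z. F z = (\<Prod>k\<in>S. (z - k) ^ nat (zorder F k)) * g z" "\<And>k. k \<in> S \<Longrightarrow> g k \<noteq> 0"
    using insert.IH by auto
  define P where "P z = (\<Prod>k\<in>S. (z - k) ^ nat (zorder F k))" for z
  have Pa: "P a \<noteq> 0" using insert.hyps by (auto simp: P_def)
  have Ph: "P holomorphic_on UNIV" unfolding P_def[abs_def] by (intro holomorphic_intros)
  have FPg: "F z = P z * g z" for z using g(2) by (simp add: P_def)
  have gp: "g p \<noteq> 0" using nz FPg[of p] by auto
  define n where "n = nat (zorder g a)"
  obtain h r where h: "r > 0" "h holomorphic_on cball a r" "\<And>w. w \<in> cball a r \<Longrightarrow> g w = h w * (w - a) ^ n \<and> h w \<noteq> 0"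
    and ge: "zorder g a \<ge> 0"
  proof -
    have "(if g a = 0 then 0 < zorder g a else zorder g a = 0) \<and>
     (\<exists>r>0. cball a r \<subseteq> UNIV \<and> zor_poly g a holomorphic_on cball a r \<and>
          (\<forall>w\<in>cball a r. g w = zor_poly g a w * (w - a) ^ nat (zorder g a) \<and> zor_poly g a w \<noteq> 0))"
      by (rule zorder_exist_zero[OF g(1)]) (use gp in auto)
    then show thesis using that unfolding n_def by (metis order.order_iff_strict)
  qed
  \<comment> \<open>The factors already split off do not vanish at a, hence F and the cofactor g
    have the same order there.\<close>
  have zF: "zorder F a = int n"
  proof (rule zorder_eqI)
    show "open (ball a r)" "a \<in> ball a r" using h by auto
    show "(\<lambda>w. P w * h w) holomorphic_on ball a r"
      by (intro holomorphic_intros holomorphic_on_subset[OF Ph] holomorphic_on_subset[OF h(2)]) auto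
    show "P a * h a \<noteq> 0" using Pa h(3)[of a] h(1) by auto
    fix w assume w: "w \<in> ball a r" "w \<noteq> a"
    have "F w = P w * (h w * (w - a) ^ n)" using FPg[of w] h(3)[of w] w by simp
    then show "F w = P w * h w * (w - a) powi int n" by (simp add: power_int_def mult.assoc)
  qed
  define G where "G z = (if z = a then h a else g z / (z - a) ^ n)" for z
  have Gh: "G z = h z" if "z \<in> cball a r" for z
    using h(3)[OF that] by (auto simp: G_def)
  have "G holomorphic_on (ball a r \<union> - {a})"
  proof (rule holomorphic_on_Un)
    show "G holomorphic_on ball a r"
      by (rule holomorphic_transform[OF holomorphic_on_subset[OF h(2)]]) (auto simp: Gh)
    have "(\<lambda>z. g z / (z - a) ^ n) holomorphic_on - {a}"
      by (intro holomorphic_intros holomorphic_on_subset[OF g(1)]) auto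
    then show "G holomorphic_on - {a}" by (rule holomorphic_transform) (auto simp: G_def)
  qed auto
  moreover have "ball a r \<union> - {a} = UNIV" using h(1) by auto
  ultimately have Ghol: "G holomorphic_on UNIV" by simp
  have gG: "g z = (z - a) ^ n * G z" for z
  proof (cases "z = a")
    case True then show ?thesis using h(3)[of a] h(1) by (simp add: G_def)
  qed (simp add: G_def)
  show ?case
  proof (intro exI conjI allI ballI)
    show "G holomorphic_on UNIV" by fact
    fix z show "F z = (\<Prod>k\<in>insert a S. (z - k) ^ nat (zorder F k)) * G z"
      using insert.hyps FPg[of z] gG[of z] by (simp add: P_def zF mult_ac)
  next
    fix k assume "k \<in> insert a S"
    show "G k \<noteq> 0"
    proof (cases "k = a")
      case True
      have "h a \<noteq> 0" using h(3)[of a] h(1) by simp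
      then show ?thesis by (simp add: True G_def)
    next
      case False
      then have "g k \<noteq> 0" using g(3) \<open>k \<in> insert a S\<close> by simp
      then show ?thesis unfolding gG[of k] by simp
    qed
  qed
qed

lemma zorder_even:
  fixes F :: "complex \<Rightarrow> complex"
  assumes F: "F holomorphic_on UNIV" and nz: "F p \<noteq> 0" and even: "\<And>z. F (-z) = F z"
  shows "zorder F (-a) = zorder F a"
proof -
  define n where "n = nat (zorder F a)"
  obtain h r where h: "r > 0" "h holomorphic_on cball a r" "\<And>w. w \<in> cball a r \<Longrightarrow> F w = h w * (w - a) ^ n \<and> h w \<noteq> 0"
    and ge: "zorder F a \<ge> 0"
  proof -
    have "(if F a = 0 then 0 < zorder F a else zorder F a = 0) \<and>
     (\<exists>r>0. cball a r \<subseteq> UNIV \<and> zor_poly F a holomorphic_on cball a r \<and>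
          (\<forall>w\<in>cball a r. F w = zor_poly F a w * (w - a) ^ nat (zorder F a) \<and> zor_poly F a w \<noteq> 0))"
      by (rule zorder_exist_zero[OF F]) (use nz in auto)
    then show thesis using that unfolding n_def by (metis order.order_iff_strict)
  qed
  have "zorder F (-a) = int n"
  proof (rule zorder_eqI)
    show "open (ball (-a) r)" "-a \<in> ball (-a) r" using h by auto
    have sub: "uminus ` ball (-a) r \<subseteq> cball a r"
    proof
      fix z assume "z \<in> uminus ` ball (-a) r"
      then obtain w where w: "z = - w" "cmod (-a - w) < r" by (auto simp: dist_norm)
      have "a - z = - (-a - w)" using w by simp
      then have "cmod (a - z) = cmod (-a - w)" by (simp only: norm_minus_cancel)
      then show "z \<in> cball a r" using w by (simp add: dist_norm)
    qed
    show "(\<lambda>w. (-1)^n * h (-w)) holomorphic_on ball (-a) r"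
      by (intro holomorphic_intros holomorphic_on_compose_gen[OF _ h(2), unfolded o_def] sub)
    show "(-1)^n * h (- (-a)) \<noteq> 0" using h(3)[of a] h(1) by auto
    fix w assume w: "w \<in> ball (-a) r" "w \<noteq> -a"
    have "F w = F (-w)" using even by simp
    also have "\<dots> = h (-w) * (-w - a) ^ n" using h(3)[of "-w"] w sub by blast
    also have "-w - a = (-1) * (w - -a)" by simp
    also have "((-1) * (w - -a)) ^ n = (-1)^n * (w - -a)^n" by (rule power_mult_distrib)
    finally show "F w = (-1)^n * h (-w) * (w - -a) powi int n" by (simp add: power_int_def mult_ac)
  qed
  then show ?thesis using ge by (simp add: n_def)
qed

text \<open>Borel-Caratheodory with a quadratic gain. The Schwarz lemma applied once gives a factor
  |w|/R; for an even function the quotient by z vanishes at 0 again, and a second application gives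
  (|w|/R)^2.\<close>

lemma even_borel_caratheodory:
  fixes G :: "complex \<Rightarrow> complex"
  assumes G: "G holomorphic_on UNIV" and R: "R > 0" and nz: "\<And>z. cmod z < R \<Longrightarrow> G z \<noteq> 0"
    and G0: "G 0 = 1" and even: "\<And>z. G (-z) = G z" and A: "A \<ge> 0" and le: "\<And>z. cmod z < R \<Longrightarrow> cmod (G z) \<le> exp A"
    and w: "cmod w \<le> R / 2"
  shows "\<bar>ln (cmod (G w))\<bar> \<le> 8 * (A + 1) * (cmod w / R)^2"
proof -
  obtain L0 where L0: "L0 holomorphic_on ball 0 R" "\<And>z. z \<in> ball 0 R \<Longrightarrow> G z = exp (L0 z)"
    using contractible_imp_holomorphic_log[of G "ball 0 R"] holomorphic_on_subset[OF G] nz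
    by (auto simp: convex_imp_contractible)
  \<comment> \<open>The symmetrised logarithm is even and vanishes at 0 by construction, whatever
    branch L0 is; its real part is 2 ln |G|.\<close>
  define M where "M z = L0 z + L0 (-z) - 2 * L0 0" for z
  have Mh: "M holomorphic_on ball 0 R"
    unfolding M_def[abs_def]
    by (intro holomorphic_intros L0 holomorphic_on_compose_gen[OF _ L0(1), unfolded o_def]) (auto intro!: holomorphic_intros)
  have Meven: "M (-z) = M z" for z by (simp add: M_def)
  have M0: "M 0 = 0" by (simp add: M_def)
  have ReM: "Re (M z) = 2 * ln (cmod (G z))" if "cmod z < R" for z
  proof -
    have "Re (L0 z) = ln (cmod (G z))" if "cmod z < R" for z using L0(2)[of z] that by simp
    from this[of z] this[of "-z"] this[of 0] show ?thesis using that R by (simp add: M_def even G0)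
  qed
  \<comment> \<open>Re M is at most 2A; the added 1 makes the bound strict and B positive even when
    A = 0.\<close>
  define B where "B = 2 * (A + 1)"
  have B: "B > 0" using A by (simp add: B_def)
  have ReMB: "Re (M z) < B" if "cmod z < R" for z
  proof -
    have "cmod (G z) > 0" using nz that by simp
    then have "ln (cmod (G z)) \<le> A" using le[OF that] using ln_le_cancel_iff[of "cmod (G z)" "exp A"] by simp
    then show ?thesis using ReM[OF that] by (simp add: B_def)
  qed
  \<comment> \<open>The map v -> v/(2B - v) sends the half-plane Re v < B into the unit disc and
    fixes 0.\<close>
  define f where "f z = (let v = M (of_real R * z) in v / (2 * of_real B - v))" for z
  have Rz: "cmod (of_real R * z) < R" if "cmod z < 1" for z using that R by (simp add: norm_mult)
  have den: "2 * of_real B - M (of_real R * z) \<noteq> 0" if "cmod z < 1" for z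
  proof
    assume "2 * of_real B - M (of_real R * z) = 0"
    then have "Re (M (of_real R * z)) = 2 * B" by (simp add: complex_eq_iff)
    then show False using ReMB[OF Rz[OF that]] B by simp
  qed
  have MR: "(\<lambda>z. M (of_real R * z)) holomorphic_on ball 0 1"
    by (rule holomorphic_on_compose_gen[OF _ Mh, unfolded o_def]) (use R in \<open>auto intro!: holomorphic_intros simp: norm_mult\<close>)
  have fh: "f holomorphic_on ball 0 1"
    unfolding f_def[abs_def] Let_def by (intro holomorphic_intros MR) (use den in auto)
  have f0: "f 0 = 0" by (simp add: f_def M0)
  have feven: "f (-z) = f z" for z by (simp add: f_def Meven)
  have f1: "cmod (f z) < 1" if "cmod z < 1" for z
  proof -
    define v where "v = M (of_real R * z)"
    have "Re v < B" using ReMB[OF Rz[OF that]] by (simp add: v_def)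
    then have "(Re v)^2 < (2 * B - Re v)^2" using B mult_pos_pos[of B "B - Re v"] by (simp add: power2_eq_square algebra_simps)
    then have "(cmod v)^2 < (cmod (2 * of_real B - v))^2" by (simp add: cmod_power2)
    then have "cmod v < cmod (2 * of_real B - v)" by (rule power2_less_imp_less) simp
    then show ?thesis by (simp add: f_def norm_divide divide_less_eq_1 flip: v_def)
  qed
  have fz: "cmod (f z) \<le> cmod z" if "cmod z < 1" for z by (rule Schwarz_Lemma(1)[OF fh f0 f1 that])
  obtain k where k: "k holomorphic_on ball 0 1" "\<And>z. cmod z < 1 \<Longrightarrow> f z = z * k z" "deriv f 0 = k 0"
    using Schwarz3[OF fh f0] by metis
  have "k 0 = 0"
  proof -
    have "(f has_field_derivative k 0) (at 0)"
      using holomorphic_derivI[OF fh, of 0] k(3) by auto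
    then have d: "(f has_field_derivative k 0) (at (- 0))" by simp
    have "((\<lambda>z. f (-z)) has_field_derivative k 0 * (-1)) (at 0)"
      using DERIV_chain2[of f "k 0" "\<lambda>z. -z" 0 "-1" UNIV] d DERIV_minus[OF DERIV_ident, of "0::complex" UNIV] by simp
    then have "(f has_field_derivative - k 0) (at 0)" by (simp add: feven)
    then have "- k 0 = k 0" using DERIV_unique[of f "- k 0" 0 "k 0"] d by simp
    then show ?thesis by (simp add: equation_minus_iff)
  qed
  have k1: "cmod (k z) \<le> 1" if "cmod z < 1" for z
    using fz[OF that] k(2)[OF that] \<open>k 0 = 0\<close> by (cases "z = 0") (auto simp: norm_mult)
  \<comment> \<open>The first application only gives |k| <= 1, while the lemma asks for strict
    inequality; halving k provides it at the cost of a factor 2.\<close>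
  have k2: "cmod (k z / 2) \<le> cmod z" if "cmod z < 1" for z
  proof (rule Schwarz_Lemma(1)[of "\<lambda>z. k z / 2"])
    show "(\<lambda>z. k z / 2) holomorphic_on ball 0 1" by (intro holomorphic_intros k) auto
    show "cmod (k x / 2) < 1" if "cmod x < 1" for x
    proof -
      have "cmod (k x / 2) = cmod (k x) / 2" by (simp add: norm_divide)
      then show ?thesis using k1[OF that] by linarith
    qed
  qed (use \<open>k 0 = 0\<close> that in auto)
  have f2: "cmod (f z) \<le> 2 * cmod z ^ 2" if "cmod z < 1" for z
    using mult_left_mono[OF k2[OF that], of "cmod z"] k(2)[OF that] by (simp add: norm_mult norm_divide power2_eq_square)
  define z where "z = w / of_real R"
  have z: "cmod z \<le> 1/2" "cmod z = cmod w / R" using w R by (auto simp: z_def norm_divide field_simps)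
  have wz: "of_real R * z = w" using R by (simp add: z_def)
  have z1: "cmod z < 1" using z(1) by linarith
  have fh2: "cmod (f z) \<le> 1/2"
  proof -
    have "2 * cmod z ^ 2 \<le> 2 * (1/2)^2" using z(1) by (intro mult_left_mono power_mono) auto
    then show ?thesis using f2[OF z1] by (simp add: power2_eq_square)
  qed
  have "M w * (1 + f z) = 2 * of_real B * f z"
  proof -
    have "2 * of_real B - M w \<noteq> 0" using den[OF z1] by (simp only: wz not_False_eq_True)
    then show ?thesis unfolding f_def Let_def wz by (simp add: field_simps)
  qed
  then have "cmod (M w) * cmod (1 + f z) = 2 * B * cmod (f z)" using B by (metis abs_of_pos norm_mult norm_of_real norm_numeral)
  moreover have "cmod (1 + f z) \<ge> 1/2" using norm_diff_ineq[of 1 "f z"] fh2 by simp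
  then have "cmod (M w) * (1/2) \<le> cmod (M w) * cmod (1 + f z)" by (intro mult_left_mono) auto
  ultimately have "cmod (M w) \<le> 4 * B * cmod (f z)" by simp
  also have "\<dots> \<le> 4 * B * (2 * cmod z ^ 2)" using B f2[OF z1] by (intro mult_left_mono) auto
  finally have Mw: "cmod (M w) \<le> 16 * (A + 1) * (cmod w / R)^2" by (simp add: B_def z(2) algebra_simps)
  have "2 * \<bar>ln (cmod (G w))\<bar> = \<bar>Re (M w)\<bar>" using ReM[of w] w R by simp
  also have "\<dots> \<le> cmod (M w)" by (rule abs_Re_le_cmod)
  finally have "2 * \<bar>ln (cmod (G w))\<bar> \<le> 2 * (8 * (A + 1) * (cmod w / R)^2)" using Mw by argo
  then show ?thesis by simp
qed

text \<open>The annulus 2^J < |z| <= 2^(J+1) carries total weight at most C 2^(3(J+1)/2), and the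
  denominator there exceeds 2^(2J); the exponent 3/2 < 2 leaves a geometric series.\<close>

lemma summable_on_dyadic:
  fixes m :: "complex \<Rightarrow> real"
  assumes m: "\<And>z. z \<in> Z \<Longrightarrow> m z \<ge> 0" and fin: "\<And>R. finite {z \<in> Z. cmod z \<le> R}"
    and count: "\<And>R. R \<ge> 1 \<Longrightarrow> (\<Sum>z\<in>{z \<in> Z. cmod z \<le> R}. m z) \<le> C * R powr (3/2)" and C: "C \<ge> 0"
  shows "(\<lambda>z. m z / cmod z ^ 2) summable_on Z"
proof (rule nonneg_bdd_above_summable_on)
  show "0 \<le> m z / cmod z ^ 2" if "z \<in> Z" for z using m[OF that] by simp
  define S0 where "S0 = (\<Sum>z\<in>{z \<in> Z. cmod z \<le> 1}. m z / cmod z ^ 2)"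
  \<comment> \<open>The ratio of the geometric series: 2^(3/2) from the counting bound divided by
    2^2 from the denominator.\<close>
  define q :: real where "q = 2 powr (-1/2)"
  have q: "0 < q" "q < 1" by (auto simp: q_def powr_less_one)
  have step: "(\<Sum>z\<in>{z \<in> Z. cmod z \<le> 2 ^ J}. m z / cmod z ^ 2) \<le> S0 + (\<Sum>j<J. C * 2 powr (3/2) * q ^ j)" for J :: nat
  proof (induction J)
    case 0 then show ?case by (simp add: S0_def)
  next
    case (Suc J)
    let ?A = "{z \<in> Z. cmod z \<le> 2 ^ J}" and ?B = "{z \<in> Z. cmod z \<le> 2 ^ Suc J}"
    have sub: "?A \<subseteq> ?B" by (auto intro: order_trans)
    have "(\<Sum>z\<in>?B. m z / cmod z ^ 2) = (\<Sum>z\<in>?B - ?A. m z / cmod z ^ 2) + (\<Sum>z\<in>?A. m z / cmod z ^ 2)"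
      by (rule sum.subset_diff[OF sub fin])
    also have "(\<Sum>z\<in>?B - ?A. m z / cmod z ^ 2) \<le> (\<Sum>z\<in>?B - ?A. m z / (2 ^ J)^2)"
      by (intro sum_mono divide_left_mono power_mono) (auto simp: m intro!: mult_pos_pos zero_less_power)
    also have "\<dots> = (\<Sum>z\<in>?B - ?A. m z) / (2 ^ J)^2" by (simp add: sum_divide_distrib)
    also have "\<dots> \<le> (\<Sum>z\<in>?B. m z) / (2 ^ J)^2"
      by (intro divide_right_mono sum_mono2 fin) (auto simp: m)
    also have "\<dots> \<le> (C * (2 ^ Suc J) powr (3/2)) / (2 ^ J)^2"
      by (intro divide_right_mono count) (auto simp: one_le_power[of 2 "Suc J"] simp del: power_Suc)
    also have "\<dots> = C * 2 powr (3/2) * q ^ J"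
    proof -
      have a: "(2::real) ^ n = 2 powr real n" for n :: nat by (simp add: powr_realpow)
      have "q ^ J = 2 powr (real J * (-1/2))" by (simp add: q_def powr_powr mult.commute flip: powr_realpow)
      moreover have "((2::real) ^ Suc J) powr (3/2) / (2 ^ J)^2 = 2 powr (3/2) * 2 powr (real J * (-1/2))"
      proof -
        have "((2::real) ^ Suc J) powr (3/2) = 2 powr (real (Suc J) * (3/2))" unfolding a powr_powr ..
        moreover have "((2::real) ^ J)^2 = 2 powr (real (J * 2))" unfolding a[symmetric] by (simp add: power_mult)
        moreover have "real (Suc J) * (3/2) - real (J * 2) = 3/2 + real J * (-1/2)" by (simp add: field_simps)
        ultimately show ?thesis by (simp only: powr_add[symmetric] powr_diff[symmetric])
      qed
      ultimately show ?thesis by (simp add: mult.assoc flip: times_divide_eq_right)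
    qed
    finally show ?case using Suc.IH by simp
  qed
  have geo: "(\<Sum>j<J. C * 2 powr (3/2) * q ^ j) \<le> C * 2 powr (3/2) * (1 / (1 - q))" for J :: nat
  proof -
    have "(\<Sum>j<J. q ^ j) \<le> (\<Sum>j. q ^ j)" using q by (intro sum_le_suminf summable_geometric) auto
    also have "\<dots> = 1 / (1 - q)" using q by (intro suminf_geometric) auto
    finally show ?thesis using C unfolding sum_distrib_left[symmetric] by (intro mult_left_mono) auto
  qed
  show "bdd_above (sum (\<lambda>z. m z / cmod z ^ 2) ` {F. F \<subseteq> Z \<and> finite F})"
  proof (rule bdd_aboveI2)
    fix F assume F: "F \<in> {F. F \<subseteq> Z \<and> finite F}"
    then have "bdd_above (cmod ` F)" by auto
    then obtain b where b: "\<And>z. z \<in> F \<Longrightarrow> cmod z \<le> b" by (auto simp: bdd_above_def)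
    obtain J :: nat where J: "b < 2 ^ J" using real_arch_pow[of 2 b] by auto
    have "sum (\<lambda>z. m z / cmod z ^ 2) F \<le> (\<Sum>z\<in>{z \<in> Z. cmod z \<le> 2 ^ J}. m z / cmod z ^ 2)"
      using F b J
    proof (intro sum_mono2 fin)
      show "F \<subseteq> {z \<in> Z. cmod z \<le> 2 ^ J}" using F b J by fastforce
    qed (auto simp: m)
    then show "sum (\<lambda>z. m z / cmod z ^ 2) F \<le> S0 + C * 2 powr (3/2) * (1 / (1 - q))"
      using step[of J] geo[of J] by linarith
  qed
qed

lemma abs_ln_cmod_one_plus_le:
  assumes "cmod z \<le> 1/4" shows "\<bar>ln (cmod (1 + z))\<bar> \<le> 2 * cmod z"
proof -
  have "1 + z \<noteq> 0"
  proof
    assume "1 + z = 0"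
    then have "z = -1" by (simp add: eq_neg_iff_add_eq_0 add.commute)
    then show False using assms by simp
  qed
  then have "ln (cmod (1 + z)) = Re (Ln (1 + z))" by simp
  also have "\<bar>\<dots>\<bar> \<le> cmod (Ln (1 + z))" by (rule abs_Re_le_cmod)
  also have "\<dots> \<le> 2 * cmod z" by (rule norm_Ln_le) (use assms in auto)
  finally show ?thesis .
qed

text \<open>The exponent 3/2 leaves room for the growth R ln R of the completed zeta function and
  stays below 2, the order at which the quadratic estimate would stop giving a vanishing
  error.\<close>

locale even_entire =
  fixes F :: "complex \<Rightarrow> complex" and C :: real
  assumes holo: "F holomorphic_on UNIV" and F0: "F 0 = 1" and even: "\<And>z. F (-z) = F z"
    and C_nonneg: "C \<ge> 0" and growth: "\<And>z. cmod (F z) \<le> exp (C * (1 + cmod z) powr (3/2))"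
begin

definition Z :: "complex set" where "Z = {z. F z = 0}"
definition m :: "complex \<Rightarrow> nat" where "m z = nat (zorder F z)"

lemma zero_notin_Z: "0 \<notin> Z" by (simp add: Z_def F0)

lemma uminus_Z: "-z \<in> Z \<longleftrightarrow> z \<in> Z" by (simp add: Z_def even)

lemma m_uminus: "m (-z) = m z"
  using zorder_even[OF holo, of 0] even F0 by (simp add: m_def)

lemma finite_Z_cball: "finite {z \<in> Z. cmod z \<le> R}"
proof -
  have "finite {z \<in> cball 0 R. F z = 0}"
  proof (cases "F constant_on UNIV")
    case True
    then have "F z = 1" for z using F0 by (metis UNIV_I constant_on_def)
    then show ?thesis by simp
  next
    case False
    then show ?thesis by (intro holomorphic_compact_finite_zeros[OF holo]) auto
  qed
  then show ?thesis by (rule rev_finite_subset) (auto simp: Z_def)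
qed

definition S :: "real \<Rightarrow> complex set" where "S R = {z \<in> Z. cmod z \<le> R}"

lemma finite_S: "finite (S R)" by (simp add: S_def finite_Z_cball)

text \<open>The zeros in |k| <= R are divided out by factors normalised to 1 at 0. On the circle |w|
  = 4R each such factor has modulus at least 3, so the maximum principle bounds G by the growth of F
  divided by 3 to the number of zeros. This surplus later counts the zeros.\<close>

lemma quotient_exists:
  assumes R: "R > 0"
  obtains G where "G holomorphic_on UNIV" "\<And>z. F z = (\<Prod>k\<in>S R. (1 - z / k) ^ m k) * G z" "G 0 = 1"
    "\<And>z. G (-z) = G z" "\<And>z. cmod z \<le> R \<Longrightarrow> G z \<noteq> 0"
    "\<And>z. cmod z \<le> 4 * R \<Longrightarrow> cmod (G z) \<le> exp (C * (1 + 4 * R) powr (3/2)) / 3 ^ (\<Sum>k\<in>S R. m k)"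
proof -
  obtain g where g: "g holomorphic_on UNIV" "\<And>z. F z = (\<Prod>k\<in>S R. (z - k) ^ m k) * g z" "\<And>k. k \<in> S R \<Longrightarrow> g k \<noteq> 0"
    using divide_out_zeros[OF holo, of 0, OF _ finite_S[of R]] F0 unfolding m_def by auto
  define G where "G z = (\<Prod>k\<in>S R. (-k) ^ m k) * g z" for z
  define P where "P z = (\<Prod>k\<in>S R. (1 - z / k) ^ m k)" for z
  have k0: "k \<noteq> 0" if "k \<in> S R" for k using that zero_notin_Z by (auto simp: S_def)
  have FPG: "F z = P z * G z" for z
  proof -
    have "(\<Prod>k\<in>S R. (z - k) ^ m k) = (\<Prod>k\<in>S R. (1 - z / k) ^ m k * (-k) ^ m k)"
      by (rule prod.cong[OF refl]) (use k0 in \<open>simp add: field_simps flip: power_mult_distrib\<close>)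
    then show ?thesis by (simp add: g(2) P_def G_def prod.distrib mult_ac)
  qed
  have Gh: "G holomorphic_on UNIV" unfolding G_def[abs_def] by (intro holomorphic_intros g)
  have G0: "G 0 = 1" using FPG[of 0] F0 by (simp add: P_def)
  have Gnz: "G z \<noteq> 0" if "cmod z \<le> R" for z
  proof (cases "z \<in> S R")
    case True then show ?thesis using g(3) k0 finite_S by (auto simp: G_def)
  next
    case False
    then have "F z \<noteq> 0" using that by (auto simp: S_def Z_def)
    then show ?thesis using FPG[of z] by auto
  qed
  have Peven: "P (-z) = P z" for z
  proof -
    have "P (-z) = (\<Prod>k\<in>S R. (1 - z / (-k)) ^ m (-k))" by (simp add: P_def m_uminus)
    also have "\<dots> = P z" unfolding P_def
      by (rule prod.reindex_bij_witness[of _ uminus uminus]) (auto simp: S_def uminus_Z)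
    finally show ?thesis .
  qed
  have Geven: "G (-z) = G z" for z
  proof -
    \<comment> \<open>Dividing by P shows evenness only off the zeros; these are finitely many, so
      continuity extends it to the whole plane.\<close>
    let ?U = "- S R"
    have oU: "open ?U" using finite_imp_closed[OF finite_S] by auto
    have eq: "G (-z) - G z = 0" if "z \<in> ?U" for z
    proof -
      have "P z \<noteq> 0" using that finite_S k0 by (auto simp: P_def field_simps)
      then show ?thesis using FPG[of z] FPG[of "-z"] even[of z] Peven[of z] by auto
    qed
    have cont: "continuous_on UNIV (\<lambda>z. G (-z) - G z)"
      by (intro continuous_intros continuous_on_compose2[OF holomorphic_on_imp_continuous_on[OF Gh]] holomorphic_on_imp_continuous_on[OF Gh]) auto
    have "closure ?U = UNIV"
      using closure_complement[of "S R"] empty_interior_finite[OF finite_S, of R] by simp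
    then have "G (-z) - G z = 0"
      using continuous_constant_on_closure[of ?U "\<lambda>z. G (-z) - G z" 0 z] cont eq by auto
    then show ?thesis by simp
  qed
  have bound: "cmod (G z) \<le> exp (C * (1 + 4 * R) powr (3/2)) / 3 ^ (\<Sum>k\<in>S R. m k)" if z: "cmod z \<le> 4 * R" for z
  proof (rule maximum_modulus_frontier[of G "cball 0 (4 * R)"])
    show "G holomorphic_on interior (cball 0 (4 * R))" using Gh by (rule holomorphic_on_subset) auto
    show "continuous_on (closure (cball 0 (4 * R))) G" using Gh by (intro holomorphic_on_imp_continuous_on holomorphic_on_subset[OF Gh]) auto
    show "z \<in> cball 0 (4 * R)" using z by auto
    fix w assume "w \<in> frontier (cball 0 (4 * R) :: complex set)"
    then have w: "cmod w = 4 * R" using R by auto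
    have "cmod (P w) \<ge> (\<Prod>k\<in>S R. 3 ^ m k)"
      unfolding P_def prod_norm[symmetric] norm_power
    proof (intro prod_mono conjI power_mono)
      fix k assume k: "k \<in> S R"
      have "cmod (w / k) \<ge> 4" using k k0[OF k] w by (simp add: norm_divide S_def field_simps)
      then show "3 \<le> cmod (1 - w / k)" using norm_triangle_ineq2[of "w / k" 1] by (simp add: norm_minus_commute)
    qed auto
    then have P3: "cmod (P w) \<ge> 3 ^ (\<Sum>k\<in>S R. m k)" by (simp add: power_sum)
    have "cmod (P w) * cmod (G w) \<le> exp (C * (1 + 4 * R) powr (3/2))"
      using growth[of w] FPG[of w] w by (simp add: norm_mult)
    then have "3 ^ (\<Sum>k\<in>S R. m k) * cmod (G w) \<le> exp (C * (1 + 4 * R) powr (3/2))"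
      using mult_right_mono[OF P3, of "cmod (G w)"] by simp
    then show "cmod (G w) \<le> exp (C * (1 + 4 * R) powr (3/2)) / 3 ^ (\<Sum>k\<in>S R. m k)"
      by (simp add: field_simps)
  qed auto
  show thesis by (rule that[of G]) (use Gh FPG G0 Gnz Geven bound in \<open>auto simp: P_def\<close>)
qed

lemma count_zeros_le:
  assumes R: "R \<ge> 1"
  shows "(\<Sum>k\<in>S R. real (m k)) \<le> (C * 5 powr (3/2)) * R powr (3/2)"
proof -
  obtain G where G: "G 0 = 1" "\<And>z. cmod z \<le> 4 * R \<Longrightarrow> cmod (G z) \<le> exp (C * (1 + 4 * R) powr (3/2)) / 3 ^ (\<Sum>k\<in>S R. m k)"
  proof (rule quotient_exists[of R])
    show "R > 0" using R by simp
  qed (rule that)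
  have "3 ^ (\<Sum>k\<in>S R. m k) \<le> exp (C * (1 + 4 * R) powr (3/2))"
    using G(1) G(2)[of 0] R by (simp add: field_simps)
  moreover have "exp (real (\<Sum>k\<in>S R. m k)) \<le> 3 ^ (\<Sum>k\<in>S R. m k)"
    using power_mono[of "exp 1 :: real" 3 "\<Sum>k\<in>S R. m k"] exp_le

      exp_of_nat_mult[of "\<Sum>k\<in>S R. m k" "1::real"] by simp
  ultimately have "exp (real (\<Sum>k\<in>S R. m k)) \<le> exp (C * (1 + 4 * R) powr (3/2))" by linarith
  then have "real (\<Sum>k\<in>S R. m k) \<le> C * (1 + 4 * R) powr (3/2)" by simp
  also have "\<dots> \<le> C * (5 * R) powr (3/2)" using R C_nonneg by (intro mult_left_mono powr_mono2) auto
  also have "\<dots> = (C * 5 powr (3/2)) * R powr (3/2)" using R by (simp add: powr_mult)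
  finally show ?thesis by simp
qed

lemma summable_zeros: "(\<lambda>z. real (m z) / cmod z ^ 2) summable_on Z"
  by (rule summable_on_dyadic[OF _ finite_Z_cball count_zeros_le[unfolded S_def]]) (use C_nonneg in auto)

lemma filterlim_S: "filterlim S (finite_subsets_at_top Z) at_top"
  unfolding filterlim_finite_subsets_at_top
proof (intro allI impI)
  fix X assume X: "finite X \<and> X \<subseteq> Z"
  then have "bdd_above (cmod ` X)" by auto
  then obtain b where b: "\<And>z. z \<in> X \<Longrightarrow> cmod z \<le> b" by (auto simp: bdd_above_def)
  show "\<forall>\<^sub>F y in at_top. finite (S y) \<and> X \<subseteq> S y \<and> S y \<subseteq> Z"
    using eventually_ge_at_top[of b]
    by eventually_elim (use X b finite_S in \<open>auto simp: S_def intro: order_trans\<close>)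
qed

text \<open>The sum converges absolutely, so it may be evaluated along the discs \<open>S R\<close>.
  There the error is ln |G w|, which is O(R^(3/2) / R^2). The weight m/2 arises because z and -z
  share the factor 1 - w^2/z^2 and both are indexed.\<close>

theorem ln_abs_has_sum:
  assumes w: "w \<notin> Z"
  shows "((\<lambda>z. real (m z) / 2 * ln (cmod (1 - w^2 / z^2))) has_sum ln (cmod (F w))) Z"
proof -
  define f where "f z = real (m z) / 2 * ln (cmod (1 - w^2 / z^2))" for z
  have z0: "z \<noteq> 0" if "z \<in> Z" for z using that zero_notin_Z by auto
  have Fw: "F w \<noteq> 0" using w by (simp add: Z_def)
  have sm: "f summable_on Z"
  proof -
    define B where "B = S (2 * cmod w)"
    have "(\<lambda>z. \<bar>f z\<bar>) summable_on (Z - B)"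
    proof (rule summable_on_comparison_test)
      show "(\<lambda>z. cmod w ^ 2 * (real (m z) / cmod z ^ 2)) summable_on (Z - B)"
        by (intro summable_on_cmult_right summable_on_subset_banach[OF summable_zeros]) auto
      fix z assume z: "z \<in> Z - B"
      then have zw: "cmod z > 2 * cmod w" by (auto simp: B_def S_def)
      have c: "cmod (- (w^2 / z^2)) = cmod w ^ 2 / cmod z ^ 2" by (simp add: norm_divide norm_power)
      have "(2 * cmod w)^2 \<le> (cmod z)^2" using zw by (intro power_mono) auto
      then have "cmod (- (w^2 / z^2)) \<le> 1/4" unfolding c using z0[of z] z by (simp add: field_simps)
      then have "\<bar>ln (cmod (1 + - (w^2 / z^2)))\<bar> \<le> 2 * (cmod w ^ 2 / cmod z ^ 2)"
        unfolding c[symmetric] by (rule abs_ln_cmod_one_plus_le)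
      then have "real (m z) / 2 * \<bar>ln (cmod (1 - w^2 / z^2))\<bar> \<le> real (m z) / 2 * (2 * (cmod w ^ 2 / cmod z ^ 2))"
        by (intro mult_left_mono) auto
      then show "\<bar>f z\<bar> \<le> cmod w ^ 2 * (real (m z) / cmod z ^ 2)" by (simp add: f_def abs_mult mult_ac)
    qed auto
    then have "f summable_on (Z - B)" unfolding summable_on_iff_abs_summable_on_real[of f] real_norm_def .
    moreover have "f summable_on B" by (simp add: B_def finite_S summable_on_finite)
    moreover have "B \<subseteq> Z" by (auto simp: B_def S_def)
    ultimately show ?thesis using summable_on_Un_disjoint[of f "Z - B" B] by (simp add: Un_absorb2 Diff_disjoint inf_commute)
  qed
  then have hs: "(f has_sum infsum f Z) Z" by (rule has_sum_infsum)
  then have "(sum f \<longlongrightarrow> infsum f Z) (finite_subsets_at_top Z)" by (simp add: has_sum_def)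
  from filterlim_compose[OF this filterlim_S]
  have lim1: "((\<lambda>R. sum f (S R)) \<longlongrightarrow> infsum f Z) at_top" .
  have est: "\<bar>ln (cmod (F w)) - sum f (S R)\<bar> \<le> 8 * (C * (1 + 4 * R) powr (3/2) + 1) * (cmod w / R)^2" if R: "R > 0" "R \<ge> 2 * cmod w" for R
  proof -
    obtain G where G: "G holomorphic_on UNIV" "\<And>z. F z = (\<Prod>k\<in>S R. (1 - z / k) ^ m k) * G z" "G 0 = 1"
      "\<And>z. G (-z) = G z" "\<And>z. cmod z \<le> R \<Longrightarrow> G z \<noteq> 0"
      "\<And>z. cmod z \<le> 4 * R \<Longrightarrow> cmod (G z) \<le> exp (C * (1 + 4 * R) powr (3/2)) / 3 ^ (\<Sum>k\<in>S R. m k)"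
      by (rule quotient_exists[OF R(1)]) (rule that)
    have Gle: "cmod (G z) \<le> exp (C * (1 + 4 * R) powr (3/2))" if "cmod z < R" for z
    proof -
      have "cmod (G z) \<le> exp (C * (1 + 4 * R) powr (3/2)) / 3 ^ (\<Sum>k\<in>S R. m k)" using G(6)[of z] that R by simp
      also have "\<dots> \<le> exp (C * (1 + 4 * R) powr (3/2)) / 1" by (intro divide_left_mono) auto
      finally show ?thesis by simp
    qed
    have lnG: "\<bar>ln (cmod (G w))\<bar> \<le> 8 * (C * (1 + 4 * R) powr (3/2) + 1) * (cmod w / R)^2"
      by (rule even_borel_caratheodory[OF G(1) R(1) _ G(3,4) _ Gle]) (use G(5) R C_nonneg in auto)
    have nz: "1 - w / k \<noteq> 0" "1 + w / k \<noteq> 0" if "k \<in> S R" for k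
    proof -
      have "k \<noteq> 0" "w \<noteq> k" "w \<noteq> - k" using that z0[of k] w uminus_Z[of k] by (auto simp: S_def)
      then show "1 - w / k \<noteq> 0" "1 + w / k \<noteq> 0" by (auto simp: field_simps add_eq_0_iff)
    qed
    have "ln (cmod (F w)) = ln ((\<Prod>k\<in>S R. cmod (1 - w / k) ^ m k) * cmod (G w))"
      by (subst G(2)) (simp add: norm_mult norm_power flip: prod_norm)
    also have "\<dots> = (\<Sum>k\<in>S R. real (m k) * ln (cmod (1 - w / k))) + ln (cmod (G w))"
    proof -
      have pos: "cmod (1 - w / k) ^ m k > 0" if "k \<in> S R" for k using nz(1)[OF that] by simp
      have "G w \<noteq> 0" using G(5)[of w] R by simp
      then have "ln ((\<Prod>k\<in>S R. cmod (1 - w / k) ^ m k) * cmod (G w)) = ln (\<Prod>k\<in>S R. cmod (1 - w / k) ^ m k) + ln (cmod (G w))"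
        using prod_pos[of "S R" "\<lambda>k. cmod (1 - w / k) ^ m k"] pos by (subst ln_mult) auto
      also have "ln (\<Prod>k\<in>S R. cmod (1 - w / k) ^ m k) = (\<Sum>k\<in>S R. ln (cmod (1 - w / k) ^ m k))"

      proof (rule ln_prod[OF finite_S])
        fix k assume "k \<in> S R"
        from pos[OF this] show "cmod (1 - w / k) ^ m k \<noteq> 0" by linarith
      qed
      also have "\<dots> = (\<Sum>k\<in>S R. real (m k) * ln (cmod (1 - w / k)))"
      proof (rule sum.cong[OF refl])
        fix k
        show "ln (cmod (1 - w / k) ^ m k) = real (m k) * ln (cmod (1 - w / k))" by (rule ln_realpow)
      qed
      finally show ?thesis .
    qed
    also have "(\<Sum>k\<in>S R. real (m k) * ln (cmod (1 - w / k))) = sum f (S R)"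
    proof -
      let ?s = "\<Sum>k\<in>S R. real (m k) * ln (cmod (1 - w / k))"
      \<comment> \<open>The disc and the multiplicities are invariant under k -> -k; averaging the
        sum with its reflection combines 1 - w/k and 1 + w/k.\<close>
      have "?s = (\<Sum>k\<in>S R. real (m k) * ln (cmod (1 + w / k)))"
        by (rule sum.reindex_bij_witness[of _ uminus uminus]) (auto simp: S_def uminus_Z m_uminus)
      then have "?s = (\<Sum>k\<in>S R. (real (m k) * ln (cmod (1 - w / k)) + real (m k) * ln (cmod (1 + w / k))) / 2)"
        by (simp add: sum.distrib flip: sum_divide_distrib)
      also have "\<dots> = sum f (S R)"
      proof (rule sum.cong[OF refl])
        fix k assume k: "k \<in> S R"
        have e: "1 - w^2 / k^2 = (1 - w / k) * (1 + w / k)" by (simp add: algebra_simps power2_eq_square)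
        have "ln (cmod (1 - w^2 / k^2)) = ln (cmod (1 - w / k)) + ln (cmod (1 + w / k))"
          unfolding e norm_mult using nz[OF k] by (subst ln_mult) auto
        then show "(real (m k) * ln (cmod (1 - w / k)) + real (m k) * ln (cmod (1 + w / k))) / 2 = f k"
          by (simp add: f_def algebra_simps add_divide_distrib)
      qed
      finally show ?thesis .
    qed
    finally show ?thesis using lnG by simp
  qed
  have "((\<lambda>R. 8 * (C * (1 + 4 * R) powr (3/2) + 1) * (cmod w / R)^2) \<longlongrightarrow> 0) at_top"
  proof -
    have "((\<lambda>R::real. (1 + 4 * R) powr (3/2) / R^2) \<longlongrightarrow> 0) at_top" "((\<lambda>R::real. 1 / R^2) \<longlongrightarrow> 0) at_top"
      by real_asymp+
    then have "((\<lambda>R. 8 * cmod w ^ 2 * (C * ((1 + 4 * R) powr (3/2) / R^2) + 1 / R^2)) \<longlongrightarrow> 8 * cmod w ^ 2 * (C * 0 + 0)) at_top"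
      by (intro tendsto_intros)
    moreover have "8 * (C * X + 1) * (cmod w / R)^2 = 8 * cmod w ^ 2 * (C * (X / R^2) + 1 / R^2)" for X R :: real
      by (simp add: power_divide distrib_left distrib_right add_divide_distrib mult_ac)
    ultimately show ?thesis by simp
  qed
  then have "((\<lambda>R. ln (cmod (F w)) - sum f (S R)) \<longlongrightarrow> 0) at_top"
  proof (rule Lim_null_comparison[rotated])
    show "\<forall>\<^sub>F R in at_top. norm (ln (cmod (F w)) - sum f (S R)) \<le> 8 * (C * (1 + 4 * R) powr (3/2) + 1) * (cmod w / R)^2"
      using eventually_gt_at_top[of 0] eventually_ge_at_top[of "2 * cmod w"]
      by eventually_elim (use est in auto)
  qed
  then have "((\<lambda>R. ln (cmod (F w)) - (ln (cmod (F w)) - sum f (S R))) \<longlongrightarrow> ln (cmod (F w)) - 0) at_top"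
    by (intro tendsto_intros)
  then have "((\<lambda>R. sum f (S R)) \<longlongrightarrow> ln (cmod (F w))) at_top" by simp
  then have "infsum f Z = ln (cmod (F w))" by (rule tendsto_unique[OF trivial_limit_at_top_linorder lim1])
  with hs have "(f has_sum ln (cmod (F w))) Z" by (simp only:)
  then show ?thesis unfolding f_def[abs_def] .
qed

end

section \<open>The zeta function in the right half-plane\<close>

lemma deriv_bound_ball:
  assumes f: "f holomorphic_on ball s r" and r: "r > 0" and B: "\<And>z. z \<in> ball s r \<Longrightarrow> cmod (f z) \<le> B"
    and z: "z \<in> ball s (r/2)"
  shows "cmod (deriv f z) \<le> 4 * B / r"
proof -
  have sub: "cball z (r/4) \<subseteq> ball s r"
  proof
    fix w assume "w \<in> cball z (r/4)"
    then have "dist s w < r" using dist_triangle[of s w z] z r by simp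
    then show "w \<in> ball s r" by simp
  qed
  have "norm ((deriv ^^ 1) f z) \<le> fact 1 * B / (r/4) ^ 1"
  proof (rule Cauchy_inequality)
    show "f holomorphic_on ball z (r/4)" by (rule holomorphic_on_subset[OF f order_trans[OF ball_subset_cball sub]])
    show "continuous_on (cball z (r/4)) f" by (rule holomorphic_on_imp_continuous_on[OF holomorphic_on_subset[OF f sub]])
    show "cmod (f x) \<le> B" if "cmod (z - x) = r/4" for x
      using B sub that by (auto simp: dist_norm subset_iff)
  qed (use r in auto)
  then show ?thesis by (simp add: mult.commute)
qed

lemma zorder_local_form:
  assumes "f holomorphic_on S" "open S" "connected S" "z \<in> S" "\<exists>w\<in>S. f w \<noteq> 0"
  obtains h r where "r > 0" "h holomorphic_on cball z r"
    "\<And>w. w \<in> cball z r \<Longrightarrow> f w = h w * (w - z) ^ nat (zorder f z)" "\<And>w. w \<in> cball z r \<Longrightarrow> h w \<noteq> 0"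
proof -
  note Z = conjunct2[OF zorder_exist_zero[OF assms]]
  from Z obtain r where r: "r > 0 \<and> cball z r \<subseteq> S \<and> zor_poly f z holomorphic_on cball z r \<and>
     (\<forall>w\<in>cball z r. f w = zor_poly f z w * (w - z) ^ nat (zorder f z) \<and> zor_poly f z w \<noteq> 0)"
    by (rule exE)
  show thesis
  proof (rule that[of r "zor_poly f z"])
    show "r > 0" by (rule conjunct1[OF r])
    show "zor_poly f z holomorphic_on cball z r" by (rule conjunct1[OF conjunct2[OF conjunct2[OF r]]])
    fix w assume w: "w \<in> cball z r"
    note B = bspec[OF conjunct2[OF conjunct2[OF conjunct2[OF r]]] w]
    show "f w = zor_poly f z w * (w - z) ^ nat (zorder f z)" by (rule conjunct1[OF B])
    show "zor_poly f z w \<noteq> 0" by (rule conjunct2[OF B])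
  qed
qed

text \<open>Cauchy's estimate bounds the difference quotients by 4M/r on half the ball, so a
  majorant of g itself suffices and none for the derivative has to be supplied.\<close>

lemma holomorphic_parametric_integral:
  fixes g :: "complex \<Rightarrow> real \<Rightarrow> complex"
  assumes U: "open U" and holo: "\<And>x. (\<lambda>s. g s x) holomorphic_on U"
    and meas: "\<And>s. s \<in> U \<Longrightarrow> g s \<in> borel_measurable lborel"
    and dom: "\<And>s. s \<in> U \<Longrightarrow> \<exists>r>0. \<exists>M. ball s r \<subseteq> U \<and> integrable lborel M \<and> (\<forall>z\<in>ball s r. \<forall>x. cmod (g z x) \<le> M x)"
  shows "(\<lambda>s. \<integral>x. g s x \<partial>lborel) holomorphic_on U"
proof -
  have "(\<lambda>s. \<integral>x. g s x \<partial>lborel) field_differentiable (at s)" if s: "s \<in> U" for s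
  proof -
    obtain r M where r: "r > 0" "ball s r \<subseteq> U" and M: "integrable lborel M" "\<And>z x. z \<in> ball s r \<Longrightarrow> cmod (g z x) \<le> M x"
      using dom[OF s] by auto
    have hb: "(\<lambda>s. g s x) holomorphic_on ball s r" for x using holo r(2) by (rule holomorphic_on_subset)
    have int: "integrable lborel (g z)" if z: "z \<in> ball s r" for z
    proof (rule Bochner_Integration.integrable_bound[OF M(1)])
      show "g z \<in> borel_measurable lborel" using meas z r(2) by auto
      show "AE x in lborel. norm (g z x) \<le> norm (M x)"
        unfolding real_norm_def by (intro AE_I2 order_trans[OF M(2)[OF z] abs_ge_self])
    qed
    define D where "D x = deriv (\<lambda>s. g s x) s" for x
    have sb: "s \<in> ball s r" using r by simp
    have DD: "((\<lambda>z. (g z x - g s x) / (z - s)) \<longlongrightarrow> D x) (at s)" for x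
      using holomorphic_derivI[OF hb open_ball sb] unfolding D_def has_field_derivative_iff by simp
    have lip: "cmod ((g z x - g s x) / (z - s)) \<le> 4 * M x / r" if z: "z \<in> ball s (r/2)" "z \<noteq> s" for z x
    proof -
      have "cmod (g z x - g s x) \<le> (4 * M x / r) * cmod (z - s)"
      proof (rule field_differentiable_bound[of "ball s (r/2)" "\<lambda>s. g s x" "deriv (\<lambda>s. g s x)"])
        fix w assume w: "w \<in> ball s (r/2)"
        then have wr: "w \<in> ball s r" using r by auto
        show "((\<lambda>s. g s x) has_field_derivative deriv (\<lambda>s. g s x) w) (at w within ball s (r/2))"
          using holomorphic_derivI[OF hb open_ball wr] by (rule has_field_derivative_at_within)
        show "cmod (deriv (\<lambda>s. g s x) w) \<le> 4 * M x / r"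
          by (rule deriv_bound_ball[OF hb r(1) M(2) w])
      qed (use z r in auto)
      then show ?thesis using z by (simp add: norm_divide field_simps)
    qed
    have "((\<lambda>z. ((\<integral>x. g z x \<partial>lborel) - (\<integral>x. g s x \<partial>lborel)) / (z - s)) \<longlongrightarrow> (\<integral>x. D x \<partial>lborel)) (at s within ball s (r/2))"
      unfolding tendsto_at_iff_sequentially
    proof (intro allI impI)
      fix X :: "nat \<Rightarrow> complex" assume X: "\<forall>i. X i \<in> ball s (r/2) - {s}" "X \<longlonglongrightarrow> s"
      have Xr: "X i \<in> ball s r" for i using X(1) r by (auto dest!: spec[of _ i])
      have fl: "filterlim X (at s) sequentially" using X by (auto simp: filterlim_at)
      have m: "(\<lambda>x. (g (X i) x - g s x) / (X i - s)) \<in> borel_measurable lborel" for i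
        using borel_measurable_integrable[OF int[OF Xr]] borel_measurable_integrable[OF int[OF sb]] by measurable
      have lim: "(\<lambda>i. (g (X i) x - g s x) / (X i - s)) \<longlonglongrightarrow> D x" for x
        by (rule filterlim_compose[OF DD fl])
      have Dm: "D \<in> borel_measurable lborel"
        by (rule borel_measurable_LIMSEQ_metric[OF m lim])
      have "(\<lambda>i. \<integral>x. (g (X i) x - g s x) / (X i - s) \<partial>lborel) \<longlonglongrightarrow> (\<integral>x. D x \<partial>lborel)"
      proof (rule integral_dominated_convergence[OF Dm m])
        show "integrable lborel (\<lambda>x. 4 * M x / r)" using M(1) by (intro integrable_divide integrable_mult_right)
        show "AE x in lborel. norm ((g (X i) x - g s x) / (X i - s)) \<le> 4 * M x / r" for i
          using X(1) by (intro AE_I2 lip) auto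
      qed (use lim in simp)
      moreover have "(\<integral>x. (g (X i) x - g s x) / (X i - s) \<partial>lborel) = ((\<integral>x. g (X i) x \<partial>lborel) - (\<integral>x. g s x \<partial>lborel)) / (X i - s)" for i
        unfolding integral_divide_zero Bochner_Integration.integral_diff[OF int[OF Xr] int[OF sb]] ..
      ultimately show "((\<lambda>z. ((\<integral>x. g z x \<partial>lborel) - (\<integral>x. g s x \<partial>lborel)) / (z - s)) \<circ> X) \<longlonglongrightarrow> (\<integral>x. D x \<partial>lborel)"
        by (simp only: o_def)
    qed
    moreover have "at s within ball s (r/2) = at s" using r by (intro at_within_open) auto
    ultimately show ?thesis unfolding field_differentiable_def has_field_derivative_iff by auto
  qed
  then show ?thesis using U holomorphic_on_open by (simp add: holomorphic_on_def field_differentiable_at_within)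
qed

lemma integrable_powr_tail:
  assumes "e < -1" shows "integrable lborel (\<lambda>x. indicat_real {1..} x * x powr e)"
    and "(\<integral>x. indicat_real {1..} x * x powr e \<partial>lborel) = - 1 / (e + 1)" (is ?A)
proof -
  have hi: "((\<lambda>x. x powr e) has_integral - 1 / (e + 1)) {1..}"
    using has_integral_powr_to_inf[OF assms, of 1] by simp
  then have "(\<lambda>x::real. x powr e) absolutely_integrable_on {1..}"
    by (intro nonnegative_absolutely_integrable_1) (auto simp: has_integral_iff)
  then have I: "integrable lebesgue (\<lambda>x. indicat_real {1..} x * x powr e)" by (simp add: set_integrable_def)
  then show I': "integrable lborel (\<lambda>x. indicat_real {1..} x * x powr e)"
    by (subst (asm) integrable_completion) auto
  have "set_integrable lborel {1..} (\<lambda>x. x powr e)" using I' by (simp add: set_integrable_def)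
  from set_borel_integral_eq_integral(2)[OF this] hi
  show ?A
    by (simp add: set_lebesgue_integral_def has_integral_iff)
qed

section \<open>The fractional-part integral and the regularised zeta function\<close>

definition zint :: "complex \<Rightarrow> complex" where
  "zint s = integral {1..} (\<lambda>x::real. complex_of_real (frac x) * (complex_of_real x) powr (- s - 1))"

definition zint_fun :: "complex \<Rightarrow> real \<Rightarrow> complex" where
  "zint_fun s x = (if 1 \<le> x then of_real (frac x) * of_real x powr (- s - 1) else 0)"

lemma frac_measurable [measurable]: "(frac :: real \<Rightarrow> real) \<in> borel_measurable borel"
  unfolding frac_def[abs_def] by measurable

lemma powr_complex_measurable [measurable]: "(\<lambda>x::real. complex_of_real x powr c) \<in> borel_measurable borel"
proof -
  have "(\<lambda>x. if x = 0 then 0 else exp (c * Ln (complex_of_real x))) \<in> borel_measurable borel"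
    by measurable
  then show ?thesis unfolding powr_def by (simp add: if_distrib cong: if_cong)
qed

lemma zint_fun_measurable [measurable]: "zint_fun s \<in> borel_measurable borel"
  unfolding zint_fun_def[abs_def] by measurable

lemma cmod_zint_fun_le: "c \<le> Re s \<Longrightarrow> cmod (zint_fun s x) \<le> indicat_real {1..} x * x powr (- c - 1)"
proof (cases "1 \<le> x")
  case True
  assume c: "c \<le> Re s"
  have "cmod (zint_fun s x) = frac x * x powr (- Re s - 1)"
    using True by (simp add: zint_fun_def norm_mult norm_powr_real_powr)
  also have "\<dots> \<le> 1 * x powr (- c - 1)"
    using True c by (intro mult_mono powr_mono) (auto intro: less_imp_le frac_lt_1)
  finally show ?thesis using True by simp
qed (simp add: zint_fun_def)

lemma integrable_zint_fun:
  assumes "Re s > 0" shows "integrable lborel (zint_fun s)"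
proof (rule Bochner_Integration.integrable_bound[OF integrable_powr_tail(1)[of "- Re s - 1"]])
  show "AE x in lborel. norm (zint_fun s x) \<le> norm (indicat_real {1..} x * x powr (- Re s - 1))"
    unfolding real_norm_def by (intro AE_I2 order_trans[OF cmod_zint_fun_le[OF order_refl] abs_ge_self])
qed (use assms in auto)

lemma zint_eq:
  assumes "Re s > 0" shows "zint s = (\<integral>x. zint_fun s x \<partial>lborel)"
proof -
  let ?f = "\<lambda>x. complex_of_real (frac x) * complex_of_real x powr (- s - 1)"
  have e: "indicat_real {1..} x *\<^sub>R ?f x = zint_fun s x" for x by (simp add: zint_fun_def indicator_def)
  have "set_integrable lborel {1..} ?f"
    using integrable_zint_fun[OF assms] unfolding set_integrable_def e .
  from set_borel_integral_eq_integral(2)[OF this] show ?thesis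
    unfolding set_lebesgue_integral_def e zint_def by simp
qed

lemma cmod_zint_le:
  assumes "Re s > 0" shows "cmod (zint s) \<le> 1 / Re s"
proof -
  have "cmod (zint s) \<le> (\<integral>x. indicat_real {1..} x * x powr (- Re s - 1) \<partial>lborel)"
    unfolding zint_eq[OF assms]
    by (rule order_trans[OF integral_norm_bound])
       (intro integral_mono integrable_norm integrable_zint_fun integrable_powr_tail(1) cmod_zint_fun_le, use assms in auto)
  also have "\<dots> = 1 / Re s" using assms by (subst integrable_powr_tail(2)) auto
  finally show ?thesis .
qed

lemma holomorphic_zint: "zint holomorphic_on {s. Re s > 0}"
proof -
  have "(\<lambda>s. \<integral>x. zint_fun s x \<partial>lborel) holomorphic_on {s. Re s > 0}"
  proof (rule holomorphic_parametric_integral)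
    show "open {s. 0 < Re s}" by (rule open_halfspace_Re_gt)
    show "(\<lambda>s. zint_fun s x) holomorphic_on {s. 0 < Re s}" for x
      by (cases "1 \<le> x") (auto simp: zint_fun_def[abs_def] intro!: holomorphic_intros)
    fix s assume s: "s \<in> {s. 0 < Re s}"
    show "zint_fun s \<in> borel_measurable lborel" by simp
    have re: "Re z > Re s / 2" if "z \<in> ball s (Re s / 2)" for z
      using that abs_Re_le_cmod[of "s - z"] by (auto simp: dist_norm)
    show "\<exists>r>0. \<exists>M. ball s r \<subseteq> {s. 0 < Re s} \<and> integrable lborel M \<and> (\<forall>z\<in>ball s r. \<forall>x. cmod (zint_fun z x) \<le> M x)"
    proof (intro exI conjI ballI allI)
      show "0 < Re s / 2" using s by simp
      show "ball s (Re s / 2) \<subseteq> {s. 0 < Re s}" using re s by (auto intro: less_trans[of 0 "Re s / 2"])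
      show "integrable lborel (\<lambda>x. indicat_real {1..} x * x powr (- (Re s / 2) - 1))"
        by (rule integrable_powr_tail) (use s in auto)
      show "cmod (zint_fun z x) \<le> indicat_real {1..} x * x powr (- (Re s / 2) - 1)" if "z \<in> ball s (Re s / 2)" for z x
        by (rule cmod_zint_fun_le) (use re[OF that] in auto)
    qed
  qed
  then show ?thesis by (rule holomorphic_transform) (simp add: zint_eq)
qed

text \<open>The function (s - 1) zeta s / s, which is regular at s = 1.\<close>

definition zreg :: "complex \<Rightarrow> complex" where "zreg s = 1 - (s - 1) * zint s"

lemma zeta_eq_zint: "zeta s = s / (s - 1) - s * zint s"
  by (simp add: zeta_def zint_def)

lemma zeta_eq_zreg: "s \<noteq> 1 \<Longrightarrow> zeta s = s / (s - 1) * zreg s"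
  by (simp add: zeta_eq_zint zreg_def field_simps)

lemma holomorphic_zreg: "zreg holomorphic_on {s. Re s > 0}"
  unfolding zreg_def[abs_def] by (intro holomorphic_intros holomorphic_zint)

lemma cmod_zreg_le: "Re s > 0 \<Longrightarrow> cmod (zreg s) \<le> 1 + cmod (s - 1) / Re s"
proof -
  assume s: "Re s > 0"
  have "cmod (zreg s) \<le> 1 + cmod (s - 1) * cmod (zint s)"
    unfolding zreg_def using norm_triangle_ineq4[of 1 "(s - 1) * zint s"] by (simp add: norm_mult)
  also have "\<dots> \<le> 1 + cmod (s - 1) * (1 / Re s)" using cmod_zint_le[OF s] by (intro add_left_mono mult_left_mono) auto
  finally show ?thesis by simp
qed

lemma zint_real:
  assumes "\<sigma> > 0" shows "\<exists>c. c > 0 \<and> zint (of_real \<sigma>) = of_real c"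
proof -
  define k where "k x = (if 1 \<le> x then frac x * x powr (- \<sigma> - 1) else 0)" for x :: real
  have e: "zint_fun (of_real \<sigma>) x = of_real (k x)" for x
    using powr_of_real[of x "- \<sigma> - 1"] by (simp add: zint_fun_def k_def)
  have kint: "integrable lborel k"
    using integrable_zint_fun[of "of_real \<sigma>"] assms unfolding e[abs_def] by (simp add: complex_of_real_integrable_eq)
  \<comment> \<open>On [3/2, 7/4] the fractional part is at least 1/2 and x stays below 2, so this
    window alone makes the integral positive.\<close>
  have "0 < (\<integral>x. indicat_real {3/2..7/4::real} x * (1/2 * 2 powr (- \<sigma> - 1)) \<partial>lborel)" by simp
  also have "\<dots> \<le> (\<integral>x. k x \<partial>lborel)"
  proof (rule integral_mono[OF _ kint])
    show "integrable lborel (\<lambda>x. indicat_real {3/2..7/4::real} x * (1/2 * 2 powr (- \<sigma> - 1)))"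
      by (intro integrable_mult_left integrable_real_indicator) (auto simp: emeasure_lborel_Icc_eq)
    fix x :: real
    show "indicat_real {3/2..7/4} x * (1/2 * 2 powr (- \<sigma> - 1)) \<le> k x"
    proof (cases "x \<in> {3/2..7/4}")
      case True
      then have "\<lfloor>x\<rfloor> = 1" by (intro floor_unique) auto
      then have "frac x = x - 1" by (simp add: frac_def)
      moreover have "1/2 * 2 powr (- \<sigma> - 1) \<le> (x - 1) * x powr (- \<sigma> - 1)"
        using True assms by (intro mult_mono powr_mono2') auto
      ultimately show ?thesis using True by (simp add: k_def)
    qed (simp add: k_def)
  qed
  finally show ?thesis using assms by (intro exI[of _ "\<integral>x. k x \<partial>lborel"]) (simp add: zint_eq e)
qed

text \<open>On (0, 1] both summands of 1 + (1 - \<sigma>) c are nonnegative. This excludes real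
  zeros of \<open>zeta\<close> in the strip and makes the normalisation at s = 1/2 possible.\<close>

lemma zreg_real_nonzero:
  assumes "0 < \<sigma>" "\<sigma> \<le> 1" shows "zreg (of_real \<sigma>) \<noteq> 0"
proof -
  obtain c where c: "c > 0" "zint (of_real \<sigma>) = of_real c" using zint_real[OF assms(1)] by auto
  have "zreg (of_real \<sigma>) = of_real (1 + (1 - \<sigma>) * c)" by (simp add: zreg_def c algebra_simps)
  moreover have "1 + (1 - \<sigma>) * c > 0" using c assms by (simp add: add_pos_nonneg)
  ultimately show ?thesis by (metis less_irrefl of_real_eq_0_iff)
qed

text \<open>At the pole division by zero yields 0, so \<open>zeta 1\<close> is the default value
  \<open>- zint 1\<close>, a negative number. Hence the default creates no spurious zero at s = 1 in
  the sets of zeros with Re > 1/2.\<close>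

lemma zeta_1_nonzero: "zeta 1 \<noteq> 0"
proof -
  obtain c where "c > 0" "zint (of_real 1) = of_real c" using zint_real[of 1] by auto
  then show ?thesis by (simp add: zeta_eq_zint)
qed

lemma zeta_zero_iff: "Re s > 0 \<Longrightarrow> zeta s = 0 \<longleftrightarrow> zreg s = 0"
proof (cases "s = 1")
  case True
  then show ?thesis using zeta_1_nonzero by (simp add: zreg_def)
next
  case False
  assume "Re s > 0"
  then have "s \<noteq> 0" by auto
  then show ?thesis using False by (simp add: zeta_eq_zreg)
qed

text \<open>The \<open>LEAST\<close> in \<open>zero_mult\<close> is meaningful because some
  derivative is nonzero, by the identity theorem on the half-plane without 1 and the value at 1/2.
  The order is the same for \<open>zreg\<close>, since the quotient s/(s - 1) has neither zero nor
  pole at s.\<close>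

lemma zero_mult_eq_zorder:
  assumes s: "Re s > 0" "zeta s = 0"
  shows "zero_mult zeta s = nat (zorder zreg s)"
proof -
  define U where "U = {s. Re s > 0} - {1}"
  have s1: "s \<noteq> 1" using s zeta_1_nonzero by auto
  have oU: "open U" unfolding U_def by (intro open_delete open_halfspace_Re_gt)
  have cU: "connected U" unfolding U_def
    by (intro connected_open_delete open_halfspace_Re_gt convex_connected convex_halfspace_Re_gt) auto
  have hz: "zeta holomorphic_on U"
  proof -
    have "(\<lambda>s. s / (s - 1) * zreg s) holomorphic_on U"
      by (intro holomorphic_intros holomorphic_on_subset[OF holomorphic_zreg]) (auto simp: U_def)
    then show ?thesis by (rule holomorphic_transform) (auto simp: U_def zeta_eq_zreg)
  qed
  have sU: "s \<in> U" using s s1 by (simp add: U_def)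
  have half: "zeta (1/2) \<noteq> 0" "1/2 \<in> U"
    using zreg_real_nonzero[of "1/2"] zeta_zero_iff[of "1/2"] by (auto simp: U_def)
  have ex: "\<exists>n. (deriv ^^ n) zeta s \<noteq> 0"
    using holomorphic_fun_eq_0_on_connected[OF hz oU cU _ sU half(2)] half(1) by auto
  define n where "n = zero_mult zeta s"
  have n: "(deriv ^^ n) zeta s \<noteq> 0" "\<And>i. i < n \<Longrightarrow> (deriv ^^ i) zeta s = 0"
    using LeastI_ex[OF ex] not_less_Least unfolding n_def zero_mult_def by auto
  have zn: "zorder zeta s = int n"
    by (rule zorder_zero_eqI[OF hz oU sU]) (use n in auto)
  have nc: "\<exists>w\<in>{s. Re s > 0}. zreg w \<noteq> 0" using zreg_real_nonzero[of "1/2"] by (intro bexI[of _ "1/2"]) auto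
  obtain h r where r: "r > 0" "h holomorphic_on cball s r"
     "\<And>w. w \<in> cball s r \<Longrightarrow> zreg w = h w * (w - s) ^ nat (zorder zreg s)" "\<And>w. w \<in> cball s r \<Longrightarrow> h w \<noteq> 0"
  proof (rule zorder_local_form[OF holomorphic_zreg _ _ _ nc, of s])
    show "open {s. Re s > 0}" "connected {s. Re s > 0}"
      by (intro open_halfspace_Re_gt convex_connected convex_halfspace_Re_gt)+
    show "s \<in> {s. Re s > 0}" using s by simp
  qed (rule that)
  have "zorder zeta s = int (nat (zorder zreg s))"
  proof (rule zorder_eqI)
    show "open (ball s r \<inter> U)" using oU by auto
    show "s \<in> ball s r \<inter> U" using r sU by simp
    show "(\<lambda>w. w / (w - 1) * h w) holomorphic_on ball s r \<inter> U"
      by (intro holomorphic_intros holomorphic_on_subset[OF r(2)]) (auto simp: U_def)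
    have "s \<noteq> 0" using s by auto
    then show "s / (s - 1) * h s \<noteq> 0" using s1 r(4)[of s] r(1) by simp
    fix w assume w: "w \<in> ball s r \<inter> U" "w \<noteq> s"
    then have "zeta w = w / (w - 1) * zreg w" by (intro zeta_eq_zreg) (auto simp: U_def)
    then show "zeta w = w / (w - 1) * h w * (w - s) powi int (nat (zorder zreg s))"
      using r(3)[of w] w by (simp add: power_int_def)
  qed
  then have "int n = int (nat (zorder zreg s))" using zn by simp
  then show ?thesis unfolding n_def by (simp only: of_nat_eq_iff)
qed

section \<open>Euler product and non-vanishing\<close>

definition nps :: "complex \<Rightarrow> nat \<Rightarrow> complex" where "nps s n = of_nat n powr (- s)"

lemma nps_eq_exp: "n > 0 \<Longrightarrow> nps s n = exp (- s * of_real (ln (real n)))"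
proof -
  assume "n > 0"
  then have "Ln (of_nat n) = of_real (ln (real n))" using Ln_of_real[of "real n"] by simp
  then show ?thesis using \<open>n > 0\<close> by (simp add: nps_def powr_def)
qed

lemma nps_mult: "m > 0 \<Longrightarrow> n > 0 \<Longrightarrow> nps s (m * n) = nps s m * nps s n"
  by (simp add: nps_eq_exp ln_mult algebra_simps flip: exp_add)

lemma cmod_nps: "n > 0 \<Longrightarrow> cmod (nps s n) = real n powr (- Re s)"
  by (simp add: nps_def norm_powr_real_powr)

lemma powr_antiderivative:
  assumes "x > 0" "c \<noteq> 0"
  shows "((\<lambda>x. complex_of_real x powr c / c) has_vector_derivative complex_of_real x powr (c - 1)) (at x within S)"
proof -
  have "((\<lambda>z. z powr c / c) has_field_derivative of_real x powr (c - 1)) (at (complex_of_real x))"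
    using DERIV_cdivide[OF has_field_derivative_powr[of "of_real x" c], of c] assms
    by (simp add: complex_nonpos_Reals_iff)
  then have "((\<lambda>z. z powr c / c) \<circ> complex_of_real has_vector_derivative 1 * of_real x powr (c - 1)) (at x within S)"
    by (intro field_vector_diff_chain_within) (auto intro!: derivative_eq_intros has_field_derivative_at_within has_vector_derivative_of_real[of "\<lambda>x. x" 1, simplified])
  then show ?thesis by (simp add: o_def)
qed

lemma has_integral_zint_piece:
  assumes n: "n > 0" and s: "s \<noteq> 0" "s \<noteq> 1"
  shows "((\<lambda>x. complex_of_real (frac x) * complex_of_real x powr (- s - 1)) has_integral
     (of_nat (n + 1) powr (1 - s) - of_nat n powr (1 - s)) / (1 - s) + of_nat n * (of_nat (n + 1) powr (- s) - of_nat n powr (- s)) / s)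
     {real n..real (n + 1)}"
proof -
  define F where "F x = complex_of_real x powr (1 - s) / (1 - s) - of_nat n * (complex_of_real x powr (- s) / (- s))" for x :: real
  have "((\<lambda>x. complex_of_real x powr (1 - s - 1) - of_nat n * complex_of_real x powr (- s - 1)) has_integral (F (real (n + 1)) - F (real n))) {real n..real (n + 1)}"
  proof (rule fundamental_theorem_of_calculus)
    fix x assume x: "x \<in> {real n..real (n + 1)}"
    then have x0: "x > 0" using n by auto
    show "(F has_vector_derivative complex_of_real x powr (1 - s - 1) - of_nat n * complex_of_real x powr (- s - 1)) (at x within {real n..real (n + 1)})"
      unfolding F_def[abs_def] using s
      by (intro has_vector_derivative_diff has_vector_derivative_mult_right powr_antiderivative x0) auto
  qed simp
  then have "((\<lambda>x. complex_of_real (frac x) * complex_of_real x powr (- s - 1)) has_integral (F (real (n + 1)) - F (real n))) {real n..real (n + 1)}"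
  \<comment> \<open>On [n, n + 1) the fractional part is x - n; only at the right end point does it
    jump, and one point does not matter.\<close>
  proof (rule has_integral_spike_finite[of "{real (n + 1)}", rotated 2])
    fix x assume x: "x \<in> {real n..real (n + 1)} - {real (n + 1)}"
    then have x0: "x > 0" "real n \<le> x" "x < real n + 1" using n by auto
    then have "\<lfloor>x\<rfloor> = int n" by (intro floor_unique) auto
    then have f: "frac x = x - real n" by (simp add: frac_def)
    have "complex_of_real x powr (1 + (- s - 1)) = complex_of_real x powr 1 * complex_of_real x powr (- s - 1)"
      using x0 by (intro powr_add)
    then show "complex_of_real (frac x) * complex_of_real x powr (- s - 1) = complex_of_real x powr (1 - s - 1) - of_nat n * complex_of_real x powr (- s - 1)"
      using x0 by (simp add: f algebra_simps)
  qed auto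
  moreover have "F (real (n + 1)) - F (real n) = (of_nat (n + 1) powr (1 - s) - of_nat n powr (1 - s)) / (1 - s) + of_nat n * (of_nat (n + 1) powr (- s) - of_nat n powr (- s)) / s"
    using s by (simp add: F_def diff_divide_distrib right_diff_distrib)
  ultimately show ?thesis by simp
qed

text \<open>Partial summation. Multiplied by s and solved for the finite sum, it expresses that sum
  as s/(s - 1) - s times the integral, up to boundary terms in (Suc N)^(1-s), which vanish in the
  limit when Re s > 1.\<close>

lemma has_integral_zint_partial:
  assumes s: "s \<noteq> 0" "s \<noteq> 1"
  shows "((\<lambda>x. complex_of_real (frac x) * complex_of_real x powr (- s - 1)) has_integral
     (s / (s - 1) - s / (s - 1) * of_nat (Suc N) powr (1 - s) - (\<Sum>n\<le>N. nps s (Suc n)) + of_nat (Suc N) powr (1 - s)) / s) {1..real (Suc N)}"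
proof (induction N)
  case 0
  have "(s / (s - 1) - s / (s - 1) * of_nat (Suc 0) powr (1 - s) - (\<Sum>n\<le>0. nps s (Suc n)) + of_nat (Suc 0) powr (1 - s)) / s = 0"
    by (simp add: nps_def)
  moreover have "((\<lambda>x. complex_of_real (frac x) * complex_of_real x powr (- s - 1)) has_integral 0) {1..real (Suc 0)}"
    using has_integral_refl(2)[of "\<lambda>x. complex_of_real (frac x) * complex_of_real x powr (- s - 1)" "1::real"] by simp
  ultimately show ?case by (simp only:)
next
  case (Suc N)
  define M where "M = Suc N"
  have M: "M > 0" by (simp add: M_def)
  have c: "((\<lambda>x. complex_of_real (frac x) * complex_of_real x powr (- s - 1)) has_integral
     (s / (s - 1) - s / (s - 1) * of_nat M powr (1 - s) - (\<Sum>n\<le>N. nps s (Suc n)) + of_nat M powr (1 - s)) / s +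
     ((of_nat (M + 1) powr (1 - s) - of_nat M powr (1 - s)) / (1 - s) + of_nat M * (of_nat (M + 1) powr (- s) - of_nat M powr (- s)) / s)) {1..real (M + 1)}"
    by (rule has_integral_combine[OF _ _ Suc.IH[folded M_def] has_integral_zint_piece[OF M s]]) (auto simp: M_def)
  define p where "p = (of_nat M :: complex) powr (1 - s)"
  define q where "q = (of_nat (M + 1) :: complex) powr (1 - s)"
  define r where "r = (of_nat (M + 1) :: complex) powr (- s)"
  have pw: "(of_nat k :: complex) powr (1 - s) = of_nat k * of_nat k powr (- s)" if "k > 0" for k
    using powr_add[of "of_nat k :: complex" 1 "-s"] that by simp
  have p: "of_nat M * of_nat M powr (- s) = p" using pw[OF M] by (simp add: p_def)
  have q: "q = (of_nat M + 1) * r" using pw[of "M + 1"] by (simp add: q_def r_def add.commute)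
  have sum: "(\<Sum>n\<le>Suc N. nps s (Suc n)) = (\<Sum>n\<le>N. nps s (Suc n)) + r" by (simp add: nps_def r_def M_def add_ac)
  have "(s / (s - 1) - s / (s - 1) * p - S + p) / s + ((q - p) / (1 - s) + (of_nat M * r - p) / s)
     = (s / (s - 1) - s / (s - 1) * q - (S + r) + q) / s" for S
  proof -
    define k where "k = 1 / (s - 1)"
    have k: "s / (s - 1) = 1 + k" "s * k = 1 + k" "(q - p) / (1 - s) = - k * (q - p)"
      using s by (auto simp: k_def divide_simps) (simp_all add: algebra_simps)
    have "s * ((of_nat M * r - p) / s) = of_nat M * r - p" using s by simp
    then have "s * (- k * (q - p) + (of_nat M * r - p) / s) = - (s * k) * (q - p) + (of_nat M * r - p)"
      by (simp only: distrib_left) (simp only: mult_minus_left mult_minus_right mult.assoc)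
    also have "\<dots> = - (1 + k) * (q - p) + (of_nat M * r - p)" by (simp only: k(2))
    finally have b: "s * (- k * (q - p) + (of_nat M * r - p) / s) = - (1 + k) * (q - p) + (of_nat M * r - p)" .
    have comb: "x / s + y = z / s" if "x + s * y = z" for x y z using s that by (simp add: field_simps)
    show ?thesis unfolding k(1,3)
      by (rule comb, subst b) (simp add: q algebra_simps)
  qed
  from this[of "\<Sum>n\<le>N. nps s (Suc n)"] c
  have "((\<lambda>x. complex_of_real (frac x) * complex_of_real x powr (- s - 1)) has_integral
     (s / (s - 1) - s / (s - 1) * q - (\<Sum>n\<le>Suc N. nps s (Suc n)) + q) / s) {1..real (M + 1)}"
    unfolding sum right_diff_distrib p p_def[symmetric] q_def[symmetric] r_def[symmetric] by simp
  then show ?case by (simp add: q_def M_def)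
qed

lemma tendsto_nat_powr_neg:
  assumes "Re c < 0" shows "(\<lambda>N. (of_nat (Suc N) :: complex) powr c) \<longlonglongrightarrow> 0"
proof (rule tendsto_norm_zero_cancel)
  have "(\<lambda>N. real (Suc N) powr Re c) \<longlonglongrightarrow> 0"
    by (rule tendsto_neg_powr[OF assms filterlim_compose[OF filterlim_real_sequentially filterlim_Suc]])
  moreover have "cmod ((of_nat (Suc N) :: complex) powr c) = real (Suc N) powr Re c" for N
    using norm_powr_real_powr[of "of_nat (Suc N)" c] by (simp del: of_nat_Suc)
  ultimately show "(\<lambda>N. cmod ((of_nat (Suc N) :: complex) powr c)) \<longlonglongrightarrow> 0" by simp
qed

lemma zeta_sums:
  assumes s: "Re s > 1" shows "(\<lambda>n. nps s (Suc n)) sums zeta s"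
proof -
  let ?f = "\<lambda>x. complex_of_real (frac x) * complex_of_real x powr (- s - 1)"
  have s01: "s \<noteq> 0" "s \<noteq> 1" using s by auto
  have s0: "Re s > 0" using s by simp
  have int: "integrable lborel (zint_fun s)" by (rule integrable_zint_fun[OF s0])
  have "(\<lambda>N. \<integral>x. indicat_real {..real (Suc N)} x *\<^sub>R zint_fun s x \<partial>lborel) \<longlonglongrightarrow> (\<integral>x. zint_fun s x \<partial>lborel)"
    by (rule filterlim_compose[OF tendsto_integral_at_top[OF _ int] filterlim_compose[OF filterlim_real_sequentially filterlim_Suc]]) simp
  moreover have "(\<integral>x. indicat_real {..real (Suc N)} x *\<^sub>R zint_fun s x \<partial>lborel) =
     (s / (s - 1) - s / (s - 1) * of_nat (Suc N) powr (1 - s) - (\<Sum>n\<le>N. nps s (Suc n)) + of_nat (Suc N) powr (1 - s)) / s" for N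
  proof -
    have e: "indicat_real {..real (Suc N)} x *\<^sub>R zint_fun s x = indicat_real {1..real (Suc N)} x *\<^sub>R ?f x" for x
      by (simp add: zint_fun_def indicator_def)
    have "integrable lborel (\<lambda>x. indicat_real {..real (Suc N)} x *\<^sub>R zint_fun s x)"
      by (rule integrable_mult_indicator[OF _ int]) simp
    then have "set_integrable lborel {1..real (Suc N)} ?f" unfolding e set_integrable_def .
    from set_borel_integral_eq_integral(2)[OF this] show ?thesis
      unfolding e set_lebesgue_integral_def using integral_unique[OF has_integral_zint_partial[OF s01, of N]] by simp
  qed
  ultimately have "(\<lambda>N. (s / (s - 1) - s / (s - 1) * of_nat (Suc N) powr (1 - s) - (\<Sum>n\<le>N. nps s (Suc n)) + of_nat (Suc N) powr (1 - s)) / s) \<longlonglongrightarrow> zint s"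
    unfolding zint_eq[OF s0] by simp
  note L = this
  have t0: "(\<lambda>N. (of_nat (Suc N) :: complex) powr (1 - s)) \<longlonglongrightarrow> 0" by (rule tendsto_nat_powr_neg) (use s in simp)
  have "(\<lambda>N. s / (s - 1) - s / (s - 1) * of_nat (Suc N) powr (1 - s) + of_nat (Suc N) powr (1 - s)
      - s * ((s / (s - 1) - s / (s - 1) * of_nat (Suc N) powr (1 - s) - (\<Sum>n\<le>N. nps s (Suc n)) + of_nat (Suc N) powr (1 - s)) / s))
      \<longlonglongrightarrow> s / (s - 1) - s / (s - 1) * 0 + 0 - s * zint s"
    by (intro tendsto_intros L t0)
  moreover have "s / (s - 1) - s / (s - 1) * a + a - s * ((s / (s - 1) - s / (s - 1) * a - S + a) / s) = S" for a S
    using s01 by simp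
  ultimately have "(\<lambda>N. \<Sum>n\<le>N. nps s (Suc n)) \<longlonglongrightarrow> zeta s" by (simp add: zeta_eq_zint del: of_nat_Suc)
  then show ?thesis by (simp add: sums_def_le)
qed

lemma summable_norm_nps: "Re s > 1 \<Longrightarrow> summable (\<lambda>n. cmod (nps s (Suc n)))"
proof -
  assume "Re s > 1"
  then have "summable (\<lambda>n. real n powr (- Re s))" by (simp add: summable_real_powr_iff)
  then have "summable (\<lambda>n. real (Suc n) powr (- Re s))" by (subst summable_Suc_iff)
  then show ?thesis by (simp add: cmod_nps del: of_nat_Suc)
qed

lemma zeta_has_sum:
  assumes s: "Re s > 1" shows "(nps s has_sum zeta s) {0<..}"
proof -
  have "((\<lambda>n. nps s (Suc n)) has_sum zeta s) UNIV"
    by (rule norm_summable_imp_has_sum[OF summable_norm_nps[OF s] zeta_sums[OF s]])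
  moreover have "(nps s has_sum zeta s) (range Suc) \<longleftrightarrow> ((nps s \<circ> Suc) has_sum zeta s) UNIV"
    by (rule has_sum_reindex) simp
  ultimately have "(nps s has_sum zeta s) (range Suc)" unfolding o_def by (simp only:)
  moreover have "range Suc = {0<..}" by (rule greaterThan_0[symmetric])
  ultimately show ?thesis by (simp only:)
qed

lemma nps_abs_summable:
  assumes s: "Re s > 1" "A \<subseteq> {0<..}" shows "(\<lambda>n. cmod (nps s n)) summable_on A"
proof -
  have "(\<lambda>n. cmod (nps s (Suc n))) summable_on UNIV"
    by (rule norm_summable_imp_summable_on) (use summable_norm_nps[OF s(1)] in simp)
  moreover have "(\<lambda>n. cmod (nps s n)) summable_on (range Suc) \<longleftrightarrow> ((\<lambda>n. cmod (nps s n)) \<circ> Suc) summable_on UNIV"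
    by (rule summable_on_reindex) simp
  ultimately have "(\<lambda>n. cmod (nps s n)) summable_on (range Suc)" unfolding o_def by (simp only:)
  moreover have "range Suc = {0<..}" by (rule greaterThan_0[symmetric])
  ultimately have "(\<lambda>n. cmod (nps s n)) summable_on {0<..}" by (simp only:)
  then show ?thesis by (rule summable_on_subset_banach[OF _ s(2)])
qed

lemma nps_summable:
  assumes s: "Re s > 1" "A \<subseteq> {0<..}" shows "nps s summable_on A"
  by (rule abs_summable_summable[OF nps_abs_summable[OF assms]])

text \<open>Removing the multiples of one prime at a time from the Dirichlet series yields the Euler product
without rearranging an infinite product.\<close>

definition sifted :: "nat set \<Rightarrow> nat set" where "sifted P = {n. n > 0 \<and> (\<forall>p\<in>P. \<not> p dvd n)}"

lemma sieve_identity: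
  assumes s: "Re s > 1" and P: "finite P" "\<And>p. p \<in> P \<Longrightarrow> prime p"
  shows "zeta s * (\<Prod>p\<in>P. 1 - nps s p) = infsum (nps s) (sifted P)"
  using P
proof (induction P rule: finite_induct)
  case empty
  have "sifted {} = {0<..}" by (auto simp: sifted_def)
  then show ?case using infsumI[OF zeta_has_sum[OF s]] by simp
next
  case (insert q P)
  have q: "prime q" by (rule insert.prems) simp
  then have q0: "q > 0" by (rule prime_gt_0_nat)
  have sub: "sifted P \<subseteq> {0<..}" by (auto simp: sifted_def)
  have inj: "inj_on ((*) q) (sifted P)" using q0 by (simp add: inj_on_def)
  \<comment> \<open>A prime p in P divides q k only if it divides k, because p and q are distinct
    primes. So the multiples of q left in \<open>sifted P\<close> form a copy of
    \<open>sifted P\<close> scaled by q, and its sum is q^(-s) times the old one.\<close>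
  have img: "(*) q ` sifted P = {n \<in> sifted P. q dvd n}"
  proof (intro equalityI subsetI)
    fix n assume "n \<in> (*) q ` sifted P"
    then obtain k where k: "n = q * k" "k \<in> sifted P" by auto
    have "\<not> p dvd q * k" if p: "p \<in> P" for p
    proof
      assume "p dvd q * k"
      moreover have pp: "prime p" by (rule insert.prems) (use p in simp)
      ultimately have "p dvd q \<or> p dvd k" by (simp add: prime_dvd_mult_iff)
      moreover have "\<not> p dvd k" using k p by (auto simp: sifted_def)
      ultimately have "p = q" using primes_dvd_imp_eq[OF pp q] by simp
      then show False using insert.hyps p by simp
    qed
    then show "n \<in> {n \<in> sifted P. q dvd n}" using k q0 by (auto simp: sifted_def)
  next
    fix n assume "n \<in> {n \<in> sifted P. q dvd n}"
    then have n: "n \<in> sifted P" "q dvd n" by auto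
    then obtain k where k: "n = q * k" by (elim dvdE)
    then have "k \<in> sifted P" using n q by (auto simp: sifted_def)
    then show "n \<in> (*) q ` sifted P" using k by auto
  qed
  have S: "infsum (nps s) ((*) q ` sifted P) = nps s q * infsum (nps s) (sifted P)"
  proof -
    have "infsum (nps s) ((*) q ` sifted P) = infsum (\<lambda>n. nps s (q * n)) (sifted P)"
      by (subst infsum_reindex[OF inj]) (simp add: o_def)
    also have "\<dots> = infsum (\<lambda>n. nps s q * nps s n) (sifted P)"
      by (rule infsum_cong) (use q0 in \<open>simp add: sifted_def nps_mult\<close>)
    also have "\<dots> = nps s q * infsum (nps s) (sifted P)"
      by (rule infsum_cmult_right) (use nps_summable[OF s sub] in auto)
    finally show ?thesis .
  qed
  have split: "sifted P = sifted (insert q P) \<union> (*) q ` sifted P" unfolding img by (auto simp: sifted_def)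
  have disj: "sifted (insert q P) \<inter> (*) q ` sifted P = {}" unfolding img by (auto simp: sifted_def)
  have "infsum (nps s) (sifted P) = infsum (nps s) (sifted (insert q P)) + infsum (nps s) ((*) q ` sifted P)"
    by (subst split, rule infsum_Un_disjoint[OF nps_summable[OF s] nps_summable[OF s] disj])
       (use img in \<open>auto simp: sifted_def\<close>)
  then have "infsum (nps s) (sifted (insert q P)) = (1 - nps s q) * infsum (nps s) (sifted P)"
    unfolding S by (simp add: algebra_simps)
  then show ?case using insert by (simp add: mult_ac)
qed

text \<open>After sieving by all primes up to N only 1 and numbers above N survive, so the deviation
  from 1 is at most a tail of an absolutely convergent series. Stated as a product with limit 1, it
  gives non-vanishing at once.\<close>

lemma euler_product:
  assumes s: "Re s > 1"
  shows "(\<lambda>N. zeta s * (\<Prod>p\<in>{p. prime p \<and> p \<le> N}. 1 - nps s p)) \<longlonglongrightarrow> 1"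
proof -
  let ?P = "\<lambda>N. {p::nat. prime p \<and> p \<le> N}"
  let ?c = "\<lambda>n. cmod (nps s n)"
  have sub: "A \<subseteq> {0<..} \<Longrightarrow> ?c summable_on A" for A by (rule nps_abs_summable[OF s])
  have le: "cmod (zeta s * (\<Prod>p\<in>?P N. 1 - nps s p) - 1) \<le> infsum ?c {0<..} - (\<Sum>n\<in>{0<..N}. ?c n)" if N: "N \<ge> 1" for N
  proof -
    have S: "zeta s * (\<Prod>p\<in>?P N. 1 - nps s p) = infsum (nps s) (sifted (?P N))"
      by (rule sieve_identity[OF s]) auto
    have one: "1 \<in> sifted (?P N)" by (auto simp: sifted_def)
    have rest: "sifted (?P N) - {1} \<subseteq> {N<..}"
    proof
      fix n assume n: "n \<in> sifted (?P N) - {1}"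
      then have "n \<noteq> 1" "n > 0" by (auto simp: sifted_def)
      then obtain p where p: "prime p" "p dvd n" using prime_factor_nat by auto
      then have "\<not> p \<le> N" using n by (auto simp: sifted_def)
      moreover have "p \<le> n" using p \<open>n > 0\<close> by (intro dvd_imp_le)
      ultimately show "n \<in> {N<..}" by simp
    qed
    have sm: "sifted (?P N) - {1} \<subseteq> {0<..}" by (auto simp: sifted_def)
    have "infsum (nps s) (sifted (?P N)) = infsum (nps s) ({1} \<union> (sifted (?P N) - {1}))" using one by (simp add: insert_absorb)
    also have "\<dots> = infsum (nps s) {1} + infsum (nps s) (sifted (?P N) - {1})"
      by (rule infsum_Un_disjoint[OF _ nps_summable[OF s sm]]) auto
    finally have "zeta s * (\<Prod>p\<in>?P N. 1 - nps s p) - 1 = infsum (nps s) (sifted (?P N) - {1})"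
      using S by (simp add: nps_def)
    also have "cmod \<dots> \<le> infsum ?c (sifted (?P N) - {1})" by (rule norm_infsum_bound) (use sub[OF sm] in simp)
    also have "\<dots> \<le> infsum ?c {N<..}"
      by (rule infsum_mono2[OF sub sub]) (use rest sm in auto)
    also have "infsum ?c {0<..} = infsum ?c {0<..N} + infsum ?c {N<..}"
    proof -
      have "{0<..} = {0<..N} \<union> {N<..}" by auto
      moreover have "infsum ?c ({0<..N} \<union> {N<..}) = infsum ?c {0<..N} + infsum ?c {N<..}"
        by (rule infsum_Un_disjoint[OF sub sub]) auto
      ultimately show ?thesis by (simp only:)
    qed
    then have "infsum ?c {N<..} = infsum ?c {0<..} - (\<Sum>n\<in>{0<..N}. ?c n)" by simp
    finally show ?thesis .
  qed
  have fl: "filterlim (\<lambda>N::nat. {0<..N}) (finite_subsets_at_top {0<..}) sequentially"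
    unfolding filterlim_finite_subsets_at_top
  proof (intro allI impI)
    fix X :: "nat set" assume X: "finite X \<and> X \<subseteq> {0<..}"
    then obtain b where b: "\<And>x. x \<in> X \<Longrightarrow> x \<le> b" by (auto simp: finite_nat_set_iff_bounded_le)
    show "\<forall>\<^sub>F y in sequentially. finite {0<..y} \<and> X \<subseteq> {0<..y} \<and> {0<..y} \<subseteq> {0<..}"
    proof (rule eventually_sequentiallyI[of b])
      fix y assume "b \<le> y"
      then have "x \<le> y" if "x \<in> X" for x using b[OF that] by simp
      then show "finite {0<..y} \<and> X \<subseteq> {0<..y} \<and> {0<..y} \<subseteq> {0<..}" using X by auto
    qed
  qed
  have "(?c has_sum infsum ?c {0<..}) {0<..}" by (rule has_sum_infsum[OF sub[OF order_refl]])
  then have "(\<lambda>N. \<Sum>n\<in>{0<..N}. ?c n) \<longlonglongrightarrow> infsum ?c {0<..}"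
    unfolding has_sum_def by (rule filterlim_compose[OF _ fl])
  then have z: "(\<lambda>N. infsum ?c {0<..} - (\<Sum>n\<in>{0<..N}. ?c n)) \<longlonglongrightarrow> infsum ?c {0<..} - infsum ?c {0<..}"
    by (intro tendsto_intros)
  have "(\<lambda>N. zeta s * (\<Prod>p\<in>?P N. 1 - nps s p) - 1) \<longlonglongrightarrow> 0"
    by (rule Lim_null_comparison[OF eventually_sequentiallyI[of 1]]) (use le z in auto)
  then show ?thesis by (simp add: LIM_zero_iff)
qed

lemma zeta_nonzero_Re_gt_1: "Re s > 1 \<Longrightarrow> zeta s \<noteq> 0"
proof
  assume s: "Re s > 1" and z: "zeta s = 0"
  have "(\<lambda>N::nat. 0 :: complex) \<longlonglongrightarrow> 1" using euler_product[OF s] by (simp add: z)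
  then show False by (simp add: LIMSEQ_const_iff)
qed

text \<open>Take logarithms: - ln |1 - u| is the sum of Re (u^n)/n, and 3 + 4 cos x + cos 2x = 2 (1
  + cos x)^2 >= 0 for x = n \<theta>. The term n = 0 contributes 0 because division by zero
  does.\<close>

lemma three_four_one_factor:
  assumes z: "cmod z < 1" and w: "cmod w < 1" and r: "0 \<le> r" "r < 1"
    and zr: "z = of_real r * cis \<theta>" and wr: "w = of_real r * cis (2 * \<theta>)"
  shows "cmod (1 - of_real r) ^ 3 * cmod (1 - z) ^ 4 * cmod (1 - w) \<le> 1"
proof -
  have ser: "(\<lambda>n. Re (u ^ n) / real n) sums (- ln (cmod (1 - u)))" if u: "cmod u < 1" for u :: complex
  proof -
    have "(\<lambda>n. - ((- (- u)) ^ n) / of_nat n) sums ln (1 + (- u))" by (rule Ln_series') (use u in simp)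
    from sums_Re[OF this] have "(\<lambda>n. Re (- (u ^ n) / of_nat n)) sums Re (ln (1 - u))" by simp
    then have "(\<lambda>n. - Re (- (u ^ n) / of_nat n)) sums - Re (ln (1 - u))" by (rule sums_minus)
    moreover have "1 - u \<noteq> 0" using u by auto
    ultimately show ?thesis by (simp add: Re_divide_of_nat)
  qed
  have r1: "cmod (of_real r) < 1" using r by simp
  have S: "(\<lambda>n. 3 * (Re (of_real r ^ n) / real n) + 4 * (Re (z ^ n) / real n) + Re (w ^ n) / real n) sums
      (3 * (- ln (cmod (1 - of_real r))) + 4 * (- ln (cmod (1 - z))) + (- ln (cmod (1 - w))))"
    by (intro sums_add sums_mult ser r1 z w)
  have nn: "0 \<le> 3 * (Re (of_real r ^ n) / real n) + 4 * (Re (z ^ n) / real n) + Re (w ^ n) / real n" for n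
  proof -
    have zn: "of_real r ^ n = (of_real (r ^ n) :: complex)" "z ^ n = of_real (r ^ n) * cis (real n * \<theta>)" "w ^ n = of_real (r ^ n) * cis (real n * (2 * \<theta>))"
      unfolding zr wr power_mult_distrib Complex.DeMoivre of_real_power by (rule refl)+
    have "real n * (2 * \<theta>) = 2 * (real n * \<theta>)" by simp
    then have wn: "w ^ n = of_real (r ^ n) * cis (2 * (real n * \<theta>))" using zn(3) by (simp only:)
    have rc: "Re (of_real a * cis b) = a * cos b" for a b by simp
    have e: "Re (of_real r ^ n) = r ^ n" "Re (z ^ n) = r ^ n * cos (real n * \<theta>)" "Re (w ^ n) = r ^ n * cos (2 * (real n * \<theta>))"
      unfolding zn(1,2) wn rc by (rule Re_complex_of_real refl)+
    have "3 + 4 * cos x + cos (2 * x) = 2 * (1 + cos x)^2" for x :: real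
      unfolding cos_double_cos by (simp add: power2_eq_square algebra_simps)
    then have "0 \<le> 3 + 4 * cos x + cos (2 * x)" for x :: real by simp
    then have "0 \<le> r ^ n * (3 + 4 * cos (real n * \<theta>) + cos (2 * (real n * \<theta>))) / real n"
      using r by (intro divide_nonneg_nonneg mult_nonneg_nonneg) auto
    then show ?thesis unfolding e by (simp add: algebra_simps add_divide_distrib)
  qed
  have "0 \<le> 3 * (- ln (cmod (1 - of_real r))) + 4 * (- ln (cmod (1 - z))) + (- ln (cmod (1 - w)))"
    by (rule sums_le[OF nn sums_zero S])
  then have l: "3 * ln (cmod (1 - of_real r)) + 4 * ln (cmod (1 - z)) + ln (cmod (1 - w)) \<le> 0" by simp
  have nz: "cmod (1 - of_real r) > 0" "cmod (1 - z) > 0" "cmod (1 - w) > 0" using r z w by auto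
  have "ln (cmod (1 - of_real r) ^ 3 * cmod (1 - z) ^ 4 * cmod (1 - w)) = 3 * ln (cmod (1 - of_real r)) + 4 * ln (cmod (1 - z)) + ln (cmod (1 - w))"
    using nz by (simp add: ln_mult ln_realpow)
  then have "ln (cmod (1 - of_real r) ^ 3 * cmod (1 - z) ^ 4 * cmod (1 - w)) \<le> ln 1" using l by simp
  then show ?thesis using nz by (subst (asm) ln_le_cancel_iff) auto
qed

text \<open>For every prime p the local inequality holds with r = p^(-\<sigma>) and angle - t ln p,
  so the finite products of 1 - p^(-s) contribute at most 1. Multiplied by the zeta values they tend
  to 1, hence those values alone give at least 1.\<close>

lemma three_four_one:
  assumes s: "\<sigma> > 1"
  shows "1 \<le> cmod (zeta (of_real \<sigma>)) ^ 3 * cmod (zeta (Complex \<sigma> t)) ^ 4 * cmod (zeta (Complex \<sigma> (2 * t)))"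
proof -
  let ?P = "\<lambda>N. {p::nat. prime p \<and> p \<le> N}"
  define E where "E s N = (\<Prod>p\<in>?P N. 1 - nps s p)" for s N
  have L: "(\<lambda>N. cmod (zeta s * E s N)) \<longlonglongrightarrow> 1" if "Re s > 1" for s
    using tendsto_norm[OF euler_product[OF that]] by (simp add: E_def)
  let ?a = "of_real \<sigma> :: complex" and ?b = "Complex \<sigma> t" and ?c = "Complex \<sigma> (2 * t)"
  have T: "(\<lambda>N. cmod (zeta ?a * E ?a N) ^ 3 * cmod (zeta ?b * E ?b N) ^ 4 * cmod (zeta ?c * E ?c N)) \<longlonglongrightarrow> 1 ^ 3 * 1 ^ 4 * 1"
    by (intro tendsto_mult tendsto_power L) (use s in auto)
  have EE: "cmod (E ?a N) ^ 3 * cmod (E ?b N) ^ 4 * cmod (E ?c N) \<le> 1" for N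
  proof -
    have "cmod (E ?a N) ^ 3 * cmod (E ?b N) ^ 4 * cmod (E ?c N) = (\<Prod>p\<in>?P N. cmod (1 - nps ?a p) ^ 3 * cmod (1 - nps ?b p) ^ 4 * cmod (1 - nps ?c p))"
      by (simp add: E_def prod.distrib prod_power_distrib flip: prod_norm)
    also have "\<dots> \<le> 1"
    proof (rule prod_le_1)
      fix p assume "p \<in> ?P N"
      then have pp: "prime p" by simp
      then have p: "p > 1" by (rule prime_gt_1_nat)
      define r where "r = real p powr (- \<sigma>)"
      have "real p powr (- \<sigma>) < real p powr 0" by (rule powr_less_mono) (use p s in auto)
      then have r: "0 \<le> r" "r < 1" using p by (simp_all add: r_def)
      have form: "nps (Complex \<sigma> y) p = of_real r * cis (- y * ln (real p))" for y
      proof -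
        have e: "- Complex \<sigma> y * of_real (ln (real p)) = Complex (- \<sigma> * ln (real p)) (- y * ln (real p))"
          by (rule complex_eqI) simp_all
        have "nps (Complex \<sigma> y) p = exp (- Complex \<sigma> y * of_real (ln (real p)))"
          by (rule nps_eq_exp[OF less_trans[OF zero_less_one p]])
        also have "\<dots> = of_real (exp (- \<sigma> * ln (real p))) * cis (- y * ln (real p))"
          unfolding e exp_eq_polar complex.sel ..
        also have "exp (- \<sigma> * ln (real p)) = r" using p by (simp add: r_def powr_def)
        finally show ?thesis .
      qed
      have a: "nps ?a p = of_real r" using form[of 0] by (simp add: complex_of_real_def)
      have c: "nps ?c p = of_real r * cis (2 * (- t * ln (real p)))" using form[of "2 * t"] by (simp add: mult.assoc)
      have "cmod (1 - of_real r) ^ 3 * cmod (1 - nps ?b p) ^ 4 * cmod (1 - nps ?c p) \<le> 1"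
        by (rule three_four_one_factor[of _ _ r "- t * ln (real p)"]) (use r form[of t] c in \<open>simp_all add: norm_mult\<close>)
      then show "0 \<le> cmod (1 - nps ?a p) ^ 3 * cmod (1 - nps ?b p) ^ 4 * cmod (1 - nps ?c p) \<and>
        cmod (1 - nps ?a p) ^ 3 * cmod (1 - nps ?b p) ^ 4 * cmod (1 - nps ?c p) \<le> 1" by (simp add: a)
    qed
    finally show ?thesis .
  qed
  define Q where "Q = cmod (zeta ?a) ^ 3 * cmod (zeta ?b) ^ 4 * cmod (zeta ?c)"
  have "cmod (zeta ?a * E ?a N) ^ 3 * cmod (zeta ?b * E ?b N) ^ 4 * cmod (zeta ?c * E ?c N) \<le> Q" for N
  proof -
    have "cmod (zeta ?a * E ?a N) ^ 3 * cmod (zeta ?b * E ?b N) ^ 4 * cmod (zeta ?c * E ?c N) = Q * (cmod (E ?a N) ^ 3 * cmod (E ?b N) ^ 4 * cmod (E ?c N))"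
      by (simp add: Q_def norm_mult power_mult_distrib mult_ac)
    also have "\<dots> \<le> Q * 1" using EE[of N] by (intro mult_left_mono) (auto simp: Q_def)
    finally show ?thesis by simp
  qed
  then have "1 ^ 3 * 1 ^ 4 * 1 \<le> Q" by (intro LIMSEQ_le_const2[OF T]) auto
  then show ?thesis by (simp add: Q_def)
qed

lemma zeta_nonzero_Re_ge_1:
  assumes s: "Re s \<ge> 1" shows "zeta s \<noteq> 0"
proof (cases "Re s > 1")
  case True then show ?thesis by (rule zeta_nonzero_Re_gt_1)
next
  case False
  define t where "t = Im s"
  have s_eq: "s = Complex 1 t" using False assms by (simp add: complex_eq_iff t_def)
  show ?thesis
  proof (cases "t = 0")
    case True
    have "Complex 1 0 = 1" by (simp add: complex_eq_iff)
    then show ?thesis using zeta_1_nonzero True by (simp add: s_eq)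
  next
    case t0: False
    show ?thesis
    proof
      assume z: "zeta s = 0"
      have oH: "open {s. Re s > 0}" by (rule open_halfspace_Re_gt)
      have z0: "zreg s = 0" using zeta_zero_iff[of s] z assms by simp
      have dz: "(zreg has_field_derivative deriv zreg s) (at s)"
        using holomorphic_derivI[OF holomorphic_zreg oH] assms by simp
      have czr': "\<forall>w\<in>{s. Re s > 0}. isCont zreg w"
        using holomorphic_on_imp_continuous_on[OF holomorphic_zreg] unfolding continuous_on_eq_continuous_at[OF oH] .
      have czr: "isCont zreg w" if "Re w > 0" for w
        by (rule bspec[OF czr']) (use that in simp)
      have dn: "((\<lambda>\<sigma>. Complex \<sigma> y) \<longlongrightarrow> Complex 1 y) (at_right 1)" for y
        by (rule tendsto_Complex[OF tendsto_ident_at tendsto_const])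
      have dq: "((\<lambda>\<sigma>. zreg (Complex \<sigma> t) / (Complex \<sigma> t - s)) \<longlongrightarrow> deriv zreg s) (at_right 1)"
      proof -
        have "((\<lambda>w. zreg w / (w - s)) \<longlongrightarrow> deriv zreg s) (at s)" using dz z0 by (simp add: has_field_derivative_iff)
        moreover have "\<forall>\<^sub>F \<sigma> in at_right 1. Complex \<sigma> t \<in> UNIV \<and> Complex \<sigma> t \<noteq> Complex 1 t"
          using eventually_at_right_less[of "1::real"] by eventually_elim simp
        then have "filterlim (\<lambda>\<sigma>. Complex \<sigma> t) (at s) (at_right 1)"
          unfolding filterlim_at s_eq using dn[of t] by (intro conjI)
        ultimately show ?thesis by (rule filterlim_compose)
      qed
      have A: "((\<lambda>\<sigma>. cmod (zreg (Complex \<sigma> y))) \<longlongrightarrow> cmod (zreg (Complex 1 y))) (at_right 1)" for y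
        by (intro tendsto_norm isCont_tendsto_compose[OF czr dn]) simp
      define k where "k y w = cmod w / cmod (w - 1)" for y :: real and w :: complex
      \<comment> \<open>The pole at 1 contributes (\<sigma> - 1)^(-3), the assumed zero (\<sigma> -
        1)^4, and 1 + 2it is a regular point. One factor \<sigma> - 1 is left over, so Q tends to 0
        although it equals a product that is at least 1.\<close>
      define Q where "Q \<sigma> = (\<sigma> * cmod (zreg (Complex \<sigma> 0))) ^ 3 * (cmod (Complex \<sigma> t) / cmod (Complex \<sigma> t - 1) * cmod (zreg (Complex \<sigma> t) / (Complex \<sigma> t - s))) ^ 4
          * (cmod (Complex \<sigma> (2 * t)) / cmod (Complex \<sigma> (2 * t) - 1) * cmod (zreg (Complex \<sigma> (2 * t)))) * (\<sigma> - 1)" for \<sigma>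
      have "(Q \<longlongrightarrow> (1 * cmod (zreg (Complex 1 0))) ^ 3 * (cmod (Complex 1 t) / cmod (Complex 1 t - 1) * cmod (deriv zreg s)) ^ 4
          * (cmod (Complex 1 (2 * t)) / cmod (Complex 1 (2 * t) - 1) * cmod (zreg (Complex 1 (2 * t)))) * (1 - 1)) (at_right 1)"
        unfolding Q_def using t0
        by (intro tendsto_mult tendsto_power tendsto_divide tendsto_norm tendsto_diff A dn dq tendsto_ident_at tendsto_const isCont_tendsto_compose[OF czr dn])
           (auto simp: complex_eq_iff)
      then have Q0: "(Q \<longlongrightarrow> 0) (at_right 1)" by simp
      have Q1: "1 \<le> Q \<sigma>" if sg: "\<sigma> > 1" for \<sigma>
      proof -
        have zz: "cmod (zeta (Complex \<sigma> y)) = cmod (Complex \<sigma> y) / cmod (Complex \<sigma> y - 1) * cmod (zreg (Complex \<sigma> y))" for y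
        proof -
          have "Complex \<sigma> y \<noteq> 1" using sg by (simp add: complex_eq_iff)
          from zeta_eq_zreg[OF this] show ?thesis by (simp only: norm_mult norm_divide)
        qed
        have c0: "cmod (Complex \<sigma> 0) = \<sigma>" "cmod (Complex \<sigma> 0 - 1) = \<sigma> - 1" "cmod (Complex \<sigma> t - s) = \<sigma> - 1"
          using sg by (simp_all add: cmod_def s_eq)
        have "1 \<le> cmod (zeta (Complex \<sigma> 0)) ^ 3 * cmod (zeta (Complex \<sigma> t)) ^ 4 * cmod (zeta (Complex \<sigma> (2 * t)))"
          using three_four_one[OF sg, of t] by (simp add: complex_of_real_def)
        also have "\<dots> = Q \<sigma>"
        proof -
          have ident: "(a / d * b) ^ 3 * (e * f) ^ 4 * g = (a * b) ^ 3 * (e * (f / d)) ^ 4 * g * d" if d: "d > 0" for a b d e f g :: real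
          proof -
            have "d ^ 4 = d ^ 3 * d" by (simp add: eval_nat_numeral)
            then show ?thesis using d unfolding power_mult_distrib power_divide by simp
          qed
          show ?thesis unfolding zz Q_def norm_divide c0 by (rule ident) (use sg in simp)
        qed
        finally show ?thesis .
      qed
      have "\<forall>\<^sub>F \<sigma> in at_right 1. 1 \<le> Q \<sigma>" using eventually_at_right_less[of "1::real"] by eventually_elim (rule Q1)
      from tendsto_lowerbound[OF Q0 this] show False by simp
    qed
  qed
qed

section \<open>The theta functional equation\<close>

text \<open>The characteristic function of the standard normal distribution, rescaled by c = sqrt (2
  pi x); the real part of its defining integral is the cosine integral.\<close>

lemma
  assumes x: "x > 0"
  shows integrable_gaussian_cos: "integrable lborel (\<lambda>v. exp (- pi * v^2 * x) * cos (2 * pi * m * v))" (is ?A)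
    and integral_gaussian_cos: "(\<integral>v. exp (- pi * v^2 * x) * cos (2 * pi * m * v) \<partial>lborel) = exp (- pi * m^2 / x) / sqrt x" (is ?B)
proof -
  define c where "c = sqrt (2 * pi * x)"
  have c: "c > 0" "c^2 = 2 * pi * x" using x by (simp_all add: c_def)
  define t where "t = 2 * pi * m / c"
  define f where "f y = std_normal_density y * cos (t * y)" for y
  have sint: "integrable lborel std_normal_density" using integrable_normal_moment[of 1 0 0] by simp
  have fint: "integrable lborel f"
    by (rule Bochner_Integration.integrable_bound[OF sint]) (auto simp: f_def[abs_def] abs_mult mult_left_le)
  have fval: "(\<integral>y. f y \<partial>lborel) = exp (- (t^2) / 2)"
  proof -
    have "char std_normal_distribution t = of_real (exp (- (t^2) / 2))" using char_std_normal_distribution by simp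
    moreover have "char std_normal_distribution t = (\<integral>y. std_normal_density y *\<^sub>R iexp (t * y) \<partial>lborel)"
      unfolding char_def by (subst integral_density) auto
    moreover have "Re (\<integral>y. std_normal_density y *\<^sub>R iexp (t * y) \<partial>lborel) = (\<integral>y. Re (std_normal_density y *\<^sub>R iexp (t * y)) \<partial>lborel)"
    proof (rule integral_Re[symmetric])
      show "integrable lborel (\<lambda>y. std_normal_density y *\<^sub>R iexp (t * y))"
        by (rule Bochner_Integration.integrable_bound[OF sint]) (auto simp: norm_mult)
    qed
    moreover have "Re (std_normal_density y *\<^sub>R iexp (t * y)) = f y" for y
      by (simp add: f_def Re_exp)
    ultimately show ?thesis by simp
  qed
  have e: "f (0 + c * v) = 1 / sqrt (2 * pi) * (exp (- pi * v^2 * x) * cos (2 * pi * m * v))" for v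
  proof -
    have "(c * v)^2 / 2 = pi * v^2 * x" using c(2) by (simp add: power_mult_distrib)
    moreover have "t * (c * v) = 2 * pi * m * v" using c(1) by (simp add: t_def)
    ultimately show ?thesis unfolding f_def std_normal_density_def by (simp only: minus_divide_left[symmetric] mult_minus_left mult.assoc add_0)
  qed
  have I: "integrable lborel (\<lambda>v. 1 / sqrt (2 * pi) * (exp (- pi * v^2 * x) * cos (2 * pi * m * v)))"
    using lborel_integrable_real_affine[OF fint, of c 0] c(1) unfolding e by simp
  have s: "sqrt (2 * pi) > 0" by simp
  have "integrable lborel (\<lambda>v. sqrt (2 * pi) * (1 / sqrt (2 * pi) * (exp (- pi * v^2 * x) * cos (2 * pi * m * v))))"
    by (rule integrable_mult_right[OF I])
  then show ?A using s by simp
  have "exp (- (t^2) / 2) = c * (\<integral>v. f (0 + c * v) \<partial>lborel)"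
    using lborel_integral_real_affine[of c f 0] c(1) fval by simp
  also have "\<dots> = c * (1 / sqrt (2 * pi) * (\<integral>v. exp (- pi * v^2 * x) * cos (2 * pi * m * v) \<partial>lborel))"
    unfolding e by simp
  finally have "(\<integral>v. exp (- pi * v^2 * x) * cos (2 * pi * m * v) \<partial>lborel) = exp (- (t^2) / 2) * (sqrt (2 * pi) / c)"
    using c(1) s by (simp add: field_simps)
  moreover have "sqrt (2 * pi) / c = 1 / sqrt x" using x by (simp add: c_def real_sqrt_mult)
  moreover have "- (t^2) / 2 = - pi * m^2 / x"
    using x c by (simp add: t_def power_divide power_mult_distrib field_simps power2_eq_square)
  ultimately show ?B
    by (simp only: times_divide_eq_right mult_1_right)
qed

lemma has_integral_shift_interval:
  fixes f :: "real \<Rightarrow> real"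
  assumes "(f has_integral i) {a + c..b + c}"
  shows "((\<lambda>x. f (x + c)) has_integral i) {a..b}"
  using has_integral_affinity'[of f i "a + c" "b + c" 1 c] assms by simp

text \<open>Uniqueness of Fourier coefficients by a peak kernel. Powers of a trigonometric
  polynomial T that exceeds 1 only near 0 integrate r to 0; if r 0 > 0, these integrals would grow
  without bound. Applied to a difference in both orders, it yields equality at 0 with no theorem on
  pointwise convergence.\<close>

lemma cos_coefficients_zero_nonpos:
  fixes r :: "real \<Rightarrow> real"
  assumes cont: "continuous_on {-1/2..1/2} r"
    and zero: "\<And>m::int. integral {-1/2..1/2} (\<lambda>v. r v * cos (2 * pi * of_int m * v)) = 0"
  shows "r 0 \<le> 0"
proof (rule ccontr)
  assume "\<not> r 0 \<le> 0"
  then have r0: "r 0 > 0" by simp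
  let ?I = "{-1/2..1/2::real}"
  have "isCont r 0" using continuous_on_interior[OF cont, of 0] by (simp add: interior_atLeastAtMost_real)
  then have "\<forall>\<^sub>F v in at 0. r v > r 0 / 2" using r0 by (intro order_tendstoD(1)[of r "r 0"]) (auto simp: isCont_def)
  then obtain d where d: "d > 0" "\<And>v. v \<noteq> 0 \<Longrightarrow> \<bar>v\<bar> < d \<Longrightarrow> r v > r 0 / 2"
    unfolding eventually_at by (auto simp: dist_real_def)
  define \<eta> where "\<eta> = min (d/2) (1/4)"
  have \<eta>: "0 < \<eta>" "\<eta> < d" "\<eta> \<le> 1/4" using d by (auto simp: \<eta>_def)
  have r\<eta>: "r v \<ge> r 0 / 2" if "\<bar>v\<bar> \<le> \<eta>" for v using d(2)[of v] that \<eta> r0 by (cases "v = 0") auto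
  \<comment> \<open>With this e, T lies between -1 and 1 - e for |v| >= \<eta> and is nonnegative
    for |v| <= \<eta>, since \<eta> <= 1/4 keeps the cosine nonnegative there.\<close>
  define e where "e = (1 - cos (2 * pi * \<eta>)) / 2"
  have mono: "cos (2 * pi * v) \<le> cos (2 * pi * \<eta>)" if "\<eta> \<le> \<bar>v\<bar>" "\<bar>v\<bar> \<le> 1/2" for v
  proof -
    have "cos (2 * pi * \<bar>v\<bar>) \<le> cos (2 * pi * \<eta>)" using that \<eta> by (intro cos_monotone_0_pi_le) auto
    moreover have "cos (2 * pi * v) = cos (2 * pi * \<bar>v\<bar>)" by (cases "v \<ge> 0") auto
    ultimately show ?thesis by simp
  qed
  have mono2: "cos (2 * pi * v) \<ge> cos (2 * pi * \<eta>)" if "\<bar>v\<bar> \<le> \<eta>" for v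
  proof -
    have "cos (2 * pi * \<bar>v\<bar>) \<ge> cos (2 * pi * \<eta>)" using that \<eta> by (intro cos_monotone_0_pi_le) auto
    moreover have "cos (2 * pi * v) = cos (2 * pi * \<bar>v\<bar>)" by (cases "v \<ge> 0") auto
    ultimately show ?thesis by simp
  qed
  have "cos (2 * pi * \<eta>) < cos 0" using \<eta> by (intro cos_monotone_0_pi) auto
  moreover have "cos (2 * pi * \<eta>) \<ge> 0" using \<eta> by (intro cos_ge_zero) (auto simp: field_simps intro: order_trans[of _ 0])
  ultimately have e: "0 < e" "e \<le> 1/2" by (auto simp: e_def)
  define T where "T v = cos (2 * pi * v) + e" for v
  have Tcont: "continuous_on A T" for A unfolding T_def by (intro continuous_intros)
  have int: "(\<lambda>v. r v * T v ^ N * cos (2 * pi * c * v)) integrable_on ?I" for N c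
    by (intro integrable_continuous_interval continuous_intros cont Tcont)
  have Tz: "integral ?I (\<lambda>v. r v * T v ^ N * cos (2 * pi * of_int m * v)) = 0" for N and m :: int
  proof (induction N arbitrary: m)
    case 0 then show ?case using zero[of m] by simp
  next
    case (Suc N)
    \<comment> \<open>The product-to-sum formula moves one factor cos (2 pi v) into the frequencies
      m + 1 and m - 1; this is why the induction is over arbitrary m.\<close>
    have eq: "r v * T v ^ Suc N * cos (2 * pi * of_int m * v) =
        (r v * T v ^ N * cos (2 * pi * of_int (m + 1) * v)) * (1/2) + (r v * T v ^ N * cos (2 * pi * of_int (m - 1) * v)) * (1/2)
        + (r v * T v ^ N * cos (2 * pi * of_int m * v)) * e" for v
    proof -
      have a: "2 * pi * of_int (m + 1) * v = 2 * pi * of_int m * v + 2 * pi * v" "2 * pi * of_int (m - 1) * v = 2 * pi * of_int m * v - 2 * pi * v"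
        by (simp_all add: algebra_simps)
      show ?thesis unfolding a cos_add cos_diff T_def by (simp add: algebra_simps)
    qed
    have h: "((\<lambda>v. r v * T v ^ N * cos (2 * pi * of_int k * v)) has_integral 0) ?I" for k :: int
      using integrable_integral[OF int[of N "of_int k"]] unfolding Suc.IH .
    have "((\<lambda>v. r v * T v ^ Suc N * cos (2 * pi * of_int m * v)) has_integral 0 * (1/2) + 0 * (1/2) + 0 * e) ?I"
      unfolding eq by (intro has_integral_add has_integral_mult_left h)
    then show ?case by (simp add: integral_unique)
  qed
  have Z: "integral ?I (\<lambda>v. r v * T v ^ N) = 0" for N using Tz[of N 0] by simp
  have intN: "(\<lambda>v. r v * T v ^ N) integrable_on ?I" for N
    by (intro integrable_continuous_interval continuous_intros cont Tcont)
  have "compact (r ` ?I)" by (intro compact_continuous_image cont) simp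
  then have "bounded (r ` ?I)" by (rule compact_imp_bounded)
  then obtain M where "\<forall>x\<in>r ` ?I. norm x \<le> M" unfolding bounded_iff by (elim exE)
  then have M: "\<bar>r v\<bar> \<le> M" if "v \<in> ?I" for v using bspec[OF _ imageI[OF that]] by simp
  have M0: "M \<ge> 0" using M[of 0] by simp
  have "isCont (\<lambda>v. cos (2 * pi * v)) 0" by (intro continuous_intros)
  then have "\<forall>\<^sub>F v in at 0. cos (2 * pi * v) > 1 - e / 2" using e by (intro order_tendstoD(1)[of _ 1]) (auto simp: isCont_def)
  then obtain d2 where d2: "d2 > 0" "\<And>v. v \<noteq> 0 \<Longrightarrow> \<bar>v\<bar> < d2 \<Longrightarrow> cos (2 * pi * v) > 1 - e / 2"
    unfolding eventually_at by (auto simp: dist_real_def)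
  define \<kappa> where "\<kappa> = min (d2/2) \<eta>"
  have \<kappa>: "0 < \<kappa>" "\<kappa> < d2" "\<kappa> \<le> \<eta>" using d2 \<eta> by (auto simp: \<kappa>_def)
  have cos\<kappa>: "T v \<ge> 1 + e / 2" if "\<bar>v\<bar> \<le> \<kappa>" for v using d2(2)[of v] that \<kappa> e by (cases "v = 0") (auto simp: T_def)
  \<comment> \<open>A lower bound that is easy to integrate: growth (1 + e/2)^N near 0, and the
    worst case -M wherever T is bounded by 1 or the integrand is only known to be
    nonnegative.\<close>
  define low where "low N v = (if \<bar>v\<bar> \<le> \<kappa> then (r 0 / 2) * (1 + e/2) ^ N else 0) - M" for N and v :: real
  have lowle: "low N v \<le> r v * T v ^ N" if v: "v \<in> ?I" for N v
  proof (cases "\<bar>v\<bar> \<le> \<eta>")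
    case True
    have T0: "T v \<ge> 0" using mono2[OF True] e \<open>cos (2 * pi * \<eta>) \<ge> 0\<close> by (simp add: T_def)
    show ?thesis
    proof (cases "\<bar>v\<bar> \<le> \<kappa>")
      case True2: True
      have "(r 0 / 2) * (1 + e/2) ^ N \<le> r v * T v ^ N"
        using r\<eta>[OF True] cos\<kappa>[OF True2] r0 e by (intro mult_mono power_mono) auto
      then show ?thesis using M0 True2 by (simp add: low_def)
    next
      case False
      have "0 \<le> r v * T v ^ N" using r\<eta>[OF True] r0 T0 by (intro mult_nonneg_nonneg) auto
      then show ?thesis using M0 False by (simp add: low_def)
    qed
  next
    case False
    have "cos (2 * pi * v) \<le> 1 - 2 * e"
  proof -
    have "\<bar>v\<bar> \<le> 1/2" using v by (auto simp: abs_le_iff)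
    then show ?thesis using mono[of v] False unfolding e_def by (simp add: field_simps)
  qed
    then have "\<bar>T v\<bar> \<le> 1" unfolding T_def abs_le_iff using e cos_ge_minus_one[of "2 * pi * v"] by linarith
    then have "\<bar>T v\<bar> ^ N \<le> 1" by (intro power_le_one) auto
    then have "\<bar>r v\<bar> * \<bar>T v\<bar> ^ N \<le> M * 1" using M[OF v] by (intro mult_mono) auto
    moreover have "\<bar>r v * T v ^ N\<bar> = \<bar>r v\<bar> * \<bar>T v\<bar> ^ N" by (simp add: abs_mult power_abs)
    ultimately have "- M \<le> r v * T v ^ N" using abs_ge_minus_self[of "r v * T v ^ N"] by linarith
    then show ?thesis using False \<kappa> by (simp add: low_def)
  qed
  have lowint: "(low N has_integral (2 * \<kappa>) * ((r 0 / 2) * (1 + e/2) ^ N) - M) ?I" for N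
  proof -
    have "((\<lambda>v. (r 0 / 2) * (1 + e/2) ^ N) has_integral (\<kappa> - (- \<kappa>)) *\<^sub>R ((r 0 / 2) * (1 + e/2) ^ N)) {-\<kappa>..\<kappa>}"
      using has_integral_const_real[of "(r 0 / 2) * (1 + e/2) ^ N" "-\<kappa>" \<kappa>] \<kappa> by simp
    then have "((\<lambda>v. if v \<in> {-\<kappa>..\<kappa>} then (r 0 / 2) * (1 + e/2) ^ N else 0) has_integral (2 * \<kappa>) * ((r 0 / 2) * (1 + e/2) ^ N)) ?I"
      using \<kappa> \<eta> by (subst has_integral_restrict) auto
    moreover have "((\<lambda>v. M) has_integral (1/2 - (-1/2)) *\<^sub>R M) ?I" using has_integral_const_real[of M "-1/2" "1/2"] by simp
    ultimately have "((\<lambda>v. (if v \<in> {-\<kappa>..\<kappa>} then (r 0 / 2) * (1 + e/2) ^ N else 0) - M) has_integral (2 * \<kappa>) * ((r 0 / 2) * (1 + e/2) ^ N) - (1/2 - (-1/2)) *\<^sub>R M) ?I"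
      by (rule has_integral_diff)
    moreover have "low N v = (if v \<in> {-\<kappa>..\<kappa>} then (r 0 / 2) * (1 + e/2) ^ N else 0) - M" for v by (auto simp: low_def abs_le_iff)
    ultimately show ?thesis by (simp add: low_def[abs_def])
  qed
  have ub: "(2 * \<kappa>) * ((r 0 / 2) * (1 + e/2) ^ N) - M \<le> 0" for N
    using has_integral_le[OF lowint integrable_integral[OF intN[of N]] lowle] Z[of N] by simp
  have "\<exists>N. M / (\<kappa> * r 0) < (1 + e/2) ^ N" using e by (intro real_arch_pow) auto
  then obtain N where "M / (\<kappa> * r 0) < (1 + e/2) ^ N" by (elim exE)
  then have "M < \<kappa> * r 0 * (1 + e/2) ^ N" using \<kappa> r0 by (simp add: pos_divide_less_eq mult.commute)
  then show False using ub[of N] by simp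
qed

text \<open>Jacobi's theta function, the sum of exp (- pi n^2 x) over all integers n, is
  \<open>1 + 2 * theta_tail x\<close>.\<close>

definition theta_tail :: "real \<Rightarrow> real" where
  "theta_tail x = (\<Sum>n. exp (- pi * (real (Suc n))^2 * x))"

lemma theta_term_le: "x > 0 \<Longrightarrow> exp (- pi * (real (Suc n))^2 * x) \<le> exp (- pi * x) * exp (- pi * x) ^ n"
proof -
  assume x: "x > 0"
  have "real (Suc n) * 1 \<le> real (Suc n) * real (Suc n)" by (intro mult_left_mono) auto
  then have "pi * x * real (Suc n) \<le> pi * x * (real (Suc n))^2" using x unfolding power2_eq_square by (intro mult_left_mono) auto
  then have "exp (- pi * (real (Suc n))^2 * x) \<le> exp (real (Suc n) * (- pi * x))" by (simp add: mult_ac)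
  also have "\<dots> = exp (- pi * x) ^ Suc n" by (rule exp_of_nat_mult)
  finally show ?thesis by simp
qed

lemma theta_summable:
  assumes x: "x > 0" shows "summable (\<lambda>n. exp (- pi * (real (Suc n))^2 * x))"
proof (rule summable_comparison_test')
  show "summable (\<lambda>n. exp (- pi * x) * exp (- pi * x) ^ n)" using x by (intro summable_mult summable_geometric) simp
  show "norm (exp (- pi * (real (Suc n))^2 * x)) \<le> exp (- pi * x) * exp (- pi * x) ^ n" for n
    using theta_term_le[OF x] by simp
qed

lemma theta_tail_le:
  assumes x: "x > 0" shows "theta_tail x \<le> exp (- pi * x) / (1 - exp (- pi * x))" (is ?A) "theta_tail x \<ge> 0"
proof -
  have q: "norm (exp (- pi * x)) < 1" using x by simp
  have "theta_tail x \<le> (\<Sum>n. exp (- pi * x) * exp (- pi * x) ^ n)"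
    unfolding theta_tail_def using theta_term_le[OF x]
    by (intro suminf_le theta_summable x summable_mult summable_geometric q) auto
  also have "\<dots> = exp (- pi * x) * (1 / (1 - exp (- pi * x)))"
    unfolding suminf_mult[OF summable_geometric[OF q]] suminf_geometric[OF q] ..
  finally show ?A by simp
  show "theta_tail x \<ge> 0" unfolding theta_tail_def by (intro suminf_nonneg theta_summable x) auto
qed

lemma integral_cos_period:
  fixes m :: int
  shows "integral {-1/2..1/2} (\<lambda>v. cos (2 * pi * of_int m * v)) = (if m = 0 then 1 else 0)"
proof (cases "m = 0")
  case True
  then show ?thesis by simp
next
  case False
  define c where "c = 2 * pi * of_int m"
  have c: "c \<noteq> 0" using False by (simp add: c_def)
  have "((\<lambda>v. cos (c * v)) has_integral (sin (c * (1/2)) / c - sin (c * (-1/2)) / c)) {-1/2..1/2}"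
    by (rule fundamental_theorem_of_calculus)
       (use c in \<open>auto intro!: derivative_eq_intros simp: has_real_derivative_iff_has_vector_derivative[symmetric]\<close>)
  moreover have "sin (c * (1/2)) = 0" "sin (c * (-1/2)) = 0"
    using sin_int_times_real[of m] sin_zero_iff_int2[of "c * (1/2)"] by (auto simp: c_def mult_ac)
  ultimately show ?thesis using False by (simp add: integral_unique c_def mult_ac)
qed

text \<open>Poisson summation for the Gaussian. The periodised Gaussian P' and the cosine series Q'
  with its Fourier transform as coefficients both converge uniformly on one period and have the same
  cosine coefficients, hence the same value at 0.\<close>

lemma theta_functional_equation:
  assumes x: "x > 0" shows "1 + 2 * theta_tail x = (1 + 2 * theta_tail (1 / x)) / sqrt x"
proof -
  let ?I = "{-1/2..1/2::real}"
  define g where "g v = exp (- pi * v^2 * x)" for v :: real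
  define p where "p n v = g (v + real (Suc n)) + g (v - real (Suc n))" for n v
  define P where "P N v = g v + (\<Sum>n<N. p n v)" for N v
  define P' where "P' v = g v + (\<Sum>n. p n v)" for v
  have gcont: "continuous_on A g" for A unfolding g_def by (intro continuous_intros)
  have pcont: "continuous_on A (p n)" for A n unfolding p_def
    by (intro continuous_intros continuous_on_compose2[OF gcont]) auto
  have Pcont: "continuous_on A (P N)" for A N unfolding P_def by (intro continuous_intros gcont pcont)
  define q where "q = exp (- pi * (x / 4))"
  have q: "0 < q" "q < 1" using x by (auto simp: q_def)
  \<comment> \<open>For |v| <= 1/2 the shifted points v + (n+1) and v - (n+1) have modulus at least
    (n+1)/2, and (k/2)^2 >= k/4 for k >= 1 turns Gaussian decay into the geometric majorant needed
    for the M-test.\<close>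
  have gle: "g w \<le> q ^ Suc n" if w: "\<bar>w\<bar> \<ge> real (Suc n) / 2" for w n
  proof -
    have "(real (Suc n) / 2)^2 \<le> \<bar>w\<bar>^2" using w by (intro power_mono) auto
    moreover have "real (Suc n) / 4 \<le> (real (Suc n) / 2)^2"
    proof -
      have "k / 4 \<le> (k / 2)^2" if "k \<ge> 1" for k :: real
        using mult_left_mono[of 1 k k] that by (simp add: power_divide power2_eq_square)
      then show ?thesis by simp
    qed
    ultimately have "real (Suc n) / 4 \<le> w^2" by simp
    then have "(pi * x) * (real (Suc n) / 4) \<le> (pi * x) * w^2" using x by (intro mult_left_mono) auto
    then have "g w \<le> exp (real (Suc n) * (- pi * (x / 4)))" by (simp add: g_def mult_ac)
    also have "\<dots> = q ^ Suc n" unfolding q_def by (rule exp_of_nat_mult)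
    finally show ?thesis .
  qed
  have ple: "norm (p n v) \<le> 2 * (q * q ^ n)" if v: "v \<in> ?I" for n v
  proof -
    have b: "\<bar>v + real (Suc n)\<bar> \<ge> real (Suc n) / 2" "\<bar>v - real (Suc n)\<bar> \<ge> real (Suc n) / 2" using v by auto
    note gle[OF b(1)] gle[OF b(2)]
    moreover have "p n v \<ge> 0" by (simp add: p_def g_def)
    ultimately show ?thesis by (simp add: p_def)
  qed
  have qs: "summable (\<lambda>n. 2 * (q * q ^ n))" using q by (intro summable_mult summable_geometric) simp
  have ulP: "uniform_limit ?I (\<lambda>N v. P N v) P' sequentially"
    unfolding P_def P'_def by (intro uniform_limit_intros Weierstrass_m_test[OF ple qs])
  define a where "a k = exp (- pi * (real k)^2 / x) / sqrt x" for k
  define Q where "Q N v = a 0 + (\<Sum>n<N. 2 * a (Suc n) * cos (2 * pi * real (Suc n) * v))" for N v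
  define Q' where "Q' v = a 0 + (\<Sum>n. 2 * a (Suc n) * cos (2 * pi * real (Suc n) * v))" for v
  have apos: "a k \<ge> 0" for k using x by (simp add: a_def)
  have asum: "summable (\<lambda>n. 2 * a (Suc n))"
  proof -
    have "summable (\<lambda>n. exp (- pi * (real (Suc n))^2 * (1 / x)) * (1 / sqrt x))"
      using x by (intro summable_mult2 theta_summable) simp
    then show ?thesis unfolding a_def by (intro summable_mult) simp
  qed
  have Qcont: "continuous_on A (Q N)" for A N unfolding Q_def by (intro continuous_intros)
  have ulQ: "uniform_limit ?I (\<lambda>N v. Q N v) Q' sequentially"
    unfolding Q_def Q'_def
    by (intro uniform_limit_intros Weierstrass_m_test[OF _ asum])
       (simp add: abs_mult apos mult_left_le)
  have P'cont: "continuous_on ?I P'" by (rule uniform_limit_theorem[OF _ ulP]) (simp_all add: Pcont)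
  have Q'cont: "continuous_on ?I Q'" by (rule uniform_limit_theorem[OF _ ulQ]) (simp_all add: Qcont)
  have coefP: "integral ?I (\<lambda>v. P' v * cos (2 * pi * of_int m * v)) = a (nat \<bar>m\<bar>)" for m :: int
  proof -
    let ?c = "\<lambda>v. cos (2 * pi * of_int m * v)"
    have ccont: "continuous_on A ?c" for A by (intro continuous_intros)
    have per: "?c (v + real k) = ?c v" "?c (v - real k) = ?c v" for v k
    proof -
      have e: "2 * pi * of_int m * (v + real k) = 2 * pi * of_int m * v + 2 * of_int (m * int k) * pi"
        "2 * pi * of_int m * (v - real k) = 2 * pi * of_int m * v - 2 * of_int (m * int k) * pi" by (simp_all add: algebra_simps)
      have sc: "sin (2 * of_int j * pi) = 0" "cos (2 * of_int j * pi) = 1" for j :: int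
        using sin_int_2pin[of j] cos_int_2pin[of j] by (simp_all add: mult_ac)
      show "?c (v + real k) = ?c v" "?c (v - real k) = ?c v" unfolding e cos_add cos_diff sc by simp_all
    qed
    \<comment> \<open>The cosine has period 1, so the translated integrals over one period fit
      together to the integral of the unshifted Gaussian over [-N - 1/2, N + 1/2].\<close>
    have hicomb: "((\<lambda>v. P N v * ?c v) has_integral integral {- real N - 1/2..real N + 1/2} (\<lambda>v. g v * ?c v)) ?I" for N
    proof (induction N)
      case 0
      have "(\<lambda>v. g v * ?c v) integrable_on ?I" by (intro integrable_continuous_interval continuous_intros gcont)
      then show ?case by (simp add: P_def integrable_integral)
    next
      case (Suc N)
      let ?h = "\<lambda>v. g v * ?c v"
      have hint: "?h integrable_on {a..b}" for a b by (intro integrable_continuous_interval continuous_intros gcont)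
      have s1: "((\<lambda>v. g (v + real (Suc N)) * ?c v) has_integral integral {real N + 1/2..real N + 3/2} ?h) ?I"
      proof -
        have "((\<lambda>v. ?h (v + real (Suc N))) has_integral integral {real N + 1/2..real N + 3/2} ?h) ?I"
          by (rule has_integral_shift_interval) (use integrable_integral[OF hint[of "real N + 1/2" "real N + 3/2"]] in \<open>simp add: add_ac\<close>)
        then show ?thesis unfolding per .
      qed
      have b3: "-1/2 - real (Suc N) = - real N - 3/2" "1/2 - real (Suc N) = - real N - 1/2" by simp_all
      have s2: "((\<lambda>v. g (v - real (Suc N)) * ?c v) has_integral integral {- real N - 3/2..- real N - 1/2} ?h) ?I"
      proof -
        have "((\<lambda>v. ?h (v - real (Suc N))) has_integral integral {- real N - 3/2..- real N - 1/2} ?h) ?I"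
          using has_integral_shift_interval[of ?h "integral {- real N - 3/2..- real N - 1/2} ?h" "-1/2" "- real (Suc N)" "1/2"]
            integrable_integral[OF hint[of "- real N - 3/2" "- real N - 1/2"]]
          by (simp only: diff_conv_add_uminus[symmetric] b3)
        then show ?thesis unfolding per .
      qed
      have e: "P (Suc N) v * ?c v = P N v * ?c v + (g (v + real (Suc N)) * ?c v + g (v - real (Suc N)) * ?c v)" for v
        by (simp add: P_def p_def algebra_simps del: of_nat_Suc)
      have I: "integral {- real N - 3/2..real N + 3/2} ?h = integral {- real N - 3/2..- real N - 1/2} ?h + (integral {- real N - 1/2..real N + 1/2} ?h + integral {real N + 1/2..real N + 3/2} ?h)"
        using Henstock_Kurzweil_Integration.integral_combine[of "- real N - 3/2" "- real N - 1/2" "real N + 3/2" ?h]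
          Henstock_Kurzweil_Integration.integral_combine[of "- real N - 1/2" "real N + 1/2" "real N + 3/2" ?h] hint by simp
      have b: "- real (Suc N) - 1/2 = - real N - 3/2" "real (Suc N) + 1/2 = real N + 3/2" by simp_all
      show ?case unfolding e b I
        using has_integral_add[OF Suc.IH has_integral_add[OF s1 s2]] by (simp add: add_ac)
    qed
    have ulPc: "uniform_limit ?I (\<lambda>N v. P N v * ?c v) (\<lambda>v. P' v * ?c v) sequentially"
    proof (rule uniform_lim_mult[OF ulP uniform_limit_const])
      show "bounded (P' ` ?I)" by (intro compact_imp_bounded compact_continuous_image P'cont) simp
      show "bounded (?c ` ?I)" by (intro compact_imp_bounded compact_continuous_image ccont) simp
    qed
    have "(\<lambda>N. integral {- real N - 1/2..real N + 1/2} (\<lambda>v. g v * ?c v)) \<longlonglongrightarrow> integral ?I (\<lambda>v. P' v * ?c v)"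
    proof -
      have "uniform_limit (cbox (-1/2) (1/2)) (\<lambda>N v. P N v * ?c v) (\<lambda>v. P' v * ?c v) sequentially" using ulPc by simp
      then obtain I J where IJ: "\<And>N. ((\<lambda>v. P N v * ?c v) has_integral I N) (cbox (-1/2) (1/2))"
        "((\<lambda>v. P' v * ?c v) has_integral J) (cbox (-1/2) (1/2))" "(I \<longlongrightarrow> J) sequentially"
        by (rule uniform_limit_integral_cbox) (auto intro!: continuous_intros Pcont)
      have "I = (\<lambda>N. integral {- real N - 1/2..real N + 1/2} (\<lambda>v. g v * ?c v))"
      proof
        fix N show "I N = integral {- real N - 1/2..real N + 1/2} (\<lambda>v. g v * ?c v)"
          using has_integral_unique[OF IJ(1)[of N]] hicomb[of N] by simp
      qed
      moreover have "J = integral ?I (\<lambda>v. P' v * ?c v)" using integral_unique[OF IJ(2)] by simp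
      ultimately show ?thesis using IJ(3) by (simp only:)
    qed
    moreover have "(\<lambda>N. integral {- real N - 1/2..real N + 1/2} (\<lambda>v. g v * ?c v)) \<longlonglongrightarrow> a (nat \<bar>m\<bar>)"
    proof -
      have gi: "integrable lborel (\<lambda>v. g v * ?c v)" unfolding g_def by (rule integrable_gaussian_cos[OF x])
      have eq: "integral {- real N - 1/2..real N + 1/2} (\<lambda>v. g v * ?c v) = (\<integral>v. indicat_real {- real N - 1/2..real N + 1/2} v *\<^sub>R (g v * ?c v) \<partial>lborel)" for N
      proof -
        have "set_integrable lborel {- real N - 1/2..real N + 1/2} (\<lambda>v. g v * ?c v)"
          unfolding set_integrable_def by (rule integrable_mult_indicator[OF _ gi]) simp
        from set_borel_integral_eq_integral(2)[OF this] show ?thesis by (simp add: set_lebesgue_integral_def)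
      qed
      have "(\<lambda>N. \<integral>v. indicat_real {- real N - 1/2..real N + 1/2} v *\<^sub>R (g v * ?c v) \<partial>lborel) \<longlonglongrightarrow> (\<integral>v. g v * ?c v \<partial>lborel)"
      proof (rule integral_dominated_convergence[where w="\<lambda>v. \<bar>g v * ?c v\<bar>"])
        show "(\<lambda>v. g v * ?c v) \<in> borel_measurable lborel" using gi by (rule borel_measurable_integrable)
        show "(\<lambda>v. indicat_real {- real N - 1/2..real N + 1/2} v *\<^sub>R (g v * ?c v)) \<in> borel_measurable lborel" for N
          by (rule borel_measurable_integrable, rule integrable_mult_indicator[OF _ gi]) simp
        show "integrable lborel (\<lambda>v. \<bar>g v * ?c v\<bar>)" by (rule integrable_abs[OF gi])
        show "AE v in lborel. norm (indicat_real {- real N - 1/2..real N + 1/2} v *\<^sub>R (g v * ?c v)) \<le> \<bar>g v * ?c v\<bar>" for N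
          by (intro AE_I2) (simp split: split_indicator)
        show "AE v in lborel. (\<lambda>N. indicat_real {- real N - 1/2..real N + 1/2} v *\<^sub>R (g v * ?c v)) \<longlonglongrightarrow> g v * ?c v"
        proof (intro AE_I2)
          fix v :: real
          obtain n :: nat where n: "\<bar>v\<bar> \<le> real n" using real_arch_simple[of "\<bar>v\<bar>"] by auto
          have "indicat_real {- real N - 1/2..real N + 1/2} v *\<^sub>R (g v * ?c v) = g v * ?c v" if "n \<le> N" for N
          proof -
            have "real n \<le> real N" using that by (rule of_nat_mono)
            then have "- real N - 1/2 \<le> v" "v \<le> real N + 1/2" using n by linarith+
            then show ?thesis by simp
          qed
          then have "\<forall>\<^sub>F N in sequentially. indicat_real {- real N - 1/2..real N + 1/2} v *\<^sub>R (g v * ?c v) = g v * ?c v"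
            by (rule eventually_sequentiallyI)
          then show "(\<lambda>N. indicat_real {- real N - 1/2..real N + 1/2} v *\<^sub>R (g v * ?c v)) \<longlonglongrightarrow> g v * ?c v"
            by (rule tendsto_eventually)
        qed
      qed
      moreover have "(\<integral>v. g v * ?c v \<partial>lborel) = a (nat \<bar>m\<bar>)"
        using integral_gaussian_cos[OF x, of "of_int m"] by (simp add: g_def a_def of_nat_nat)
      ultimately show ?thesis unfolding eq by simp
    qed
    ultimately show ?thesis by (rule LIMSEQ_unique)
  qed
  have coefQ: "integral ?I (\<lambda>v. Q' v * cos (2 * pi * of_int m * v)) = a (nat \<bar>m\<bar>)" for m :: int
  proof -
    let ?c = "\<lambda>v. cos (2 * pi * of_int m * v)"
    have ccont: "continuous_on A ?c" for A by (intro continuous_intros)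
    define k where "k = nat \<bar>m\<bar>"
    have hi: "((\<lambda>v. Q N v * ?c v) has_integral (if k \<le> N then a k else 0)) ?I" for N
    proof (induction N)
      case 0
      have "?c integrable_on ?I" by (intro integrable_continuous_interval ccont)
      then have "(?c has_integral (if m = 0 then 1 else 0)) ?I" using integral_cos_period[of m] by (simp add: has_integral_iff)
      from has_integral_mult_right[OF this, of "a 0"] show ?case by (auto simp: Q_def k_def)
    next
      case (Suc N)
      have pr: "cos (2 * pi * real (Suc N) * v) * ?c v = (cos (2 * pi * of_int (int (Suc N) + m) * v) + cos (2 * pi * of_int (int (Suc N) - m) * v)) * (1/2)" for v
      proof -
        have "2 * pi * of_int (int (Suc N) + m) * v = 2 * pi * real (Suc N) * v + 2 * pi * of_int m * v"
          "2 * pi * of_int (int (Suc N) - m) * v = 2 * pi * real (Suc N) * v - 2 * pi * of_int m * v" by (simp_all add: algebra_simps)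
        then show ?thesis by (simp only: cos_add cos_diff) simp
      qed
      have ci: "((\<lambda>v. cos (2 * pi * of_int j * v)) has_integral (if j = 0 then 1 else 0)) ?I" for j :: int
      proof -
        have "(\<lambda>v. cos (2 * pi * of_int j * v)) integrable_on ?I" by (intro integrable_continuous_interval continuous_intros)
        then show ?thesis using integral_cos_period[of j] by (simp add: has_integral_iff)
      qed
      have "((\<lambda>v. cos (2 * pi * real (Suc N) * v) * ?c v) has_integral ((if int (Suc N) + m = 0 then 1 else 0) + (if int (Suc N) - m = 0 then 1 else 0)) * (1/2)) ?I"
        unfolding pr by (intro has_integral_mult_left has_integral_add ci)
      moreover have "((if int (Suc N) + m = 0 then 1 else 0) + (if int (Suc N) - m = 0 then 1 else 0)) * (1/2) = (if k = Suc N then 1/2 else (0::real))"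
        by (auto simp: k_def)
      ultimately have "((\<lambda>v. cos (2 * pi * real (Suc N) * v) * ?c v) has_integral (if k = Suc N then 1/2 else 0)) ?I" by (simp only:)
      from has_integral_mult_right[OF this, of "2 * a (Suc N)"]
      have t: "((\<lambda>v. 2 * a (Suc N) * (cos (2 * pi * real (Suc N) * v) * ?c v)) has_integral (if k = Suc N then a k else 0)) ?I"
        by (auto split: if_splits)
      have "Q (Suc N) v * ?c v = Q N v * ?c v + 2 * a (Suc N) * (cos (2 * pi * real (Suc N) * v) * ?c v)" for v
        by (simp add: Q_def algebra_simps del: of_nat_Suc)
      then show ?case using has_integral_add[OF Suc.IH t] by (auto split: if_splits)
    qed
    have "uniform_limit ?I (\<lambda>N v. Q N v * ?c v) (\<lambda>v. Q' v * ?c v) sequentially"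
    proof (rule uniform_lim_mult[OF ulQ uniform_limit_const])
      show "bounded (Q' ` ?I)" by (intro compact_imp_bounded compact_continuous_image Q'cont) simp
      show "bounded (?c ` ?I)" by (intro compact_imp_bounded compact_continuous_image ccont) simp
    qed
    then have "uniform_limit (cbox (-1/2) (1/2)) (\<lambda>N v. Q N v * ?c v) (\<lambda>v. Q' v * ?c v) sequentially" by simp
    then obtain I J where IJ: "\<And>N. ((\<lambda>v. Q N v * ?c v) has_integral I N) (cbox (-1/2) (1/2))"
      "((\<lambda>v. Q' v * ?c v) has_integral J) (cbox (-1/2) (1/2))" "(I \<longlongrightarrow> J) sequentially"
      by (rule uniform_limit_integral_cbox) (auto intro!: continuous_intros Qcont)
    have "I N = a k" if "k \<le> N" for N
      using has_integral_unique[OF IJ(1)[of N]] hi[of N] that by simp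
    then have "\<forall>\<^sub>F N in sequentially. I N = a k" by (rule eventually_sequentiallyI)
    then have "I \<longlonglongrightarrow> a k" by (rule tendsto_eventually)
    then have "J = a k" by (rule LIMSEQ_unique[OF IJ(3)])
    then show ?thesis using IJ(2) by (simp add: integral_unique k_def)
  qed
  have int: "(\<lambda>v. P' v * cos (2 * pi * of_int m * v)) integrable_on ?I" "(\<lambda>v. Q' v * cos (2 * pi * of_int m * v)) integrable_on ?I" for m :: int
    by (intro integrable_continuous_interval continuous_intros P'cont Q'cont)+
  have "P' 0 - Q' 0 \<le> 0"
  proof (rule cos_coefficients_zero_nonpos[of "\<lambda>v. P' v - Q' v"])
    show "continuous_on ?I (\<lambda>v. P' v - Q' v)" by (intro continuous_on_diff P'cont Q'cont)
    show "integral ?I (\<lambda>v. (P' v - Q' v) * cos (2 * pi * of_int m * v)) = 0" for m :: int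
      unfolding left_diff_distrib integral_diff[OF int(1) int(2)] coefP coefQ by simp
  qed
  moreover have "Q' 0 - P' 0 \<le> 0"
  proof (rule cos_coefficients_zero_nonpos[of "\<lambda>v. Q' v - P' v"])
    show "continuous_on ?I (\<lambda>v. Q' v - P' v)" by (intro continuous_on_diff P'cont Q'cont)
    show "integral ?I (\<lambda>v. (Q' v - P' v) * cos (2 * pi * of_int m * v)) = 0" for m :: int
      unfolding left_diff_distrib integral_diff[OF int(2) int(1)] coefP coefQ by simp
  qed
  ultimately have "P' 0 = Q' 0" by linarith
  moreover have "P' 0 = 1 + 2 * theta_tail x"
  proof -
    have "p n 0 = 2 * exp (- pi * (real (Suc n))^2 * x)" for n
    proof -
      have "(- 1 - real n)^2 = (1 + real n)^2" by (simp add: power2_eq_square algebra_simps)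
      then show ?thesis by (simp add: p_def g_def)
    qed
    then show ?thesis using suminf_mult[OF theta_summable[OF x], of 2] by (simp add: P'_def g_def theta_tail_def)
  qed
  moreover have "Q' 0 = (1 + 2 * theta_tail (1 / x)) / sqrt x"
  proof -
    have "2 * a (Suc n) * cos (2 * pi * real (Suc n) * 0) = (2 / sqrt x) * exp (- pi * (real (Suc n))^2 * (1 / x))" for n
    proof -
      define A where "A = (real (Suc n))^2"
      have "a (Suc n) = exp (- pi * (1 / x) * A) / sqrt x" unfolding a_def A_def by (simp add: field_simps)
      then show ?thesis unfolding A_def[symmetric] by (simp add: mult_ac)
    qed
    moreover have "a 0 = 1 / sqrt x" by (simp add: a_def)
    moreover have "1 / x > 0" using x by simp
    note suminf_mult[OF theta_summable[OF this], of "2 / sqrt x"]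
    ultimately have "Q' 0 = 1 / sqrt x + 2 / sqrt x * theta_tail (1 / x)" unfolding Q'_def theta_tail_def by (simp only:)
    then show ?thesis by (simp add: add_divide_distrib)
  qed
  ultimately show ?thesis by simp
qed

section \<open>The completed zeta function\<close>

lemma powr_times_pos: "0 < a \<Longrightarrow> 0 < b \<Longrightarrow> complex_of_real (a * b) powr z = complex_of_real a powr z * complex_of_real b powr z"
  using powr_times_real[of "complex_of_real a" "complex_of_real b" z] by simp

lemma powr_inverse_pos: "0 < a \<Longrightarrow> complex_of_real (1 / a) powr z = complex_of_real a powr (- z)"
proof -
  assume a: "0 < a"
  have "Ln (complex_of_real (1 / a)) = - Ln (complex_of_real a)"
    using a Ln_of_real[of "1/a"] Ln_of_real[of a] by (simp add: ln_div)
  then show ?thesis using a by (simp add: powr_def)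
qed

lemma cmod_powr_pos: "0 < x \<Longrightarrow> cmod (complex_of_real x powr z) = x powr Re z"
  by (simp add: norm_powr_real_powr)

section \<open>Mellin transforms of exponentials and of theta\<close>

definition gamma_kernel :: "real \<Rightarrow> complex \<Rightarrow> real \<Rightarrow> complex" where
  "gamma_kernel c z x = (if 0 < x then complex_of_real x powr (z - 1) * of_real (exp (- c * x)) else 0)"

lemma gamma_kernel_measurable [measurable]: "gamma_kernel c z \<in> borel_measurable borel"
  unfolding gamma_kernel_def[abs_def] by measurable

lemma
  assumes z: "Re z > 0"
  shows integrable_gamma_kernel_1: "integrable lborel (gamma_kernel 1 z)"
    and integral_gamma_kernel_1: "(\<integral>x. gamma_kernel 1 z x \<partial>lborel) = Gamma z" (is ?A)
proof -
  let ?f = "\<lambda>t. complex_of_real t powr (z - 1) / of_real (exp t)"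
  have e: "indicat_real {0<..} x *\<^sub>R ?f x = gamma_kernel 1 z x" for x
    by (simp add: gamma_kernel_def indicator_def exp_minus divide_inverse of_real_inverse)
  have "integrable lebesgue (\<lambda>x. indicat_real {0<..} x *\<^sub>R ?f x)"
    using absolutely_integrable_Gamma_integral'[OF z] unfolding set_integrable_def .
  then show I: "integrable lborel (gamma_kernel 1 z)"
    unfolding e by (subst (asm) integrable_completion) auto
  have "set_integrable lborel {0<..} ?f" using I unfolding set_integrable_def e .
  from set_borel_integral_eq_integral(2)[OF this] integral_unique[OF Gamma_integral_complex'[OF z]]
  show ?A
    unfolding set_lebesgue_integral_def e by simp
qed

lemma
  assumes z: "Re z > 0" and c: "c > 0"
  shows integrable_gamma_kernel: "integrable lborel (gamma_kernel c z)"
    and integral_gamma_kernel: "(\<integral>x. gamma_kernel c z x \<partial>lborel) = Gamma z * complex_of_real c powr (- z)" (is ?A)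
proof -
  have e: "gamma_kernel 1 z (0 + c * x) = complex_of_real c powr (z - 1) * gamma_kernel c z x" for x
    using c powr_times_pos[of c x "z - 1"] by (auto simp: gamma_kernel_def zero_less_mult_iff mult_ac)
  have nz: "complex_of_real c powr (z - 1) \<noteq> 0" using c by simp
  have "integrable lborel (\<lambda>x. gamma_kernel 1 z (0 + c * x))"
    by (rule lborel_integrable_real_affine[OF integrable_gamma_kernel_1[OF z]]) (use c in simp)
  then have "integrable lborel (\<lambda>x. complex_of_real c powr (z - 1) * gamma_kernel c z x)" unfolding e .
  then have "integrable lborel (\<lambda>x. inverse (complex_of_real c powr (z - 1)) * (complex_of_real c powr (z - 1) * gamma_kernel c z x))"
    by (rule integrable_mult_right)
  then show "integrable lborel (gamma_kernel c z)" unfolding mult.assoc[symmetric] left_inverse[OF nz] mult_1_left .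
  have "Gamma z = \<bar>c\<bar> *\<^sub>R (\<integral>x. gamma_kernel 1 z (0 + c * x) \<partial>lborel)"
    using lborel_integral_real_affine[of c "gamma_kernel 1 z" 0] integral_gamma_kernel_1[OF z] c by simp
  also have "\<dots> = of_real c * complex_of_real c powr (z - 1) * (\<integral>x. gamma_kernel c z x \<partial>lborel)"
    unfolding e using c by (simp add: scaleR_conv_of_real)
  also have "of_real c * complex_of_real c powr (z - 1) = complex_of_real c powr z"
    using powr_add[of "complex_of_real c" 1 "z - 1"] c by simp
  finally have G: "Gamma z = complex_of_real c powr z * (\<integral>x. gamma_kernel c z x \<partial>lborel)" .
  have "complex_of_real c powr z * complex_of_real c powr (- z) = 1"
    using c by (simp add: powr_minus)
  then show ?A
    unfolding G by (simp add: mult_ac)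
qed

lemma cmod_gamma_kernel: "cmod (gamma_kernel c z x) = Re (gamma_kernel c (of_real (Re z)) x)"
  using powr_of_real[of x "Re z - 1"]
  by (simp add: gamma_kernel_def norm_mult norm_powr_real_powr)

lemma theta_measurable [measurable]: "theta_tail \<in> borel_measurable borel"
  unfolding theta_tail_def[abs_def] by measurable

definition theta_mellin :: "complex \<Rightarrow> real \<Rightarrow> complex" where
  "theta_mellin s x = (if 0 < x then of_real (theta_tail x) * complex_of_real x powr (s/2 - 1) else 0)"

text \<open>Riemann's integral, termwise with c = pi n^2. The interchange is justified by the norms:
  they are the same Gamma integrals at the real part of s, and their series converges because Re s >
  1.\<close>

lemma
  assumes s: "Re s > 1"
  shows integrable_theta_mellin: "integrable lborel (theta_mellin s)"
    and integral_theta_mellin: "(\<integral>x. theta_mellin s x \<partial>lborel) = Gamma (s/2) * complex_of_real pi powr (- (s/2)) * zeta s" (is ?A)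
proof -
  define f where "f n = gamma_kernel (pi * (real (Suc n))^2) (s/2)" for n
  have c: "pi * (real (Suc n))^2 > 0" for n by simp
  have cp: "complex_of_real (pi * (real (Suc n))^2) powr (- (w/2)) = complex_of_real pi powr (- (w/2)) * nps w (Suc n)" for n w
  proof -
    have "complex_of_real ((real (Suc n))^2) powr (- (w/2)) = nps w (Suc n)"
      using Ln_of_real[of "(real (Suc n))^2"] Ln_of_real[of "real (Suc n)"]
      by (simp add: nps_eq_exp powr_def ln_realpow del: of_nat_Suc)
    then show ?thesis using powr_times_pos[of pi "(real (Suc n))^2" "- (w/2)"] by simp
  qed
  have s2: "Re (s/2) > 0" using s by simp
  have fint: "integrable lborel (f n)" for n unfolding f_def by (rule integrable_gamma_kernel[OF s2 c])
  have fval: "(\<integral>x. f n x \<partial>lborel) = Gamma (s/2) * complex_of_real pi powr (- (s/2)) * nps s (Suc n)" for n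
    unfolding f_def integral_gamma_kernel[OF s2 c] cp by (simp only: mult.assoc)
  have nint: "(\<integral>x. cmod (f n x) \<partial>lborel) = Re (Gamma (of_real (Re s/2)) * complex_of_real pi powr (- (of_real (Re s) / 2)) * nps (of_real (Re s)) (Suc n))" for n
  proof -
    have r: "Re (of_real (Re s/2)) > 0" using s by simp
    have "cmod (f n x) = Re (gamma_kernel (pi * (real (Suc n))^2) (of_real (Re s/2)) x)" for x
      unfolding f_def cmod_gamma_kernel by simp
    then have "(\<integral>x. cmod (f n x) \<partial>lborel) = Re (\<integral>x. gamma_kernel (pi * (real (Suc n))^2) (of_real (Re s/2)) x \<partial>lborel)"
      by (simp only: integral_Re[OF integrable_gamma_kernel[OF r c]])
    also have "\<dots> = Re (Gamma (of_real (Re s/2)) * complex_of_real (pi * (real (Suc n))^2) powr (- (of_real (Re s)/2)))"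
      unfolding integral_gamma_kernel[OF r c] by simp
    finally show ?thesis unfolding cp by (simp only: mult.assoc)
  qed
  have summ: "summable (\<lambda>n. \<integral>x. cmod (f n x) \<partial>lborel)"
  proof -
    define K where "K = Gamma (of_real (Re s/2)) * complex_of_real pi powr (- (of_real (Re s) / 2))"
    have "summable (\<lambda>n. cmod K * cmod (nps (of_real (Re s)) (Suc n)))"
      by (intro summable_mult summable_norm_nps) (use s in simp)
    then have "summable (\<lambda>n. K * nps (of_real (Re s)) (Suc n))"
      by (intro summable_norm_cancel[of "\<lambda>n. K * nps (of_real (Re s)) (Suc n)"]) (simp only: norm_mult)
    then have "summable (\<lambda>n. Re (K * nps (of_real (Re s)) (Suc n)))" by (rule summable_Re)
    then show ?thesis unfolding nint K_def .
  qed
  have fx: "f n x = of_real (exp (- pi * (real (Suc n))^2 * x)) * complex_of_real x powr (s/2 - 1)" if "x > 0" for n x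
    using that by (simp add: f_def gamma_kernel_def mult_ac)
  have aes: "AE x in lborel. summable (\<lambda>n. cmod (f n x))"
  proof (intro AE_I2)
    fix x :: real
    show "summable (\<lambda>n. cmod (f n x))"
    proof (cases "x > 0")
      case True
      have "summable (\<lambda>n. exp (- pi * (real (Suc n))^2 * x) * cmod (complex_of_real x powr (s/2 - 1)))"
        by (intro summable_mult2 theta_summable True)
      then show ?thesis unfolding fx[OF True] norm_mult norm_of_real by simp
    next
      case False
      then show ?thesis by (simp add: f_def gamma_kernel_def)
    qed
  qed
  have sumf: "(\<Sum>n. f n x) = theta_mellin s x" for x
  proof (cases "x > 0")
    case True
    have "(\<lambda>n. exp (- pi * (real (Suc n))^2 * x)) sums theta_tail x"
      unfolding theta_tail_def by (intro summable_sums theta_summable True)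
    then have "(\<lambda>n. complex_of_real (exp (- pi * (real (Suc n))^2 * x))) sums of_real (theta_tail x)" by (rule sums_of_real)
    then have "(\<lambda>n. f n x) sums (of_real (theta_tail x) * complex_of_real x powr (s/2 - 1))"
      unfolding fx[OF True] by (rule sums_mult2)
    then show ?thesis using True by (simp add: theta_mellin_def sums_iff)
  next
    case False
    then show ?thesis by (simp add: f_def gamma_kernel_def theta_mellin_def)
  qed
  have "integrable lborel (\<lambda>x. \<Sum>n. f n x)" by (rule integrable_suminf[OF fint aes summ])
  then show "integrable lborel (theta_mellin s)" unfolding sumf .
  have "(\<lambda>n. \<integral>x. f n x \<partial>lborel) sums (\<integral>x. (\<Sum>n. f n x) \<partial>lborel)" by (rule sums_integral[OF fint aes summ])
  then have "(\<lambda>n. Gamma (s/2) * complex_of_real pi powr (- (s/2)) * nps s (Suc n)) sums (\<integral>x. theta_mellin s x \<partial>lborel)"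
    unfolding fval sumf .
  moreover have "(\<lambda>n. Gamma (s/2) * complex_of_real pi powr (- (s/2)) * nps s (Suc n)) sums (Gamma (s/2) * complex_of_real pi powr (- (s/2)) * zeta s)"
    by (intro sums_mult zeta_sums s)
  ultimately show ?A
    by (rule sums_unique2)
qed

lemma
  assumes w: "Re w < -1"
  shows integrable_powr_tail_complex: "integrable lborel (\<lambda>x. if 1 < x then complex_of_real x powr w else 0)"
    and integral_powr_tail_complex: "(\<integral>x. (if 1 < x then complex_of_real x powr w else 0) \<partial>lborel) = - 1 / (w + 1)"
proof -
  let ?f = "\<lambda>x. if 1 < x then complex_of_real x powr w else 0"
  show I: "integrable lborel ?f"
  proof (rule Bochner_Integration.integrable_bound[OF integrable_powr_tail(1)[OF w]])
    show "AE x in lborel. norm (?f x) \<le> norm (indicat_real {1..} x * x powr Re w)"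
      by (intro AE_I2) (simp add: cmod_powr_pos)
  qed measurable
  have w1: "w + 1 \<noteq> 0" using w by (auto simp: complex_eq_iff)
  have fl: "filterlim (\<lambda>N. real (Suc N)) at_top sequentially" by (rule filterlim_compose[OF filterlim_real_sequentially filterlim_Suc])
  have L: "(\<lambda>N. \<integral>x. indicat_real {..real (Suc N)} x *\<^sub>R ?f x \<partial>lborel) \<longlonglongrightarrow> (\<integral>x. ?f x \<partial>lborel)"
    by (rule filterlim_compose[OF tendsto_integral_at_top[OF _ I] fl]) simp
  have v: "(\<integral>x. indicat_real {..real (Suc N)} x *\<^sub>R ?f x \<partial>lborel) = of_nat (Suc N) powr (w + 1) / (w + 1) - 1 / (w + 1)" for N
  proof -
    have "((\<lambda>x. complex_of_real x powr (w + 1 - 1)) has_integral (complex_of_real (real (Suc N)) powr (w + 1) / (w + 1) - complex_of_real 1 powr (w + 1) / (w + 1))) {1..real (Suc N)}"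
    proof (rule fundamental_theorem_of_calculus)
      show "((\<lambda>x. complex_of_real x powr (w + 1) / (w + 1)) has_vector_derivative complex_of_real x powr (w + 1 - 1)) (at x within {1..real (Suc N)})"
        if "x \<in> {1..real (Suc N)}" for x
        by (rule powr_antiderivative[OF _ w1]) (use that in simp)
    qed simp
    then have h: "((\<lambda>x. complex_of_real x powr w) has_integral (of_nat (Suc N) powr (w + 1) / (w + 1) - 1 / (w + 1))) {1..real (Suc N)}" by simp
    have e: "indicat_real {..real (Suc N)} x *\<^sub>R ?f x = indicat_real {1<..real (Suc N)} x *\<^sub>R complex_of_real x powr w" for x
      by (auto simp: indicator_def)
    have "integrable lborel (\<lambda>x. indicat_real {..real (Suc N)} x *\<^sub>R ?f x)" by (rule integrable_mult_indicator[OF _ I]) simp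
    then have "set_integrable lborel {1<..real (Suc N)} (\<lambda>x. complex_of_real x powr w)" unfolding e set_integrable_def .
    from set_borel_integral_eq_integral(2)[OF this]
    have "(\<integral>x. indicat_real {..real (Suc N)} x *\<^sub>R ?f x \<partial>lborel) = integral {1<..real (Suc N)} (\<lambda>x. complex_of_real x powr w)"
      unfolding e set_lebesgue_integral_def .
    also have "\<dots> = integral {1..real (Suc N)} (\<lambda>x. complex_of_real x powr w)"
      by (rule integral_spike_set) (auto intro: negligible_subset[of "{1}"])
    finally show ?thesis using integral_unique[OF h] by simp
  qed
  have "(\<lambda>N. of_nat (Suc N) powr (w + 1) / (w + 1) - 1 / (w + 1)) \<longlonglongrightarrow> 0 / (w + 1) - 1 / (w + 1)"
    by (intro tendsto_intros tendsto_nat_powr_neg w1) (use w in simp)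
  from LIMSEQ_unique[OF L[unfolded v] this] show "(\<integral>x. ?f x \<partial>lborel) = - 1 / (w + 1)" by simp
qed

lemma integral_inversion_real:
  fixes f :: "real \<Rightarrow> real"
  assumes f: "integrable lborel (\<lambda>x. if 0 < x \<and> x < 1 then f x else 0)" and m: "f \<in> borel_measurable borel"
  shows "(\<integral>x. (if 0 < x \<and> x < 1 then f x else 0) \<partial>lborel) = (\<integral>x. (if 1 < x then f (1 / x) / x^2 else 0) \<partial>lborel)"
proof -
  note m[measurable]
  let ?S = "{1<..} :: real set"
  have img: "(\<lambda>x. 1 / x) ` ?S = {0<..<1}"
  proof (intro equalityI subsetI)
    fix y :: real assume "y \<in> {0<..<1}"
    then have "y = 1 / (1 / y)" "1 / y \<in> ?S" by auto
    then show "y \<in> (\<lambda>x. 1 / x) ` ?S" by (rule image_eqI)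
  qed auto
  have e: "indicat_real {0<..<1} x *\<^sub>R f x = (if 0 < x \<and> x < 1 then f x else 0)" for x by simp
  have e2: "indicat_real {1<..} x *\<^sub>R (\<bar>- 1 / x^2\<bar> * f (1 / x)) = (if 1 < x then f (1 / x) / x^2 else 0)" for x by simp
  have si: "set_integrable lborel {0<..<1} f" using f unfolding set_integrable_def e .
  have ai: "f absolutely_integrable_on {0<..<1}"
    using si unfolding set_integrable_def by (subst integrable_completion) auto
  define b where "b = integral {0<..<1} f"
  have "f absolutely_integrable_on ((\<lambda>x. 1 / x) ` ?S) \<and> integral ((\<lambda>x. 1 / x) ` ?S) f = b"
    using ai unfolding img b_def by simp
  moreover have "((\<lambda>x. \<bar>- 1 / x^2\<bar> * f (1 / x)) absolutely_integrable_on ?S \<and> integral ?S (\<lambda>x. \<bar>- 1 / x^2\<bar> * f (1 / x)) = b)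
      \<longleftrightarrow> (f absolutely_integrable_on ((\<lambda>x. 1 / x) ` ?S) \<and> integral ((\<lambda>x. 1 / x) ` ?S) f = b)"
  proof -
    have S: "?S \<in> sets lebesgue" by simp
    have d: "((\<lambda>x. 1 / x) has_field_derivative - 1 / x^2) (at x within ?S)" if "x \<in> ?S" for x
      using that by (auto intro!: derivative_eq_intros simp: power2_eq_square)
    have i: "inj_on (\<lambda>x. 1 / x) ?S" by (auto simp: inj_on_def)
    show ?thesis by (rule has_absolute_integral_change_of_variables_1'[of ?S "\<lambda>x. 1 / x" "\<lambda>x. - 1 / x^2" f b, OF S d i])
  qed
  ultimately have g: "(\<lambda>x. \<bar>- 1 / x^2\<bar> * f (1 / x)) absolutely_integrable_on ?S" "integral ?S (\<lambda>x. \<bar>- 1 / x^2\<bar> * f (1 / x)) = b"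
    by simp_all
  have gi: "set_integrable lborel ?S (\<lambda>x. \<bar>- 1 / x^2\<bar> * f (1 / x))"
    using g(1) unfolding set_integrable_def by (subst (asm) integrable_completion) auto
  have "(\<integral>x. (if 1 < x then f (1 / x) / x^2 else 0) \<partial>lborel) = b"
    using set_borel_integral_eq_integral(2)[OF gi] g(2) unfolding set_lebesgue_integral_def e2 by simp
  moreover have "(\<integral>x. (if 0 < x \<and> x < 1 then f x else 0) \<partial>lborel) = b"
    using set_borel_integral_eq_integral(2)[OF si] unfolding set_lebesgue_integral_def e b_def by simp
  ultimately show ?thesis by simp
qed

lemma integral_inversion_complex:
  fixes f :: "real \<Rightarrow> complex"
  assumes f: "integrable lborel (\<lambda>x. if 0 < x \<and> x < 1 then f x else 0)" and m: "f \<in> borel_measurable borel"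
    and g: "integrable lborel (\<lambda>x. if 1 < x then f (1 / x) / of_real (x^2) else 0)"
  shows "(\<integral>x. (if 0 < x \<and> x < 1 then f x else 0) \<partial>lborel) = (\<integral>x. (if 1 < x then f (1 / x) / of_real (x^2) else 0) \<partial>lborel)"
proof (rule complex_eqI)
  note m[measurable]
  have e: "Re (if 0 < x \<and> x < 1 then f x else 0) = (if 0 < x \<and> x < 1 then Re (f x) else 0)"
    "Im (if 0 < x \<and> x < 1 then f x else 0) = (if 0 < x \<and> x < 1 then Im (f x) else 0)" for x by simp_all
  have e2: "Re (if 1 < x then f (1 / x) / of_real (x^2) else 0) = (if 1 < x then Re (f (1 / x)) / x^2 else 0)"
    "Im (if 1 < x then f (1 / x) / of_real (x^2) else 0) = (if 1 < x then Im (f (1 / x)) / x^2 else 0)" for x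
    using Re_divide_of_real[of "f (1/x)" "x^2"] Im_divide_of_real[of "f (1/x)" "x^2"] by simp_all
  have mm: "(\<lambda>x. Re (f x)) \<in> borel_measurable borel" "(\<lambda>x. Im (f x)) \<in> borel_measurable borel" by simp_all
  have ff: "integrable lborel (\<lambda>x. if 0 < x \<and> x < 1 then Re (f x) else 0)" "integrable lborel (\<lambda>x. if 0 < x \<and> x < 1 then Im (f x) else 0)"
    using integrable_Re[OF f] integrable_Im[OF f] unfolding e .
  show "Re (\<integral>x. (if 0 < x \<and> x < 1 then f x else 0) \<partial>lborel) = Re (\<integral>x. (if 1 < x then f (1 / x) / of_real (x^2) else 0) \<partial>lborel)"
    unfolding integral_Re[OF f, symmetric] integral_Re[OF g, symmetric] e e2 by (rule integral_inversion_real[OF ff(1) mm(1)])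
  show "Im (\<integral>x. (if 0 < x \<and> x < 1 then f x else 0) \<partial>lborel) = Im (\<integral>x. (if 1 < x then f (1 / x) / of_real (x^2) else 0) \<partial>lborel)"
    unfolding integral_Im[OF f, symmetric] integral_Im[OF g, symmetric] e e2 by (rule integral_inversion_real[OF ff(2) mm(2)])
qed

text \<open>The exponents are s/2 - 1 and (1 - s)/2 - 1, so s -> 1 - s merely swaps them.\<close>

definition xi_kernel :: "complex \<Rightarrow> real \<Rightarrow> complex" where
  "xi_kernel s x = (if 1 < x then of_real (theta_tail x) * (of_real x powr (s/2 - 1) + of_real x powr (- s/2 - 1/2)) else 0)"

lemma xi_kernel_measurable [measurable]: "xi_kernel s \<in> borel_measurable borel"
  unfolding xi_kernel_def[abs_def] by measurable

lemma theta_tail_le_exp: "1 < x \<Longrightarrow> theta_tail x \<le> 2 * exp (- x)"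
proof -
  assume x: "1 < x"
  have "exp (- pi * x) \<le> exp (- x)" using x pi_gt3 by simp
  moreover have "exp (- pi * x) \<le> 1/2"
  proof -
    have "pi * x \<ge> 1 * 1" using x pi_gt3 by (intro mult_mono) auto
    then have "exp (pi * x) \<ge> 1 + pi * x" "1 + pi * x \<ge> 2" using exp_ge_add_one_self by auto
    then have "2 \<le> exp (pi * x)" by linarith
    then show ?thesis by (simp add: exp_minus field_simps)
  qed
  ultimately have "exp (- pi * x) / (1 - exp (- pi * x)) \<le> exp (- x) / (1/2)"
    by (intro frac_le) auto
  then show ?thesis using theta_tail_le(1)[of x] x by simp
qed

text \<open>Both exponents are at most N in real part and theta decays like exp (- x), so the kernel
  is dominated by a Gamma integrand with integral N!. This is the source of the factorial growth
  bound.\<close>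

lemma cmod_xi_kernel_le:
  assumes s: "cmod s \<le> real N"
  shows "cmod (xi_kernel s x) \<le> 4 * cmod (gamma_kernel 1 (of_nat N + 1) x)"
proof (cases "1 < x")
  case True
  have th: "\<bar>theta_tail x\<bar> \<le> 2 * exp (- x)" using theta_tail_le_exp[OF True] theta_tail_le(2)[of x] True by simp
  have R: "\<bar>Re s\<bar> \<le> real N" using s abs_Re_le_cmod[of s] by linarith
  have p: "cmod (of_real x powr (s/2 - 1)) \<le> x powr real N" "cmod (of_real x powr (- s/2 - 1/2)) \<le> x powr real N"
    using True R by (auto simp: norm_powr_real_powr intro!: powr_mono)
  have "cmod (xi_kernel s x) \<le> \<bar>theta_tail x\<bar> * (cmod (of_real x powr (s/2 - 1)) + cmod (of_real x powr (- s/2 - 1/2)))"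
    using True by (simp add: xi_kernel_def norm_mult mult_left_mono norm_triangle_ineq)
  also have "\<dots> \<le> (2 * exp (- x)) * (x powr real N + x powr real N)"
    using th p by (intro mult_mono add_mono) auto
  also have "\<dots> = 4 * cmod (gamma_kernel 1 (of_nat N + 1) x)"
    using True by (simp add: gamma_kernel_def norm_mult norm_power powr_realpow)
  finally show ?thesis .
qed (simp add: xi_kernel_def)

lemma integrable_xi_bound: "integrable lborel (\<lambda>x. 4 * cmod (gamma_kernel 1 (of_nat N + 1) x))"
  by (intro integrable_mult_right integrable_norm integrable_gamma_kernel) auto

lemma integral_xi_bound: "(\<integral>x. 4 * cmod (gamma_kernel 1 (of_nat N + 1) x) \<partial>lborel) = 4 * fact N"
proof -
  have r: "0 < Re (of_nat N + 1)" by simp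
  have e: "cmod (gamma_kernel 1 (of_nat N + 1) x) = Re (gamma_kernel 1 (of_nat N + 1) x)" for x
    unfolding cmod_gamma_kernel[of 1 "of_nat N + 1"] by simp
  have "(\<integral>x. cmod (gamma_kernel 1 (of_nat N + 1) x) \<partial>lborel) = Re (Gamma (of_nat N + 1))"
    unfolding e integral_Re[OF integrable_gamma_kernel[OF r zero_less_one]] integral_gamma_kernel[OF r zero_less_one] by simp
  also have "\<dots> = fact N" using Gamma_fact[of N, where 'a = complex] by (simp add: add.commute)
  finally show ?thesis by simp
qed

definition xi_entire :: "complex \<Rightarrow> complex" where "xi_entire s = (\<integral>x. xi_kernel s x \<partial>lborel)"

lemma ex_nat_ge_cmod: obtains N where "cmod s \<le> real N" "real N \<le> cmod s + 1"
  using that[of "nat \<lceil>cmod s\<rceil>"] by simp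

lemma integrable_xi_kernel: "integrable lborel (xi_kernel s)"
proof -
  obtain N where "cmod s \<le> real N" by (rule ex_nat_ge_cmod)
  note b = cmod_xi_kernel_le[OF this]
  show ?thesis by (rule Bochner_Integration.integrable_bound[OF integrable_xi_bound[of N]]) (use b in auto)
qed

lemma cmod_xi_entire_le: "cmod s \<le> real N \<Longrightarrow> cmod (xi_entire s) \<le> 4 * fact N"
proof -
  assume "cmod s \<le> real N"
  then have "cmod (xi_entire s) \<le> (\<integral>x. 4 * cmod (gamma_kernel 1 (of_nat N + 1) x) \<partial>lborel)"
    unfolding xi_entire_def
    by (intro Bochner_Integration.integral_norm_bound_integral integrable_xi_kernel integrable_xi_bound cmod_xi_kernel_le)
  then show ?thesis unfolding integral_xi_bound .
qed

lemma holomorphic_xi_entire: "xi_entire holomorphic_on UNIV"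
  unfolding xi_entire_def[abs_def]
proof (rule holomorphic_parametric_integral)
  show "(\<lambda>s. xi_kernel s x) holomorphic_on UNIV" for x
    by (cases "1 < x") (auto simp: xi_kernel_def[abs_def] intro!: holomorphic_intros)
  fix s :: complex
  show "xi_kernel s \<in> borel_measurable lborel" by simp
  obtain N where N: "cmod s + 1 \<le> real N" using ex_nat_ge_cmod[of "of_real (cmod s + 1)"] by (auto simp del: of_real_add)
  show "\<exists>r>0. \<exists>M. ball s r \<subseteq> UNIV \<and> integrable lborel M \<and> (\<forall>z\<in>ball s r. \<forall>x. cmod (xi_kernel z x) \<le> M x)"
  proof (intro exI[of _ 1] exI[of _ "\<lambda>x. 4 * cmod (gamma_kernel 1 (of_nat N + 1) x)"] conjI ballI allI integrable_xi_bound)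
    fix z x assume z: "z \<in> ball s 1"
    have "cmod z \<le> cmod s + cmod (z - s)" by (metis add.commute diff_add_cancel norm_triangle_ineq)
    also have "cmod (z - s) \<le> 1" using z by (simp add: dist_norm norm_minus_commute)
    finally have "cmod z \<le> real N" using N by simp
    then show "cmod (xi_kernel z x) \<le> 4 * cmod (gamma_kernel 1 (of_nat N + 1) x)" by (rule cmod_xi_kernel_le)
  qed auto
qed simp

lemma xi_entire_reflect: "xi_entire (1 - s) = xi_entire s"
proof -
  have "(1 - s)/2 - 1 = - s/2 - 1/2" "- (1 - s)/2 - 1/2 = s/2 - 1" by (simp_all add: field_simps)
  then have "xi_kernel (1 - s) x = xi_kernel s x" for x
    unfolding xi_kernel_def by (simp only: add.commute)
  then show ?thesis by (simp add: xi_entire_def)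
qed

text \<open>The Mellin integral is split at x = 1 and the lower part carried to x > 1 by x -> 1/x.
  The transformation law turns it into the second half of \<open>xi_kernel\<close> plus two pure
  powers, whose integrals are the polar terms 1/(s - 1) and - 1/s.\<close>

lemma completed_zeta_integral:
  assumes s: "Re s > 1"
  shows "Gamma (s/2) * complex_of_real pi powr (- (s/2)) * zeta s = xi_entire s + 1 / (s - 1) - 1 / s"
proof -
  let ?lo = "\<lambda>x. if 0 < x \<and> x < 1 then theta_mellin s x else 0"
  let ?hi = "\<lambda>x. if 1 < x then theta_mellin s x else 0"
  let ?a = "\<lambda>x. if 1 < x then of_real (theta_tail x) * of_real x powr (- s/2 - 1/2) else (0::complex)"
  let ?P = "\<lambda>w x. if 1 < x then complex_of_real x powr w else 0"
  note I = integrable_theta_mellin[OF s]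
  have "theta_mellin s \<in> borel_measurable lborel" using I by (rule borel_measurable_integrable)
  then have meas[measurable]: "theta_mellin s \<in> borel_measurable borel" by simp
  have "(\<lambda>x. indicat_real {0<..<1} x *\<^sub>R theta_mellin s x) = ?lo" "(\<lambda>x. indicat_real {1<..} x *\<^sub>R theta_mellin s x) = ?hi"
    by (auto simp: fun_eq_iff indicator_def)
  then have lo: "integrable lborel ?lo" and hi: "integrable lborel ?hi"
    using integrable_mult_indicator[OF _ I, of "{0<..<1}"] integrable_mult_indicator[OF _ I, of "{1<..}"] by simp_all
  have ae: "AE x in lborel. theta_mellin s x = ?lo x + ?hi x"
    using AE_lborel_singleton[of "1::real"] by eventually_elim (auto simp: theta_mellin_def)
  have "(\<integral>x. theta_mellin s x \<partial>lborel) = (\<integral>x. ?lo x + ?hi x \<partial>lborel)"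
    by (rule integral_cong_AE) (use ae in auto)
  also have "\<dots> = (\<integral>x. ?lo x \<partial>lborel) + (\<integral>x. ?hi x \<partial>lborel)" by (rule Bochner_Integration.integral_add[OF lo hi])
  finally have split: "(\<integral>x. theta_mellin s x \<partial>lborel) = (\<integral>x. ?lo x \<partial>lborel) + (\<integral>x. ?hi x \<partial>lborel)" .
  have xi: "xi_kernel s x = ?hi x + ?a x" for x by (simp add: xi_kernel_def theta_mellin_def distrib_left)
  have "integrable lborel (\<lambda>x. xi_kernel s x - ?hi x)" by (intro Bochner_Integration.integrable_diff integrable_xi_kernel hi)
  then have a: "integrable lborel ?a" unfolding xi by simp
  have xie: "xi_entire s = (\<integral>x. ?hi x \<partial>lborel) + (\<integral>x. ?a x \<partial>lborel)"
    unfolding xi_entire_def xi by (rule Bochner_Integration.integral_add[OF hi a])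
  have w: "Re (- s/2 - 1/2) < -1" "Re (- s/2 - 1) < -1" using s by auto
  note P1 = integrable_powr_tail_complex[OF w(1)] integral_powr_tail_complex[OF w(1)]
  note P2 = integrable_powr_tail_complex[OF w(2)] integral_powr_tail_complex[OF w(2)]
  \<comment> \<open>Solving the transformation law for theta_tail (1/x) gives (sqrt x (1 + 2
    theta_tail x) - 1)/2; the terms without theta produce the two powers with weight 1/2.\<close>
  have inv: "(if 1 < x then theta_mellin s (1 / x) / of_real (x^2) else 0) = ?a x + (1/2 * ?P (- s/2 - 1/2) x - 1/2 * ?P (- s/2 - 1) x)" for x
  proof (cases "1 < x")
    case True
    then have x: "x > 0" by simp
    define T where "T = complex_of_real (theta_tail x)"
    define Q where "Q = complex_of_real x powr (- s/2 - 1)"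
    have "theta_tail (1 / x) = (sqrt x * (1 + 2 * theta_tail x) - 1) / 2"
      using theta_functional_equation[OF x] x by (simp add: field_simps)
    then have th: "complex_of_real (theta_tail (1 / x)) = (of_real (sqrt x) * (1 + 2 * T) - 1) / 2"
      unfolding T_def by (simp only: of_real_mult of_real_add of_real_diff of_real_divide of_real_1 of_real_numeral)
    have "complex_of_real (1 / x) powr (s/2 - 1) = of_real x powr (- (s/2 - 1))" by (rule powr_inverse_pos[OF x])
    also have "\<dots> = of_real x powr (- s/2 - 1 + 2)" by (simp add: algebra_simps)
    also have "\<dots> = Q * of_real (x^2)" using x powr_add[of "complex_of_real x" "- s/2 - 1" 2] powr_nat[of "complex_of_real x" 2] by (simp add: Q_def)
    finally have p1: "complex_of_real (1 / x) powr (s/2 - 1) = Q * of_real (x^2)" .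
    have "- s/2 - 1/2 = - s/2 - 1 + 1/2" by simp
    then have "complex_of_real x powr (- s/2 - 1/2) = of_real x powr (- s/2 - 1 + 1/2)" by (rule arg_cong)
    also have "\<dots> = Q * of_real x powr (1/2)" unfolding Q_def by (rule powr_add)
    also have "complex_of_real x powr (1/2) = of_real (sqrt x)" using x powr_of_real[of x "1/2"] by (simp add: powr_half_sqrt)
    finally have p2: "complex_of_real x powr (- s/2 - 1/2) = Q * of_real (sqrt x)" .
    have m: "theta_mellin s (1 / x) = of_real (theta_tail (1 / x)) * of_real (1 / x) powr (s/2 - 1)" using x by (simp add: theta_mellin_def)
    have "theta_mellin s (1 / x) / of_real (x^2) = (of_real (sqrt x) * (1 + 2 * T) - 1) / 2 * Q"
      unfolding m th p1 using x by simp
    then show ?thesis using True unfolding T_def[symmetric] p2 Q_def[symmetric] by (simp add: algebra_simps add_divide_distrib diff_divide_distrib)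
  qed simp
  have half: "integrable lborel (\<lambda>x. 1/2 * ?P (- s/2 - 1/2) x)" "integrable lborel (\<lambda>x. 1/2 * ?P (- s/2 - 1) x)"
    by (intro integrable_mult_right P1 P2)+
  have invi: "integrable lborel (\<lambda>x. if 1 < x then theta_mellin s (1 / x) / of_real (x^2) else 0)"
    unfolding inv by (intro Bochner_Integration.integrable_add Bochner_Integration.integrable_diff a half)
  have "(\<integral>x. ?lo x \<partial>lborel) = (\<integral>x. (if 1 < x then theta_mellin s (1 / x) / of_real (x^2) else 0) \<partial>lborel)"
    by (rule integral_inversion_complex[OF lo meas invi])
  also have "\<dots> = (\<integral>x. ?a x \<partial>lborel) + ((\<integral>x. 1/2 * ?P (- s/2 - 1/2) x \<partial>lborel) - (\<integral>x. 1/2 * ?P (- s/2 - 1) x \<partial>lborel))"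
    unfolding inv Bochner_Integration.integral_add[OF a Bochner_Integration.integrable_diff[OF half]] Bochner_Integration.integral_diff[OF half] ..
  also have "\<dots> = (\<integral>x. ?a x \<partial>lborel) + (1/2 * (- 1 / (- s/2 - 1/2 + 1)) - 1/2 * (- 1 / (- s/2 - 1 + 1)))"
    unfolding integral_mult_right_zero P1(2) P2(2) ..
  also have "1/2 * (- 1 / (- s/2 - 1/2 + 1)) - 1/2 * (- 1 / (- s/2 - 1 + 1)) = 1 / (s - 1) - 1 / s"
  proof -
    have h: "1/2 * (- 1 / (- d / 2)) = 1 / d" for d :: complex by simp
    have e: "- s/2 - 1/2 + 1 = - (s - 1) / 2" "- s/2 - 1 + 1 = - s / 2" by (simp_all add: field_simps)
    show ?thesis unfolding e h ..
  qed
  finally show ?thesis unfolding integral_theta_mellin[OF s, symmetric] split xie by simp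
qed

text \<open>Twice Riemann's xi function: multiplying the completed zeta function by s (s - 1) turns
  the polar terms into the constant 1.\<close>

definition xi_poly :: "complex \<Rightarrow> complex" where "xi_poly s = 1 + s * (s - 1) * xi_entire s"

text \<open>Proved where the Dirichlet series converges and continued to Re s > 0, both sides being
  holomorphic there. The square comes from s (s - 1) times s/(s - 1).\<close>

lemma xi_poly_eq_zreg:
  assumes s: "Re s > 0"
  shows "xi_poly s = s^2 * (Gamma (s/2) * complex_of_real pi powr (- (s/2))) * zreg s"
proof (rule analytic_continuation_open[of "{s. 1 < Re s}" "{s. 0 < Re s}" xi_poly _ s])
  show "open {s. 1 < Re s}" "open {s. 0 < Re s}" by (rule open_halfspace_Re_gt)+
  show "connected {s. 0 < Re s}" by (rule convex_connected[OF convex_halfspace_Re_gt])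
  have "2 \<in> {s. 1 < Re s}" by simp
  then show "{s. 1 < Re s} \<noteq> {}" by blast
  show "{s. 1 < Re s} \<subseteq> {s. 0 < Re s}" by auto
  show "xi_poly holomorphic_on {s. 0 < Re s}"
    unfolding xi_poly_def[abs_def] by (intro holomorphic_intros holomorphic_on_subset[OF holomorphic_xi_entire]) auto
  have G: "(\<lambda>s. Gamma (s/2)) holomorphic_on {s. 0 < Re s}"
    by (intro holomorphic_Gamma' holomorphic_intros) (auto elim!: nonpos_Ints_cases simp: complex_eq_iff)
  show "(\<lambda>s. s^2 * (Gamma (s/2) * complex_of_real pi powr (- (s/2))) * zreg s) holomorphic_on {s. 0 < Re s}"
    by (intro holomorphic_intros holomorphic_zreg G) auto
  fix z assume "z \<in> {s. 1 < Re s}"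
  then have z: "Re z > 1" by simp
  then have n: "z \<noteq> 1" "z \<noteq> 0" "z - 1 \<noteq> 0" by auto
  have "Gamma (z/2) * complex_of_real pi powr (- (z/2)) * (z / (z - 1) * zreg z) = xi_entire z + 1 / (z - 1) - 1 / z"
    using completed_zeta_integral[OF z] zeta_eq_zreg[OF n(1)] by simp
  then have "z * (z - 1) * (Gamma (z/2) * complex_of_real pi powr (- (z/2)) * (z / (z - 1) * zreg z)) = z * (z - 1) * (xi_entire z + 1 / (z - 1) - 1 / z)"
    by simp
  moreover have "z * (z - 1) * (xi_entire z + 1 / (z - 1) - 1 / z) = xi_poly z" using n by (simp add: xi_poly_def field_simps)
  moreover have "z * (z - 1) * (Gamma (z/2) * complex_of_real pi powr (- (z/2)) * (z / (z - 1) * zreg z)) = z^2 * (Gamma (z/2) * complex_of_real pi powr (- (z/2))) * zreg z"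
    using n by (simp add: power2_eq_square)
  ultimately show "xi_poly z = z^2 * (Gamma (z/2) * complex_of_real pi powr (- (z/2))) * zreg z" by simp
qed (use s in simp)

lemma xi_poly_reflect: "xi_poly (1 - s) = xi_poly s"
  by (simp add: xi_poly_def xi_entire_reflect algebra_simps)

lemma gamma_factor_nonzero: "Re s > 0 \<Longrightarrow> s^2 * (Gamma (s/2) * complex_of_real pi powr (- (s/2))) \<noteq> 0"
proof -
  assume s: "Re s > 0"
  then have "s \<noteq> 0" by auto
  moreover have "s / 2 \<notin> \<int>\<^sub>\<le>\<^sub>0" using s by (auto elim!: nonpos_Ints_cases simp: complex_eq_iff)
  then have "Gamma (s/2) \<noteq> 0" by (simp add: Gamma_eq_zero_iff)
  ultimately show ?thesis by simp
qed

lemma xi_poly_half: "xi_poly (1/2) \<noteq> 0"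
  using xi_poly_eq_zreg[of "1/2"] gamma_factor_nonzero[of "1/2"] zreg_real_nonzero[of "1/2"] by simp

definition xi_fun :: "complex \<Rightarrow> complex" where "xi_fun w = xi_poly (1/2 + w) / xi_poly (1/2)"

text \<open>With R = (1 + |w|)^(3/2), the exponent 10 is 6 + 2 + 2: the factorial bound with N <= 2
  (1 + |w|) gives 6R, and the quadratic polynomial and the numerical factor 5 are each at most exp
  (2R). The logarithm pays for the normalisation at 0.\<close>

definition xi_bound :: real where "xi_bound = 10 + \<bar>ln (cmod (xi_poly (1/2)))\<bar>"

lemma fact_le_exp: "real (fact N) \<le> exp (2 * real N powr (3/2))"
proof (cases "N = 0")
  case False
  then have N: "real N > 0" by simp
  have "ln (sqrt (real N)) \<le> sqrt (real N)" using ln_le_minus_one[of "sqrt (real N)"] N by simp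
  then have l: "ln (real N) \<le> 2 * sqrt (real N)" using N by (simp add: ln_sqrt)
  have "real (fact N) \<le> real N ^ N" using fact_le_power[of N, where 'a = real] by simp
  also have "\<dots> = exp (real N * ln (real N))" using N by (simp add: exp_of_nat_mult)
  also have "\<dots> \<le> exp (real N * (2 * sqrt (real N)))" using l by (simp add: mult_left_mono)
  also have "real N * (2 * sqrt (real N)) = 2 * real N powr (3/2)"
    using powr_add[of "real N" 1 "1/2"] N by (simp add: powr_half_sqrt)
  finally show ?thesis .
qed simp

lemma cmod_xi_fun_le: "cmod (xi_fun w) \<le> exp (xi_bound * (1 + cmod w) powr (3/2))"
proof -
  define r where "r = 1 + cmod w"
  define R where "R = r powr (3/2)"
  have r: "r \<ge> 1" by (simp add: r_def)
  have Rr: "r \<le> R" using powr_mono[of 1 "3/2" r] r by (simp add: R_def)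
  then have R: "R \<ge> 1" using r by simp
  have s: "cmod (1/2 + w) \<le> r" "cmod (1/2 + w - 1) \<le> r"
    using norm_triangle_ineq[of "1/2" w] norm_triangle_ineq[of "w" "-1/2"] by (simp_all add: r_def algebra_simps)
  obtain N where N: "cmod (1/2 + w) \<le> real N" "real N \<le> cmod (1/2 + w) + 1" by (rule ex_nat_ge_cmod)
  have "real N powr (3/2) \<le> (2 * r) powr (3/2)" using N(2) s(1) r by (intro powr_mono2) auto
  also have "\<dots> = 2 powr (3/2) * R" using r by (simp add: powr_mult R_def)
  also have "2 powr (3/2) \<le> (3::real)"
  proof -
    have "2 powr (3/2) = 2 * sqrt (2::real)" using powr_add[of "2::real" 1 "1/2"] by (simp add: powr_half_sqrt)
    moreover have "sqrt (2::real) \<le> 3/2" by (rule real_le_lsqrt) (auto simp: power2_eq_square)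
    ultimately show ?thesis by simp
  qed
  finally have N3: "real N powr (3/2) \<le> 3 * R" using R by simp
  have E: "cmod (xi_entire (1/2 + w)) \<le> 4 * exp (6 * R)"
  proof -
    have "cmod (xi_entire (1/2 + w)) \<le> 4 * fact N" by (rule cmod_xi_entire_le[OF N(1)])
    also have "\<dots> \<le> 4 * exp (2 * real N powr (3/2))" using fact_le_exp[of N] by simp
    also have "\<dots> \<le> 4 * exp (6 * R)" using N3 by simp
    finally show ?thesis .
  qed
  have r2: "r^2 \<le> exp (2 * R)"
  proof -
    have "r \<le> exp R" using exp_ge_add_one_self[of R] Rr by linarith
    then have "r^2 \<le> exp R ^ 2" using r by (intro power_mono) auto
    then show ?thesis by (simp add: exp_double)
  qed
  have e5: "5 \<le> exp (2 * R)"
  proof -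
    have "5/2 \<le> exp (1::real)" using exp_lower_Taylor_quadratic[of "1::real"] by simp
    then have "(5/2)^2 \<le> exp (1::real) ^ 2" by (intro power_mono) auto
    then have "5 \<le> exp (2::real)" by (simp add: exp_double[of 1, simplified] power2_eq_square)
    also have "\<dots> \<le> exp (2 * R)" using R by simp
    finally show ?thesis .
  qed
  have "cmod (xi_poly (1/2 + w)) \<le> 1 + r * r * (4 * exp (6 * R))"
    unfolding xi_poly_def
  proof (rule order_trans[OF norm_triangle_ineq])
    have "cmod ((1/2 + w) * (1/2 + w - 1) * xi_entire (1/2 + w)) \<le> r * r * (4 * exp (6 * R))"
      unfolding norm_mult using s E r by (intro mult_mono) auto
    then show "cmod 1 + cmod ((1/2 + w) * (1/2 + w - 1) * xi_entire (1/2 + w)) \<le> 1 + r * r * (4 * exp (6 * R))" by simp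
  qed
  also have "\<dots> \<le> r^2 * exp (6 * R) + r * r * (4 * exp (6 * R))"
    using mult_mono[of 1 "r^2" 1 "exp (6 * R)"] r R by simp
  also have "\<dots> = 5 * (r^2 * exp (6 * R))" by (simp add: power2_eq_square algebra_simps)
  also have "\<dots> \<le> exp (2 * R) * (exp (2 * R) * exp (6 * R))" using e5 r2 by (intro mult_mono) auto
  also have "\<dots> = exp (10 * R)" by (simp add: exp_add[symmetric])
  finally have X: "cmod (xi_poly (1/2 + w)) \<le> exp (10 * R)" .
  define l where "l = ln (cmod (xi_poly (1/2)))"
  have el: "cmod (xi_poly (1/2)) = exp l" using xi_poly_half by (simp add: l_def)
  have "cmod (xi_fun w) = cmod (xi_poly (1/2 + w)) * exp (- l)"
    unfolding xi_fun_def norm_divide el exp_minus by (rule divide_inverse)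
  also have "\<dots> \<le> exp (10 * R) * exp (- l)" using X by (rule mult_right_mono) simp
  also have "\<dots> = exp (10 * R - l)" by (simp add: exp_add[symmetric])
  also have "\<dots> \<le> exp (xi_bound * R)"
  proof -
    have "- l \<le> \<bar>l\<bar> * 1" by simp
    also have "\<dots> \<le> \<bar>l\<bar> * R" using R by (intro mult_left_mono) auto
    finally show ?thesis by (simp add: xi_bound_def l_def[symmetric] distrib_right)
  qed
  finally show ?thesis by (simp add: R_def r_def)
qed

interpretation xi: even_entire xi_fun xi_bound
proof
  show "xi_fun holomorphic_on UNIV"
    unfolding xi_fun_def[abs_def] xi_poly_def[abs_def]
    by (intro holomorphic_intros holomorphic_on_compose_gen[OF _ holomorphic_xi_entire, unfolded o_def]) (use xi_poly_half in \<open>auto simp: xi_poly_def\<close>)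
  show "xi_fun 0 = 1" using xi_poly_half by (simp add: xi_fun_def)
  show "xi_fun (- z) = xi_fun z" for z using xi_poly_reflect[of "1/2 + z"] by (simp add: xi_fun_def algebra_simps)
  show "xi_bound \<ge> 0" by (simp add: xi_bound_def)
  show "cmod (xi_fun z) \<le> exp (xi_bound * (1 + cmod z) powr (3/2))" for z by (rule cmod_xi_fun_le)
qed

lemma xi_fun_zero_iff: "Re w > -1/2 \<Longrightarrow> xi_fun w = 0 \<longleftrightarrow> zeta (1/2 + w) = 0"
  using xi_poly_eq_zreg[of "1/2 + w"] gamma_factor_nonzero[of "1/2 + w"] zeta_zero_iff[of "1/2 + w"] xi_poly_half
  by (simp add: xi_fun_def)

lemma xi_Z_Re_less: "w \<in> xi.Z \<Longrightarrow> Re w < 1/2"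
proof (rule ccontr)
  assume w: "w \<in> xi.Z" "\<not> Re w < 1/2"
  then have "zeta (1/2 + w) = 0" using xi_fun_zero_iff[of w] by (simp add: xi.Z_def)
  moreover have "1/2 + w \<noteq> 1" using calculation zeta_1_nonzero by auto
  ultimately show False using zeta_nonzero_Re_ge_1[of "1/2 + w"] w(2) by simp
qed

text \<open>Non-vanishing of \<open>zeta\<close> for Re s >= 1 handles one side of the strip and
  evenness of \<open>xi_fun\<close> the other.\<close>

lemma xi_Z_abs_Re: "w \<in> xi.Z \<Longrightarrow> \<bar>Re w\<bar> < 1/2"
  using xi_Z_Re_less[of w] xi_Z_Re_less[of "-w"] xi.uminus_Z[of w] by simp

text \<open>No zero is real, so w -> -w exchanges zeros above and below the real axis without fixed
  or doubly counted points, although \<open>Nzeta\<close> includes ordinate 0.\<close>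

lemma xi_Z_Im: "w \<in> xi.Z \<Longrightarrow> Im w \<noteq> 0"
proof
  assume w: "w \<in> xi.Z" "Im w = 0"
  note R = xi_Z_abs_Re[OF w(1)]
  have "zeta (1/2 + w) = 0" using xi_fun_zero_iff[of w] w(1) R by (simp add: xi.Z_def)
  then have "zreg (1/2 + w) = 0" using zeta_zero_iff[of "1/2 + w"] R by simp
  moreover have "1/2 + w = of_real (1/2 + Re w)" using w(2) by (simp add: complex_eq_iff)
  ultimately show False using zreg_real_nonzero[of "1/2 + Re w"] R by simp
qed

lemma xi_zorder_local:
  obtains h r where "r > 0" "h holomorphic_on cball a r"
    "\<And>w. w \<in> cball a r \<Longrightarrow> xi_fun w = h w * (w - a) ^ xi.m a" "\<And>w. w \<in> cball a r \<Longrightarrow> h w \<noteq> 0"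
proof (rule zorder_local_form[OF xi.holo, of a])
  show "\<exists>w\<in>UNIV. xi_fun w \<noteq> 0" using xi.F0 by (intro bexI[of _ 0]) auto
  fix h r assume "r > 0" "h holomorphic_on cball a r"
    "\<And>w. w \<in> cball a r \<Longrightarrow> xi_fun w = h w * (w - a) ^ nat (zorder xi_fun a)" "\<And>w. w \<in> cball a r \<Longrightarrow> h w \<noteq> 0"
  then show thesis using that[of r h] by (simp add: xi.m_def)
qed auto

lemma nat_zorder_eqI:
  assumes "r > 0" "h holomorphic_on ball a r" "h a \<noteq> 0" "\<And>w. w \<in> ball a r \<Longrightarrow> f w = h w * (w - a) ^ n"
  shows "nat (zorder f a) = n"
proof -
  have "zorder f a = int n"
    by (rule zorder_eqI[OF open_ball _ assms(2,3)]) (use assms(1,4) in auto)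
  then show ?thesis by simp
qed

lemma xi_m_eq_zero_mult:
  assumes w: "w \<in> xi.Z" "Re w > -1/2"
  shows "xi.m w = zero_mult zeta (1/2 + w)"
proof -
  define G where "G s = s^2 * (Gamma (s/2) * complex_of_real pi powr (- (s/2)))" for s
  have G: "(\<lambda>s. Gamma (s/2)) holomorphic_on {s. 0 < Re s}"
    by (intro holomorphic_Gamma' holomorphic_intros) (auto elim!: nonpos_Ints_cases simp: complex_eq_iff)
  have hG: "G holomorphic_on {s. 0 < Re s}" unfolding G_def[abs_def] by (intro holomorphic_intros G) auto
  have s: "Re (1/2 + w) > 0" "zeta (1/2 + w) = 0" using w xi_fun_zero_iff[of w] by (auto simp: xi.Z_def)
  obtain h r where h: "r > 0" "h holomorphic_on cball w r" "\<And>v. v \<in> cball w r \<Longrightarrow> xi_fun v = h v * (v - w) ^ xi.m w" "\<And>v. v \<in> cball w r \<Longrightarrow> h v \<noteq> 0"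
    by (rule xi_zorder_local[where a = w]) (rule that)
  define e where "e = min r (Re (1/2 + w))"
  have e: "e > 0" using h(1) s(1) by (simp add: e_def)
  have bR: "Re v > 0" if "v \<in> ball (1/2 + w) e" for v
    using that abs_Re_le_cmod[of "1/2 + w - v"] by (auto simp: dist_norm e_def)
  have bb: "v - 1/2 \<in> ball w r" if "v \<in> ball (1/2 + w) e" for v
    using that by (simp add: dist_norm e_def algebra_simps)
  have "nat (zorder zreg (1/2 + w)) = xi.m w"
  proof (rule nat_zorder_eqI[OF e, of "\<lambda>v. h (v - 1/2) * xi_poly (1/2) / G v"])
    have "(\<lambda>v. h (v - 1/2)) holomorphic_on ball (1/2 + w) e"
      by (rule holomorphic_on_compose_gen[OF _ h(2), unfolded o_def]) (use bb in \<open>auto intro!: holomorphic_intros simp: less_imp_le\<close>)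
    moreover have "G holomorphic_on ball (1/2 + w) e" by (rule holomorphic_on_subset[OF hG]) (use bR in auto)
    moreover have "G v \<noteq> 0" if "v \<in> ball (1/2 + w) e" for v using gamma_factor_nonzero[OF bR[OF that]] by (simp add: G_def)
    ultimately show "(\<lambda>v. h (v - 1/2) * xi_poly (1/2) / G v) holomorphic_on ball (1/2 + w) e"
      by (intro holomorphic_intros) auto
    show "h (1/2 + w - 1/2) * xi_poly (1/2) / G (1/2 + w) \<noteq> 0"
      using h(4)[of w] h(1) xi_poly_half gamma_factor_nonzero[OF s(1)] by (simp add: G_def)
    fix v assume v: "v \<in> ball (1/2 + w) e"
    have g: "G v \<noteq> 0" using gamma_factor_nonzero[OF bR[OF v]] by (simp add: G_def)
    have "xi_poly v / xi_poly (1/2) = h (v - 1/2) * (v - 1/2 - w) ^ xi.m w"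
      using h(3)[of "v - 1/2"] bb[OF v] by (simp add: xi_fun_def)
    moreover have "xi_poly v = G v * zreg v" using xi_poly_eq_zreg[OF bR[OF v]] by (simp add: G_def)
    ultimately have "G v * zreg v = h (v - 1/2) * (v - 1/2 - w) ^ xi.m w * xi_poly (1/2)" using xi_poly_half by (simp add: field_simps)
    then show "zreg v = h (v - 1/2) * xi_poly (1/2) / G v * (v - (1/2 + w)) ^ xi.m w" using g by (simp add: field_simps diff_diff_eq)
  qed
  then show ?thesis using zero_mult_eq_zorder[OF s] by simp
qed

section \<open>Summation over families of logarithmic factors\<close>

lemma summable_on_absI:
  fixes f :: "'a \<Rightarrow> real"
  assumes "g summable_on A" "\<And>i. i \<in> A \<Longrightarrow> P i \<Longrightarrow> \<bar>f i\<bar> \<le> g i" "finite {i \<in> A. \<not> P i}"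
  shows "f summable_on A"
proof -
  have "g summable_on {i \<in> A. P i}" by (rule summable_on_subset_banach[OF assms(1)]) auto
  then have "(\<lambda>i. norm (f i)) summable_on {i \<in> A. P i}"
    by (rule Infinite_Sum.abs_summable_on_comparison_test') (use assms(2) in auto)
  then have "f summable_on {i \<in> A. P i}" by (rule Infinite_Sum.abs_summable_summable)
  then have "f summable_on ({i \<in> A. P i} \<union> {i \<in> A. \<not> P i})"
    by (rule summable_on_Un_disjoint[OF _ summable_on_finite[OF assms(3)]]) auto
  moreover have "{i \<in> A. P i} \<union> {i \<in> A. \<not> P i} = A" by auto
  ultimately show ?thesis by simp
qed

text \<open>Reduction to series over the naturals: A is enumerated and padded with the zero function
  outside the image, which treats finite and infinite A alike.\<close>

lemma
  fixes f :: "'i \<Rightarrow> 'b \<Rightarrow> real"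
  assumes A: "countable A" and int: "\<And>i. i \<in> A \<Longrightarrow> integrable M (f i)"
    and pt: "\<And>x. (\<lambda>i. f i x) summable_on A" and summ: "(\<lambda>i. \<integral>x. \<bar>f i x\<bar> \<partial>M) summable_on A"
  shows integrable_infsum: "integrable M (\<lambda>x. \<Sum>\<^sub>\<infinity>i\<in>A. f i x)" (is ?A)
    and has_sum_integral: "((\<lambda>i. \<integral>x. f i x \<partial>M) has_sum (\<integral>x. (\<Sum>\<^sub>\<infinity>i\<in>A. f i x) \<partial>M)) A" (is ?B)
proof -
  define e where "e = to_nat_on A"
  have inj: "inj_on e A" unfolding e_def using A by (rule inj_on_to_nat_on)
  define g where "g n = (if n \<in> e ` A then f (inv_into A e n) else (\<lambda>_. 0))" for n
  have ge: "g (e i) = f i" if "i \<in> A" for i using that inj by (simp add: g_def)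
  have g0: "g n = (\<lambda>_. 0)" if "n \<notin> e ` A" for n using that by (simp add: g_def)
  have bij: "bij_betw e A (e ` A)" using inj by (simp add: bij_betw_def)
  \<comment> \<open>One statement for point evaluation, integral and L1 norm alike: all that matters
    is that F kills the padding.\<close>
  have transfer: "((\<lambda>n. F (g n)) has_sum S) UNIV \<longleftrightarrow> ((\<lambda>i. F (f i)) has_sum S) A" if F0: "F (\<lambda>_. 0) = 0" for F :: "('b \<Rightarrow> real) \<Rightarrow> real" and S
  proof -
    have "((\<lambda>n. F (g n)) has_sum S) UNIV \<longleftrightarrow> ((\<lambda>n. F (g n)) has_sum S) (e ` A)"
    proof (rule has_sum_cong_neutral)
      fix n assume "n \<in> UNIV - e ` A"
      then have "n \<notin> e ` A" by simp
      then show "F (g n) = 0" unfolding g0[OF \<open>n \<notin> e ` A\<close>] by (simp only: F0)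
    qed simp_all
    also have "\<dots> \<longleftrightarrow> ((\<lambda>i. F (g (e i))) has_sum S) A"
      by (rule has_sum_reindex_bij_betw[OF bij, symmetric])
    also have "\<dots> \<longleftrightarrow> ((\<lambda>i. F (f i)) has_sum S) A" by (rule has_sum_cong) (simp add: ge)
    finally show ?thesis .
  qed
  have gi: "integrable M (g n)" for n using int by (auto simp: g_def inv_into_into)
  have pt': "((\<lambda>n. g n x) has_sum (\<Sum>\<^sub>\<infinity>i\<in>A. f i x)) UNIV" for x
    using transfer[of "\<lambda>h. h x"] has_sum_infsum[OF pt[of x]] by simp
  have "(\<lambda>n. g n x) summable_on UNIV" for x using pt'[of x] by (rule has_sum_imp_summable)
  then have "(\<lambda>n. norm (g n x)) summable_on UNIV" for x by (rule summable_on_iff_abs_summable_on_real[THEN iffD1])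
  then have aes: "AE x in M. summable (\<lambda>n. norm (g n x))" by (intro AE_I2 summable_on_imp_summable)
  obtain S where "((\<lambda>i. \<integral>x. \<bar>f i x\<bar> \<partial>M) has_sum S) A" using summ by (auto simp: summable_on_def)
  then have "((\<lambda>n. \<integral>x. norm (g n x) \<partial>M) has_sum S) UNIV"
    using transfer[of "\<lambda>h. \<integral>x. \<bar>h x\<bar> \<partial>M"] by simp
  then have sn: "summable (\<lambda>n. \<integral>x. norm (g n x) \<partial>M)" by (intro summable_on_imp_summable has_sum_imp_summable)
  have sg: "(\<Sum>n. g n x) = (\<Sum>\<^sub>\<infinity>i\<in>A. f i x)" for x using has_sum_imp_sums[OF pt'[of x]] by (simp add: sums_iff)
  show ?A using integrable_suminf[OF gi aes sn] unfolding sg .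
  have s: "(\<lambda>n. \<integral>x. g n x \<partial>M) sums (\<integral>x. (\<Sum>\<^sub>\<infinity>i\<in>A. f i x) \<partial>M)" using sums_integral[OF gi aes sn] unfolding sg .
  have "summable (\<lambda>n. norm (\<integral>x. g n x \<partial>M))"
    by (rule summable_comparison_test'[OF sn]) (use integral_norm_bound in auto)
  then have "((\<lambda>n. \<integral>x. g n x \<partial>M) has_sum (\<integral>x. (\<Sum>\<^sub>\<infinity>i\<in>A. f i x) \<partial>M)) UNIV"
    using s by (rule norm_summable_imp_has_sum)
  then show ?B
    using transfer[of "\<lambda>h. \<integral>x. h x \<partial>M"] by simp
qed

text \<open>Instantiated twice: by the zeros, reflected into the right half-plane and weighted by
  multiplicity, and by the poles of the Gamma factor with weight 1. Estimates of size n/|p|^2 are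
  required only for large |p|; the finitely many small parameters cannot affect convergence.\<close>

locale lnfac_family =
  fixes A :: "'i set" and p :: "'i \<Rightarrow> complex" and n :: "'i \<Rightarrow> real"
  assumes Re_p: "\<And>i. i \<in> A \<Longrightarrow> Re (p i) \<ge> 0" and p_nz: "\<And>i. i \<in> A \<Longrightarrow> p i \<noteq> 0" and n_nonneg: "\<And>i. n i \<ge> 0"
    and A_countable: "countable A" and summable_p: "(\<lambda>i. n i / cmod (p i)^2) summable_on A"
    and finite_p: "\<And>R. finite {i \<in> A. cmod (p i) < R}"
begin

lemma summable_bigO:
  fixes f :: "'i \<Rightarrow> real"
  assumes "\<And>i. i \<in> A \<Longrightarrow> cmod (p i) \<ge> R \<Longrightarrow> \<bar>f i\<bar> \<le> B * (n i / cmod (p i)^2)"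
  shows "f summable_on A"
  by (rule summable_on_absI[where P = "\<lambda>i. cmod (p i) \<ge> R", OF summable_on_cmult_right[OF summable_p, of B]])
    (use assms finite_p[of R] in \<open>auto simp: not_le\<close>)

abbreviation lnfac_sum :: "real \<Rightarrow> real" where
  "lnfac_sum u \<equiv> \<Sum>\<^sub>\<infinity>i\<in>A. n i * lnfac (p i) u"

lemma summable_lnfac: "(\<lambda>i. n i * lnfac (p i) u) summable_on A"
proof (rule summable_bigO[of "2 * \<bar>u\<bar>" _ "u^2"])
  fix i assume i: "i \<in> A" "2 * \<bar>u\<bar> \<le> cmod (p i)"
  have "\<bar>n i * lnfac (p i) u\<bar> = n i * \<bar>lnfac (p i) u\<bar>" using n_nonneg[of i] by (simp add: abs_mult)
  also have "\<dots> \<le> n i * (u^2 / cmod (p i)^2)" by (intro mult_left_mono abs_lnfac_small p_nz i n_nonneg)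
  finally show "\<bar>n i * lnfac (p i) u\<bar> \<le> u^2 * (n i / cmod (p i)^2)" by (simp add: mult_ac)
qed

lemma
  assumes K: "K \<in> borel_measurable borel" and KT: "integrable lborel (\<lambda>u. indicat_real {-T..T} u * K u)"
    and T: "T \<ge> 0" and C: "C \<ge> 0" and dec: "\<And>u. \<bar>u\<bar> > T \<Longrightarrow> \<bar>K u\<bar> \<le> C * diff_kernel 2 u"
    and Kint: "\<And>a. Re a \<ge> 0 \<Longrightarrow> a \<noteq> 0 \<Longrightarrow> integrable lborel (\<lambda>u. K u * lnfac a u)"
  shows integrable_kernel_family: "integrable lborel (\<lambda>u. K u * lnfac_sum u)" (is ?A)
    and has_sum_kernel_family: "((\<lambda>i. n i * (\<integral>u. K u * lnfac (p i) u \<partial>lborel)) has_sum (\<integral>u. K u * lnfac_sum u \<partial>lborel)) A" (is ?B)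
proof -
  obtain B where B: "B \<ge> 0" "\<And>a. Re a \<ge> 0 \<Longrightarrow> cmod a \<ge> max 4 (2 * T) \<Longrightarrow> (\<integral>u. \<bar>K u * lnfac a u\<bar> \<partial>lborel) \<le> B / cmod a ^ 2"
    by (rule kernel_lnfac_bound[OF K KT T C]) (erule dec, rule that)
  define f where "f i u = n i * (K u * lnfac (p i) u)" for i u
  have int: "integrable lborel (f i)" if "i \<in> A" for i
    unfolding f_def[abs_def] using Kint[OF Re_p p_nz] that by (intro integrable_mult_right) auto
  have feq: "f i u = K u * (n i * lnfac (p i) u)" for i u by (simp add: f_def)
  have pt: "(\<lambda>i. f i u) summable_on A" for u
    unfolding feq by (intro summable_on_cmult_right summable_lnfac)
  have summ: "(\<lambda>i. \<integral>u. \<bar>f i u\<bar> \<partial>lborel) summable_on A"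
  proof (rule summable_bigO[of "max 4 (2 * T)" _ B])
    fix i assume i: "i \<in> A" "max 4 (2 * T) \<le> cmod (p i)"
    have "(\<integral>u. \<bar>f i u\<bar> \<partial>lborel) = n i * (\<integral>u. \<bar>K u * lnfac (p i) u\<bar> \<partial>lborel)"
      using n_nonneg[of i] by (simp add: f_def abs_mult[of "n i"])
    also have "\<dots> \<le> n i * (B / cmod (p i)^2)" by (intro mult_left_mono B(2) Re_p i n_nonneg)
    finally show "\<bar>\<integral>u. \<bar>f i u\<bar> \<partial>lborel\<bar> \<le> B * (n i / cmod (p i)^2)" by (simp add: mult_ac)
  qed
  have e: "(\<Sum>\<^sub>\<infinity>i\<in>A. f i u) = K u * lnfac_sum u" for u
    unfolding feq by (rule infsum_cmult_right) (rule summable_lnfac)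
  have fi: "(\<integral>u. f i u \<partial>lborel) = n i * (\<integral>u. K u * lnfac (p i) u \<partial>lborel)" for i by (simp add: f_def)
  show ?A
    using integrable_infsum[OF A_countable int pt summ] unfolding e .
  show ?B
    using has_sum_integral[OF A_countable int pt summ] unfolding e fi .
qed

end

section \<open>The concrete kernels applied to whole families\<close>

lemma integrable_diff_kernel: "R \<ge> 1 \<Longrightarrow> integrable lborel (diff_kernel R)"
  and integral_diff_kernel: "R \<ge> 1 \<Longrightarrow> (\<integral>u. diff_kernel R u \<partial>lborel) = pi * (1 - 1 / R)"
proof -
  assume R: "R \<ge> 1"
  have I: "integrable lborel (\<lambda>u::real. 1 / (1 + u^2))" "integrable lborel (\<lambda>u. 1 / (R^2 + u^2))"
    using integrable_cauchy_kernel[of 1] integrable_cauchy_kernel[of R] R by simp_all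
  show "integrable lborel (diff_kernel R)" unfolding diff_kernel_def[abs_def] by (intro Bochner_Integration.integrable_diff I)
  have "(\<integral>u. diff_kernel R u \<partial>lborel) = pi - pi / R"
    unfolding diff_kernel_def[abs_def] Bochner_Integration.integral_diff[OF I]
    using integral_cauchy_kernel[of 1] integral_cauchy_kernel[of R] R by simp
  then show "(\<integral>u. diff_kernel R u \<partial>lborel) = pi * (1 - 1 / R)" by (simp add: right_diff_distrib)
qed

lemma diff_kernel_measurable [measurable]: "diff_kernel R \<in> borel_measurable borel"
  unfolding diff_kernel_def[abs_def] by measurable

lemma diff_kernel_le_2: "R \<ge> 1 \<Longrightarrow> diff_kernel R u \<le> 2 * R^2 * diff_kernel 2 u"
proof -
  assume R: "R \<ge> 1"
  have R2: "R^2 \<ge> 1" "R^2 > 0" using R by simp_all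
  have p: "1 + u^2 > 0" "R^2 + u^2 > 0" "4 + u^2 > 0" using R2 by (auto simp: add_pos_nonneg)
  have "(4 + u^2) * (R^2 - 1) \<le> (4 * (R^2 + u^2)) * R^2"
  proof (rule mult_mono)
    have "4 * (R^2 + u^2) = 4 * R^2 + 4 * u^2" by simp
    then show "4 + u^2 \<le> 4 * (R^2 + u^2)" using R2(1) zero_le_power2[of u] by linarith
  qed (use R2 in auto)
  then have "(R^2 - 1) / (R^2 + u^2) \<le> 4 * R^2 / (4 + u^2)" using p by (simp add: field_simps)
  also have "\<dots> \<le> 6 * R^2 / (4 + u^2)" using p R2 by (intro divide_right_mono) auto
  finally have "(R^2 - 1) / (R^2 + u^2) / (1 + u^2) \<le> 6 * R^2 / (4 + u^2) / (1 + u^2)" using p by (intro divide_right_mono) auto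
  then show ?thesis using R by (simp add: diff_kernel_eq mult.commute)
qed

text \<open>The second term cancels the leading term of ln |1 - t^2/u^2| at infinity, so that the kernel is
dominated by diff_kernel 2.\<close>

definition green_kernel :: "real \<Rightarrow> real \<Rightarrow> real" where
  "green_kernel t u = ln \<bar>1 - t^2 / u^2\<bar> + t^2 / (1 + u^2)"

lemma green_kernel_measurable [measurable]: "green_kernel t \<in> borel_measurable borel"
  unfolding green_kernel_def[abs_def] by measurable

lemma
  assumes t: "t > 0"
  shows integrable_green_kernel: "integrable lborel (green_kernel t)"
    and integral_green_kernel: "(\<integral>u. green_kernel t u \<partial>lborel) = t^2 * pi" (is ?A)
proof -
  have I: "integrable lborel (\<lambda>u::real. t^2 * (1 / (1 + u^2)))"
    using integrable_cauchy_kernel[of 1] by (intro integrable_mult_right) simp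
  have J: "(\<integral>u. t^2 * (1 / (1 + u^2)) \<partial>(lborel :: real measure)) = t^2 * pi"
    unfolding integral_mult_right_zero using integral_cauchy_kernel[of 1] by simp
  have e: "green_kernel t u = ln \<bar>1 - t^2 / u^2\<bar> + t^2 * (1 / (1 + u^2))" for u by (simp add: green_kernel_def)
  show "integrable lborel (green_kernel t)" unfolding e[abs_def] by (intro Bochner_Integration.integrable_add integrable_ln_green I t)
  show ?A
    unfolding e Bochner_Integration.integral_add[OF integrable_ln_green[OF t] I] integral_ln_green[OF t] J by simp
qed

lemma
  assumes t: "t > 0" and a: "Re a \<ge> 0" "a \<noteq> 0"
  shows integrable_green_kernel_lnfac: "integrable lborel (\<lambda>u. green_kernel t u * lnfac a u)" (is ?A)
    and integral_green_kernel_lnfac: "(\<integral>u. green_kernel t u * lnfac a u \<partial>lborel) =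
      - 2 * pi * (\<integral>u. indicat_real {0..t} u * argfac a u \<partial>lborel) + t^2 * pi * ln (cmod (1 + 1 / a))" (is ?B)
proof -
  have e: "green_kernel t u * lnfac a u = ln \<bar>1 - t^2 / u^2\<bar> * lnfac a u + t^2 * (lnfac a u / (1^2 + u^2))" for u
    by (simp add: green_kernel_def distrib_right)
  note G = integrable_green_lnfac[OF t a] integral_green_lnfac[OF t a]
  note P = integrable_poisson_lnfac[OF zero_less_one a] integral_poisson_lnfac[OF zero_less_one a]
  show ?A
    unfolding e by (intro Bochner_Integration.integrable_add G integrable_mult_right P)
  show ?B
    unfolding e Bochner_Integration.integral_add[OF G(1) integrable_mult_right[OF P(1)]] G(2) integral_mult_right_zero P(2) by simp
qed

text \<open>With x = t^2/u^2 <= 1/4, the error of ln (1 - x) against -x is at most 2 x^2 = 2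
  t^4/u^4, and replacing t^2/u^2 by t^2/(1 + u^2) costs at most t^2/u^4. For |u| > 2 the quantity
  u^(-4) is below \<open>diff_kernel 2 u\<close>.\<close>

lemma green_kernel_decay:
  assumes t: "t > 0" and u: "\<bar>u\<bar> > max 2 (2 * t)"
  shows "\<bar>green_kernel t u\<bar> \<le> (2 * t^4 + t^2) * diff_kernel 2 u"
proof -
  define x where "x = t^2 / u^2"
  have u0: "u \<noteq> 0" using u by auto
  have "(2 * t)^2 \<le> \<bar>u\<bar>^2" using u t by (intro power_mono) auto
  then have x: "0 < x" "x \<le> 1/4" using t u0 by (auto simp: x_def field_simps)
  have "ln (1 - x) \<le> - x" using ln_le_minus_one[of "1 - x"] x by simp
  moreover have "- x - 2 * x^2 \<le> ln (1 - x)" using ln_one_minus_pos_lower_bound[of x] x by simp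
  ultimately have l: "\<bar>ln (1 - x) + x\<bar> \<le> 2 * x^2" using zero_le_power2[of x] by linarith
  have u4: "u^4 = u^2 * u^2" by (simp add: power2_eq_square power4_eq_xxxx)
  have U: "u^2 > 0" using u0 by simp
  have p: "1 + u^2 > 0" "4 + u^2 > 0" "u^4 > 0" using U by (auto simp: add_pos_pos)
  have "(2::real)^2 \<le> \<bar>u\<bar>^2" using u by (intro power_mono) auto
  then have U4: "u^2 \<ge> 4" by simp
  have k: "1 / u^4 \<le> diff_kernel 2 u"
  proof -
    have "16 \<le> u^2 * u^2" using mult_mono[OF U4 U4] by simp
    moreover have "4 * u^2 \<le> u^2 * u^2" using U4 U by (intro mult_right_mono) auto
    ultimately have "(1 + u^2) * (2^2 + u^2) \<le> 3 * u^4" unfolding u4 by (simp add: algebra_simps)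
    then have "3 / (3 * u^4) \<le> 3 / ((1 + u^2) * (2^2 + u^2))" using p by (intro divide_left_mono mult_pos_pos) auto
    then have "1 / u^4 \<le> 3 / ((1 + u^2) * (2^2 + u^2))" by simp
    then show ?thesis by (simp add: diff_kernel_eq)
  qed
  have v: "c / v - c / (1 + v) = c / (v * (1 + v))" "c / (v * (1 + v)) \<le> c / (v * v)" "0 \<le> c / (v * (1 + v))" if "v > 0" "c \<ge> 0" for c v :: real
  proof -
    show "c / v - c / (1 + v) = c / (v * (1 + v))" using that by (subst diff_frac_eq) (auto simp: algebra_simps)
    show "c / (v * (1 + v)) \<le> c / (v * v)" using that by (intro divide_left_mono mult_left_mono) auto
    show "0 \<le> c / (v * (1 + v))" using that by simp
  qed
  have m: "x - t^2 / (1 + u^2) \<le> t^2 / u^4" "0 \<le> x - t^2 / (1 + u^2)"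
    using v[OF U, of "t^2"] unfolding x_def u4 by simp_all
  have "green_kernel t u = (ln (1 - x) + x) - (x - t^2 / (1 + u^2))" using x by (simp add: green_kernel_def x_def[symmetric])
  then have "\<bar>green_kernel t u\<bar> \<le> 2 * x^2 + t^2 / u^4" using l m by linarith
  also have "2 * x^2 = 2 * t^4 / u^4" by (simp add: x_def power_divide power4_eq_xxxx power2_eq_square)
  finally have "\<bar>green_kernel t u\<bar> \<le> (2 * t^4 + t^2) * (1 / u^4)" by (simp add: add_divide_distrib)
  also have "\<dots> \<le> (2 * t^4 + t^2) * diff_kernel 2 u" using k t by (intro mult_left_mono) auto
  finally show ?thesis .
qed

context lnfac_family
begin

lemma
  assumes R: "R \<ge> 1"
  shows integrable_diff_kernel_family: "integrable lborel (\<lambda>u. diff_kernel R u * lnfac_sum u)" (is ?A)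
    and has_sum_diff_kernel_family: "((\<lambda>i. n i * (pi * (ln (cmod (1 + 1 / p i)) - ln (cmod (1 + of_real R / p i)) / R))) has_sum
        (\<integral>u. diff_kernel R u * lnfac_sum u \<partial>lborel)) A" (is ?B)
proof -
  have K: "diff_kernel R \<in> borel_measurable borel" by measurable
  have KT: "integrable lborel (\<lambda>u. indicat_real {-0..0} u * diff_kernel R u)"
    using integrable_mult_indicator[OF _ integrable_diff_kernel[OF R], of "{-0..0}"] by simp
  have dec: "\<bar>diff_kernel R u\<bar> \<le> (2 * R^2) * diff_kernel 2 u" for u
    using diff_kernel_le_2[OF R] diff_kernel_nonneg[OF R] by simp
  note h = K KT order_refl[of "0::real"] _ dec integrable_diff_kernel_lnfac[OF R]
  show ?A
    by (rule integrable_kernel_family[OF h]) auto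
  have "((\<lambda>i. n i * (\<integral>u. diff_kernel R u * lnfac (p i) u \<partial>lborel)) has_sum
        (\<integral>u. diff_kernel R u * lnfac_sum u \<partial>lborel)) A"
    by (rule has_sum_kernel_family[OF h]) auto
  moreover have "((\<lambda>i. n i * (\<integral>u. diff_kernel R u * lnfac (p i) u \<partial>lborel)) has_sum S) A \<longleftrightarrow>
     ((\<lambda>i. n i * (pi * (ln (cmod (1 + 1 / p i)) - ln (cmod (1 + of_real R / p i)) / R))) has_sum S) A" for S
    by (rule has_sum_cong) (simp add: integral_diff_kernel_lnfac[OF R Re_p p_nz])
  ultimately show ?B by simp
qed

lemma
  assumes t: "t > 0"
  shows integrable_green_kernel_family: "integrable lborel (\<lambda>u. green_kernel t u * lnfac_sum u)" (is ?A)
    and has_sum_green_kernel_family: "((\<lambda>i. n i * (- 2 * pi * (\<integral>u. indicat_real {0..t} u * argfac (p i) u \<partial>lborel) + t^2 * pi * ln (cmod (1 + 1 / p i)))) has_sum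
        (\<integral>u. green_kernel t u * lnfac_sum u \<partial>lborel)) A" (is ?B)
proof -
  let ?T = "max 2 (2 * t)"
  have K: "green_kernel t \<in> borel_measurable borel" by measurable
  have KT: "integrable lborel (\<lambda>u. indicat_real {-?T..?T} u * green_kernel t u)"
    using integrable_mult_indicator[OF _ integrable_green_kernel[OF t], of "{-?T..?T}"] by simp
  note h = K KT _ _ green_kernel_decay[OF t] integrable_green_kernel_lnfac[OF t]
  show ?A
    by (rule integrable_kernel_family[OF h]) auto
  have "((\<lambda>i. n i * (\<integral>u. green_kernel t u * lnfac (p i) u \<partial>lborel)) has_sum
        (\<integral>u. green_kernel t u * lnfac_sum u \<partial>lborel)) A"
    by (rule has_sum_kernel_family[OF h]) auto
  moreover have "((\<lambda>i. n i * (\<integral>u. green_kernel t u * lnfac (p i) u \<partial>lborel)) has_sum S) A \<longleftrightarrow>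
     ((\<lambda>i. n i * (- 2 * pi * (\<integral>u. indicat_real {0..t} u * argfac (p i) u \<partial>lborel) + t^2 * pi * ln (cmod (1 + 1 / p i)))) has_sum S) A" for S
    by (rule has_sum_cong) (simp add: integral_green_kernel_lnfac[OF t Re_p p_nz])
  ultimately show ?B by simp
qed

end

section \<open>The logarithm of zeta on the critical line\<close>

text \<open>Quotient of the Weierstrass products of Gamma at s/2 for s = 1/2 + w and for s = 1/2.
  The k-th factors combine to 1 + w/(2k + 1/2), and the factor 1/z in front becomes 1/(1 +
  2w).\<close>

lemma ln_cmod_Gamma_quotient:
  assumes w: "Re w > -1/2"
  shows "(\<lambda>k. Re w / (2 * real (Suc k)) - ln (cmod (1 + w / of_real (2 * real (Suc k) + 1/2)))) sums
     (ln (cmod (Gamma (1/4 + w/2) / Gamma (1/4))) + euler_mascheroni * Re w / 2 + ln (cmod (1 + 2 * w)))"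
proof -
  define q where "q k = exp (w / of_real (2 * real (Suc k))) / (1 + w / of_real (2 * real (Suc k) + 1/2))" for k
  define c where "c = exp (- euler_mascheroni * (w/2)) / (1 + 2 * w)"
  have s: "1/4 + w/2 \<noteq> 0" "1 + 2 * w \<noteq> 0" using w by (auto simp: complex_eq_iff)
  have nn: "1 + w / of_real (2 * real (Suc k) + 1/2) \<noteq> 0" for k
  proof
    assume "1 + w / of_real (2 * real (Suc k) + 1/2) = 0"
    then have "Re (1 + w / of_real (2 * real (Suc k) + 1/2)) = 0" by simp
    then have "1 + Re w / (2 * real (Suc k) + 1/2) = 0" by (simp only: plus_complex.sel one_complex.sel Re_divide_of_real)
    then show False using w by (simp add: field_simps)
  qed
  have np: "1/4 + w/2 \<notin> \<int>\<^sub>\<le>\<^sub>0" "(1/4::complex) \<notin> \<int>\<^sub>\<le>\<^sub>0" using w by (auto elim!: nonpos_Ints_cases simp: complex_eq_iff)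
  have ratio: "Gamma_series_Weierstrass (1/4 + w/2) n / Gamma_series_Weierstrass (1/4) n = c * (\<Prod>k<n. q k)" for n
  proof -
    have f: "exp ((1/4 + w/2) / of_nat (Suc k)) / (1 + (1/4 + w/2) / of_nat (Suc k)) / (exp ((1/4) / of_nat (Suc k)) / (1 + (1/4) / of_nat (Suc k))) = q k" for k
    proof -
      define r where "r = complex_of_nat (Suc k)"
      have r: "r \<noteq> 0" "1 + (1/4) / r \<noteq> 0" "2 * r + 1/2 \<noteq> 0"
      proof -
        show r0: "r \<noteq> 0" by (simp add: r_def del: of_nat_Suc)
        have "Re (2 * r + 1/2) > 0" by (simp add: r_def)
        then show r1: "2 * r + 1/2 \<noteq> 0" by (intro notI) (simp only: zero_complex.sel)
        have "1 + (1/4) / r = (2 * r + 1/2) / (2 * r)" using r0 by (simp add: field_simps)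
        then show "1 + (1/4) / r \<noteq> 0" using r0 r1 by simp
      qed
      have q: "q k = exp (w / (2 * r)) / (1 + w / (2 * r + 1/2))" by (simp add: q_def r_def)
      have "(1/4 + w/2) / r = (1/4) / r + w / (2 * r)" using r by (simp add: field_simps)
      then have e: "exp ((1/4 + w/2) / r) = exp ((1/4) / r) * exp (w / (2 * r))" by (simp add: exp_add)
      have d: "1 + (1/4 + w/2) / r = (1 + (1/4) / r) * (1 + w / (2 * r + 1/2))"
      proof -
        define D where "D = 2 * r + 1/2"
        have D: "D \<noteq> 0" using r by (simp add: D_def)
        have "1 + (1/4) / r = D / (2 * r)" unfolding D_def using r by (simp add: add_divide_distrib)
        moreover have "1 + w / D = (D + w) / D" using D by (simp add: add_divide_distrib)
        moreover have "1 + (1/4 + w/2) / r = (D + w) / (2 * r)" unfolding D_def using r by (simp add: add_divide_distrib)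
        ultimately show ?thesis unfolding D_def[symmetric] using D by simp
      qed
      show ?thesis unfolding r_def[symmetric] e d q using r by simp
    qed
    have P: "(\<Prod>k=1..n. exp (z / of_nat k) / (1 + z / of_nat k)) = (\<Prod>k<n. exp (z / of_nat (Suc k)) / (1 + z / of_nat (Suc k)))" for z :: complex
      by (rule prod.reindex_bij_witness[of _ "\<lambda>k. Suc k" "\<lambda>k. k - 1"]) auto
    have "exp (- euler_mascheroni * (1/4 + w/2)) / (1/4 + w/2) / (exp (- euler_mascheroni * (1/4)) / (1/4)) = c"
    proof -
      have "- euler_mascheroni * (1/4 + w/2) = - euler_mascheroni * (1/4) + - euler_mascheroni * (w/2)" by (simp add: algebra_simps)
      then have e: "exp (- euler_mascheroni * (1/4 + w/2)) = exp (- euler_mascheroni * (1/4)) * exp (- euler_mascheroni * (w/2))" by (simp only: exp_add)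
      have q: "1/4 + w/2 = (1 + 2 * w) * (1/4)" by (simp add: field_simps)
      show ?thesis unfolding e unfolding q c_def by (simp only: mult.commute[of "exp (- euler_mascheroni * (1/4))"] times_divide_times_eq[symmetric]) simp
    qed
    then show ?thesis unfolding Gamma_series_Weierstrass_def P times_divide_times_eq[symmetric] prod_dividef[symmetric] f
      by (simp only: times_divide_times_eq[symmetric] prod_dividef[symmetric] f)
  qed
  have lim: "(\<lambda>n. c * (\<Prod>k<n. q k)) \<longlonglongrightarrow> Gamma (1/4 + w/2) / Gamma (1/4)"
    unfolding ratio[symmetric] by (intro tendsto_intros Gamma_Weierstrass_complex) (use np(2) in \<open>simp add: Gamma_eq_zero_iff\<close>)
  have G: "Gamma (1/4 + w/2) / Gamma (1/4) \<noteq> 0" using np by (simp add: Gamma_eq_zero_iff)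
  have l: "(\<lambda>n. ln (cmod (c * (\<Prod>k<n. q k)))) \<longlonglongrightarrow> ln (cmod (Gamma (1/4 + w/2) / Gamma (1/4)))"
    by (intro tendsto_ln tendsto_norm lim) (use G in simp)
  have qn: "q k \<noteq> 0" for k using nn[of k] by (simp add: q_def)
  have lq: "ln (cmod (q k)) = Re w / (2 * real (Suc k)) - ln (cmod (1 + w / of_real (2 * real (Suc k) + 1/2)))" for k
  proof -
    have "cmod (q k) = exp (Re w / (2 * real (Suc k))) / cmod (1 + w / of_real (2 * real (Suc k) + 1/2))"
      unfolding q_def norm_divide norm_exp_eq_Re Re_divide_of_real ..
    then show ?thesis using nn[of k] by (simp add: ln_div del: of_real_add of_real_mult of_nat_Suc)
  qed
  have lc: "ln (cmod c) = - (euler_mascheroni * Re w / 2) - ln (cmod (1 + 2 * w))"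
  proof -
    have "cmod c = exp (- (euler_mascheroni * Re w / 2)) / cmod (1 + 2 * w)"
    proof -
      have "(euler_mascheroni :: complex) = of_real euler_mascheroni" by simp
      then have "Re (euler_mascheroni :: complex) = euler_mascheroni" "Im (euler_mascheroni :: complex) = 0"
        by (metis Re_complex_of_real, metis Im_complex_of_real)
      then have "Re (- euler_mascheroni * (w/2)) = - (euler_mascheroni * Re w / 2)" by simp
      then show ?thesis unfolding c_def norm_divide norm_exp_eq_Re by simp
    qed
    then show ?thesis using s by (simp add: ln_div)
  qed
  have cn: "c \<noteq> 0" using s by (simp add: c_def)
  have "ln (cmod (c * (\<Prod>k<n. q k))) = ln (cmod c) + (\<Sum>k<n. ln (cmod (q k)))" for n
    using qn cn by (simp add: norm_mult ln_mult prod_norm[symmetric] ln_prod)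
  with l have "(\<lambda>n. ln (cmod c) + (\<Sum>k<n. ln (cmod (q k)))) \<longlonglongrightarrow> ln (cmod (Gamma (1/4 + w/2) / Gamma (1/4)))" by simp
  from tendsto_diff[OF this tendsto_const[of "ln (cmod c)"]]
  show ?thesis unfolding sums_def lq[symmetric] by (simp add: lc algebra_simps)
qed

text \<open>\<open>xi_fun\<close> contains s^2, that is (1 + 2w)^2 up to a constant; one of these
  factors cancels the pole of Gamma at w = -1/2, which is why ln |1 + 2w| appears only once. The
  term ln pi comes from pi^(-w/2).\<close>

lemma ln_cmod_zreg:
  assumes w: "Re w > -1/2" "w \<notin> xi.Z"
  shows "(\<lambda>k. Re w / (2 * real (Suc k)) - ln (cmod (1 + w / of_real (2 * real (Suc k) + 1/2)))) sums
    (ln (cmod (zreg (1/2))) + ln (cmod (xi_fun w)) - ln (cmod (1 + 2 * w)) + Re w / 2 * (euler_mascheroni + ln pi) - ln (cmod (zreg (1/2 + w))))"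
proof -
  define s where "s = 1/2 + w"
  have s: "Re s > 0" using w by (simp add: s_def)
  have s2: "s / 2 = 1/4 + w/2" by (simp add: s_def field_simps)
  have np: "1/4 + w/2 \<notin> \<int>\<^sub>\<le>\<^sub>0" "(1/4::complex) \<notin> \<int>\<^sub>\<le>\<^sub>0" using w by (auto elim!: nonpos_Ints_cases simp: complex_eq_iff)
  have G: "Gamma (1/4 + w/2) \<noteq> 0" "Gamma (1/4) \<noteq> (0::complex)" using np by (simp_all add: Gamma_eq_zero_iff)
  have n1: "1 + 2 * w \<noteq> 0" using w by (auto simp: complex_eq_iff)
  have z: "zreg (1/2 + w) \<noteq> 0" "zreg (1/2) \<noteq> 0"
    using xi_fun_zero_iff[OF w(1)] zeta_zero_iff[of "1/2 + w"] w zreg_real_nonzero[of "1/2"] by (auto simp: xi.Z_def)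
  have p: "complex_of_real pi powr (- (s/2)) = complex_of_real pi powr (- (1/4)) * complex_of_real pi powr (- (w/2))"
    using powr_add[of "complex_of_real pi" "- (1/4)" "- (w/2)"] by (simp add: s2)
  have ss: "s = (1 + 2 * w) / 2" by (simp add: s_def field_simps)
  have "xi_fun w = (s^2 * (Gamma (s/2) * complex_of_real pi powr (- (s/2))) * zreg s) / ((1/2)^2 * (Gamma (1/4) * complex_of_real pi powr (- (1/4))) * zreg (1/2))"
    using xi_poly_eq_zreg[OF s] xi_poly_eq_zreg[of "1/2"] by (simp add: xi_fun_def s_def[symmetric])
  also have "\<dots> = (1 + 2 * w)^2 * (Gamma (1/4 + w/2) / Gamma (1/4)) * complex_of_real pi powr (- (w/2)) * (zreg s / zreg (1/2))"
    unfolding p unfolding s2 unfolding ss power_divide using z G by simp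
  finally have x: "xi_fun w = (1 + 2 * w)^2 * (Gamma (1/4 + w/2) / Gamma (1/4)) * complex_of_real pi powr (- (w/2)) * (zreg s / zreg (1/2))" .
  have "ln (cmod (xi_fun w)) = 2 * ln (cmod (1 + 2 * w)) + ln (cmod (Gamma (1/4 + w/2) / Gamma (1/4))) - Re w / 2 * ln pi + (ln (cmod (zreg s)) - ln (cmod (zreg (1/2))))"
  proof -
    define g where "g = cmod (Gamma (1/4 + w/2) / Gamma (1/4))"
    have g: "g > 0" using G by (simp add: g_def)
    have "cmod (xi_fun w) = cmod (1 + 2 * w)^2 * g * (pi powr (- Re w / 2)) * (cmod (zreg s) / cmod (zreg (1/2)))"
      unfolding x g_def by (simp add: norm_mult norm_power norm_divide norm_powr_real_powr)
    then have "ln (cmod (xi_fun w)) = ln (cmod (1 + 2 * w)^2) + ln g + ln (pi powr (- Re w / 2)) + ln (cmod (zreg s) / cmod (zreg (1/2)))"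
    proof -
      have m: "ln (a * b * c * d) = ln a + ln b + ln c + ln d" if "a > 0" "b > 0" "c > 0" "d > 0" for a b c d :: real
        using that by (simp add: ln_mult)
      assume "cmod (xi_fun w) = cmod (1 + 2 * w)^2 * g * (pi powr (- Re w / 2)) * (cmod (zreg s) / cmod (zreg (1/2)))"
      then show ?thesis using m[of "cmod (1 + 2 * w)^2" g "pi powr (- Re w / 2)" "cmod (zreg s) / cmod (zreg (1/2))"] g n1 z
        by (simp only: s_def zero_less_norm_iff zero_less_power zero_less_divide_iff powr_gt_zero pi_gt_zero pi_neq_zero not_False_eq_True simp_thms)
    qed
    also have "\<dots> = 2 * ln (cmod (1 + 2 * w)) + ln g - Re w / 2 * ln pi + (ln (cmod (zreg s)) - ln (cmod (zreg (1/2))))"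
      using z n1 by (simp add: ln_realpow ln_div ln_powr s_def)
    finally show ?thesis by (simp add: g_def)
  qed
  then have e: "ln (cmod (Gamma (1/4 + w/2) / Gamma (1/4))) + euler_mascheroni * Re w / 2 + ln (cmod (1 + 2 * w)) =
     ln (cmod (zreg (1/2))) + ln (cmod (xi_fun w)) - ln (cmod (1 + 2 * w)) + Re w / 2 * (euler_mascheroni + ln pi) - ln (cmod (zreg (1/2 + w)))"
    by (simp add: s_def algebra_simps add_divide_distrib)
  show ?thesis using ln_cmod_Gamma_quotient[OF w(1)] unfolding e .
qed

text \<open>lnfac a is even in a, so each zero may be reflected into the right half-plane.\<close>

definition rpart :: "complex \<Rightarrow> complex" where "rpart z = (if Re z \<ge> 0 then z else - z)"

text \<open>The poles of Gamma (1/4 + w/2) are w = -1/2, treated separately, and w = -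
  \<open>gpole k\<close>.\<close>

definition gpole :: "nat \<Rightarrow> real" where "gpole k = 2 * real (Suc k) + 1/2"

lemma gpole_pos: "gpole k > 0" by (simp add: gpole_def)

lemma cmod_rpart [simp]: "cmod (rpart z) = cmod z" by (simp add: rpart_def)

lemma rpart_power2 [simp]: "rpart z ^ 2 = z ^ 2" by (simp add: rpart_def)

lemma lnfac_rpart [simp]: "lnfac (rpart z) u = lnfac z u" by (simp add: lnfac_def)

interpretation zf: lnfac_family xi.Z rpart "\<lambda>z. real (xi.m z)"
proof
  show "0 \<le> Re (rpart z)" for z by (simp add: rpart_def)
  show "rpart z \<noteq> 0" if "z \<in> xi.Z" for z using that xi.zero_notin_Z by (auto simp: rpart_def)
  have "xi.Z = (\<Union>n::nat. {z \<in> xi.Z. cmod z \<le> real n})" using real_arch_simple by auto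
  moreover have "countable (\<Union>n::nat. {z \<in> xi.Z. cmod z \<le> real n})"
    by (rule countable_UN) (simp_all add: countable_finite xi.finite_Z_cball)
  ultimately show "countable xi.Z" by (rule ssubst)
  show "(\<lambda>z. real (xi.m z) / (cmod (rpart z))^2) summable_on xi.Z" using xi.summable_zeros by simp
  show "finite {z \<in> xi.Z. cmod (rpart z) < R}" for R
    by (rule finite_subset[OF _ xi.finite_Z_cball[of R]]) auto
qed simp

lemma summable_gpole: "summable (\<lambda>k. 1 / gpole k ^ 2)"
proof (rule summable_comparison_test')
  show "summable (\<lambda>k. 1 / real (Suc k) ^ 2)" using sums_summable[OF inverse_squares_sums] by simp
  show "norm (1 / gpole k ^ 2) \<le> 1 / real (Suc k) ^ 2" if "k \<ge> 0" for k
    using power_mono[of "real (Suc k)" "gpole k" 2] by (simp add: gpole_def frac_le)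
qed

interpretation gf: lnfac_family UNIV "\<lambda>k. complex_of_real (gpole k)" "\<lambda>_. 1"
proof
  show "0 \<le> Re (complex_of_real (gpole k))" for k using gpole_pos[of k] by simp
  show "complex_of_real (gpole k) \<noteq> 0" for k using gpole_pos[of k] by simp
  show "(\<lambda>k. 1 / (cmod (complex_of_real (gpole k)))^2) summable_on UNIV"
    using summable_gpole gpole_pos by (subst summable_on_UNIV_nonneg_real_iff) auto
  show "finite {k \<in> UNIV. cmod (complex_of_real (gpole k)) < R}" for R
  proof (rule finite_subset)
    show "{k \<in> UNIV. cmod (complex_of_real (gpole k)) < R} \<subseteq> {..nat \<lceil>R\<rceil>}"
    proof
      fix k assume "k \<in> {k \<in> UNIV. cmod (complex_of_real (gpole k)) < R}"
      then have "gpole k < R" using gpole_pos[of k] by simp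
      then have "real k \<le> R" by (simp add: gpole_def)
      then have "real k \<le> real (nat \<lceil>R\<rceil>)" by (rule order_trans[OF _ real_nat_ceiling_ge])
      then show "k \<in> {..nat \<lceil>R\<rceil>}" by simp
    qed
  qed simp
qed auto

abbreviation zero_log :: "real \<Rightarrow> real" where
  "zero_log u \<equiv> \<Sum>\<^sub>\<infinity>z\<in>xi.Z. real (xi.m z) * lnfac (rpart z) u"

abbreviation gamma_log :: "real \<Rightarrow> real" where
  "gamma_log u \<equiv> \<Sum>\<^sub>\<infinity>k. 1 * lnfac (complex_of_real (gpole k)) u"

definition log_zeta :: "real \<Rightarrow> real" where "log_zeta u = ln (cmod (zreg (Complex (1/2) u)))"

lemma log_zeta_measurable [measurable]: "log_zeta \<in> borel_measurable borel"
proof -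
  have "continuous_on UNIV (\<lambda>u. zreg (Complex (1/2) u))"
  proof (rule continuous_on_compose2[OF holomorphic_on_imp_continuous_on[OF holomorphic_zreg]])
    show "continuous_on UNIV (\<lambda>u. Complex (1/2) u)" unfolding Complex_eq by (intro continuous_intros)
  qed auto
  then have "(\<lambda>u. zreg (Complex (1/2) u)) \<in> borel_measurable borel" by (rule borel_measurable_continuous_onI)
  then show ?thesis unfolding log_zeta_def[abs_def] by measurable
qed

text \<open>On the critical line |s| = |s - 1|, so the factor s/(s - 1) between \<open>zeta\<close>
  and \<open>zreg\<close> has modulus 1.\<close>

lemma ln_cmod_zeta_line: "ln (cmod (zeta (1/2 + \<i> * complex_of_real u))) = log_zeta u"
proof -
  have e: "1/2 + \<i> * complex_of_real u = Complex (1/2) u" by (simp add: Complex_eq)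
  have n: "Complex (1/2) u \<noteq> 1" by (simp add: complex_eq_iff)
  have "cmod (Complex (1/2) u) = cmod (Complex (1/2) u - 1)" by (simp add: cmod_def power2_eq_square)
  moreover have "cmod (Complex (1/2) u - 1) \<noteq> 0" using n by simp
  ultimately show ?thesis
    unfolding e log_zeta_def zeta_eq_zreg[OF n] by (simp add: norm_mult norm_divide)
qed

lemma AE_not_countable: "countable X \<Longrightarrow> AE u in lborel. (u::real) \<notin> X"
  using AE_not_in[OF countable_imp_null_set_lborel] .

lemma AE_imaginary_notin_Z: "AE u in lborel. Complex 0 u \<notin> xi.Z"
proof -
  have "countable (Im ` xi.Z)" by (intro countable_image zf.A_countable)
  from AE_not_countable[OF this] show ?thesis by eventually_elim force
qed

lemma lnfac_of_real: "b > 0 \<Longrightarrow> lnfac (of_real b) u = ln (cmod (1 + Complex 0 u / of_real b))"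
proof -
  assume b: "b > 0"
  have q: "1 + u^2 / b^2 > 0" by (simp add: add_pos_nonneg)
  have "1 + of_real (u^2) / of_real b ^ 2 = complex_of_real (1 + u^2 / b^2)" by simp
  then have "lnfac (of_real b) u = ln (1 + u^2 / b^2) / 2" using q unfolding lnfac_def by (simp only: norm_of_real abs_of_pos)
  moreover have "cmod (1 + Complex 0 u / of_real b) = sqrt (1 + u^2 / b^2)"
    using b by (simp add: cmod_def Re_divide_of_real Im_divide_of_real power_divide)
  ultimately show ?thesis using q by (simp add: ln_sqrt)
qed

text \<open>On the imaginary axis Re w = 0, so the compensating terms and those with Euler's
  constant and ln pi vanish, and ln |1 + iu/b| is \<open>lnfac\<close> at b. The last term is the
  leftover factor 1 + 2w.\<close>

lemma log_zeta_expansion: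
  assumes u: "Complex 0 u \<notin> xi.Z"
  shows "log_zeta u = ln (cmod (zreg (1/2))) + zero_log u
     + gamma_log u - lnfac (1/2) u"
proof -
  have e: "1/2 + Complex 0 u = Complex (1/2) u" by (simp add: complex_eq_iff)
  have "((\<lambda>z. real (xi.m z) / 2 * ln (cmod (1 - (Complex 0 u)^2 / z^2))) has_sum ln (cmod (xi_fun (Complex 0 u)))) xi.Z"
    by (rule xi.ln_abs_has_sum[OF u])
  moreover have "(Complex 0 u)^2 = - of_real (u^2)" by (simp add: complex_eq_iff power2_eq_square)
  ultimately have "((\<lambda>z. real (xi.m z) * lnfac (rpart z) u) has_sum ln (cmod (xi_fun (Complex 0 u)))) xi.Z"
    unfolding lnfac_rpart unfolding lnfac_def by simp
  then have Z: "zero_log u = ln (cmod (xi_fun (Complex 0 u)))" by (rule infsumI)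
  have "(\<lambda>k. - lnfac (of_real (gpole k)) u) sums
    (ln (cmod (zreg (1/2))) + ln (cmod (xi_fun (Complex 0 u))) - ln (cmod (1 + 2 * Complex 0 u)) - log_zeta u)"
    using ln_cmod_zreg[OF _ u] unfolding lnfac_of_real[OF gpole_pos] e log_zeta_def[symmetric] gpole_def[symmetric] by simp
  then have g: "(\<lambda>k. lnfac (of_real (gpole k)) u) sums
    - (ln (cmod (zreg (1/2))) + ln (cmod (xi_fun (Complex 0 u))) - ln (cmod (1 + 2 * Complex 0 u)) - log_zeta u)"
    using sums_minus by fastforce
  have "(\<lambda>k. 1 * lnfac (complex_of_real (gpole k)) u) sums gamma_log u"
    by (intro has_sum_imp_sums has_sum_infsum gf.summable_lnfac)
  then have G: "gamma_log u =
     - (ln (cmod (zreg (1/2))) + ln (cmod (xi_fun (Complex 0 u))) - ln (cmod (1 + 2 * Complex 0 u)) - log_zeta u)"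
    using g by (simp add: sums_iff)
  have "lnfac (1/2) u = ln (cmod (1 + 2 * Complex 0 u))" using lnfac_of_real[of "1/2" u] by (simp add: mult.commute)
  then show ?thesis unfolding Z G by simp
qed

lemma
  assumes K: "K \<in> borel_measurable borel" "integrable lborel K"
    and Ka: "\<And>a. Re a \<ge> 0 \<Longrightarrow> a \<noteq> 0 \<Longrightarrow> integrable lborel (\<lambda>u. K u * lnfac a u)"
    and Kz: "integrable lborel (\<lambda>u. K u * zero_log u)"
    and Kg: "integrable lborel (\<lambda>u. K u * gamma_log u)"
  shows integrable_kernel_log_zeta: "integrable lborel (\<lambda>u. K u * log_zeta u)" (is ?A)
    and integral_kernel_log_zeta: "(\<integral>u. K u * log_zeta u \<partial>lborel) = ln (cmod (zreg (1/2))) * (\<integral>u. K u \<partial>lborel)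
      + (\<integral>u. K u * zero_log u \<partial>lborel)
      + (\<integral>u. K u * gamma_log u \<partial>lborel) - (\<integral>u. K u * lnfac (1/2) u \<partial>lborel)" (is ?B)
proof -
  note K(1)[measurable]
  define c where "c = ln (cmod (zreg (1/2)))"
  define f where "f u = K u * zero_log u" for u
  define g where "g u = K u * gamma_log u" for u
  have fg: "integrable lborel f" "integrable lborel g" using Kz Kg unfolding f_def g_def by simp_all
  have Kh: "integrable lborel (\<lambda>u. K u * lnfac (1/2) u)" by (rule Ka) auto
  have Kc: "integrable lborel (\<lambda>u. c * K u)" by (intro integrable_mult_right K)
  have I: "integrable lborel (\<lambda>u. c * K u + f u + g u - K u * lnfac (1/2) u)"
    by (intro Bochner_Integration.integrable_diff Bochner_Integration.integrable_add fg Kh Kc)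
  have ae: "AE u in lborel. c * K u + f u + g u - K u * lnfac (1/2) u = K u * log_zeta u"
    using AE_imaginary_notin_Z by eventually_elim (simp add: f_def g_def log_zeta_expansion c_def algebra_simps)
  show ?A by (rule integrable_cong_AE_imp[OF I _ ae]) measurable
  have "(\<integral>u. K u * log_zeta u \<partial>lborel) = (\<integral>u. c * K u + f u + g u - K u * lnfac (1/2) u \<partial>lborel)"
    by (rule integral_transfer_AE[OF I ae]) measurable
  also have "\<dots> = c * (\<integral>u. K u \<partial>lborel) + (\<integral>u. f u \<partial>lborel) + (\<integral>u. g u \<partial>lborel) - (\<integral>u. K u * lnfac (1/2) u \<partial>lborel)"
    using fg Kh Kc by simp
  finally show ?B
    by (simp add: c_def f_def[abs_def] g_def[abs_def])
qed

lemma has_sum_diff_real: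
  fixes f g :: "'a \<Rightarrow> real"
  assumes "(f has_sum a) A" "(g has_sum b) A" shows "((\<lambda>x. f x - g x) has_sum (a - b)) A"
  using has_sum_add[OF assms(1) has_sum_cmult_right[OF assms(2), of "-1"]] by simp

lemma abs_Re_rpart: "z \<in> xi.Z \<Longrightarrow> 0 \<le> Re (rpart z) \<and> Re (rpart z) < 1/2"
  using xi_Z_abs_Re[of z] by (auto simp: rpart_def)

lemma rpart_nonzero: "z \<in> xi.Z \<Longrightarrow> rpart z \<noteq> 0" by (rule zf.p_nz)

text \<open>Value at y of the harmonic extension of \<open>zero_log\<close> from the imaginary axis:
  ln |\<open>xi_fun\<close>| after all zeros in the right half-plane have been reflected across that
  axis.\<close>

definition zpoisson :: "real \<Rightarrow> real" where
  "zpoisson y = (\<Sum>\<^sub>\<infinity>z\<in>xi.Z. real (xi.m z) * ln (cmod (1 + of_real y / rpart z)))"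

text \<open>The first-order term Re (y/a) equals y Re a / |a|^2 and fits the known summability
  because Re a < 1/2; a bound by y/|a| would not.\<close>

lemma summable_zpoisson:
  assumes y: "y > 0" shows "(\<lambda>z. real (xi.m z) * ln (cmod (1 + of_real y / rpart z))) summable_on xi.Z"
proof (rule zf.summable_bigO[of "2 * y" _ "y / 2 + 2 * y^2"])
  fix z assume z: "z \<in> xi.Z" "2 * y \<le> cmod (rpart z)"
  define a where "a = rpart z"
  have a: "0 \<le> Re a" "Re a < 1/2" "a \<noteq> 0" using abs_Re_rpart[OF z(1)] rpart_nonzero[OF z(1)] by (auto simp: a_def)
  have c: "cmod (of_real y / a) = y / cmod a" using y by (simp add: norm_divide)
  have "cmod (of_real y / a) \<le> 1/2" unfolding c using z(2) a y by (simp add: a_def[symmetric] field_simps)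
  then have "\<bar>ln (cmod (1 + of_real y / a)) - Re (of_real y / a)\<bar> \<le> 2 * (y / cmod a)^2"
    using ln_cmod_one_plus_approx[of "of_real y / a"] unfolding c by simp
  moreover have "Re (of_real y / a) = y * Re a / (cmod a)^2"
    by (simp add: Re_divide cmod_power2)
  moreover have "y * Re a \<le> y * (1/2)" using a y by (intro mult_left_mono) auto
  then have "y * Re a / (cmod a)^2 \<le> (y / 2) / (cmod a)^2" by (intro divide_right_mono) auto
  moreover have "0 \<le> y * Re a / (cmod a)^2" using a y by simp
  moreover have "\<bar>l\<bar> \<le> A + q" if "\<bar>l - r\<bar> \<le> A" "0 \<le> r" "r \<le> q" for l r A q :: real using that by linarith
  ultimately have "\<bar>ln (cmod (1 + of_real y / a))\<bar> \<le> 2 * (y / cmod a)^2 + (y / 2) / (cmod a)^2" by simp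
  also have "\<dots> = (y / 2 + 2 * y^2) / (cmod a)^2" by (simp add: power_divide add_divide_distrib)
  finally have "real (xi.m z) * \<bar>ln (cmod (1 + of_real y / a))\<bar> \<le> real (xi.m z) * ((y / 2 + 2 * y^2) / (cmod a)^2)"
    by (rule mult_left_mono) simp
  then show "\<bar>real (xi.m z) * ln (cmod (1 + of_real y / rpart z))\<bar> \<le> (y / 2 + 2 * y^2) * (real (xi.m z) / cmod (rpart z)^2)"
    by (simp add: a_def abs_mult mult_ac)
qed

text \<open>The counterpart for the Gamma poles. Being real, they leave a first-order term
  y/\<open>gpole k\<close> that diverges when summed, hence the subtraction of y/(2(k+1)).\<close>

definition gpoisson :: "real \<Rightarrow> real" where
  "gpoisson y = (\<Sum>k. ln (1 + y / gpole k) - y / (2 * real (Suc k)))"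

lemma gpoisson_sums:
  assumes y: "y \<ge> 1/2"
  shows "(\<lambda>k. ln (1 + y / gpole k) - y / (2 * real (Suc k))) sums gpoisson y" (is ?A)
    and ln_zreg_eq: "ln (cmod (zreg (1/2 + of_real y))) = ln (cmod (zreg (1/2))) + ln (cmod (xi_fun (of_real y))) + gpoisson y
       - ln (1 + 2 * y) + y / 2 * (euler_mascheroni + ln pi)"
proof -
  have nZ: "complex_of_real y \<notin> xi.Z" using xi_Z_abs_Re[of "of_real y"] y by auto
  have c: "cmod (1 + complex_of_real y / of_real (gpole k)) = 1 + y / gpole k" for k
  proof -
    have "1 + complex_of_real y / of_real (gpole k) = of_real (1 + y / gpole k)" by simp
    moreover have "1 + y / gpole k > 0" using y gpole_pos[of k] by (simp add: add_pos_nonneg)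
    ultimately show ?thesis by (simp only: norm_of_real abs_of_pos)
  qed
  have "1 + 2 * complex_of_real y = of_real (1 + 2 * y)" by simp
  then have c2: "cmod (1 + 2 * complex_of_real y) = 1 + 2 * y" using y by (simp only: norm_of_real)
  have r: "Re (complex_of_real y) > -1/2" using y by simp
  have "(\<lambda>k. y / (2 * real (Suc k)) - ln (1 + y / gpole k)) sums
    (ln (cmod (zreg (1/2))) + ln (cmod (xi_fun (of_real y))) - ln (1 + 2 * y) + y / 2 * (euler_mascheroni + ln pi) - ln (cmod (zreg (1/2 + of_real y))))"
    using ln_cmod_zreg[OF r nZ] unfolding gpole_def[symmetric] c c2 Re_complex_of_real .
  from sums_minus[OF this] have s: "(\<lambda>k. ln (1 + y / gpole k) - y / (2 * real (Suc k))) sums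
    - (ln (cmod (zreg (1/2))) + ln (cmod (xi_fun (of_real y))) - ln (1 + 2 * y) + y / 2 * (euler_mascheroni + ln pi) - ln (cmod (zreg (1/2 + of_real y))))" by simp
  then have "gpoisson y = - (ln (cmod (zreg (1/2))) + ln (cmod (xi_fun (of_real y))) - ln (1 + 2 * y) + y / 2 * (euler_mascheroni + ln pi) - ln (cmod (zreg (1/2 + of_real y))))"
    unfolding gpoisson_def by (simp only: sums_iff)
  with s show ?A
    "ln (cmod (zreg (1/2 + of_real y))) = ln (cmod (zreg (1/2))) + ln (cmod (xi_fun (of_real y))) + gpoisson y
       - ln (1 + 2 * y) + y / 2 * (euler_mascheroni + ln pi)" by simp_all
qed

text \<open>pi * lam 1 is the integral of log_zeta u / (1 + u^2). Up to the contribution of the zeros off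
the critical line, lam y is ln |zreg (1/2 + y)|, whence lam y = o(y).\<close>

definition lam :: "real \<Rightarrow> real" where
  "lam y = ln (cmod (zreg (1/2))) + zpoisson y + gpoisson y - ln (1 + 2 * y) + y / 2 * (euler_mascheroni + ln pi)"

lemma ln_cmod_half_pole: "y > 0 \<Longrightarrow> ln (cmod (1 + of_real y / (1/2))) = ln (1 + 2 * y)"
proof -
  assume y: "y > 0"
  have "1 + complex_of_real y / (1/2) = of_real (1 + 2 * y)" by simp
  then show ?thesis using y by (simp only: norm_of_real)
qed

lemma ln_cmod_gpole: "y > 0 \<Longrightarrow> ln (cmod (1 + of_real y / complex_of_real (gpole k))) = ln (1 + y / gpole k)"
proof -
  assume y: "y > 0"
  have "1 + of_real y / complex_of_real (gpole k) = of_real (1 + y / gpole k)" by simp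
  moreover have "1 + y / gpole k > 0" using y gpole_pos[of k] by (simp add: add_pos_pos)
  ultimately show ?thesis by (simp only: norm_of_real abs_of_pos)
qed

lemma
  assumes R: "R \<ge> 1"
  shows integrable_diff_kernel_log_zeta: "integrable lborel (\<lambda>u. diff_kernel R u * log_zeta u)" (is ?A)
    and integral_diff_kernel_log_zeta: "(\<integral>u. diff_kernel R u * log_zeta u \<partial>lborel) = pi * (lam 1 - lam R / R)" (is ?B)
proof -
  note h = diff_kernel_measurable integrable_diff_kernel[OF R] integrable_diff_kernel_lnfac[OF R]
    zf.integrable_diff_kernel_family[OF R] gf.integrable_diff_kernel_family[OF R]
  show ?A by (rule integrable_kernel_log_zeta[OF h])
  have R0: "R > 0" using R by simp
  have "((\<lambda>z. pi * (real (xi.m z) * ln (cmod (1 + of_real 1 / rpart z)) - real (xi.m z) * ln (cmod (1 + of_real R / rpart z)) / R)) has_sum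
      pi * (zpoisson 1 - zpoisson R / R)) xi.Z"
    unfolding zpoisson_def
    by (intro has_sum_cmult_right has_sum_diff_real has_sum_divide_const has_sum_infsum summable_zpoisson R0) simp
  then have "((\<lambda>z. real (xi.m z) * (pi * (ln (cmod (1 + 1 / rpart z)) - ln (cmod (1 + of_real R / rpart z)) / R))) has_sum
      pi * (zpoisson 1 - zpoisson R / R)) xi.Z" by (simp add: algebra_simps)
  from has_sum_unique[OF zf.has_sum_diff_kernel_family[OF R] this]
  have Z: "(\<integral>u. diff_kernel R u * zero_log u \<partial>lborel) = pi * (zpoisson 1 - zpoisson R / R)" .
  have "(\<lambda>k. 1 * (pi * (ln (cmod (1 + 1 / complex_of_real (gpole k))) - ln (cmod (1 + of_real R / complex_of_real (gpole k))) / R))) sums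
     (\<integral>u. diff_kernel R u * gamma_log u \<partial>lborel)"
    by (rule has_sum_imp_sums[OF gf.has_sum_diff_kernel_family[OF R]])
  then have s1: "(\<lambda>k. pi * (ln (1 + 1 / gpole k) - ln (1 + R / gpole k) / R)) sums
     (\<integral>u. diff_kernel R u * gamma_log u \<partial>lborel)"
    using ln_cmod_gpole[of 1] ln_cmod_gpole[OF R0] by simp
  \<comment> \<open>The combination f(1) - f(R)/R annihilates every multiple of y. This removes the
    compensating terms here, and also the term with Euler's constant and ln pi in
    \<open>lam\<close>.\<close>
  have "(\<lambda>k. pi * ((ln (1 + 1 / gpole k) - 1 / (2 * real (Suc k))) - (ln (1 + R / gpole k) - R / (2 * real (Suc k))) / R)) sums (pi * (gpoisson 1 - gpoisson R / R))"
    by (intro sums_mult sums_diff sums_divide gpoisson_sums) (use R in auto)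
  moreover have "(ln (1 + 1 / gpole k) - 1 / (2 * real (Suc k))) - (ln (1 + R / gpole k) - R / (2 * real (Suc k))) / R = ln (1 + 1 / gpole k) - ln (1 + R / gpole k) / R" for k
    using R0 by (simp add: diff_divide_distrib)
  ultimately have s2: "(\<lambda>k. pi * (ln (1 + 1 / gpole k) - ln (1 + R / gpole k) / R)) sums (pi * (gpoisson 1 - gpoisson R / R))" by (simp only:)
  note G = sums_unique2[OF s1 s2]
  have H: "(\<integral>u. diff_kernel R u * lnfac (1/2) u \<partial>lborel) = pi * (ln (1 + 2 * 1) - ln (1 + 2 * R) / R)"
    using integral_diff_kernel_lnfac[OF R, of "1/2"] ln_cmod_half_pole[of 1] ln_cmod_half_pole[OF R0] by simp
  have "(\<integral>u. diff_kernel R u * log_zeta u \<partial>lborel) = ln (cmod (zreg (1/2))) * (\<integral>u. diff_kernel R u \<partial>lborel)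
      + (\<integral>u. diff_kernel R u * zero_log u \<partial>lborel)
      + (\<integral>u. diff_kernel R u * gamma_log u \<partial>lborel) - (\<integral>u. diff_kernel R u * lnfac (1/2) u \<partial>lborel)"
    by (rule integral_kernel_log_zeta[OF h])
  also have "\<dots> = ln (cmod (zreg (1/2))) * (pi * (1 - 1 / R)) + pi * (zpoisson 1 - zpoisson R / R)
     + pi * (gpoisson 1 - gpoisson R / R) - pi * (ln (1 + 2 * 1) - ln (1 + 2 * R) / R)"
    unfolding Z G H integral_diff_kernel[OF R] ..
  also have "\<dots> = pi * (lam 1 - lam R / R)" unfolding lam_def using R0 by (simp add: field_simps)
  finally show ?B .
qed

text \<open>Dominated convergence for sums (Tannery's theorem), obtained by exchanging a uniform
  limit over finite subsets with the limit in k.\<close>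

lemma (in lnfac_family) infsum_tendsto_zero:
  fixes f :: "nat \<Rightarrow> 'i \<Rightarrow> real"
  assumes b: "\<And>k i. i \<in> A \<Longrightarrow> \<bar>f k i\<bar> \<le> B * (n i / cmod (p i)^2)" and l: "\<And>i. i \<in> A \<Longrightarrow> (\<lambda>k. f k i) \<longlonglongrightarrow> 0"
  shows "(\<lambda>k. \<Sum>\<^sub>\<infinity>i\<in>A. f k i) \<longlonglongrightarrow> 0"
proof (rule swap_uniform_limit'[where F = "finite_subsets_at_top A" and S = UNIV and f = "\<lambda>X k. \<Sum>i\<in>X. f k i" and g = "\<lambda>_. 0"])
  show "uniform_limit UNIV (\<lambda>X k. \<Sum>i\<in>X. f k i) (\<lambda>k. \<Sum>\<^sub>\<infinity>i\<in>A. f k i) (finite_subsets_at_top A)"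
    by (rule Weierstrass_m_test_general[OF _ summable_on_cmult_right[OF summable_p, of B]]) (use b in auto)
  show "\<forall>\<^sub>F X in finite_subsets_at_top A. (\<lambda>k. \<Sum>i\<in>X. f k i) \<longlonglongrightarrow> 0"
    by (rule eventually_finite_subsets_at_top_weakI) (intro tendsto_null_sum l, auto)
qed auto

text \<open>With D = |a - y|^2 one has h = ln (1 + 4 y Re a / D)/4, at most y Re a / D. Two lower
  bounds for D serve different ends: |a|^2 gives a summable majorant uniform in y, and (y/2)^2 gives
  convergence to 0 for each fixed zero.\<close>

lemma zero_quotient_bounds:
  assumes a: "0 \<le> Re a" "Re a < 1/2" and y: "y \<ge> 1"
  defines "h \<equiv> (ln (cmod (1 + of_real y / a)) - ln (cmod (1 - of_real y / a))) / 2"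
  shows "0 \<le> h" "h / y \<le> 1 / cmod a ^ 2" "h / y \<le> 2 / y^2"
proof -
  define D where "D = (cmod (a - of_real y))^2"
  have D: "D = (Re a - y)^2 + (Im a)^2" by (simp add: D_def cmod_power2)
  have q: "(y - 1/2)^2 \<le> (Re a - y)^2" using a y power_mono[of "y - 1/2" "y - Re a" 2] by (simp add: power2_commute)
  have "(y/2)^2 \<le> (y - 1/2)^2" using y by (intro power_mono) auto
  then have Dy: "(y/2)^2 \<le> D" using q zero_le_power2[of "Im a"] unfolding D by linarith
  have "(Re a)^2 \<le> (1/2)^2" "(1/2)^2 \<le> (y - 1/2)^2" using a y by (intro power_mono; simp)+
  then have "(Re a)^2 \<le> (Re a - y)^2" using q by linarith
  then have Da: "cmod a ^ 2 \<le> D" unfolding D cmod_power2 by simp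
  have Dp: "D > 0" using Dy y zero_less_power[of "y/2" 2] by linarith
  have N: "(cmod (a + of_real y))^2 = D + 4 * Re a * y" unfolding D by (simp add: cmod_power2) (simp add: power2_eq_square algebra_simps)
  have ay: "0 \<le> 4 * Re a * y" using a y by simp
  have h: "h = ln (1 + 4 * Re a * y / D) / 4 \<and> 0 \<le> h" if "a \<noteq> 0"
  proof -
    have "1 + of_real y / a = (a + of_real y) / a" "1 - of_real y / a = (a - of_real y) / a" using that by (simp_all add: add_divide_distrib diff_divide_distrib)
    then have e: "cmod (1 + of_real y / a) = cmod (a + of_real y) / cmod a" "cmod (1 - of_real y / a) = cmod (a - of_real y) / cmod a"
      by (simp_all only: norm_divide)
    have nz: "cmod (a - of_real y) > 0" "cmod (a + of_real y) > 0"
    proof -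
      show "cmod (a - of_real y) > 0" using Dp unfolding D_def by (cases "a - of_real y = 0") auto
      have "(cmod (a + of_real y))^2 > 0" unfolding N using Dp ay by linarith
      then show "cmod (a + of_real y) > 0" by (cases "a + of_real y = 0") auto
    qed
    have "h = (ln (cmod (a + of_real y)) - ln (cmod (a - of_real y))) / 2"
      unfolding h_def e using that nz by (simp add: ln_div)
    also have "\<dots> = (ln ((cmod (a + of_real y))^2) - ln ((cmod (a - of_real y))^2)) / 4" using nz by (simp add: ln_realpow)
    also have "\<dots> = (ln (D + 4 * Re a * y) - ln D) / 4" unfolding N D_def ..
    also have "\<dots> = ln ((D + 4 * Re a * y) / D) / 4"
    proof -
      have "D + 4 * Re a * y > 0" using Dp ay by linarith
      then show ?thesis using ln_div[of "D + 4 * Re a * y" D] Dp by simp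
    qed
    also have "(D + 4 * Re a * y) / D = 1 + 4 * Re a * y / D" using Dp by (simp add: add_divide_distrib)
    finally have "h = ln (1 + 4 * Re a * y / D) / 4" .
    moreover have "0 \<le> 4 * Re a * y / D" using ay Dp by simp
    then have "0 \<le> ln (1 + 4 * Re a * y / D)" by (intro ln_ge_zero) simp
    ultimately show ?thesis by simp
  qed
  have h2: "0 \<le> h \<and> h / y \<le> (1/2) / D"
  proof (cases "a = 0")
    case True
    then show ?thesis using Dp by (simp add: h_def)
  next
    case False
    have "h = ln (1 + 4 * Re a * y / D) / 4" "0 \<le> h" using h[OF False] by auto
    moreover have "ln (1 + 4 * Re a * y / D) \<le> 4 * Re a * y / D" using ay Dp by (intro ln_add_one_self_le_self) simp
    ultimately have "h \<le> Re a * y / D" "0 \<le> h" by simp_all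
    then have "h / y \<le> Re a * y / D / y" using y by (intro divide_right_mono) auto
    also have "\<dots> = Re a / D" using y by simp
    also have "\<dots> \<le> (1/2) / D" using a Dp by (intro divide_right_mono) auto
    finally show ?thesis using \<open>0 \<le> h\<close> by simp
  qed
  then show "0 \<le> h" by simp
  have "(1/2) / D \<le> (1/2) / (y/2)^2" using Dy y Dp by (intro divide_left_mono) auto
  also have "\<dots> = 2 / y^2" by (simp add: power_divide)
  finally show "h / y \<le> 2 / y^2" using h2 by simp
  show "h / y \<le> 1 / cmod a ^ 2"
  proof (cases "a = 0")
    case True
    then show ?thesis by (simp add: h_def)
  next
    case False
    then have "(1/2) / D \<le> 1 / cmod a ^ 2" using Da Dp by (intro frac_le) auto
    then show ?thesis using h2 by simp
  qed
qed

text \<open>For real s >= 3/2 the Dirichlet series has positive terms and first term 1, so |zeta| >=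
  1; since s/(s - 1) <= 3 this gives |zreg| >= 1/3. The upper bound is the elementary one.\<close>

lemma abs_ln_cmod_zreg_le:
  assumes y: "y \<ge> 1"
  shows "\<bar>ln (cmod (zreg (1/2 + of_real y)))\<bar> \<le> ln 3"
proof -
  define s where "s = 1/2 + y"
  have es: "1/2 + complex_of_real y = of_real s" by (simp add: s_def)
  have s: "s \<ge> 3/2" using y by (simp add: s_def)
  have "of_real s - 1 = complex_of_real (s - 1)" by simp
  then have m: "cmod (of_real s - 1) = s - 1" using s by (simp only: norm_of_real)
  have up: "cmod (zreg (of_real s)) \<le> 3"
  proof -
    have "cmod (zreg (of_real s)) \<le> 1 + (s - 1) / s" using cmod_zreg_le[of "of_real s"] s m by simp
    also have "\<dots> \<le> 3" using s by (simp add: field_simps)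
    finally show ?thesis .
  qed
  have z1: "1 \<le> cmod (zeta (of_real s))"
  proof -
    have "Re (complex_of_real s) > 1" using s by simp
    note sz = zeta_sums[OF this]
    have r: "Re (nps (of_real s) n) = real n powr (- s)" for n
      using powr_of_real[of "real n" "- s"] by (simp add: nps_def)
    define f where "f n = real (Suc n) powr (- s)" for n
    have "f sums Re (zeta (of_real s))" using sums_Re[OF sz] unfolding r f_def .
    then have "sum f {..<1} \<le> Re (zeta (of_real s))"
      using sum_le_suminf[of f "{..<1}"] by (simp add: sums_iff f_def)
    then have "1 \<le> Re (zeta (of_real s))" by (simp add: f_def)
    then show ?thesis using complex_Re_le_cmod[of "zeta (of_real s)"] by linarith
  qed
  have "s \<noteq> 1" using s by auto
  then have "complex_of_real s \<noteq> 1" by simp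
  then have "cmod (zeta (of_real s)) = s / (s - 1) * cmod (zreg (of_real s))"
    using s m by (simp add: zeta_eq_zreg norm_mult norm_divide)
  then have "s / (s - 1) * cmod (zreg (of_real s)) \<ge> 1" using z1 by simp
  moreover have "s / (s - 1) \<le> 3" using s by (simp add: field_simps)
  then have "s / (s - 1) * cmod (zreg (of_real s)) \<le> 3 * cmod (zreg (of_real s))" by (rule mult_right_mono) simp
  ultimately have lo: "1/3 \<le> cmod (zreg (of_real s))" by linarith
  have "ln (1/3) \<le> ln (cmod (zreg (of_real s)))" "ln (cmod (zreg (of_real s))) \<le> ln 3"
    using lo up by (auto intro!: ln_mono)
  then show ?thesis unfolding es by (simp add: ln_div abs_le_iff)
qed

lemma lam_over_tendsto: "(\<lambda>n. lam (real (Suc n)) / real (Suc n)) \<longlonglongrightarrow> 0"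
proof -
  define f where "f n z = real (xi.m z) * ((ln (cmod (1 + of_real (real (Suc n)) / rpart z)) - ln (cmod (1 - of_real (real (Suc n)) / rpart z))) / 2) / real (Suc n)" for n z
  have lamf: "lam (real (Suc n)) / real (Suc n) = ln (cmod (zreg (1/2 + of_real (real (Suc n))))) / real (Suc n) + (\<Sum>\<^sub>\<infinity>z\<in>xi.Z. f n z)" for n
  proof -
    define y where "y = real (Suc n)"
    have y: "y \<ge> 1" by (simp add: y_def)
    have nZ: "complex_of_real y \<notin> xi.Z" using xi_Z_abs_Re[of "of_real y"] y by auto
    have h1: "((\<lambda>z. real (xi.m z) / 2 * ln (cmod (1 - (of_real y)^2 / z^2))) has_sum ln (cmod (xi_fun (of_real y)))) xi.Z"
      by (rule xi.ln_abs_has_sum[OF nZ])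
    have y0: "y > 0" using y by simp
    have h2: "((\<lambda>z. real (xi.m z) * ln (cmod (1 + of_real y / rpart z))) has_sum zpoisson y) xi.Z"
      unfolding zpoisson_def by (intro has_sum_infsum summable_zpoisson y0)
    \<comment> \<open>A zero enters \<open>zpoisson\<close> as ln |1 + y/a| and ln
      |\<open>xi_fun\<close>| as the mean of ln |1 + y/a| and ln |1 - y/a|, with a =
      \<open>rpart z\<close>; the difference is half of ln |(1 + y/a)/(1 - y/a)|, which is 0 when Re
      a = 0.\<close>
    have "((\<lambda>z. (real (xi.m z) * ln (cmod (1 + of_real y / rpart z)) - real (xi.m z) / 2 * ln (cmod (1 - (of_real y)^2 / z^2))) / y) has_sum
       (zpoisson y - ln (cmod (xi_fun (of_real y)))) / y) xi.Z"
      by (intro has_sum_divide_const has_sum_diff_real h1 h2)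
    moreover have "(real (xi.m z) * ln (cmod (1 + of_real y / rpart z)) - real (xi.m z) / 2 * ln (cmod (1 - (of_real y)^2 / z^2))) / y = f n z" if z: "z \<in> xi.Z" for z
    proof -
      define a where "a = rpart z"
      have a: "0 \<le> Re a" "Re a < 1/2" "a \<noteq> 0" using abs_Re_rpart[OF z] rpart_nonzero[OF z] by (auto simp: a_def)
      have "1 - (of_real y)^2 / z^2 = (1 - of_real y / a) * (1 + of_real y / a)"
        unfolding rpart_power2[of z, symmetric] a_def[symmetric] by (simp add: power2_eq_square algebra_simps)
      moreover have "1 - of_real y / a \<noteq> 0" "1 + of_real y / a \<noteq> 0"
      proof -
        show "1 - of_real y / a \<noteq> 0"
        proof
          assume "1 - of_real y / a = 0"
          then have "a = of_real y" using a(3) by (simp add: field_simps)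
          then show False using a y by simp
        qed
        show "1 + of_real y / a \<noteq> 0"
        proof
          assume "1 + of_real y / a = 0"
          then have "a + of_real y = 0" using a(3) by (simp add: field_simps)
          then have "Re (a + of_real y) = 0" by simp
          then show False using a y by simp
        qed
      qed
      ultimately have "ln (cmod (1 - (of_real y)^2 / z^2)) = ln (cmod (1 - of_real y / a)) + ln (cmod (1 + of_real y / a))"
        by (simp add: norm_mult ln_mult)
      then have l: "ln (cmod (1 - (of_real y)^2 / z^2)) = ln (cmod (1 - of_real y / rpart z)) + ln (cmod (1 + of_real y / rpart z))" by (simp add: a_def)
      show ?thesis unfolding f_def y_def[symmetric] l by (simp add: algebra_simps add_divide_distrib diff_divide_distrib)
    qed
    ultimately have "(f n has_sum (zpoisson y - ln (cmod (xi_fun (of_real y)))) / y) xi.Z"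
      by (subst (asm) has_sum_cong) auto
    then have s: "(\<Sum>\<^sub>\<infinity>z\<in>xi.Z. f n z) = (zpoisson y - ln (cmod (xi_fun (of_real y)))) / y" by (rule infsumI)
    have "lam y = ln (cmod (zreg (1/2 + of_real y))) + (zpoisson y - ln (cmod (xi_fun (of_real y))))"
      using ln_zreg_eq[of y] y by (simp add: lam_def)
    then show ?thesis unfolding y_def[symmetric] s by (simp add: add_divide_distrib)
  qed
  have "(\<lambda>n. ln (cmod (zreg (1/2 + of_real (real (Suc n))))) / real (Suc n)) \<longlonglongrightarrow> 0"
  proof (rule Lim_null_comparison)
    show "\<forall>\<^sub>F n in sequentially. norm (ln (cmod (zreg (1/2 + of_real (real (Suc n))))) / real (Suc n)) \<le> ln 3 / real (Suc n)"
      using abs_ln_cmod_zreg_le[of "real (Suc n)" for n] by (intro always_eventually allI) (simp add: divide_right_mono)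
    show "(\<lambda>n. ln 3 / real (Suc n)) \<longlonglongrightarrow> 0" by real_asymp
  qed
  moreover have "(\<lambda>n. \<Sum>\<^sub>\<infinity>z\<in>xi.Z. f n z) \<longlonglongrightarrow> 0"
  proof (rule zf.infsum_tendsto_zero[where B = 1])
    fix n z assume z: "z \<in> xi.Z"
    define h where "h = (ln (cmod (1 + of_real (real (Suc n)) / rpart z)) - ln (cmod (1 - of_real (real (Suc n)) / rpart z))) / 2"
    have b: "0 \<le> h" "h / real (Suc n) \<le> 1 / cmod (rpart z) ^ 2"
      using zero_quotient_bounds[of "rpart z" "real (Suc n)"] abs_Re_rpart[OF z] unfolding h_def by auto
    have "\<bar>f n z\<bar> = real (xi.m z) * (h / real (Suc n))" using b(1) unfolding f_def h_def[symmetric] by simp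
    also have "\<dots> \<le> real (xi.m z) * (1 / cmod (rpart z) ^ 2)" using b(2) by (rule mult_left_mono) simp
    finally show "\<bar>f n z\<bar> \<le> 1 * (real (xi.m z) / cmod (rpart z) ^ 2)" by simp
  next
    fix z assume z: "z \<in> xi.Z"
    show "(\<lambda>n. f n z) \<longlonglongrightarrow> 0"
    proof (rule Lim_null_comparison)
      show "\<forall>\<^sub>F n in sequentially. norm (f n z) \<le> real (xi.m z) * (2 / real (Suc n)^2)"
      proof (intro always_eventually allI)
        fix n
        define h where "h = (ln (cmod (1 + of_real (real (Suc n)) / rpart z)) - ln (cmod (1 - of_real (real (Suc n)) / rpart z))) / 2"
        have b: "0 \<le> h" "h / real (Suc n) \<le> 2 / real (Suc n) ^ 2"
          using zero_quotient_bounds[of "rpart z" "real (Suc n)"] abs_Re_rpart[OF z] unfolding h_def by auto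
        have "norm (f n z) = real (xi.m z) * (h / real (Suc n))" using b(1) unfolding f_def h_def[symmetric] by simp
        also have "\<dots> \<le> real (xi.m z) * (2 / real (Suc n) ^ 2)" using b(2) by (rule mult_left_mono) simp
        finally show "norm (f n z) \<le> real (xi.m z) * (2 / real (Suc n)^2)" .
      qed
      have "(\<lambda>n. c * (2 / real (Suc n)^2)) \<longlonglongrightarrow> 0" for c :: real by real_asymp
      then show "(\<lambda>n. real (xi.m z) * (2 / real (Suc n)^2)) \<longlonglongrightarrow> 0" .
    qed
  qed
  ultimately have "(\<lambda>n. ln (cmod (zreg (1/2 + of_real (real (Suc n))))) / real (Suc n) + (\<Sum>\<^sub>\<infinity>z\<in>xi.Z. f n z)) \<longlonglongrightarrow> 0 + 0"
    by (rule tendsto_add)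
  then show ?thesis unfolding lamf by simp
qed

lemma log_zeta_le: "log_zeta u \<le> ln 4 + lnfac 1 u"
proof -
  have l1: "lnfac 1 u = ln (sqrt (1 + u^2))"
  proof -
    have "1 + complex_of_real (u^2) / 1^2 = of_real (1 + u^2)" by simp
    then have "lnfac 1 u = ln \<bar>1 + u^2\<bar> / 2" unfolding lnfac_def by (simp only: norm_of_real)
    then show ?thesis by (simp add: ln_sqrt add_pos_nonneg)
  qed
  have q: "1 \<le> sqrt (1 + u^2)" "\<bar>u\<bar> \<le> sqrt (1 + u^2)" by (simp_all add: real_le_rsqrt)
  have "cmod (zreg (Complex (1/2) u)) \<le> 1 + cmod (Complex (1/2) u - 1) / (1/2)"
    using cmod_zreg_le[of "Complex (1/2) u"] by simp
  moreover have "cmod (Complex (1/2) u - 1) \<le> 1/2 + \<bar>u\<bar>"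
    using cmod_le[of "Complex (1/2) u - 1"] by simp
  moreover have "X \<le> 4 * S" if "X \<le> 1 + Y / (1/2)" "Y \<le> 1/2 + U" "1 \<le> S" "U \<le> S" for X Y S U :: real
    using that by simp
  ultimately have b: "cmod (zreg (Complex (1/2) u)) \<le> 4 * sqrt (1 + u^2)" using q by blast
  have q4: "1 \<le> 4 * sqrt (1 + u^2)" using q by linarith
  have e: "ln 4 + lnfac 1 u = ln (4 * sqrt (1 + u^2))" unfolding l1 using q by (subst ln_mult) auto
  show ?thesis
  proof (cases "zreg (Complex (1/2) u) = 0")
    case True
    then show ?thesis unfolding e log_zeta_def using ln_ge_zero[OF q4] by simp
  next
    case False
    then show ?thesis unfolding e log_zeta_def using b by (intro ln_mono) auto
  qed
qed

text \<open>\<open>log_zeta\<close> is bounded above by \<open>b\<close> but not usefully below, so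
  integrability cannot come from a majorant. The nonnegative function b - \<open>log_zeta\<close> is
  integrated against \<open>diff_kernel R\<close>, which increases to 1/(1 + u^2) as R grows;
  monotone convergence gives integrability and value together, because lam R / R tends to 0.\<close>

lemma
  shows integrable_log_zeta_kernel: "integrable lborel (\<lambda>u. log_zeta u / (1 + u^2))" (is ?A)
    and integral_log_zeta_kernel: "(\<integral>u. log_zeta u / (1 + u^2) \<partial>lborel) = pi * lam 1" (is ?B)
proof -
  define b where "b u = ln 4 + lnfac 1 u" for u
  define g where "g n u = diff_kernel (real (Suc n)) u * (b u - log_zeta u)" for n u
  define J where "J n = ln 4 * (pi * (1 - 1 / real (Suc n))) + pi * (ln 2 - ln (1 + real (Suc n)) / real (Suc n)) - pi * (lam 1 - lam (real (Suc n)) / real (Suc n))" for n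
  have R: "real (Suc n) \<ge> 1" for n by simp
  have bm[measurable]: "b \<in> borel_measurable borel" unfolding b_def[abs_def] by measurable
  have I1: "integrable lborel (\<lambda>u. diff_kernel (real (Suc n)) u * b u)"
    and V1: "(\<integral>u. diff_kernel (real (Suc n)) u * b u \<partial>lborel) = ln 4 * (pi * (1 - 1 / real (Suc n))) + pi * (ln 2 - ln (1 + real (Suc n)) / real (Suc n))" for n
  proof -
    have e: "diff_kernel (real (Suc n)) u * b u = ln 4 * diff_kernel (real (Suc n)) u + diff_kernel (real (Suc n)) u * lnfac 1 u" for u
      by (simp add: b_def algebra_simps)
    have i: "integrable lborel (\<lambda>u. ln 4 * diff_kernel (real (Suc n)) u)" "integrable lborel (\<lambda>u. diff_kernel (real (Suc n)) u * lnfac 1 u)"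
      by (intro integrable_mult_right integrable_diff_kernel R) (rule integrable_diff_kernel_lnfac[OF R], auto)
    show "integrable lborel (\<lambda>u. diff_kernel (real (Suc n)) u * b u)" unfolding e by (intro Bochner_Integration.integrable_add i)
    have c: "1 + complex_of_real (real (Suc n)) / 1 = of_real (1 + real (Suc n))" "1 + 1 / 1 = complex_of_real 2" by simp_all
    have "(\<integral>u. diff_kernel (real (Suc n)) u * lnfac 1 u \<partial>lborel) = pi * (ln 2 - ln (1 + real (Suc n)) / real (Suc n))"
      using integral_diff_kernel_lnfac[OF R[of n], of 1] unfolding c norm_of_real by simp
    then show "(\<integral>u. diff_kernel (real (Suc n)) u * b u \<partial>lborel) = ln 4 * (pi * (1 - 1 / real (Suc n))) + pi * (ln 2 - ln (1 + real (Suc n)) / real (Suc n))"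
      unfolding e Bochner_Integration.integral_add[OF i] using integral_diff_kernel[OF R[of n]] by simp
  qed
  have ge: "g n = (\<lambda>u. diff_kernel (real (Suc n)) u * b u - diff_kernel (real (Suc n)) u * log_zeta u)" for n
    unfolding g_def[abs_def] right_diff_distrib ..
  have gi: "integrable lborel (g n)" for n
    unfolding ge by (intro Bochner_Integration.integrable_diff I1 integrable_diff_kernel_log_zeta R)
  have gv: "(\<integral>u. g n u \<partial>lborel) = J n" for n
    unfolding ge Bochner_Integration.integral_diff[OF I1 integrable_diff_kernel_log_zeta[OF R]] V1 integral_diff_kernel_log_zeta[OF R] J_def ..
  have nn: "0 \<le> b u - log_zeta u" for u using log_zeta_le[of u] by (simp add: b_def)
  have kmono: "mono (\<lambda>n. diff_kernel (real (Suc n)) u)" for u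
  proof (rule monoI)
    fix i j :: nat assume "i \<le> j"
    then have "real (Suc i) ^ 2 \<le> real (Suc j) ^ 2" by (intro power_mono) auto
    then have "1 / (real (Suc j) ^ 2 + u^2) \<le> 1 / (real (Suc i) ^ 2 + u^2)" by (intro frac_le) (auto intro: add_pos_nonneg)
    then show "diff_kernel (real (Suc i)) u \<le> diff_kernel (real (Suc j)) u" by (simp only: diff_kernel_def)
  qed
  have m: "AE u in lborel. mono (\<lambda>n. g n u)"
    unfolding g_def by (intro AE_I2 monoI mult_right_mono nn monoD[OF kmono])
  have p: "AE u in lborel. 0 \<le> g n u" for n
    unfolding g_def by (intro AE_I2 mult_nonneg_nonneg nn diff_kernel_nonneg R)
  have l: "AE u in lborel. (\<lambda>n. g n u) \<longlonglongrightarrow> (b u - log_zeta u) / (1 + u^2)"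
  proof (rule AE_I2)
    fix u :: real
    have "(\<lambda>n. 1 / (real (Suc n)^2 + u^2)) \<longlonglongrightarrow> 0" by real_asymp
    then have "(\<lambda>n. (1 / (1 + u^2) - 1 / (real (Suc n)^2 + u^2)) * (b u - log_zeta u)) \<longlonglongrightarrow> (1 / (1 + u^2) - 0) * (b u - log_zeta u)"
      by (intro tendsto_intros)
    then show "(\<lambda>n. g n u) \<longlonglongrightarrow> (b u - log_zeta u) / (1 + u^2)" by (simp add: g_def diff_kernel_def)
  qed
  have "(\<lambda>n. ln (1 + real (Suc n)) / real (Suc n)) \<longlonglongrightarrow> 0" "(\<lambda>n. 1 / real (Suc n)) \<longlonglongrightarrow> 0" by real_asymp+
  then have Jl: "J \<longlonglongrightarrow> ln 4 * (pi * (1 - 0)) + pi * (ln 2 - 0) - pi * (lam 1 - 0)"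
    unfolding J_def[abs_def] by (intro tendsto_intros lam_over_tendsto)
  have ilim: "(\<lambda>n. integral\<^sup>L lborel (g n)) \<longlonglongrightarrow> ln 4 * (pi * (1 - 0)) + pi * (ln 2 - 0) - pi * (lam 1 - 0)"
    using Jl unfolding gv[symmetric] .
  have um: "(\<lambda>u. (b u - log_zeta u) / (1 + u^2)) \<in> borel_measurable lborel" by measurable
  note M = integral_monotone_convergence_nonneg[OF gi m p l ilim um]
  have i0: "integrable lborel (\<lambda>u::real. ln 4 * (1 / (1^2 + u^2)))" "integrable lborel (\<lambda>u. lnfac 1 u / (1^2 + u^2))"
    using integrable_cauchy_kernel[of 1] integrable_poisson_lnfac[of 1 1] by (intro integrable_mult_right, simp_all)
  have v0: "(\<integral>u. ln 4 * (1 / (1^2 + u^2)) \<partial>(lborel::real measure)) = ln 4 * pi" "(\<integral>u. lnfac 1 u / (1^2 + u^2) \<partial>lborel) = pi * ln 2"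
    unfolding integral_mult_right_zero using integral_cauchy_kernel[of 1] integral_poisson_lnfac[of 1 1] by simp_all
  have e: "log_zeta u / (1 + u^2) = (ln 4 * (1 / (1^2 + u^2)) + lnfac 1 u / (1^2 + u^2)) - (b u - log_zeta u) / (1 + u^2)" for u
    by (simp add: b_def add_divide_distrib diff_divide_distrib)
  show ?A
    unfolding e by (intro Bochner_Integration.integrable_diff Bochner_Integration.integrable_add i0 M)
  show ?B
    unfolding e Bochner_Integration.integral_diff[OF Bochner_Integration.integrable_add[OF i0] M(1)] M(2) Bochner_Integration.integral_add[OF i0] v0
    by (simp add: algebra_simps)
qed

section \<open>The Green integral of log zeta\<close>

text \<open>The two arguments nearly cancel: their sum is the argument of (a + iu)(cnj a + iu) =
  |a|^2 - u^2 + 2iu Re a, at most its imaginary over its real part. Re a < 1/2 makes the numerator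
  at most u, and 2u + 1 <= |a| keeps the denominator above |a|^2/2.\<close>

lemma abs_argfac_le:
  assumes a: "0 \<le> Re a" "Re a < 1/2" and u: "0 \<le> u" "2 * u + 1 \<le> cmod a"
  shows "\<bar>argfac a u\<bar> \<le> u / cmod a ^ 2"
proof -
  define x y where "x = a + Complex 0 u" and "y = cnj a + Complex 0 u"
  have a1: "1 \<le> cmod a" using u by linarith
  have c2: "cmod a ^ 2 = (Re a)^2 + (Im a)^2" by (rule cmod_power2)
  have "(2 * u + 1)^2 \<le> cmod a ^ 2" using u by (intro power_mono) auto
  moreover have "(2 * u + 1)^2 = 4 * u^2 + 4 * u + 1" by (simp add: power2_eq_square algebra_simps)
  ultimately have ca: "4 * u^2 + 4 * u + 1 \<le> cmod a ^ 2" by simp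
  have "(Re a)^2 \<le> (1/2)^2" using a by (intro power_mono) auto
  then have "(Re a)^2 \<le> 1/4" by (simp add: power_divide)
  then have "u^2 < (Im a)^2" using ca c2 u zero_le_power2[of u] by linarith
  then have Iu: "u < \<bar>Im a\<bar>" using u by (metis abs_le_square_iff abs_of_nonneg not_le)
  then have Iu': "u < Im a \<or> u < - Im a" by linarith
  have xy: "x \<noteq> 0" "y \<noteq> 0" using Iu' u by (auto simp: x_def y_def complex_eq_iff)
  define W where "W = x * y"
  have W0: "W \<noteq> 0" using xy by (simp add: W_def)
  have "0 \<le> Re x" "0 \<le> Re y" using a by (simp_all add: x_def y_def)
  then have b: "\<bar>Im (Ln x)\<bar> \<le> pi/2" "\<bar>Im (Ln y)\<bar> \<le> pi/2" using Re_Ln_pos_le xy by auto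
  \<comment> \<open>Both arguments are at least -pi/2, which alone would admit the sum -pi, outside
    the principal range; since u >= 0, one of them is nonnegative.\<close>
  have "0 \<le> Im x \<or> 0 \<le> Im y" using u by (auto simp: x_def y_def)
  then have "0 \<le> Im (Ln x) \<or> 0 \<le> Im (Ln y)" using Im_Ln_pos_le xy by auto
  moreover have "- P < q + r \<and> q + r \<le> P" if "0 \<le> q \<or> 0 \<le> r" "\<bar>q\<bar> \<le> P / 2" "\<bar>r\<bar> \<le> P / 2" "0 < P" for q r P :: real
    using that by (auto simp: abs_le_iff)
  ultimately have s: "- pi < Im (Ln x) + Im (Ln y)" "Im (Ln x) + Im (Ln y) \<le> pi" using b pi_gt_zero by simp_all
  have L: "Ln W = Ln x + Ln y" unfolding W_def by (rule Ln_times_simple[OF xy s])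
  have R: "Re W = cmod a ^ 2 - u^2" "Im W = 2 * u * Re a"
    unfolding c2 W_def by (simp_all add: x_def y_def power2_eq_square algebra_simps)
  have Rb: "Re W \<ge> cmod a ^ 2 / 2" unfolding R using ca u zero_le_power2[of u] by linarith
  have "cmod a > 0" using a1 by linarith
  then have cp: "cmod a ^ 2 > 0" by simp
  then have RW: "Re W > 0" using Rb by linarith
  have "argfac a u = Im (Ln W) / 2" unfolding L by (simp add: argfac_def x_def y_def)
  also have "Im (Ln W) = arctan (Im W / Re W)"
    using Im_Ln_eq[OF W0] RW by simp
  finally have "\<bar>argfac a u\<bar> \<le> \<bar>Im W / Re W\<bar> / 2" using abs_arctan_le[of "Im W / Re W"] by simp
  also have "\<bar>Im W / Re W\<bar> = 2 * u * Re a / Re W" using RW R(2) u a by (simp add: abs_mult)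
  also have "\<dots> \<le> u / (cmod a ^ 2 / 2)"
  proof (rule frac_le)
    show "2 * u * Re a \<le> u" using mult_left_mono[of "Re a" "1/2" "2 * u"] a u by simp
  qed (use Rb cp u a in auto)
  finally show ?thesis by simp
qed

text \<open>Two errors of order \<open>gpole k\<close>^(-2): arctan x against x, and
  u/\<open>gpole k\<close> against u/(2(k+1)), where the denominators differ by 1/2.\<close>

lemma abs_arctan_gpole_le:
  assumes u: "0 \<le> u" "2 * u \<le> gpole k"
  shows "\<bar>arctan (u / gpole k) - u / (2 * real (Suc k))\<bar> \<le> (2 * u^2 + u) / gpole k ^ 2"
proof -
  define b where "b = gpole k"
  define j where "j = 2 * real (Suc k)"
  have b: "b > 0" "b = j + 1/2" using gpole_pos by (simp_all add: b_def gpole_def j_def)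
  have j: "j \<ge> 2" by (simp add: j_def)
  define x where "x = u / b"
  have x: "0 \<le> x" "x \<le> 1/2" using u b by (simp_all add: x_def b_def[symmetric] field_simps)
  have "cmod (Ln (1 + \<i> * of_real x) - \<i> * of_real x) \<le> cmod (\<i> * of_real x)^2 / (1 - cmod (\<i> * of_real x))"
    by (rule Ln_approx_linear) (use x in \<open>simp add: norm_mult\<close>)
  also have "\<dots> = x^2 / (1 - x)" using x by (simp add: norm_mult)
  also have "\<dots> \<le> x^2 / (1/2)" by (rule divide_left_mono) (use x in auto)
  finally have "\<bar>Im (Ln (1 + \<i> * of_real x) - \<i> * of_real x)\<bar> \<le> 2 * x^2"
    using abs_Im_le_cmod[of "Ln (1 + \<i> * of_real x) - \<i> * of_real x"] by simp
  moreover have "Im (Ln (1 + \<i> * of_real x)) = arctan x"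
    using Im_Ln_eq[of "1 + \<i> * of_real x"] by (simp add: complex_eq_iff)
  ultimately have A: "\<bar>arctan x - x\<bar> \<le> 2 * x^2" by simp
  have "x - u / j = (u * j - u * b) / (b * j)" unfolding x_def using b j by (intro diff_frac_eq) auto
  also have "u * j - u * b = - (u / 2)" by (simp add: b(2) algebra_simps)
  also have "- (u / 2) / (b * j) = - (u / (2 * (j * b)))" by (simp add: mult.commute)
  finally have "x - u / j = - (u / (2 * (j * b)))" .
  moreover have "u / (2 * (j * b)) \<le> u / b^2"
    unfolding power2_eq_square using u b j by (intro divide_left_mono) (auto intro: mult_right_mono)
  moreover have "0 \<le> u / (2 * (j * b))" using u b j by simp
  ultimately have "\<bar>x - u / j\<bar> \<le> u / b^2" by simp
  then have "\<bar>arctan x - u / j\<bar> \<le> 2 * x^2 + u / b^2" using A by linarith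
  also have "\<dots> = (2 * u^2 + u) / b^2" by (simp add: x_def power_divide add_divide_distrib)
  finally show ?thesis by (simp add: x_def b_def j_def)
qed

lemma (in lnfac_family)
  fixes f :: "'i \<Rightarrow> real \<Rightarrow> real" and t R B :: real
  assumes int: "\<And>i. i \<in> A \<Longrightarrow> integrable lborel (\<lambda>u. indicat_real {0..t} u * f i u)"
    and bound: "\<And>i u. i \<in> A \<Longrightarrow> cmod (p i) \<ge> R \<Longrightarrow> 0 \<le> u \<Longrightarrow> u \<le> t \<Longrightarrow> \<bar>f i u\<bar> \<le> B / cmod (p i)^2" and t: "t \<ge> 0" and B: "B \<ge> 0"
  shows integrable_interval_family: "integrable lborel (\<lambda>u. indicat_real {0..t} u * (\<Sum>\<^sub>\<infinity>i\<in>A. n i * f i u))" (is ?A)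
    and has_sum_interval_family: "((\<lambda>i. n i * (\<integral>u. indicat_real {0..t} u * f i u \<partial>lborel)) has_sum
        (\<integral>u. indicat_real {0..t} u * (\<Sum>\<^sub>\<infinity>i\<in>A. n i * f i u) \<partial>lborel)) A" (is ?B)
proof -
  define g where "g i u = n i * (indicat_real {0..t} u * f i u)" for i u
  have gb: "\<bar>g i u\<bar> \<le> indicat_real {0..t} u * (B * (n i / cmod (p i)^2))" if i: "i \<in> A" "cmod (p i) \<ge> R" for i u
  proof (cases "u \<in> {0..t}")
    case True
    then have "\<bar>f i u\<bar> \<le> B / cmod (p i)^2" using bound[OF i] by auto
    then have "n i * \<bar>f i u\<bar> \<le> n i * (B / cmod (p i)^2)" by (rule mult_left_mono[OF _ n_nonneg])
    then show ?thesis using True n_nonneg[of i] by (simp add: g_def abs_mult mult_ac)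
  qed (simp add: g_def)
  have gi: "integrable lborel (g i)" if "i \<in> A" for i unfolding g_def[abs_def] by (intro integrable_mult_right int that)
  have pt: "(\<lambda>i. g i u) summable_on A" for u
  proof (rule summable_bigO[of R _ "indicat_real {0..t} u * B"])
    show "\<bar>g i u\<bar> \<le> indicat_real {0..t} u * B * (n i / cmod (p i)^2)" if "i \<in> A" "R \<le> cmod (p i)" for i
      using gb[OF that, of u] by (simp only: mult.assoc)
  qed
  have summ: "(\<lambda>i. \<integral>u. \<bar>g i u\<bar> \<partial>lborel) summable_on A"
  proof (rule summable_bigO[of R _ "t * B"])
    fix i assume i: "i \<in> A" "R \<le> cmod (p i)"
    have ii: "integrable lborel (\<lambda>u. indicat_real {0..t} u * (B * (n i / cmod (p i)^2)))"
      by (intro integrable_mult_left integrable_real_indicator) (auto simp: emeasure_lborel_Icc_eq)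
    have "(\<integral>u. \<bar>g i u\<bar> \<partial>lborel) \<le> (\<integral>u. indicat_real {0..t} u * (B * (n i / cmod (p i)^2)) \<partial>lborel)"
      by (intro Bochner_Integration.integral_mono gb[OF i] ii integrable_abs gi i)
    also have "\<dots> = t * B * (n i / cmod (p i)^2)" using t by simp
    finally show "\<bar>\<integral>u. \<bar>g i u\<bar> \<partial>lborel\<bar> \<le> t * B * (n i / cmod (p i)^2)" by simp
  qed
  have e: "(\<Sum>\<^sub>\<infinity>i\<in>A. g i u) = indicat_real {0..t} u * (\<Sum>\<^sub>\<infinity>i\<in>A. n i * f i u)" for u
  proof (cases "u \<in> {0..t}")
    case True
    then show ?thesis by (simp add: g_def)
  qed (simp add: g_def)
  have v: "(\<integral>u. g i u \<partial>lborel) = n i * (\<integral>u. indicat_real {0..t} u * f i u \<partial>lborel)" for i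
    unfolding g_def by (rule integral_mult_right_zero)
  show ?A
    using integrable_infsum[OF A_countable gi pt summ] unfolding e .
  show ?B
    using has_sum_integral[OF A_countable gi pt summ] unfolding e v .
qed

definition zarg :: "real \<Rightarrow> real" where "zarg u = (\<Sum>\<^sub>\<infinity>z\<in>xi.Z. real (xi.m z) * argfac (rpart z) u)"

definition garg :: "real \<Rightarrow> real" where
  "garg u = (\<Sum>\<^sub>\<infinity>k. 1 * (arctan (u / gpole k) - u / (2 * real (Suc k))))"

lemma summable_zarg:
  assumes u: "0 \<le> u" shows "(\<lambda>z. real (xi.m z) * argfac (rpart z) u) summable_on xi.Z"
proof (rule zf.summable_bigO[of "2 * u + 1" _ u])
  fix z assume z: "z \<in> xi.Z" "2 * u + 1 \<le> cmod (rpart z)"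
  have "\<bar>argfac (rpart z) u\<bar> \<le> u / cmod (rpart z) ^ 2" using abs_argfac_le[of "rpart z" u] abs_Re_rpart[OF z(1)] u z(2) by simp
  then have "real (xi.m z) * \<bar>argfac (rpart z) u\<bar> \<le> real (xi.m z) * (u / cmod (rpart z) ^ 2)" by (rule mult_left_mono) simp
  then show "\<bar>real (xi.m z) * argfac (rpart z) u\<bar> \<le> u * (real (xi.m z) / cmod (rpart z) ^ 2)" by (simp add: abs_mult mult_ac)
qed

lemma garg_sums:
  assumes u: "0 \<le> u" shows "(\<lambda>k. arctan (u / gpole k) - u / (2 * real (Suc k))) sums garg u"
proof -
  have "(\<lambda>k. 1 * (arctan (u / gpole k) - u / (2 * real (Suc k)))) summable_on UNIV"
  proof (rule gf.summable_bigO[of "2 * u" _ "2 * u^2 + u"])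
    fix k assume k: "2 * u \<le> cmod (complex_of_real (gpole k))"
    then have "2 * u \<le> gpole k" using gpole_pos[of k] by simp
    from abs_arctan_gpole_le[OF u this]
    show "\<bar>1 * (arctan (u / gpole k) - u / (2 * real (Suc k)))\<bar> \<le> (2 * u^2 + u) * (1 / (cmod (complex_of_real (gpole k)))^2)"
      by simp
  qed
  then have "((\<lambda>k. 1 * (arctan (u / gpole k) - u / (2 * real (Suc k)))) has_sum garg u) UNIV"
    unfolding garg_def by (rule has_sum_infsum)
  then show ?thesis using has_sum_imp_sums by fastforce
qed

lemma vartheta_eq:
  assumes u: "0 \<le> u"
  shows "vartheta u = - arctan (2 * u) - u / 2 * (euler_mascheroni + ln pi) - garg u"
proof -
  have "(\<lambda>k. u / (2 * real (Suc k)) - arctan (u / gpole k)) sums (- garg u)"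
    using sums_minus[OF garg_sums[OF u]] by simp
  then have "(\<Sum>k. u / (2 * real (Suc k)) - arctan (u / (2 * real (Suc k) + 1/2))) = - garg u"
    unfolding gpole_def by (simp only: sums_iff)
  then show ?thesis by (simp add: vartheta_def)
qed

lemma argfac_of_real: "b > 0 \<Longrightarrow> argfac (of_real b) u = arctan (u / b)"
  using Im_Ln_eq[of "of_real b + Complex 0 u"] by (simp add: argfac_def complex_eq_iff)

lemma integrable_interval_argfac:
  assumes "t \<ge> 0" shows "integrable lborel (\<lambda>u. indicat_real {0..t} u * argfac a u)"
proof (rule Bochner_Integration.integrable_bound)
  show "integrable lborel (\<lambda>u. indicat_real {0..t} u * pi)"
    by (intro integrable_mult_left integrable_real_indicator) (auto simp: emeasure_lborel_Icc_eq)
  have "AE u in lborel. u \<notin> {Im a, - Im a}" by (rule AE_lborel_not_in) simp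
  then show "AE u in lborel. norm (indicat_real {0..t} u * argfac a u) \<le> norm (indicat_real {0..t} u * pi)"
    by eventually_elim (auto simp: indicator_def argfac_bounded)
qed measurable

lemma has_bochner_integral_interval_id:
  assumes t: "t \<ge> 0"
  shows "integrable lborel (\<lambda>u. indicat_real {0..t} u * u)" (is ?A) "(\<integral>u. indicat_real {0..t} u * u \<partial>lborel) = t^2 / 2"
proof -
  have h: "((\<lambda>u. u) has_integral (t^2/2 - 0^2/2)) {0..t}"
    by (rule fundamental_theorem_of_calculus[OF t]) (auto intro!: derivative_eq_intros simp: has_real_derivative_iff_has_vector_derivative[symmetric])
  have s: "set_integrable lborel {0..t} (\<lambda>u. u)" by (rule borel_integrable_atLeastAtMost') (intro continuous_intros)
  show ?A using s unfolding set_integrable_def real_scaleR_def .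
  show "(\<integral>u. indicat_real {0..t} u * u \<partial>lborel) = t^2 / 2"
    using set_borel_integral_eq_integral(2)[OF s] integral_unique[OF h] unfolding set_lebesgue_integral_def real_scaleR_def by simp
qed

text \<open>\<open>F2\<close> is the integral against \<open>green_kernel t\<close> minus t^2 times
  the integral of \<open>log_zeta\<close> over 1 + u^2. The Poisson values ln |1 + 1/a| collected by
  the first are exactly those in \<open>lam 1\<close>, so they cancel. What survives beside the
  arguments is the term of \<open>lam 1\<close> with Euler's constant and ln pi, which integrates
  the linear part of \<open>vartheta\<close>.\<close>

lemma
  assumes t: "t > 0"
  shows integrable_interval_arg: "integrable lborel (\<lambda>u. indicat_real {0..t} u * (zarg u - vartheta u - 2 * arctan (2 * u)))" (is ?A)
    and F2_eq: "F2 t = - 2 * pi * (\<integral>u. indicat_real {0..t} u * (zarg u - vartheta u - 2 * arctan (2 * u)) \<partial>lborel)" (is ?B)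
proof -
  have t0: "t \<ge> 0" using t by simp
  define I where "I f = (\<integral>u. indicat_real {0..t} u * f u \<partial>lborel)" for f
  define em where "em = (euler_mascheroni + ln pi :: real)"
  have K: "integrable lborel (green_kernel t)" "(\<integral>u. green_kernel t u \<partial>lborel) = t^2 * pi"
    by (rule integrable_green_kernel[OF t], rule integral_green_kernel[OF t])
  note h = green_kernel_measurable K(1) integrable_green_kernel_lnfac[OF t]
    zf.integrable_green_kernel_family[OF t] gf.integrable_green_kernel_family[OF t]
  have GL: "integrable lborel (\<lambda>u. green_kernel t u * log_zeta u)" by (rule integrable_kernel_log_zeta[OF h])
  have zb: "\<bar>argfac (rpart z) u\<bar> \<le> t / cmod (rpart z) ^ 2" if "z \<in> xi.Z" "2 * t + 1 \<le> cmod (rpart z)" "0 \<le> u" "u \<le> t" for z u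
  proof -
    have "\<bar>argfac (rpart z) u\<bar> \<le> u / cmod (rpart z) ^ 2" using abs_argfac_le[of "rpart z" u] abs_Re_rpart[OF that(1)] that by simp
    also have "\<dots> \<le> t / cmod (rpart z) ^ 2" using that by (intro divide_right_mono) auto
    finally show ?thesis .
  qed
  have zi: "integrable lborel (\<lambda>u. indicat_real {0..t} u * zarg u)"
    unfolding zarg_def by (rule zf.integrable_interval_family[OF integrable_interval_argfac[OF t0] zb]) (use t in auto)
  have zs: "((\<lambda>z. real (xi.m z) * (\<integral>u. indicat_real {0..t} u * argfac (rpart z) u \<partial>lborel)) has_sum I zarg) xi.Z"
    unfolding I_def zarg_def by (rule zf.has_sum_interval_family[OF integrable_interval_argfac[OF t0] zb]) (use t in auto)
  have gb: "\<bar>arctan (u / gpole k) - u / (2 * real (Suc k))\<bar> \<le> (2 * t^2 + t) / (cmod (complex_of_real (gpole k)))^2"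
    if "2 * t \<le> cmod (complex_of_real (gpole k))" "0 \<le> u" "u \<le> t" for k u
  proof -
    have "2 * u \<le> gpole k" using that gpole_pos[of k] by simp
    then have "\<bar>arctan (u / gpole k) - u / (2 * real (Suc k))\<bar> \<le> (2 * u^2 + u) / gpole k ^ 2" by (rule abs_arctan_gpole_le[OF that(2)])
    also have "\<dots> \<le> (2 * t^2 + t) / gpole k ^ 2" using that by (intro divide_right_mono add_mono mult_left_mono power_mono) auto
    finally show ?thesis by simp
  qed
  have ia: "integrable lborel (\<lambda>u. indicat_real {0..t} u * arctan (u / b))" if "b > 0" for b
    using integrable_interval_argfac[OF t0, of "of_real b"] unfolding argfac_of_real[OF that] .
  have va: "(\<integral>u. indicat_real {0..t} u * (arctan (u / gpole k) - u / (2 * real (Suc k))) \<partial>lborel)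
      = (\<integral>u. indicat_real {0..t} u * argfac (of_real (gpole k)) u \<partial>lborel) - t^2 / (4 * real (Suc k))"
    and gi0: "integrable lborel (\<lambda>u. indicat_real {0..t} u * (arctan (u / gpole k) - u / (2 * real (Suc k))))" for k
  proof -
    have e: "indicat_real {0..t} u * (arctan (u / gpole k) - u / (2 * real (Suc k))) =
       indicat_real {0..t} u * arctan (u / gpole k) - indicat_real {0..t} u * u / (2 * real (Suc k))" for u
      by (simp only: right_diff_distrib times_divide_eq_right)
    note i = ia[OF gpole_pos[of k]] integrable_divide[OF has_bochner_integral_interval_id(1)[OF t0], of "2 * real (Suc k)"]
    show "integrable lborel (\<lambda>u. indicat_real {0..t} u * (arctan (u / gpole k) - u / (2 * real (Suc k))))"
      unfolding e by (intro Bochner_Integration.integrable_diff i)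
    show "(\<integral>u. indicat_real {0..t} u * (arctan (u / gpole k) - u / (2 * real (Suc k))) \<partial>lborel)
      = (\<integral>u. indicat_real {0..t} u * argfac (of_real (gpole k)) u \<partial>lborel) - t^2 / (4 * real (Suc k))"
      unfolding e Bochner_Integration.integral_diff[OF i] argfac_of_real[OF gpole_pos] integral_divide_zero has_bochner_integral_interval_id(2)[OF t0] by simp
  qed
  have gi: "integrable lborel (\<lambda>u. indicat_real {0..t} u * garg u)"
    unfolding garg_def by (rule gf.integrable_interval_family[OF gi0 gb]) (use t in auto)
  have gs: "((\<lambda>k. 1 * (\<integral>u. indicat_real {0..t} u * (arctan (u / gpole k) - u / (2 * real (Suc k))) \<partial>lborel)) has_sum I garg) UNIV"
    unfolding I_def garg_def by (rule gf.has_sum_interval_family[OF gi0 gb]) (use t in auto)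
  have "((\<lambda>z. - 2 * pi * (real (xi.m z) * (\<integral>u. indicat_real {0..t} u * argfac (rpart z) u \<partial>lborel)) + t^2 * pi * (real (xi.m z) * ln (cmod (1 + of_real 1 / rpart z))))
      has_sum (- 2 * pi * I zarg + t^2 * pi * zpoisson 1)) xi.Z"
    unfolding zpoisson_def by (intro has_sum_add has_sum_cmult_right zs has_sum_infsum summable_zpoisson) simp
  then have "((\<lambda>z. real (xi.m z) * (- 2 * pi * (\<integral>u. indicat_real {0..t} u * argfac (rpart z) u \<partial>lborel) + t^2 * pi * ln (cmod (1 + 1 / rpart z))))
      has_sum (- 2 * pi * I zarg + t^2 * pi * zpoisson 1)) xi.Z" by (simp add: algebra_simps)
  from has_sum_unique[OF zf.has_sum_green_kernel_family[OF t] this]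
  have Z: "(\<integral>u. green_kernel t u * zero_log u \<partial>lborel) = - 2 * pi * I zarg + t^2 * pi * zpoisson 1" .
  have "(\<lambda>k. 1 * (\<integral>u. indicat_real {0..t} u * (arctan (u / gpole k) - u / (2 * real (Suc k))) \<partial>lborel)) sums I garg"
    by (rule has_sum_imp_sums[OF gs])
  then have "(\<lambda>k. (\<integral>u. indicat_real {0..t} u * argfac (of_real (gpole k)) u \<partial>lborel) - t^2 / (4 * real (Suc k))) sums I garg"
    unfolding va by simp
  \<comment> \<open>The subtraction t^2/(4(k+1)) of the argument integral, multiplied by -2 pi, is
    cancelled by t^2 pi/(2(k+1)) from \<open>gpoisson\<close>. So the compensated series may be
    added term by term to match the uncompensated one.\<close>
  then have s2: "(\<lambda>k. - 2 * pi * ((\<integral>u. indicat_real {0..t} u * argfac (of_real (gpole k)) u \<partial>lborel) - t^2 / (4 * real (Suc k)))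
      + t^2 * pi * (ln (1 + 1 / gpole k) - 1 / (2 * real (Suc k)))) sums (- 2 * pi * I garg + t^2 * pi * gpoisson 1)"
    by (intro sums_add sums_mult gpoisson_sums) auto
  have "(\<lambda>k. 1 * (- 2 * pi * (\<integral>u. indicat_real {0..t} u * argfac (of_real (gpole k)) u \<partial>lborel) + t^2 * pi * ln (cmod (1 + 1 / complex_of_real (gpole k))))) sums
     (\<integral>u. green_kernel t u * gamma_log u \<partial>lborel)"
    by (rule has_sum_imp_sums[OF gf.has_sum_green_kernel_family[OF t]])
  moreover have "1 * (- 2 * pi * (\<integral>u. indicat_real {0..t} u * argfac (of_real (gpole k)) u \<partial>lborel) + t^2 * pi * ln (cmod (1 + 1 / complex_of_real (gpole k))))
    = - 2 * pi * ((\<integral>u. indicat_real {0..t} u * argfac (of_real (gpole k)) u \<partial>lborel) - t^2 / (4 * real (Suc k)))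
      + t^2 * pi * (ln (1 + 1 / gpole k) - 1 / (2 * real (Suc k)))" for k
    using ln_cmod_gpole[of 1 k] by (simp add: algebra_simps del: of_nat_Suc)
  ultimately have s1: "(\<lambda>k. - 2 * pi * ((\<integral>u. indicat_real {0..t} u * argfac (of_real (gpole k)) u \<partial>lborel) - t^2 / (4 * real (Suc k)))
      + t^2 * pi * (ln (1 + 1 / gpole k) - 1 / (2 * real (Suc k)))) sums
     (\<integral>u. green_kernel t u * gamma_log u \<partial>lborel)" by (simp only:)
  note G = sums_unique2[OF s1 s2]
  have "argfac (1/2) u = arctan (2 * u)" for u using argfac_of_real[of "1/2" u] by (simp add: mult.commute)
  then have H: "(\<integral>u. green_kernel t u * lnfac (1/2) u \<partial>lborel) = - 2 * pi * I (\<lambda>u. arctan (2 * u)) + t^2 * pi * ln (1 + 2 * 1)"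
    using integral_green_kernel_lnfac[OF t, of "1/2"] ln_cmod_half_pole[of 1] by (simp add: I_def)
  have "(\<integral>u. green_kernel t u * log_zeta u \<partial>lborel) = ln (cmod (zreg (1/2))) * (\<integral>u. green_kernel t u \<partial>lborel)
      + (\<integral>u. green_kernel t u * zero_log u \<partial>lborel)
      + (\<integral>u. green_kernel t u * gamma_log u \<partial>lborel) - (\<integral>u. green_kernel t u * lnfac (1/2) u \<partial>lborel)"
    by (rule integral_kernel_log_zeta[OF h])
  then have V: "(\<integral>u. green_kernel t u * log_zeta u \<partial>lborel) = ln (cmod (zreg (1/2))) * (t^2 * pi) + (- 2 * pi * I zarg + t^2 * pi * zpoisson 1)
     + (- 2 * pi * I garg + t^2 * pi * gpoisson 1) - (- 2 * pi * I (\<lambda>u. arctan (2 * u)) + t^2 * pi * ln (1 + 2 * 1))"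
    unfolding Z G H K(2) .
  have "F2 t = (\<integral>u. green_kernel t u * log_zeta u - t^2 * (log_zeta u / (1 + u^2)) \<partial>lborel)"
    unfolding F2_def ln_cmod_zeta_line by (rule Bochner_Integration.integral_cong) (simp_all add: green_kernel_def algebra_simps)
  also have "\<dots> = (\<integral>u. green_kernel t u * log_zeta u \<partial>lborel) - t^2 * (pi * lam 1)"
    unfolding Bochner_Integration.integral_diff[OF GL integrable_mult_right[OF integrable_log_zeta_kernel]] integral_mult_right_zero integral_log_zeta_kernel ..
  also have "\<dots> = - 2 * pi * (I zarg + I garg - I (\<lambda>u. arctan (2 * u)) + t^2 / 4 * em)"
    unfolding V lam_def em_def by (simp add: field_simps)
  finally have F: "F2 t = - 2 * pi * (I zarg + I garg - I (\<lambda>u. arctan (2 * u)) + t^2 / 4 * em)" .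
  have i2: "integrable lborel (\<lambda>u. indicat_real {0..t} u * arctan (2 * u))" using ia[of "1/2"] by (simp add: mult.commute)
  have iu: "integrable lborel (\<lambda>u. em / 2 * (indicat_real {0..t} u * u))" by (intro integrable_mult_right has_bochner_integral_interval_id t0)
  have e: "indicat_real {0..t} u * (zarg u - vartheta u - 2 * arctan (2 * u)) =
     indicat_real {0..t} u * zarg u + indicat_real {0..t} u * garg u - indicat_real {0..t} u * arctan (2 * u) + em / 2 * (indicat_real {0..t} u * u)" for u
    using vartheta_eq[of u] by (cases "u \<in> {0..t}") (auto simp: em_def algebra_simps)
  note ii = zi gi i2 iu
  show ?A
    unfolding e by (intro Bochner_Integration.integrable_add Bochner_Integration.integrable_diff ii)
  have "(\<integral>u. indicat_real {0..t} u * (zarg u - vartheta u - 2 * arctan (2 * u)) \<partial>lborel) = I zarg + I garg - I (\<lambda>u. arctan (2 * u)) + em / 2 * (t^2 / 2)"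
    unfolding e I_def has_bochner_integral_interval_id(2)[OF t0, symmetric] using ii by simp
  then show ?B
    unfolding F by (simp add: mult.commute)
qed

section \<open>The Blaschke product\<close>

definition right_zeros :: "complex set" where "right_zeros = {w \<in> xi.Z. Re w > 0}"

lemma right_zerosD: "w \<in> right_zeros \<Longrightarrow> w \<in> xi.Z \<and> 0 < Re w \<and> Re w < 1/2"
  using xi_Z_Re_less by (auto simp: right_zeros_def)

lemma zeros_right_eq:
  "{\<rho>. 1/2 < Re \<rho> \<and> zeta \<rho> = 0 \<and> \<bar>Im \<rho>\<bar> \<le> T} = (\<lambda>w. 1/2 + w) ` {w \<in> right_zeros. \<bar>Im w\<bar> \<le> T}"
proof (intro equalityI subsetI)
  fix \<rho> assume r: "\<rho> \<in> {\<rho>. 1/2 < Re \<rho> \<and> zeta \<rho> = 0 \<and> \<bar>Im \<rho>\<bar> \<le> T}"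
  have "\<rho> - 1/2 \<in> right_zeros" using r xi_fun_zero_iff[of "\<rho> - 1/2"] by (simp add: right_zeros_def xi.Z_def)
  then show "\<rho> \<in> (\<lambda>w. 1/2 + w) ` {w \<in> right_zeros. \<bar>Im w\<bar> \<le> T}" using r by (intro image_eqI[of _ _ "\<rho> - 1/2"]) auto
next
  fix \<rho> assume "\<rho> \<in> (\<lambda>w. 1/2 + w) ` {w \<in> right_zeros. \<bar>Im w\<bar> \<le> T}"
  then obtain w where w: "\<rho> = 1/2 + w" "w \<in> xi.Z" "0 < Re w" "\<bar>Im w\<bar> \<le> T" by (auto simp: right_zeros_def)
  then show "\<rho> \<in> {\<rho>. 1/2 < Re \<rho> \<and> zeta \<rho> = 0 \<and> \<bar>Im \<rho>\<bar> \<le> T}" using xi_fun_zero_iff[of w] by (simp add: xi.Z_def)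
qed

lemma finite_zeros_Im: "finite {w \<in> xi.Z. \<bar>Im w\<bar> \<le> T}"
proof (rule finite_subset[OF _ xi.finite_Z_cball[of "1/2 + T"]])
  show "{w \<in> xi.Z. \<bar>Im w\<bar> \<le> T} \<subseteq> {w \<in> xi.Z. cmod w \<le> 1/2 + T}"
  proof
    fix w assume "w \<in> {w \<in> xi.Z. \<bar>Im w\<bar> \<le> T}"
    then show "w \<in> {w \<in> xi.Z. cmod w \<le> 1/2 + T}" using cmod_le[of w] xi_Z_abs_Re[of w] by simp
  qed
qed

definition bfac :: "complex \<Rightarrow> complex \<Rightarrow> complex" where "bfac w v = blaschke_factor (1/2 + w) (1/2 + v)"

lemma Blaschke_eq_Lim:
  "Blaschke (1/2 + v) = Lim at_top (\<lambda>T. \<Prod>w\<in>{w \<in> right_zeros. \<bar>Im w\<bar> \<le> T}. bfac w v ^ xi.m w)"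
proof -
  have i: "inj_on (\<lambda>w. 1/2 + w) X" for X :: "complex set" by (auto simp: inj_on_def)
  show ?thesis unfolding Blaschke_def zeros_right_eq prod.reindex[OF i] o_def
    by (intro arg_cong[of _ _ "Lim at_top"] ext prod.cong) (auto simp: bfac_def right_zeros_def xi_m_eq_zero_mult)
qed

text \<open>A constant of modulus 1 for zeros in the right half of the strip: it converts the given
  normalisation into the usual half-plane Blaschke factor (v - w)/(v + cnj w).\<close>

definition bkap :: "complex \<Rightarrow> complex" where
  "bkap w = (1/2 - cnj w) / (1/2 + w) * of_real (cmod ((1/2 + w) / (1/2 - w)))"

text \<open>The first form is suited to differentiation, the second to convergence: it displays the
  factor as a product of two quantities tending to 1 as |w| grows.\<close>

lemma
  assumes w: "w \<in> right_zeros"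
  shows bfac_eq: "v + cnj w \<noteq> 0 \<Longrightarrow> bfac w v = bkap w * ((v - w) / (v + cnj w))"
    and bkap_nonzero: "bkap w \<noteq> 0"
    and bfac_eq_bound: "v + cnj w \<noteq> 0 \<Longrightarrow> bfac w v = of_real (cmod ((1/2 + w) / (1/2 - w))) * (1 - 2 * of_real (Re w) * (1/2 + v) / ((1/2 + w) * (v + cnj w)))"
proof -
  note W = right_zerosD[OF w]
  define \<rho> \<sigma> where "\<rho> = 1/2 + w" and "\<sigma> = 1/2 - cnj w"
  have r: "\<rho> \<noteq> 0" using W by (auto simp: complex_eq_iff \<rho>_def)
  have sg: "\<sigma> \<noteq> 0" using W by (auto simp: complex_eq_iff \<sigma>_def)
  have nw: "1/2 - w \<noteq> 0" using W by (auto simp: complex_eq_iff)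
  show "bkap w \<noteq> 0" using r sg nw by (simp add: bkap_def \<rho>_def \<sigma>_def)
  assume v: "v + cnj w \<noteq> 0"
  have c: "1 - cnj \<rho> = \<sigma>" "1 - \<rho> = 1/2 - w" by (simp_all add: \<rho>_def \<sigma>_def)
  have "1 - (1/2 + v) / \<rho> = (\<rho> - (1/2 + v)) / \<rho>" using r by (simp add: diff_divide_distrib)
  then have n1: "1 - (1/2 + v) / \<rho> = - (v - w) / \<rho>" by (simp add: \<rho>_def)
  have "\<sigma> - (1/2 + v) = - (v + cnj w)" by (simp add: \<sigma>_def)
  moreover have "1 - (1/2 + v) / \<sigma> = (\<sigma> - (1/2 + v)) / \<sigma>" using sg by (simp add: diff_divide_distrib)
  ultimately have n2: "1 - (1/2 + v) / \<sigma> = - (v + cnj w) / \<sigma>" by simp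
  have b: "bfac w v = (- (v - w) / \<rho>) / (- (v + cnj w) / \<sigma>) * of_real (cmod (\<rho> / (1/2 - w)))"
    unfolding bfac_def blaschke_factor_def \<rho>_def[symmetric] c n1 n2 ..
  also have "(- (v - w) / \<rho>) / (- (v + cnj w) / \<sigma>) = \<sigma> / \<rho> * ((v - w) / (v + cnj w))"
  proof -
    have "(- N / \<rho>) / (- D / \<sigma>) = \<sigma> / \<rho> * (N / D)" for N D :: complex by (simp add: mult.commute)
    then show ?thesis .
  qed
  finally have b1: "bfac w v = \<sigma> / \<rho> * ((v - w) / (v + cnj w)) * of_real (cmod (\<rho> / (1/2 - w)))" .
  then show "bfac w v = bkap w * ((v - w) / (v + cnj w))" by (simp add: bkap_def \<rho>_def \<sigma>_def mult_ac)
  have "of_real (2 * Re w) = w + cnj w" by (simp add: complex_add_cnj)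
  then have a: "2 * of_real (Re w) = w + cnj w" by simp
  have "\<sigma> * (v - w) = \<rho> * (v + cnj w) - (w + cnj w) * (1/2 + v)"
    by (simp add: \<sigma>_def \<rho>_def algebra_simps add_divide_distrib diff_divide_distrib)
  then have "\<sigma> / \<rho> * ((v - w) / (v + cnj w)) = (\<rho> * (v + cnj w) - (w + cnj w) * (1/2 + v)) / (\<rho> * (v + cnj w))" by simp
  also have "\<dots> = 1 - (w + cnj w) * (1/2 + v) / (\<rho> * (v + cnj w))" using r v by (simp add: diff_divide_distrib)
  finally show "bfac w v = of_real (cmod ((1/2 + w) / (1/2 - w))) * (1 - 2 * of_real (Re w) * (1/2 + v) / ((1/2 + w) * (v + cnj w)))"
    unfolding b1 a \<rho>_def by (simp add: mult.commute)
qed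

text \<open>With A = |(1/2 + w)/(1/2 - w)| the identity A^2 - 1 = 2 Re w / |1/2 - w|^2 gives |A - 1|
  <= 4/|w|^2, and the fractional correction is at most 4 (q + 1)/|w|^2. Both use 0 < Re w < 1/2. The
  threshold 8 (q + 1) brings the bound below 1/4, where the principal logarithm is harmless.\<close>

lemma cmod_bfac_minus_one_le:
  assumes w: "w \<in> right_zeros" and v: "cmod v \<le> q" and R: "cmod w \<ge> 8 * (q + 1)"
  shows "v + cnj w \<noteq> 0" "cmod (bfac w v - 1) \<le> 12 * (q + 1) / cmod w ^ 2" "12 * (q + 1) / cmod w ^ 2 \<le> 1/4"
proof -
  note W = right_zerosD[OF w]
  have q: "q \<ge> 0" using v norm_ge_zero[of v] by linarith
  define r where "r = cmod w"
  have "r \<ge> 8" "r \<ge> 8 * q" using R q by (simp_all add: r_def)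
  moreover from this have "r > 0" by linarith
  ultimately have r: "r \<ge> 8" "r \<ge> 8 * q" "r > 0" by blast+
  have d1: "cmod (1/2 + w) \<ge> r / 2" using norm_triangle_ineq2[of w "- (1/2)"] r by (simp add: r_def add.commute)
  have d2: "cmod (1/2 - w) \<ge> r / 2" using norm_triangle_ineq2[of w "1/2"] r norm_minus_commute[of w "1/2"] by (simp add: r_def)
  have d3: "cmod (v + cnj w) \<ge> r / 2" using norm_triangle_ineq2[of "cnj w" "- v"] r v q by (simp add: r_def add.commute)
  show nz: "v + cnj w \<noteq> 0" using d3 r by auto
  define A where "A = cmod ((1/2 + w) / (1/2 - w))"
  define e where "e = - (2 * of_real (Re w) * (1/2 + v) / ((1/2 + w) * (v + cnj w)))"
  have q1: "q + 1 \<le> (q + 1)^2" using q by (simp add: power2_eq_square algebra_simps)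
  have "(8 * (q + 1))^2 \<le> r^2" unfolding r_def by (rule power_mono[OF R]) (use q in simp)
  then have "64 * (q + 1)^2 \<le> r^2" unfolding power_mult_distrib by simp
  moreover have "64 * (q + 1) \<le> 64 * (q + 1)^2" using q1 by (rule mult_left_mono) simp
  ultimately have r2: "64 * (q + 1) \<le> r^2" by (rule order_trans[rotated])
  show small: "12 * (q + 1) / cmod w ^ 2 \<le> 1/4" using r2 r q by (simp add: r_def[symmetric] field_simps)
  have A1: "\<bar>A - 1\<bar> \<le> 4 / r^2"
  proof -
    have "A \<ge> 0" by (simp add: A_def)
    then have "\<bar>A - 1\<bar> * 1 \<le> \<bar>A - 1\<bar> * \<bar>A + 1\<bar>" by (intro mult_left_mono) auto
    also have "\<dots> = \<bar>A^2 - 1\<bar>" by (simp add: abs_mult[symmetric] power2_eq_square algebra_simps)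
    also have "A^2 - 1 = 2 * Re w / (cmod (1/2 - w))^2"
    proof -
      have "cmod (1/2 - w) > 0" using d2 r by linarith
      then have p: "(cmod (1/2 - w))^2 > 0" by (rule zero_less_power)
      have A2: "A^2 = (cmod (1/2 + w))^2 / (cmod (1/2 - w))^2" unfolding A_def norm_divide power_divide ..
      have "(cmod (1/2 + w))^2 = (cmod (1/2 - w))^2 + 2 * Re w" unfolding cmod_power2 by (simp add: power2_eq_square algebra_simps)
      then show ?thesis unfolding A2 using p by (simp only: add_divide_distrib) simp
    qed
    also have "\<bar>2 * Re w / (cmod (1/2 - w))^2\<bar> \<le> 1 / (r/2)^2"
    proof -
      have "(r/2)^2 \<le> (cmod (1/2 - w))^2" using d2 r by (intro power_mono) auto
      moreover have "(r/2)^2 > 0" using r by simp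
      ultimately have "2 * Re w / (cmod (1/2 - w))^2 \<le> 1 / (r/2)^2" using W by (intro frac_le) auto
      then show ?thesis using W by simp
    qed
    finally show ?thesis by (simp add: power_divide)
  qed
  have e1: "cmod e \<le> 4 * (q + 1) / r^2"
  proof -
    have "cmod e = 2 * Re w * cmod (1/2 + v) / (cmod (1/2 + w) * cmod (v + cnj w))"
      using W by (simp add: e_def norm_mult norm_divide)
    also have "\<dots> \<le> (q + 1) / ((r/2) * (r/2))"
    proof (rule frac_le)
      have "cmod (1/2 + v) \<le> q + 1" using norm_triangle_ineq[of "1/2" v] v by simp
      then show "2 * Re w * cmod (1/2 + v) \<le> q + 1" using mult_mono[of "2 * Re w" 1 "cmod (1/2 + v)" "q + 1"] W by simp
      show "(r/2) * (r/2) \<le> cmod (1/2 + w) * cmod (v + cnj w)" using d1 d3 r by (intro mult_mono) auto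
    qed (use q r in auto)
    also have "c / ((r/2) * (r/2)) = 4 * c / r^2" for c by (simp add: power2_eq_square)
    finally show ?thesis .
  qed
  have "4 * (q + 1) / r^2 \<le> 12 * (q + 1) / r^2" by (intro divide_right_mono) (use q in auto)
  then have "cmod e \<le> 1" using e1 small unfolding r_def[symmetric] by linarith
  have "bfac w v = of_real A * (1 + e)" using bfac_eq_bound[OF w nz] by (simp add: A_def e_def)
  then have "bfac w v - 1 = of_real (A - 1) * (1 + e) + e" by (simp add: algebra_simps)
  then have "cmod (bfac w v - 1) \<le> \<bar>A - 1\<bar> * cmod (1 + e) + cmod e"
    using norm_triangle_ineq[of "of_real (A - 1) * (1 + e)" e] by (simp add: norm_mult del: of_real_diff)
  also have "\<dots> \<le> 4 / r^2 * 2 + 4 * (q + 1) / r^2"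
    using norm_triangle_ineq[of 1 e] \<open>cmod e \<le> 1\<close> A1 e1 by (intro add_mono mult_mono) auto
  also have "\<dots> \<le> 12 * (q + 1) / r^2" using r q by (simp add: add_divide_distrib[symmetric] divide_right_mono)
  finally show "cmod (bfac w v - 1) \<le> 12 * (q + 1) / cmod w ^ 2" by (simp add: r_def)
qed

lemma bfac_has_derivative:
  assumes w: "w \<in> right_zeros" and v: "v + cnj w \<noteq> 0" "v - w \<noteq> 0"
  shows "(bfac w has_field_derivative bfac w v * (1 / (v - w) - 1 / (v + cnj w))) (at v)"
proof -
  have "((\<lambda>v. bkap w * ((v - w) / (v + cnj w))) has_field_derivative bkap w * ((1 * (v + cnj w) - (v - w) * 1) / ((v + cnj w) * (v + cnj w)))) (at v)"
    by (rule DERIV_cmult, rule DERIV_divide) (auto intro!: derivative_eq_intros simp: v)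
  moreover have "k * ((1 * D - N * 1) / (D * D)) = k * (N / D) * (1 / N - 1 / D)" if "D \<noteq> 0" "N \<noteq> 0" for k D N :: complex
    using that by (simp add: field_simps)
  note this[OF v]
  ultimately have d: "((\<lambda>v. bkap w * ((v - w) / (v + cnj w))) has_field_derivative bkap w * ((v - w) / (v + cnj w)) * (1 / (v - w) - 1 / (v + cnj w))) (at v)"
    by (simp only:)
  have "open (- {- cnj w})" by (intro open_Compl) auto
  then show ?thesis unfolding bfac_eq[OF w v(1)]
    by (rule has_field_derivative_transform_within_open[OF d])
      (use v bfac_eq[OF w] in \<open>auto simp: eq_neg_iff_add_eq_0\<close>)
qed

lemma has_field_derivative_prod_log:
  fixes f :: "'i \<Rightarrow> complex \<Rightarrow> complex"
  assumes "finite X" "\<And>i. i \<in> X \<Longrightarrow> (f i has_field_derivative f i z * d i) (at z)"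
  shows "((\<lambda>z. \<Prod>i\<in>X. f i z ^ k i) has_field_derivative (\<Prod>i\<in>X. f i z ^ k i) * (\<Sum>i\<in>X. of_nat (k i) * d i)) (at z)"
  using assms
proof (induction X rule: finite_induct)
  case (insert j X)
  have p: "((\<lambda>z. f j z ^ k j) has_field_derivative f j z ^ k j * (of_nat (k j) * d j)) (at z)"
  proof (cases "k j")
    case 0
    then show ?thesis by simp
  next
    case (Suc n)
    show ?thesis unfolding Suc
      by (rule derivative_eq_intros refl insert.prems insertI1)+ (simp add: algebra_simps)
  qed
  have i: "((\<lambda>z. \<Prod>i\<in>X. f i z ^ k i) has_field_derivative (\<Prod>i\<in>X. f i z ^ k i) * (\<Sum>i\<in>X. of_nat (k i) * d i)) (at z)"
    using insert by auto
  show ?case using DERIV_mult[OF p i] insert.hyps by (simp add: algebra_simps)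
qed simp

text \<open>Near a point of the axis Re v = 0 the product is split into finitely many factors for
  small zeros and the exponential of a uniformly convergent sum of principal logarithms for the
  rest; the latter may be differentiated termwise. On the axis no factor has a zero or a pole, as Re
  w > 0.\<close>

lemma Blaschke_log_deriv:
  "((\<lambda>w. of_nat (xi.m w) * (1 / (Complex 0 u - w) - 1 / (Complex 0 u + cnj w))) has_sum B_logderiv_line u) right_zeros"
proof -
  define v0 where "v0 = Complex 0 u"
  \<comment> \<open>Bounds |v| on the closed unit ball around the base point, so that one threshold
    for |w| works on the whole ball.\<close>
  define q where "q = \<bar>u\<bar> + 1"
  define W0 W1 where "W0 = {w \<in> right_zeros. cmod w < 8 * (q + 1)}" and "W1 = {w \<in> right_zeros. cmod w \<ge> 8 * (q + 1)}"
  define dl where "dl w v = 1 / (v - w) - 1 / (v + cnj w)" for w v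
  define WT where "WT T = {w \<in> right_zeros. \<bar>Im w\<bar> \<le> T}" for T
  have fWT: "finite (WT T)" for T by (rule finite_subset[OF _ finite_zeros_Im[of T]]) (auto simp: WT_def right_zeros_def)
  have fW0: "finite W0" by (rule finite_subset[OF _ xi.finite_Z_cball[of "8 * (q + 1)"]]) (auto simp: W0_def right_zeros_def)
  have v0nz: "v0 - w \<noteq> 0" "v0 + cnj w \<noteq> 0" if "w \<in> right_zeros" for w
    using right_zerosD[OF that] by (auto simp: v0_def complex_eq_iff)
  define r :: real where "r = 1"
  have r: "r > 0" "r \<le> 1" by (auto simp: r_def)
  have cv0: "cmod v0 = \<bar>u\<bar>" by (simp add: v0_def cmod_def)
  have vq: "cmod v \<le> q" if "v \<in> cball v0 r" for v
  proof -
    have "cmod v \<le> cmod v0 + cmod (v - v0)" using norm_triangle_ineq[of v0 "v - v0"] by simp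
    then show ?thesis using that r cv0 by (simp add: q_def dist_norm norm_minus_commute)
  qed
  have b1: "cmod (bfac w v - 1) \<le> 12 * (q + 1) / cmod w ^ 2" "12 * (q + 1) / cmod w ^ 2 \<le> 1/4" "v + cnj w \<noteq> 0" if "w \<in> W1" "v \<in> cball v0 r" for w v
    using cmod_bfac_minus_one_le[of w v q] that vq[OF that(2)] by (auto simp: W1_def)
  have lb: "cmod (Ln (bfac w v)) \<le> 24 * (q + 1) / cmod w ^ 2" "bfac w v \<notin> \<real>\<^sub>\<le>\<^sub>0" "bfac w v \<noteq> 0" if "w \<in> W1" "v \<in> cball v0 r" for w v
  proof -
    define z where "z = bfac w v - 1"
    note b = b1[OF that]
    have z: "cmod z \<le> 12 * (q + 1) / cmod w ^ 2" "cmod z \<le> 1/4"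
      unfolding z_def by (rule b(1), rule order_trans[OF b(1) b(2)])
    have bz: "bfac w v = 1 + z" by (simp add: z_def)
    have "cmod (Ln (1 + z)) \<le> 2 * cmod z" using z(2) by (intro norm_Ln_le) simp
    also have "\<dots> \<le> 2 * (12 * (q + 1) / cmod w ^ 2)" by (rule mult_left_mono[OF z(1)]) simp
    also have "\<dots> = 24 * (q + 1) / cmod w ^ 2" by simp
    finally show "cmod (Ln (bfac w v)) \<le> 24 * (q + 1) / cmod w ^ 2" unfolding bz .
    have "\<bar>Re z\<bar> \<le> 1/4" using z(2) abs_Re_le_cmod[of z] by linarith
    then have "Re (bfac w v) > 0" unfolding bz plus_complex.sel one_complex.sel by linarith
    then show "bfac w v \<notin> \<real>\<^sub>\<le>\<^sub>0" "bfac w v \<noteq> 0" by (auto simp: complex_nonpos_Reals_iff)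
  qed
  have fneq: "v - w \<noteq> 0" if "w \<in> W1" "v \<in> cball v0 r" for w v
    using lb(3)[OF that] bfac_eq[of w v] b1(3)[OF that] that(1) by (auto simp: W1_def)
  define f where "f X v = (\<Sum>w\<in>X. of_nat (xi.m w) * Ln (bfac w v))" for X v
  define f' where "f' X v = (\<Sum>w\<in>X. of_nat (xi.m w) * dl w v)" for X v
  define g where "g v = (\<Sum>\<^sub>\<infinity>w\<in>W1. of_nat (xi.m w) * Ln (bfac w v))" for v
  have bd: "(bfac w has_field_derivative bfac w v * dl w v) (at v)" if "w \<in> W1" "v \<in> cball v0 r" for w v
    unfolding dl_def by (rule bfac_has_derivative) (use that b1(3) fneq in \<open>auto simp: W1_def\<close>)
  have fd: "(f X has_field_derivative f' X v) (at v)" if "X \<subseteq> W1" "v \<in> cball v0 r" for X v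
    unfolding f_def[abs_def] f'_def
  proof (rule DERIV_sum)
    fix w assume "w \<in> X"
    then have w: "w \<in> W1" using that by auto
    have "((\<lambda>v. Ln (bfac w v)) has_field_derivative inverse (bfac w v) * (bfac w v * dl w v)) (at v)"
      by (rule DERIV_chain2[OF has_field_derivative_Ln[OF lb(2)[OF w that(2)]] bd[OF w that(2)]])
    then have "((\<lambda>v. Ln (bfac w v)) has_field_derivative dl w v) (at v)"
      unfolding mult.assoc[symmetric] left_inverse[OF lb(3)[OF w that(2)]] mult_1_left .
    then show "((\<lambda>v. of_nat (xi.m w) * Ln (bfac w v)) has_field_derivative of_nat (xi.m w) * dl w v) (at v)"
      by (rule DERIV_cmult)
  qed
  have W1Z: "W1 \<subseteq> xi.Z" by (auto simp: W1_def right_zeros_def)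
  have ul: "uniform_limit (cball v0 r) f g (finite_subsets_at_top W1)"
    unfolding f_def[abs_def] g_def[abs_def]
  proof (rule Weierstrass_m_test_general)
    show "(\<lambda>w. 24 * (q + 1) * (real (xi.m w) / cmod w ^ 2)) summable_on W1"
      by (intro summable_on_cmult_right summable_on_subset_banach[OF xi.summable_zeros W1Z])
    fix w v assume "w \<in> W1" "v \<in> cball v0 r"
    from lb(1)[OF this] have "real (xi.m w) * cmod (Ln (bfac w v)) \<le> real (xi.m w) * (24 * (q + 1) / cmod w ^ 2)"
      by (rule mult_left_mono) simp
    then show "norm (of_nat (xi.m w) * Ln (bfac w v)) \<le> 24 * (q + 1) * (real (xi.m w) / cmod w ^ 2)"
      by (simp add: norm_mult mult_ac)
  qed
  have ev: "\<forall>\<^sub>F X in finite_subsets_at_top W1. continuous_on (cball v0 r) (f X) \<and> (\<forall>v\<in>ball v0 r. (f X has_field_derivative f' X v) (at v))"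
  proof (rule eventually_finite_subsets_at_top_weakI, intro conjI ballI)
    fix X assume X: "X \<subseteq> W1"
    show "continuous_on (cball v0 r) (f X)"
      using fd[OF X] by (intro continuous_at_imp_continuous_on ballI DERIV_isCont)
    show "(f X has_field_derivative f' X v) (at v)" if "v \<in> ball v0 r" for v using fd[OF X, of v] that by simp
  qed
  have rb: "v0 \<in> ball v0 r" using r by simp
  have nb: "\<not> trivial_limit (finite_subsets_at_top W1)" by (rule finite_subsets_at_top_neq_bot)
  obtain g' where g': "\<And>v. v \<in> ball v0 r \<Longrightarrow> (g has_field_derivative g' v) (at v)" "((\<lambda>X. f' X v0) \<longlongrightarrow> g' v0) (finite_subsets_at_top W1)"
  proof (rule has_complex_derivative_uniform_limit[OF ev ul nb r(1)])
    fix g' assume "continuous_on (cball v0 r) g"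
      and h: "\<And>v. v \<in> ball v0 r \<Longrightarrow> (g has_field_derivative g' v) (at v) \<and> ((\<lambda>X. f' X v) \<longlongrightarrow> g' v) (finite_subsets_at_top W1)"
    show thesis
    proof (rule that)
      show "(g has_field_derivative g' v) (at v)" if "v \<in> ball v0 r" for v using h[OF that] by (rule conjunct1)
      show "((\<lambda>X. f' X v0) \<longlongrightarrow> g' v0) (finite_subsets_at_top W1)" using h[OF rb] by (rule conjunct2)
    qed
  qed
  define Q where "Q v = (\<Prod>w\<in>W0. bfac w v ^ xi.m w)" for v
  \<comment> \<open>The truncations |Im| <= T in the definition of \<open>Blaschke\<close>
    eventually contain every finite set of zeros, so the limit over T inherits the value of the
    unordered sum.\<close>
  have flt: "filterlim (\<lambda>T. WT T - W0) (finite_subsets_at_top W1) at_top"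
    unfolding filterlim_finite_subsets_at_top
  proof (intro allI impI)
    fix X assume X: "finite X \<and> X \<subseteq> W1"
    define T0 where "T0 = Max (insert 0 ((\<lambda>w. \<bar>Im w\<bar>) ` X))"
    have T0: "\<bar>Im w\<bar> \<le> T0" if "w \<in> X" for w unfolding T0_def using X that by (intro Max_ge) auto
    show "\<forall>\<^sub>F T in at_top. finite (WT T - W0) \<and> X \<subseteq> WT T - W0 \<and> WT T - W0 \<subseteq> W1"
      using eventually_ge_at_top[of T0]
    proof eventually_elim
      case (elim T)
      have "X \<subseteq> WT T - W0" using X T0 elim by (fastforce simp: W1_def W0_def WT_def)
      then show ?case using fWT by (auto simp: W1_def W0_def WT_def)
    qed
  qed
  have evW0: "\<forall>\<^sub>F T in at_top. W0 \<subseteq> WT T"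
    using eventually_ge_at_top[of "8 * (q + 1)"]
  proof eventually_elim
    case (elim T)
    show ?case
    proof
      fix w assume "w \<in> W0"
      then show "w \<in> WT T" using elim abs_Im_le_cmod[of w] by (simp add: W0_def WT_def)
    qed
  qed
  have Bv: "Blaschke (1/2 + v) = Q v * exp (g v)" if v: "v \<in> cball v0 r" for v
  proof -
    have "((\<lambda>X. f X v) \<longlongrightarrow> g v) (finite_subsets_at_top W1)" by (rule tendsto_uniform_limitI[OF ul v])
    then have "((\<lambda>T. f (WT T - W0) v) \<longlongrightarrow> g v) at_top" by (rule filterlim_compose[OF _ flt])
    then have L: "((\<lambda>T. Q v * exp (f (WT T - W0) v)) \<longlongrightarrow> Q v * exp (g v)) at_top" by (intro tendsto_intros)
    have "\<forall>\<^sub>F T in at_top. Q v * exp (f (WT T - W0) v) = (\<Prod>w\<in>WT T. bfac w v ^ xi.m w)"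
      using evW0
    proof eventually_elim
      case (elim T)
      have sub: "WT T - W0 \<subseteq> W1" by (auto simp: W1_def W0_def WT_def)
      have "exp (f (WT T - W0) v) = (\<Prod>w\<in>WT T - W0. bfac w v ^ xi.m w)"
        unfolding f_def using fWT[of T] by (subst exp_sum) (auto intro!: prod.cong simp: exp_of_nat_mult lb(3)[OF subsetD[OF sub] v])
      then show ?case unfolding Q_def using prod.subset_diff[OF elim fWT, of "\<lambda>w. bfac w v ^ xi.m w"] by (simp add: mult.commute)
    qed
    then have "((\<lambda>T. \<Prod>w\<in>WT T. bfac w v ^ xi.m w) \<longlongrightarrow> Q v * exp (g v)) at_top" using L by (rule Lim_transform_eventually[rotated])
    then show ?thesis unfolding Blaschke_eq_Lim WT_def by (intro tendsto_Lim) auto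
  qed
  have Qd: "(Q has_field_derivative Q v0 * f' W0 v0) (at v0)"
    unfolding Q_def[abs_def] f'_def dl_def
    by (rule has_field_derivative_prod_log[OF fW0]) (rule bfac_has_derivative, use v0nz in \<open>auto simp: W0_def\<close>)
  have Qnz: "Q v0 \<noteq> 0"
    unfolding Q_def using fW0 v0nz bfac_eq bkap_nonzero by (auto simp: W0_def)
  have "((\<lambda>v. Q v * exp (g v)) has_field_derivative (f' W0 v0 + g' v0) * (Q v0 * exp (g v0))) (at v0)"
    by (rule derivative_eq_intros Qd g'(1)[OF rb] refl)+ (simp add: algebra_simps)
  then have D: "((\<lambda>v. Blaschke (1/2 + v)) has_field_derivative (f' W0 v0 + g' v0) * (Q v0 * exp (g v0))) (at v0)"
    by (rule has_field_derivative_transform_within_open[OF _ open_ball rb]) (simp add: Bv)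
  have "(Blaschke has_field_derivative (f' W0 v0 + g' v0) * (Q v0 * exp (g v0))) (at (v0 + 1/2))"
    using D unfolding DERIV_shift[of Blaschke _ v0 "1/2"] by (simp add: add.commute)
  then have "deriv Blaschke (1/2 + v0) = (f' W0 v0 + g' v0) * (Q v0 * exp (g v0))" by (simp add: DERIV_imp_deriv add.commute)
  moreover have "Blaschke (1/2 + v0) = Q v0 * exp (g v0)" using Bv[of v0] r by simp
  moreover have "\<i> * complex_of_real u = v0" by (simp add: v0_def complex_eq_iff)
  ultimately have val: "B_logderiv_line u = f' W0 v0 + g' v0" unfolding B_logderiv_line_def using Qnz by simp
  have h1: "((\<lambda>w. of_nat (xi.m w) * dl w v0) has_sum g' v0) W1" using g'(2) unfolding has_sum_def f'_def .
  have h0: "((\<lambda>w. of_nat (xi.m w) * dl w v0) has_sum f' W0 v0) W0" unfolding f'_def by (rule has_sum_finite[OF fW0])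
  have U: "W0 \<inter> W1 = {}" "W0 \<union> W1 = right_zeros" by (auto simp: W0_def W1_def)
  have "((\<lambda>w. of_nat (xi.m w) * dl w v0) has_sum (f' W0 v0 + g' v0)) (W0 \<union> W1)" by (rule has_sum_Un_disjoint[OF h0 h1 U(1)])
  then show ?thesis unfolding val U(2) dl_def v0_def .
qed

section \<open>Poisson kernels of the zeros off the critical line\<close>

definition poisson :: "complex \<Rightarrow> real \<Rightarrow> real" where
  "poisson a u = Re a / ((Re a)^2 + (u - Im a)^2)"

lemma poisson_eq:
  assumes w: "0 < Re w"
  shows "1 / (Complex 0 u - w) - 1 / (Complex 0 u + cnj w) = of_real (- 2 * poisson w u)"
proof -
  have n: "Complex 0 u - w \<noteq> 0" "Complex 0 u + cnj w \<noteq> 0" using w by (auto simp: complex_eq_iff)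
  have "1 / (Complex 0 u - w) - 1 / (Complex 0 u + cnj w) = ((Complex 0 u + cnj w) - (Complex 0 u - w)) / ((Complex 0 u - w) * (Complex 0 u + cnj w))"
    using diff_frac_eq[OF n, of 1 1] by simp
  also have "(Complex 0 u + cnj w) - (Complex 0 u - w) = of_real (2 * Re w)" by (simp add: complex_eq_iff)
  also have "(Complex 0 u - w) * (Complex 0 u + cnj w) = of_real (- ((Re w)^2 + (u - Im w)^2))"
    by (simp add: complex_eq_iff power2_eq_square algebra_simps)
  also have "complex_of_real (2 * Re w) / of_real (- ((Re w)^2 + (u - Im w)^2)) = of_real (- 2 * poisson w u)"
  proof -
    have "2 * Re w / - ((Re w)^2 + (u - Im w)^2) = - 2 * poisson w u" by (simp only: poisson_def divide_minus_right times_divide_eq_right minus_mult_left minus_divide_left)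
    then show ?thesis unfolding of_real_divide[symmetric] by (rule arg_cong)
  qed
  finally show ?thesis .
qed

lemma poisson_eq_0: "Re a = 0 \<Longrightarrow> poisson a u = 0" by (simp add: poisson_def)

text \<open>Off the axis Re w = 0 the zeros come in pairs w, -w with one member in
  \<open>right_zeros\<close> and the same \<open>rpart\<close>; on the axis h contributes nothing.
  Hence the factor 2.\<close>

lemma has_sum_right_zeros:
  fixes h :: "complex \<Rightarrow> real"
  assumes h: "((\<lambda>w. real (xi.m w) * h w) has_sum S) right_zeros" and h0: "\<And>w. w \<in> xi.Z \<Longrightarrow> Re w = 0 \<Longrightarrow> h w = 0"
  shows "((\<lambda>z. real (xi.m z) * h (rpart z)) has_sum (2 * S)) xi.Z"
proof -
  define L where "L = {w \<in> xi.Z. Re w < 0}"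
  have r: "((\<lambda>z. real (xi.m z) * h (rpart z)) has_sum S) right_zeros"
    using h by (subst has_sum_cong[of _ _ "\<lambda>w. real (xi.m w) * h w"]) (auto simp: right_zeros_def rpart_def)
  have bij: "bij_betw uminus L right_zeros"
    by (rule bij_betwI[of _ _ _ uminus]) (auto simp: L_def right_zeros_def xi.uminus_Z)
  have "((\<lambda>z. real (xi.m (- z)) * h (- z)) has_sum S) L"
    using has_sum_reindex_bij_betw[OF bij, of "\<lambda>w. real (xi.m w) * h w"] h by simp
  then have l: "((\<lambda>z. real (xi.m z) * h (rpart z)) has_sum S) L"
    by (subst has_sum_cong[of _ _ "\<lambda>z. real (xi.m (- z)) * h (- z)"]) (auto simp: L_def rpart_def xi.m_uminus)
  have d: "right_zeros \<inter> L = {}" by (auto simp: L_def right_zeros_def)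
  have "((\<lambda>z. real (xi.m z) * h (rpart z)) has_sum (S + S)) (right_zeros \<union> L)" by (rule has_sum_Un_disjoint[OF r l d])
  moreover have "((\<lambda>z. real (xi.m z) * h (rpart z)) has_sum (S + S)) (right_zeros \<union> L) \<longleftrightarrow> ((\<lambda>z. real (xi.m z) * h (rpart z)) has_sum (S + S)) xi.Z"
  proof (rule has_sum_cong_neutral)
    fix z assume "z \<in> xi.Z - (right_zeros \<union> L)"
    then have "z \<in> xi.Z" "Re z = 0" by (auto simp: right_zeros_def L_def)
    then show "real (xi.m z) * h (rpart z) = 0" using h0[of z] by (simp add: rpart_def)
  qed (auto simp: right_zeros_def L_def)
  ultimately show ?thesis by simp
qed

lemma B_logderiv_line_eq:
  "B_logderiv_line u = of_real (- (\<Sum>\<^sub>\<infinity>z\<in>xi.Z. real (xi.m z) * poisson (rpart z) u))"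
    and summable_poisson: "(\<lambda>z. real (xi.m z) * poisson (rpart z) u) summable_on xi.Z"
proof -
  have "((\<lambda>w. of_nat (xi.m w) * (1 / (Complex 0 u - w) - 1 / (Complex 0 u + cnj w))) has_sum B_logderiv_line u) right_zeros"
    by (rule Blaschke_log_deriv)
  then have "((\<lambda>w. complex_of_real (real (xi.m w) * (- 2 * poisson w u))) has_sum B_logderiv_line u) right_zeros"
    by (subst has_sum_cong[of _ _ "\<lambda>w. of_nat (xi.m w) * (1 / (Complex 0 u - w) - 1 / (Complex 0 u + cnj w))"])
      (auto simp: right_zeros_def poisson_eq)
  note c = this
  have re: "((\<lambda>w. real (xi.m w) * (- 2 * poisson w u)) has_sum Re (B_logderiv_line u)) right_zeros"
    using has_sum_Re[OF c] by simp
  have "((\<lambda>w. 0::real) has_sum Im (B_logderiv_line u)) right_zeros" using has_sum_Im[OF c] by simp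
  then have im: "Im (B_logderiv_line u) = 0" using has_sum_unique[OF _ has_sum_0] by fastforce
  from has_sum_cmult_right[OF re, of "- (1/2)"]
  have "((\<lambda>w. real (xi.m w) * poisson w u) has_sum (- (1/2) * Re (B_logderiv_line u))) right_zeros" by (simp add: mult_ac)
  from has_sum_right_zeros[OF this poisson_eq_0]
  have h: "((\<lambda>z. real (xi.m z) * poisson (rpart z) u) has_sum (- Re (B_logderiv_line u))) xi.Z" by simp
  show "(\<lambda>z. real (xi.m z) * poisson (rpart z) u) summable_on xi.Z" using h by (rule has_sum_imp_summable)
  show "B_logderiv_line u = of_real (- (\<Sum>\<^sub>\<infinity>z\<in>xi.Z. real (xi.m z) * poisson (rpart z) u))"
    using infsumI[OF h] im by (simp add: complex_eq_iff)
qed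

lemma poisson_measurable [measurable]: "poisson a \<in> borel_measurable borel"
  unfolding poisson_def[abs_def] by measurable

lemma argfac_arctan: "Re a > 0 \<Longrightarrow> 2 * argfac a u = arctan ((u - Im a) / Re a) + arctan ((u + Im a) / Re a)"
  using Im_Ln_eq[of "a + Complex 0 u"] Im_Ln_eq[of "cnj a + Complex 0 u"]
  by (simp add: argfac_def complex_eq_iff add.commute)

text \<open>The antiderivative arctan ((u - Im a)/Re a), taken between -t and t, gives the sum of
  the arguments of a + it and cnj a + it. This is the link between the Blaschke product and the
  argument sums.\<close>

lemma
  assumes t: "t \<ge> 0" and a: "Re a > 0"
  shows integrable_poisson: "integrable lborel (\<lambda>u. indicat_real {-t..t} u * poisson a u)" (is ?A)
    and integral_poisson: "(\<integral>u. indicat_real {-t..t} u * poisson a u \<partial>lborel) = 2 * argfac a t" (is ?B)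
proof -
  have nz: "(Re a)^2 + (u - Im a)^2 \<noteq> 0" for u using a by (simp add: add_pos_nonneg sum_power2_eq_zero_iff)
  have h: "((poisson a) has_integral (arctan ((t - Im a) / Re a) - arctan ((- t - Im a) / Re a))) {-t..t}"
  proof (rule fundamental_theorem_of_calculus)
    fix u assume "u \<in> {-t..t}"
    have "((\<lambda>u. arctan ((u - Im a) / Re a)) has_real_derivative (1 / Re a) / (1 + ((u - Im a) / Re a)^2)) (at u within {-t..t})"
      using a by (auto intro!: derivative_eq_intros simp: divide_inverse)
    moreover have "(1 / Re a) / (1 + ((u - Im a) / Re a)^2) = poisson a u"
    proof -
      have "1 + ((u - Im a) / Re a)^2 = ((Re a)^2 + (u - Im a)^2) / (Re a)^2" using a by (simp add: power_divide add_divide_distrib)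
      then show ?thesis using a nz[of u] by (simp add: poisson_def power2_eq_square)
    qed
    ultimately show "((\<lambda>u. arctan ((u - Im a) / Re a)) has_vector_derivative poisson a u) (at u within {-t..t})"
      by (simp add: has_real_derivative_iff_has_vector_derivative)
  qed (use t in simp)
  have c: "continuous_on {-t..t} (poisson a)" unfolding poisson_def[abs_def] using nz by (intro continuous_intros) auto
  have s: "set_integrable lborel {-t..t} (poisson a)" by (rule borel_integrable_atLeastAtMost'[OF c])
  show ?A using s unfolding set_integrable_def real_scaleR_def .
  have "(- t - Im a) / Re a = - ((t + Im a) / Re a)" by (simp add: minus_divide_left)
  then have "arctan ((t - Im a) / Re a) - arctan ((- t - Im a) / Re a) = 2 * argfac a t"
    unfolding argfac_arctan[OF a] by (simp add: arctan_minus)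
  then show ?B
    using set_borel_integral_eq_integral(2)[OF s] integral_unique[OF h] unfolding set_lebesgue_integral_def real_scaleR_def by simp
qed

text \<open>Zeros with Re z = 0 need the case distinction: their Poisson kernel vanishes while
  \<open>argfac\<close> at them need not. The L1 norms on [-t, t] are O(|z|^(-2)) again because Re a
  < 1/2.\<close>

lemma
  assumes t: "t \<ge> 0"
  shows B_logderiv_integrable: "B_logderiv_line integrable_on {-t..t}"
    and B_logderiv_integral: "((\<lambda>z. real (xi.m z) * (if Re z = 0 then 0 else 2 * argfac (rpart z) t)) has_sum (- Re (integral {-t..t} B_logderiv_line))) xi.Z" (is ?A)
    and B_logderiv_integral_real: "Im (integral {-t..t} B_logderiv_line) = 0"
proof -
  define g where "g z u = real (xi.m z) * (indicat_real {-t..t} u * poisson (rpart z) u)" for z u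
  have gi: "integrable lborel (g z) \<and> (\<integral>u. g z u \<partial>lborel) = real (xi.m z) * (if Re z = 0 then 0 else 2 * argfac (rpart z) t)" if "z \<in> xi.Z" for z
  proof (cases "Re z = 0")
    case True
    then have "g z = (\<lambda>_. 0)" by (auto simp: g_def rpart_def poisson_eq_0)
    then show ?thesis using True by simp
  next
    case False
    then have r: "Re (rpart z) > 0" by (simp add: rpart_def)
    show ?thesis unfolding g_def[abs_def] using integrable_poisson[OF t r] integral_poisson[OF t r] False by simp
  qed
  have p0: "0 \<le> poisson (rpart z) u" if "z \<in> xi.Z" for z u
    using abs_Re_rpart[OF that] by (auto simp: poisson_def intro!: divide_nonneg_nonneg)
  have pt: "(\<lambda>z. g z u) summable_on xi.Z" for u
  proof -
    have "g z u = indicat_real {-t..t} u * (real (xi.m z) * poisson (rpart z) u)" for z by (simp add: g_def)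
    then show ?thesis using summable_on_cmult_right[OF summable_poisson[of u], of "indicat_real {-t..t} u"] by simp
  qed
  have gb: "\<bar>g z u\<bar> \<le> indicat_real {-t..t} u * (2 * (real (xi.m z) / cmod (rpart z) ^ 2))" if z: "z \<in> xi.Z" "cmod (rpart z) \<ge> 2 * t + 1" for z u
  proof (cases "u \<in> {-t..t}")
    case True
    define a where "a = rpart z"
    have a: "0 \<le> Re a" "Re a < 1/2" "cmod a \<ge> 2 * t + 1" using abs_Re_rpart[OF z(1)] z(2) by (auto simp: a_def)
    have D: "(Re a)^2 + (u - Im a)^2 = (cmod (a - Complex 0 u))^2" by (simp add: cmod_power2 power2_commute)
    have "cmod (Complex 0 u) \<le> t" using True by (auto simp: cmod_def)
    then have "cmod a / 2 \<le> cmod (a - Complex 0 u)" using norm_triangle_ineq2[of a "Complex 0 u"] a t by linarith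
    then have "(cmod a / 2)^2 \<le> (cmod (a - Complex 0 u))^2" by (rule power_mono) simp
    moreover have "cmod a > 0" using a t by linarith
    then have "(cmod a / 2)^2 > 0" by simp
    ultimately have "poisson a u \<le> (1/2) / (cmod a / 2)^2" unfolding poisson_def D using a by (intro frac_le) auto
    also have "\<dots> = 2 / cmod a ^ 2" by (simp add: power_divide)
    finally have "real (xi.m z) * poisson a u \<le> real (xi.m z) * (2 / cmod a ^ 2)" by (rule mult_left_mono) simp
    then show ?thesis using True p0[OF z(1), of u] by (simp add: g_def a_def mult_ac)
  qed (auto simp: g_def)
  have summ: "(\<lambda>z. \<integral>u. \<bar>g z u\<bar> \<partial>lborel) summable_on xi.Z"
  proof (rule zf.summable_bigO[of "2 * t + 1" _ "2 * t * 2"])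
    fix z assume z: "z \<in> xi.Z" "2 * t + 1 \<le> cmod (rpart z)"
    have ii: "integrable lborel (\<lambda>u. indicat_real {-t..t} u * (2 * (real (xi.m z) / cmod (rpart z) ^ 2)))"
      by (intro integrable_mult_left integrable_real_indicator) (auto simp: emeasure_lborel_Icc_eq)
    have "(\<integral>u. \<bar>g z u\<bar> \<partial>lborel) \<le> (\<integral>u. indicat_real {-t..t} u * (2 * (real (xi.m z) / cmod (rpart z) ^ 2)) \<partial>lborel)"
      using gi[OF z(1)] by (intro Bochner_Integration.integral_mono gb[OF z] ii integrable_abs) auto
    also have "\<dots> = 2 * t * 2 * (real (xi.m z) / cmod (rpart z) ^ 2)" using t by simp
    finally show "\<bar>\<integral>u. \<bar>g z u\<bar> \<partial>lborel\<bar> \<le> 2 * t * 2 * (real (xi.m z) / cmod (rpart z) ^ 2)" by simp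
  qed
  define P where "P u = (\<Sum>\<^sub>\<infinity>z\<in>xi.Z. real (xi.m z) * poisson (rpart z) u)" for u
  have e: "(\<Sum>\<^sub>\<infinity>z\<in>xi.Z. g z u) = indicat_real {-t..t} u * P u" for u
    unfolding P_def g_def by (subst infsum_cmult_right[OF summable_poisson, symmetric]) (simp add: mult_ac)
  have gi1: "integrable lborel (g z)" if "z \<in> xi.Z" for z using gi[OF that] by simp
  have "integrable lborel (\<lambda>u. indicat_real {-t..t} u * P u)"
    using integrable_infsum[OF zf.A_countable gi1 pt summ] unfolding e .
  then have s: "set_integrable lborel {-t..t} P" unfolding set_integrable_def real_scaleR_def .
  note S = set_borel_integral_eq_integral[OF s]
  have hs: "((\<lambda>z. \<integral>u. g z u \<partial>lborel) has_sum integral {-t..t} P) xi.Z"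
    using has_sum_integral[OF zf.A_countable gi1 pt summ] S(2) unfolding e set_lebesgue_integral_def real_scaleR_def by simp
  have Bl: "B_logderiv_line u = of_real (- P u)" for u unfolding P_def by (rule B_logderiv_line_eq)
  have "((\<lambda>u. complex_of_real (- P u)) has_integral of_real (- integral {-t..t} P)) {-t..t}"
    by (intro has_integral_of_real has_integral_neg integrable_integral S)
  then have hB: "(B_logderiv_line has_integral of_real (- integral {-t..t} P)) {-t..t}" unfolding Bl[abs_def, symmetric] .
  show "B_logderiv_line integrable_on {-t..t}" using hB by (rule has_integral_integrable)
  show "Im (integral {-t..t} B_logderiv_line) = 0" using integral_unique[OF hB] by simp
  have "((\<lambda>z. real (xi.m z) * (if Re z = 0 then 0 else 2 * argfac (rpart z) t)) has_sum integral {-t..t} P) xi.Z"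
    using hs gi by (subst has_sum_cong[of _ _ "\<lambda>z. \<integral>u. g z u \<partial>lborel"]) auto
  then show ?A
    using integral_unique[OF hB] by simp
qed

section \<open>The counting formula\<close>

text \<open>Terms with large |p| converge uniformly on (0, T). The finitely many others are asked to
  be continuous only at t, since such a term may jump elsewhere in the interval.\<close>

lemma (in lnfac_family) isCont_family:
  fixes f :: "'i \<Rightarrow> real \<Rightarrow> real" and t T R B :: real
  assumes t: "0 < t" "t < T" and cont: "\<And>i. i \<in> A \<Longrightarrow> isCont (f i) t"
    and contR: "\<And>i u. i \<in> A \<Longrightarrow> R \<le> cmod (p i) \<Longrightarrow> 0 < u \<Longrightarrow> u < T \<Longrightarrow> isCont (f i) u"
    and bound: "\<And>i u. i \<in> A \<Longrightarrow> R \<le> cmod (p i) \<Longrightarrow> 0 < u \<Longrightarrow> u < T \<Longrightarrow> \<bar>f i u\<bar> \<le> B / cmod (p i)^2"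
  shows "isCont (\<lambda>u. \<Sum>\<^sub>\<infinity>i\<in>A. n i * f i u) t"
proof -
  define A0 A1 where "A0 = {i \<in> A. cmod (p i) < R}" and "A1 = {i \<in> A. R \<le> cmod (p i)}"
  have fin: "finite A0" unfolding A0_def by (rule finite_p)
  have U: "A0 \<union> A1 = A" "A0 \<inter> A1 = {}" by (auto simp: A0_def A1_def)
  have b: "\<bar>n i * f i u\<bar> \<le> B * (n i / cmod (p i)^2)" if "i \<in> A1" "u \<in> {0<..<T}" for i u
  proof -
    have "\<bar>f i u\<bar> \<le> B / cmod (p i)^2" using bound[of i u] that by (auto simp: A1_def)
    then have "n i * \<bar>f i u\<bar> \<le> n i * (B / cmod (p i)^2)" by (rule mult_left_mono[OF _ n_nonneg])
    then show ?thesis using n_nonneg[of i] by (simp add: abs_mult mult_ac)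
  qed
  have s1: "(\<lambda>i. B * (n i / cmod (p i)^2)) summable_on A1"
    by (rule summable_on_subset_banach[OF summable_on_cmult_right[OF summable_p]]) (auto simp: A1_def)
  have ul: "uniform_limit {0<..<T} (\<lambda>X u. \<Sum>i\<in>X. n i * f i u) (\<lambda>u. \<Sum>\<^sub>\<infinity>i\<in>A1. n i * f i u) (finite_subsets_at_top A1)"
    by (rule Weierstrass_m_test_general[OF _ s1]) (use b in auto)
  have "\<forall>\<^sub>F X in finite_subsets_at_top A1. continuous_on {0<..<T} (\<lambda>u. \<Sum>i\<in>X. n i * f i u)"
  proof (rule eventually_finite_subsets_at_top_weakI)
    fix X assume X: "X \<subseteq> A1"
    show "continuous_on {0<..<T} (\<lambda>u. \<Sum>i\<in>X. n i * f i u)"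
    proof (intro continuous_on_sum continuous_on_mult continuous_on_const continuous_at_imp_continuous_on ballI)
      fix i u assume "i \<in> X" "u \<in> {0<..<T}"
      then show "isCont (f i) u" using contR[of i u] X by (auto simp: A1_def)
    qed
  qed
  then have "continuous_on {0<..<T} (\<lambda>u. \<Sum>\<^sub>\<infinity>i\<in>A1. n i * f i u)"
    by (rule uniform_limit_theorem[OF _ ul]) simp
  then have c1: "isCont (\<lambda>u. \<Sum>\<^sub>\<infinity>i\<in>A1. n i * f i u) t" using t by (simp add: continuous_on_eq_continuous_at)
  have c0: "isCont (\<lambda>u. \<Sum>i\<in>A0. n i * f i u) t"
    by (intro continuous_sum continuous_mult continuous_const cont) (auto simp: A0_def)
  have split: "(\<Sum>\<^sub>\<infinity>i\<in>A. n i * f i u) = (\<Sum>i\<in>A0. n i * f i u) + (\<Sum>\<^sub>\<infinity>i\<in>A1. n i * f i u)" if "u \<in> {0<..<T}" for u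
  proof -
    have "(\<lambda>i. n i * f i u) summable_on A1"
      by (rule summable_on_absI[OF s1, of "\<lambda>_. True"]) (use b that in auto)
    from infsum_Un_disjoint[OF summable_on_finite[OF fin] this U(2)] show ?thesis using fin unfolding U(1) by simp
  qed
  have "eventually (\<lambda>u. u \<in> {0<..<T}) (nhds t)" by (rule eventually_nhds_in_open) (use t in auto)
  then have "eventually (\<lambda>u. (\<Sum>\<^sub>\<infinity>i\<in>A. n i * f i u) = (\<Sum>i\<in>A0. n i * f i u) + (\<Sum>\<^sub>\<infinity>i\<in>A1. n i * f i u)) (nhds t)"
    by eventually_elim (rule split)
  then show ?thesis using continuous_add[OF c0 c1] by (simp add: isCont_cong)
qed

lemma isCont_argfac:
  assumes "u \<noteq> Im a" "u \<noteq> - Im a"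
  shows "isCont (argfac a) u"
proof -
  have "a + Complex 0 u \<notin> \<real>\<^sub>\<le>\<^sub>0" "cnj a + Complex 0 u \<notin> \<real>\<^sub>\<le>\<^sub>0"
    using assms by (auto simp: complex_nonpos_Reals_iff)
  then show ?thesis unfolding argfac_def[abs_def] Complex_eq by (intro continuous_intros) auto
qed

definition ordinates :: "real set" where "ordinates = (\<lambda>z. \<bar>Im z\<bar>) ` xi.Z"

lemma isCont_zarg:
  assumes t: "t > 0" "t \<notin> ordinates" shows "isCont zarg t"
  unfolding zarg_def[abs_def]
proof (rule zf.isCont_family[where T = "t + 1" and R = "2 * (t + 1) + 1" and B = "t + 1"])
  have Im: "\<bar>Im (rpart z)\<bar> = \<bar>Im z\<bar>" for z by (simp add: rpart_def)
  show "isCont (argfac (rpart z)) t" if "z \<in> xi.Z" for z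
  proof -
    have "\<bar>Im (rpart z)\<bar> \<noteq> t" using t that unfolding Im ordinates_def by auto
    then show ?thesis using t by (intro isCont_argfac) auto
  qed
  fix z u assume z: "z \<in> xi.Z" "2 * (t + 1) + 1 \<le> cmod (rpart z)" "0 < u" "u < t + 1"
  note a = abs_Re_rpart[OF z(1)]
  \<comment> \<open>Since Re a < 1/2, a zero of this modulus has ordinate beyond t + 1, so
    \<open>argfac\<close> has no jump for u in (0, t + 1).\<close>
  have "cmod (rpart z) \<le> 1/2 + \<bar>Im (rpart z)\<bar>" using cmod_le[of "rpart z"] a by linarith
  then show "isCont (argfac (rpart z)) u" using z by (intro isCont_argfac) auto
  have "\<bar>argfac (rpart z) u\<bar> \<le> u / cmod (rpart z) ^ 2" using abs_argfac_le[of "rpart z" u] a z by simp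
  also have "\<dots> \<le> (t + 1) / cmod (rpart z) ^ 2" using z by (intro divide_right_mono) auto
  finally show "\<bar>argfac (rpart z) u\<bar> \<le> (t + 1) / cmod (rpart z) ^ 2" .
qed (use t in auto)

lemma isCont_garg:
  assumes t: "t > 0" shows "isCont garg t"
  unfolding garg_def[abs_def]
proof (rule gf.isCont_family[where T = "t + 1" and R = "2 * (t + 1)" and B = "2 * (t + 1)^2 + (t + 1)"])
  have c: "isCont (\<lambda>u. arctan (u / gpole k) - u / (2 * real (Suc k))) u" for k u
    using gpole_pos[of k] by (intro continuous_intros) auto
  then show "isCont (\<lambda>u. arctan (u / gpole k) - u / (2 * real (Suc k))) t" for k .
  show "isCont (\<lambda>u. arctan (u / gpole k) - u / (2 * real (Suc k))) u" for k u by (rule c)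
  fix k u assume z: "2 * (t + 1) \<le> cmod (complex_of_real (gpole k))" "0 < u" "u < t + 1"
  have "\<bar>arctan (u / gpole k) - u / (2 * real (Suc k))\<bar> \<le> (2 * u^2 + u) / gpole k ^ 2"
    by (rule abs_arctan_gpole_le) (use z gpole_pos[of k] in auto)
  also have "\<dots> \<le> (2 * (t + 1)^2 + (t + 1)) / gpole k ^ 2" using z by (intro divide_right_mono add_mono mult_left_mono power_mono) auto
  finally show "\<bar>arctan (u / gpole k) - u / (2 * real (Suc k))\<bar> \<le> (2 * (t + 1)^2 + (t + 1)) / (cmod (complex_of_real (gpole k)))^2" by simp
qed (use t in auto)

text \<open>Off the ordinates the integrand of \<open>F2_eq\<close> is continuous at t, and the
  fundamental theorem of calculus applies. That formula holds for positive arguments only, hence the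
  transfer on the open set of positive reals.\<close>

lemma F2_has_derivative:
  assumes t: "t > 0" "t \<notin> ordinates"
  shows "(F2 has_real_derivative - 2 * pi * (zarg t - vartheta t - 2 * arctan (2 * t))) (at t)"
proof -
  define A where "A u = zarg u - vartheta u - 2 * arctan (2 * u)" for u
  have si: "set_integrable lborel {0..x} A" if "x > 0" for x
    using integrable_interval_arg[OF that] unfolding set_integrable_def real_scaleR_def A_def .
  have F: "F2 x = - 2 * pi * integral {0..x} A" if "x > 0" for x
    using F2_eq[OF that] set_borel_integral_eq_integral(2)[OF si[OF that]]
    unfolding set_lebesgue_integral_def real_scaleR_def A_def by simp
  have AI: "A integrable_on {0..t + 1}" using set_borel_integral_eq_integral(1)[OF si[of "t + 1"]] t by simp
  have "isCont (\<lambda>u. zarg u + garg u - arctan (2 * u) + u / 2 * (euler_mascheroni + ln pi)) t"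
    using isCont_zarg[OF t] isCont_garg[OF t(1)] by (intro continuous_intros) auto
  moreover have "eventually (\<lambda>u. u \<in> {0<..}) (nhds t)" by (rule eventually_nhds_in_open) (use t in auto)
  then have "eventually (\<lambda>u. A u = zarg u + garg u - arctan (2 * u) + u / 2 * (euler_mascheroni + ln pi)) (nhds t)"
    by eventually_elim (simp add: A_def vartheta_eq)
  ultimately have cA: "isCont A t" by (simp add: isCont_cong)
  have "((\<lambda>u. integral {0..u} A) has_vector_derivative A t) (at t within {0..t + 1} - {})"
    by (rule integral_has_vector_derivative_continuous_at[OF AI]) (use t cA in \<open>auto intro: continuous_at_imp_continuous_at_within\<close>)
  then have "((\<lambda>u. integral {0..u} A) has_real_derivative A t) (at t within {0..t + 1})"
    by (simp add: has_real_derivative_iff_has_vector_derivative)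
  moreover have "at t within {0..t + 1} = at t" by (rule at_within_interior) (use t in simp)
  ultimately have "((\<lambda>u. integral {0..u} A) has_real_derivative A t) (at t)" by simp
  then have "((\<lambda>u. - 2 * pi * integral {0..u} A) has_real_derivative - 2 * pi * A t) (at t)" by (rule DERIV_cmult)
  then have "(F2 has_real_derivative - 2 * pi * A t) (at t)"
    by (rule has_field_derivative_transform_within_open[of _ _ _ "{0<..}"]) (use t F in auto)
  then show ?thesis by (simp add: A_def)
qed

section \<open>Counting zeros by symmetry\<close>

definition mult_sum :: "complex set \<Rightarrow> real" where "mult_sum X = (\<Sum>w\<in>X. real (xi.m w))"

lemma mult_sum_uminus: "mult_sum (uminus ` X) = mult_sum X"
  unfolding mult_sum_def by (subst sum.reindex) (auto simp: inj_on_def xi.m_uminus)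

lemma Nzeta_pos:
  assumes "t \<ge> 0" shows "Nzeta t = mult_sum {w \<in> xi.Z. 0 \<le> Im w \<and> Im w \<le> t}"
proof -
  have e: "{\<rho>. 0 < Re \<rho> \<and> Re \<rho> < 1 \<and> zeta \<rho> = 0 \<and> 0 \<le> Im \<rho> \<and> Im \<rho> \<le> t} = (\<lambda>w. 1/2 + w) ` {w \<in> xi.Z. 0 \<le> Im w \<and> Im w \<le> t}"
  proof (intro equalityI subsetI)
    fix \<rho> assume r: "\<rho> \<in> {\<rho>. 0 < Re \<rho> \<and> Re \<rho> < 1 \<and> zeta \<rho> = 0 \<and> 0 \<le> Im \<rho> \<and> Im \<rho> \<le> t}"
    have "\<rho> - 1/2 \<in> xi.Z" using r xi_fun_zero_iff[of "\<rho> - 1/2"] by (simp add: xi.Z_def)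
    then show "\<rho> \<in> (\<lambda>w. 1/2 + w) ` {w \<in> xi.Z. 0 \<le> Im w \<and> Im w \<le> t}" using r by (intro image_eqI[of _ _ "\<rho> - 1/2"]) auto
  next
    fix \<rho> assume "\<rho> \<in> (\<lambda>w. 1/2 + w) ` {w \<in> xi.Z. 0 \<le> Im w \<and> Im w \<le> t}"
    then obtain w where w: "\<rho> = 1/2 + w" "w \<in> xi.Z" "0 \<le> Im w" "Im w \<le> t" by auto
    then show "\<rho> \<in> {\<rho>. 0 < Re \<rho> \<and> Re \<rho> < 1 \<and> zeta \<rho> = 0 \<and> 0 \<le> Im \<rho> \<and> Im \<rho> \<le> t}"
      using xi_fun_zero_iff[of w] xi_Z_abs_Re[of w] by (auto simp: xi.Z_def)
  qed
  have i: "inj_on (\<lambda>w. 1/2 + w) X" for X :: "complex set" by (auto simp: inj_on_def)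
  have "xi.m w = zero_mult zeta (1/2 + w)" if "w \<in> xi.Z" for w using xi_m_eq_zero_mult[OF that] xi_Z_abs_Re[OF that] by simp
  then show ?thesis using assms unfolding Nzeta_def oddext_def e sum.reindex[OF i] o_def mult_sum_def of_nat_sum by simp
qed

lemma NB_pos:
  assumes "t \<ge> 0" shows "NB t = mult_sum {w \<in> right_zeros. \<bar>Im w\<bar> \<le> t}"
proof -
  have i: "inj_on (\<lambda>w. 1/2 + w) X" for X :: "complex set" by (auto simp: inj_on_def)
  have "xi.m w = zero_mult zeta (1/2 + w)" if "w \<in> right_zeros" for w
    using xi_m_eq_zero_mult[of w] that by (simp add: right_zeros_def)
  then show ?thesis using assms unfolding NB_def oddext_def zeros_right_eq sum.reindex[OF i] o_def mult_sum_def of_nat_sum by simp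
qed

text \<open>The zeros with |Im w| <= t are counted in two ways. Splitting by the sign of Im w gives
  2 \<open>Nzeta t\<close>, because w -> -w exchanges the halves and none is real. Splitting by the
  sign of Re w gives 2 \<open>NB t\<close> plus the zeros on the axis.\<close>

lemma Nzeta_diff_NB:
  assumes t: "t \<ge> 0"
  shows "2 * (Nzeta t - NB t) = mult_sum {w \<in> xi.Z. Re w = 0 \<and> \<bar>Im w\<bar> \<le> t}"
proof -
  define Y where "Y = {w \<in> xi.Z. \<bar>Im w\<bar> \<le> t}"
  have fY: "finite Y" unfolding Y_def by (rule finite_zeros_Im)
  define C where "C P = mult_sum {w \<in> Y. P w}" for P
  have add: "C (\<lambda>w. P w \<or> Q w) = C P + C Q" if "\<And>w. w \<in> Y \<Longrightarrow> \<not> (P w \<and> Q w)" for P Q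
  proof -
    have "{w \<in> Y. P w \<or> Q w} = {w \<in> Y. P w} \<union> {w \<in> Y. Q w}" by auto
    then show ?thesis unfolding C_def mult_sum_def using fY that by (simp only:) (rule sum.union_disjoint, auto)
  qed
  have neg: "C (\<lambda>w. P (- w)) = C P" for P
  proof -
    have "{w \<in> Y. P w} = uminus ` {w \<in> Y. P (- w)}"
    proof (intro equalityI subsetI)
      fix w assume "w \<in> {w \<in> Y. P w}"
      then have "- w \<in> {w \<in> Y. P (- w)}" by (simp add: Y_def xi.uminus_Z)
      then show "w \<in> uminus ` {w \<in> Y. P (- w)}" by (intro image_eqI[of _ _ "- w"]) simp_all
    next
      fix w assume "w \<in> uminus ` {w \<in> Y. P (- w)}"
      then obtain x where "w = - x" "x \<in> Y" "P (- x)" by blast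
      then show "w \<in> {w \<in> Y. P w}" by (simp add: Y_def xi.uminus_Z)
    qed
    then show ?thesis unfolding C_def by (simp add: mult_sum_uminus)
  qed
  have cong: "C P = C Q" if "\<And>w. w \<in> Y \<Longrightarrow> P w \<longleftrightarrow> Q w" for P Q
  proof -
    have "{w \<in> Y. P w} = {w \<in> Y. Q w}" using that by auto
    then show ?thesis by (simp add: C_def)
  qed
  have Im0: "Im w \<noteq> 0" if "w \<in> Y" for w using xi_Z_Im[of w] that by (simp add: Y_def)
  have "{w \<in> xi.Z. 0 \<le> Im w \<and> Im w \<le> t} = {w \<in> Y. 0 \<le> Im w}" by (auto simp: Y_def)
  then have N: "Nzeta t = C (\<lambda>w. 0 \<le> Im w)" using Nzeta_pos[OF t] by (simp add: C_def)
  have "{w \<in> right_zeros. \<bar>Im w\<bar> \<le> t} = {w \<in> Y. 0 < Re w}" by (auto simp: Y_def right_zeros_def)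
  then have B: "NB t = C (\<lambda>w. 0 < Re w)" using NB_pos[OF t] by (simp add: C_def)
  have M: "mult_sum {w \<in> xi.Z. Re w = 0 \<and> \<bar>Im w\<bar> \<le> t} = C (\<lambda>w. Re w = 0)"
    unfolding C_def Y_def by (rule arg_cong[of _ _ mult_sum]) auto
  have "C (\<lambda>w. True) = C (\<lambda>w. 0 \<le> Im w) + C (\<lambda>w. Im w < 0)"
  proof -
    have "C (\<lambda>w. True) = C (\<lambda>w. 0 \<le> Im w \<or> Im w < 0)" by (rule cong) auto
    also have "\<dots> = C (\<lambda>w. 0 \<le> Im w) + C (\<lambda>w. Im w < 0)" by (rule add) auto
    finally show ?thesis .
  qed
  moreover have "C (\<lambda>w. Im w < 0) = C (\<lambda>w. 0 \<le> Im w)"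
  proof -
    have "C (\<lambda>w. Im w < 0) = C (\<lambda>w. 0 \<le> Im (- w))"
    proof (rule cong)
      fix w assume "w \<in> Y"
      then show "Im w < 0 \<longleftrightarrow> 0 \<le> Im (- w)" using Im0[of w] by auto
    qed
    also have "\<dots> = C (\<lambda>w. 0 \<le> Im w)" by (rule neg)
    finally show ?thesis .
  qed
  moreover have "C (\<lambda>w. True) = C (\<lambda>w. Re w = 0) + C (\<lambda>w. Re w \<noteq> 0)"
  proof -
    have "C (\<lambda>w. True) = C (\<lambda>w. Re w = 0 \<or> Re w \<noteq> 0)" by (rule cong) auto
    also have "\<dots> = C (\<lambda>w. Re w = 0) + C (\<lambda>w. Re w \<noteq> 0)" by (rule add) auto
    finally show ?thesis .
  qed
  moreover have "C (\<lambda>w. Re w \<noteq> 0) = C (\<lambda>w. 0 < Re w) + C (\<lambda>w. Re w < 0)"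
  proof -
    have "C (\<lambda>w. Re w \<noteq> 0) = C (\<lambda>w. 0 < Re w \<or> Re w < 0)" by (rule cong) auto
    also have "\<dots> = C (\<lambda>w. 0 < Re w) + C (\<lambda>w. Re w < 0)" by (rule add) auto
    finally show ?thesis .
  qed
  moreover have "C (\<lambda>w. Re w < 0) = C (\<lambda>w. 0 < Re w)"
    using neg[of "\<lambda>w. 0 < Re w"] by simp
  ultimately show ?thesis unfolding N B M by simp
qed

text \<open>For a = iy the two arguments are those of i (t + y) and i (t - y): both pi/2 when |y| <
  t, of opposite sign when |y| > t.\<close>

lemma argfac_imaginary:
  assumes a: "Re a = 0" and t: "t \<ge> 0" "t \<noteq> \<bar>Im a\<bar>"
  shows "argfac a t = (if \<bar>Im a\<bar> < t then pi / 2 else 0)"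
proof -
  have n: "a + Complex 0 t \<noteq> 0" "cnj a + Complex 0 t \<noteq> 0" using a t by (auto simp: complex_eq_iff)
  show ?thesis unfolding argfac_def Im_Ln_eq[OF n(1)] Im_Ln_eq[OF n(2)] using a t by auto
qed

text \<open>A zero off the line contributes the same amount to \<open>zarg\<close> as to half the
  integral of the Poisson kernels and cancels. A zero on the line leaves pi/2 when its ordinate is
  below t in modulus and 0 otherwise.\<close>

lemma zarg_minus_integral:
  assumes t: "t > 0" "t \<notin> ordinates"
  shows "zarg t + Re (integral {-t..t} B_logderiv_line) / 2 = pi * (Nzeta t - NB t)"
proof -
  have t0: "t \<ge> 0" using t by simp
  define J where "J = - Re (integral {-t..t} B_logderiv_line)"
  have z: "((\<lambda>z. real (xi.m z) * argfac (rpart z) t) has_sum zarg t) xi.Z"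
    unfolding zarg_def by (intro has_sum_infsum summable_zarg t0)
  have j: "((\<lambda>z. 1/2 * (real (xi.m z) * (if Re z = 0 then 0 else 2 * argfac (rpart z) t))) has_sum (1/2 * J)) xi.Z"
    unfolding J_def by (intro has_sum_cmult_right B_logderiv_integral t0)
  define X where "X = {w \<in> xi.Z. Re w = 0 \<and> \<bar>Im w\<bar> \<le> t}"
  have fX: "finite X" by (rule finite_subset[OF _ finite_zeros_Im[of t]]) (auto simp: X_def)
  have "((\<lambda>z. real (xi.m z) * argfac (rpart z) t - 1/2 * (real (xi.m z) * (if Re z = 0 then 0 else 2 * argfac (rpart z) t))) has_sum (zarg t - 1/2 * J)) xi.Z"
    by (rule has_sum_diff_real[OF z j])
  moreover have "((\<lambda>z. real (xi.m z) * argfac (rpart z) t - 1/2 * (real (xi.m z) * (if Re z = 0 then 0 else 2 * argfac (rpart z) t))) has_sum (zarg t - 1/2 * J)) xi.Z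
     \<longleftrightarrow> ((\<lambda>z. real (xi.m z) * (pi / 2)) has_sum (zarg t - 1/2 * J)) X"
  proof (rule has_sum_cong_neutral)
    have af: "argfac (rpart z) t = (if \<bar>Im z\<bar> < t then pi / 2 else 0)" "t \<noteq> \<bar>Im z\<bar>" if "z \<in> xi.Z" "Re z = 0" for z
    proof -
      show "t \<noteq> \<bar>Im z\<bar>" using t(2) that(1) by (auto simp: ordinates_def)
      then show "argfac (rpart z) t = (if \<bar>Im z\<bar> < t then pi / 2 else 0)" using argfac_imaginary[of z t] that t by (simp add: rpart_def)
    qed
    show "real (xi.m z) * (pi / 2) = 0" if "z \<in> X - xi.Z" for z using that by (auto simp: X_def)
    show "real (xi.m z) * argfac (rpart z) t - 1/2 * (real (xi.m z) * (if Re z = 0 then 0 else 2 * argfac (rpart z) t)) = 0" if "z \<in> xi.Z - X" for z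
      using that af[of z] by (auto simp: X_def)
    show "real (xi.m z) * argfac (rpart z) t - 1/2 * (real (xi.m z) * (if Re z = 0 then 0 else 2 * argfac (rpart z) t)) = real (xi.m z) * (pi / 2)" if "z \<in> xi.Z \<inter> X" for z
      using that af[of z] by (auto simp: X_def)
  qed
  ultimately have "zarg t - 1/2 * J = (\<Sum>z\<in>X. real (xi.m z) * (pi / 2))"
    using has_sum_unique has_sum_finite[OF fX] by blast
  also have "\<dots> = mult_sum X * (pi / 2)" by (simp add: mult_sum_def sum_distrib_right)
  also have "mult_sum X = 2 * (Nzeta t - NB t)" unfolding X_def by (rule Nzeta_diff_NB[OF t0, symmetric])
  finally show ?thesis by (simp add: J_def field_simps)
qed

lemma counting_formula:
  assumes t: "t > 0" "t \<notin> ordinates"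
  shows "complex_of_real (Nzeta t - NB t) = complex_of_real (N1 t) + complex_of_real (N2 t) + N3 t"
proof -
  have d: "deriv F2 t = - 2 * pi * (zarg t - vartheta t - 2 * arctan (2 * t))" by (rule DERIV_imp_deriv[OF F2_has_derivative[OF t]])
  define b where "b = Re (integral {-t..t} B_logderiv_line)"
  have ib: "integral {-t..t} B_logderiv_line = of_real b"
    using B_logderiv_integral_real[of t] t by (simp add: complex_eq_iff b_def)
  have N1: "N1 t = (vartheta t + 2 * arctan (2 * t)) / pi" using t by (simp add: N1_def oddext_def)
  \<comment> \<open>The prefactor -1/(2 pi^2) meets the factor -2 pi of the derivative. Adding
    \<open>N1\<close> cancels the phase and arctan terms, so only \<open>zarg t / pi\<close> remains
    of the two.\<close>
  have N2: "N2 t = (zarg t - vartheta t - 2 * arctan (2 * t)) / pi" using t unfolding N2_def oddext_def d by (simp add: field_simps power2_eq_square)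
  have N3: "N3 t = of_real (b / (2 * pi))" using t by (simp add: N3_def oddext_def ib)
  have "pi * (Nzeta t - NB t) = zarg t + b / 2" using zarg_minus_integral[OF t] by (simp add: b_def)
  then have "Nzeta t - NB t = (zarg t + b / 2) / pi" by (simp add: field_simps)
  also have "\<dots> = N1 t + N2 t + b / (2 * pi)" unfolding N1 N2 by (simp add: add_divide_distrib diff_divide_distrib)
  finally show ?thesis unfolding N3 of_real_add[symmetric] by (rule arg_cong)
qed

text \<open>The first two conjuncts certify that the derivative in \<open>N2\<close> and the
  integral in \<open>N3\<close> are genuine at |t|, not the arbitrary values these operators take
  where they are undefined. For negative t the identity follows from oddness of all five
  functions.\<close>

theorem theorem2p5:
  shows "AE t in lborel.
           F2 differentiable (at \<bar>t\<bar>) \<and>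
           B_logderiv_line integrable_on {-\<bar>t\<bar>..\<bar>t\<bar>} \<and>
           complex_of_real (Nzeta t - NB t)
             = complex_of_real (N1 t) + complex_of_real (N2 t) + N3 t"
proof -
  \<comment> \<open>Both signs of the ordinates and 0 are removed, so that |t| is positive and not
    an ordinate for every remaining t.\<close>
  have "countable (insert 0 (ordinates \<union> uminus ` ordinates))"
    unfolding ordinates_def by (intro countable_insert countable_Un countable_image zf.A_countable)
  from AE_not_countable[OF this] show ?thesis
  proof eventually_elim
    case (elim t)
    have a: "\<bar>t\<bar> > 0" "\<bar>t\<bar> \<notin> ordinates" using elim by (auto simp: abs_if image_iff split: if_splits)
    have odd: "Nzeta t = - Nzeta \<bar>t\<bar>" "NB t = - NB \<bar>t\<bar>" "N1 t = - N1 \<bar>t\<bar>" "N2 t = - N2 \<bar>t\<bar>" "N3 t = - N3 \<bar>t\<bar>" if "t < 0"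
      using that by (simp_all add: Nzeta_def NB_def N1_def N2_def N3_def oddext_def)
    have "F2 differentiable (at \<bar>t\<bar>)" using has_field_derivative_imp_has_derivative[OF F2_has_derivative[OF a]] by (rule differentiableI)
    moreover have "B_logderiv_line integrable_on {-\<bar>t\<bar>..\<bar>t\<bar>}" by (rule B_logderiv_integrable) simp
    moreover have "complex_of_real (Nzeta t - NB t) = complex_of_real (N1 t) + complex_of_real (N2 t) + N3 t"
    proof (cases "t < 0")
      case True
      have "complex_of_real (Nzeta t - NB t) = - complex_of_real (Nzeta \<bar>t\<bar> - NB \<bar>t\<bar>)" using odd[OF True] by simp
      also have "\<dots> = - (complex_of_real (N1 \<bar>t\<bar>) + complex_of_real (N2 \<bar>t\<bar>) + N3 \<bar>t\<bar>)" unfolding counting_formula[OF a] ..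
      also have "\<dots> = complex_of_real (N1 t) + complex_of_real (N2 t) + N3 t" unfolding odd[OF True] by simp
      finally show ?thesis .
    next
      case False
      then show ?thesis using counting_formula[OF a] by simp
    qed
    ultimately show ?case by blast
  qed
qed

end
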